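(* Let $p$ be a prime and $t\ge 1$. Suppose that for a certain pair $(k,n^\ast)$ with $n^\ast\geq 2k$, all small minimal $k$-blocking sets in $\mathrm{PG}(n^\ast,p^t)$ are linear. Then for all $n>k$, all small minimal $k$-blocking sets with exponent $e$ in $\mathrm{PG}(n,p^t)$ with $p^e\geq 7$ are linear.
   Context: All dimensions of subspaces of projective spaces are projective; an $m$-space is an $m$-dimensional subspace. Put $q=p^t$. For $1\le k\le n-1$ (always assumed when speaking of $k$-blocking sets in $\mathrm{PG}(n,q)$; in particular for the pair $(k,n^\ast)$), a $k$-blocking set in $\mathrm{PG}(n,q)$ is a set $B$ of points such that every $(n-k)$-space contains at least one point of $B$. It is small if $|B|<3(q^k+1)/2$, and minimal if no proper subset of $B$ is a $k$-blocking set. The exponent of a small minimal $k$-blocking set $B$ in $\mathrm{PG}(n,p^t)$ is the largest integer $e$ such that every $(n-k)$-space intersects $B$ in $1 \bmod p^e$ points (it is known that $e\ge 1$ exists). A point set $S$ of $\mathrm{PG}(V)$, $V$ an $(n+1)$-dimensional vector space over $\mathbb{F}_{p^t}$, is linear if there are a subfield $\mathbb{F}_{p_0}$ of $\mathbb{F}_{p^t}$ and a subset $U\subseteq V$ that is an $\mathbb{F}_{p_0}$-vector space such that $S=\{\langle u\rangle_{\mathbb{F}_{p^t}} : u\in U\setminus\{0\}\}$. *)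

theory Defs
  imports
    Complex_Main
    "HOL-Library.Cardinality"
    "HOL-Library.Function_Algebras"
    "HOL-Computational_Algebra.Primes"
    "HOL-Number_Theory.Cong"
begin

text \<open>
  Vectors are sequences \<open>nat \<Rightarrow> 'f\<close> over a finite field type \<open>'f\<close>; the underlying vector space of
  \<open>PG(n,q)\<close>, \<open>q = CARD('f)\<close>, is the subspace of sequences supported on the \<open>n + 1\<close> coordinates
  \<open>0, \<dots>, n\<close>. In this way \<open>n\<close> is an ordinary natural number that can be quantified over.
\<close>

definition fscale :: "'f::field \<Rightarrow> (nat \<Rightarrow> 'f) \<Rightarrow> nat \<Rightarrow> 'f"
  where "fscale c v = (\<lambda>i. c * v i)"

interpretation fvec: vector_space "fscale :: 'f::field \<Rightarrow> (nat \<Rightarrow> 'f) \<Rightarrow> nat \<Rightarrow> 'f"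
  by unfold_locales (auto simp: fscale_def fun_eq_iff algebra_simps)

definition coord_space :: "nat \<Rightarrow> (nat \<Rightarrow> 'f::field) set"
  where "coord_space n = {v. \<forall>i>n. v i = 0}"

lemma subspace_coord_space: "fvec.subspace (coord_space n)"
  by (auto simp: fvec.subspace_def coord_space_def fscale_def)

lemma dim_coord_space: "fvec.dim (coord_space n :: (nat \<Rightarrow> 'f::field) set) = n + 1"
proof -
  define e :: "nat \<Rightarrow> nat \<Rightarrow> 'f" where "e j = (\<lambda>i. if i = j then 1 else 0)" for j
  have inj: "inj e"
    by (rule injI) (metis e_def one_neq_zero)
  have sum_e: "(\<Sum>j\<le>m. fscale (c j) (e j)) = (\<lambda>i. if i \<le> m then c i else 0)" for c m
  proof (induction m)
    case 0
    show ?case by (auto simp: fun_eq_iff fscale_def e_def)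
  next
    case (Suc m)
    have "(\<Sum>j\<le>Suc m. fscale (c j) (e j)) = (\<lambda>i. if i \<le> m then c i else 0) + fscale (c (Suc m)) (e (Suc m))"
      by (simp add: Suc)
    also have "\<dots> = (\<lambda>i. if i \<le> Suc m then c i else 0)"
      by (rule ext) (auto simp: fscale_def e_def le_Suc_eq)
    finally show ?case .
  qed
  have ind: "fvec.independent (e ` {..n})"
  proof (rule fvec.independent_if_scalars_zero)
    fix f x assume *: "(\<Sum>x\<in>e ` {..n}. fscale (f x) x) = 0" and x: "x \<in> e ` {..n}"
    have "(\<Sum>x\<in>e ` {..n}. fscale (f x) x) = (\<Sum>j\<le>n. fscale (f (e j)) (e j))"
      by (rule sum.reindex_cong[of e]) (auto intro: inj_on_subset[OF inj])
    also have "\<dots> = (\<lambda>i. if i \<le> n then f (e i) else 0)" by (rule sum_e)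
    finally have "(\<lambda>i. if i \<le> n then f (e i) else 0) = (\<lambda>i. 0)" using * by (simp add: zero_fun_def)
    then have "f (e i) = 0" if "i \<le> n" for i
      using that by (metis (no_types, lifting))
    then show "f x = 0" using x by auto
  qed simp
  have sub: "e ` {..n} \<subseteq> coord_space n"
    by (auto simp: e_def coord_space_def)
  have "coord_space n \<subseteq> fvec.span (e ` {..n})"
  proof
    fix v :: "nat \<Rightarrow> 'f" assume "v \<in> coord_space n"
    then have "v = (\<Sum>j\<le>n. fscale (v j) (e j))"
      unfolding sum_e by (auto simp: coord_space_def fun_eq_iff)
    moreover have "(\<Sum>j\<le>n. fscale (v j) (e j)) \<in> fvec.span (e ` {..n})"
      by (intro fvec.span_sum fvec.span_scale fvec.span_base) auto
    ultimately show "v \<in> fvec.span (e ` {..n})" by simp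
  qed
  then have "fvec.dim (coord_space n :: (nat \<Rightarrow> 'f) set) = card (e ` {..n})"
    by (intro fvec.dim_unique[OF sub _ ind]) auto
  then show ?thesis
    by (simp add: card_image inj_on_subset[OF inj])
qed

text \<open>
  Projective dimension is vector space dimension minus one. A point is thus a one-dimensional
  vector subspace, and incidence is inclusion.
\<close>

definition proj_space :: "nat \<Rightarrow> nat \<Rightarrow> (nat \<Rightarrow> 'f::field) set \<Rightarrow> bool"
  where "proj_space n m W \<longleftrightarrow>
    fvec.subspace W \<and> W \<subseteq> coord_space n \<and> fvec.dim W = m + 1"

definition proj_points :: "nat \<Rightarrow> (nat \<Rightarrow> 'f::field) set set"
  where "proj_points n = {P. proj_space n 0 P}"

definition points_in :: "(nat \<Rightarrow> 'f::field) set set \<Rightarrow> (nat \<Rightarrow> 'f) set \<Rightarrow> (nat \<Rightarrow> 'f) set set"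
  where "points_in B W = {P \<in> B. P \<subseteq> W}"

text \<open>
  The following notions are only meant for \<open>1 \<le> k\<close> and \<open>k \<le> n - 1\<close>, so that the subtraction \<open>n - k\<close>
  on natural numbers is the genuine one.
\<close>

definition blocking_set :: "nat \<Rightarrow> nat \<Rightarrow> (nat \<Rightarrow> 'f::field) set set \<Rightarrow> bool"
  where "blocking_set n k B \<longleftrightarrow>
    B \<subseteq> proj_points n \<and> (\<forall>W. proj_space n (n - k) W \<longrightarrow> points_in B W \<noteq> {})"

definition minimal_blocking_set :: "nat \<Rightarrow> nat \<Rightarrow> (nat \<Rightarrow> 'f::field) set set \<Rightarrow> bool"
  where "minimal_blocking_set n k B \<longleftrightarrow>
    blocking_set n k B \<and> (\<forall>B'. B' \<subset> B \<longrightarrow> \<not> blocking_set n k B')"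

definition small_set :: "nat \<Rightarrow> (nat \<Rightarrow> 'f::{field,finite}) set set \<Rightarrow> bool"
  where "small_set k B \<longleftrightarrow> real (card B) < 3 * (real CARD('f) ^ k + 1) / 2"

definition small_minimal_blocking_set ::
    "nat \<Rightarrow> nat \<Rightarrow> (nat \<Rightarrow> 'f::{field,finite}) set set \<Rightarrow> bool"
  where "small_minimal_blocking_set n k B \<longleftrightarrow> minimal_blocking_set n k B \<and> small_set k B"

definition meets_one_mod :: "nat \<Rightarrow> nat \<Rightarrow> nat \<Rightarrow> (nat \<Rightarrow> 'f::field) set set \<Rightarrow> bool"
  where "meets_one_mod m n k B \<longleftrightarrow>
    (\<forall>W. proj_space n (n - k) W \<longrightarrow> [card (points_in B W) = 1] (mod m))"

text \<open>
  Here \<open>p\<close> is the characteristic of the field. Since congruence modulo \<open>p ^ 0 = 1\<close> is trivial,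
  letting \<open>e\<close> range over the natural numbers does not affect which \<open>e\<close> is the largest.
\<close>

definition is_exponent :: "nat \<Rightarrow> nat \<Rightarrow> nat \<Rightarrow> (nat \<Rightarrow> 'f::field) set set \<Rightarrow> nat \<Rightarrow> bool"
  where "is_exponent p n k B e \<longleftrightarrow>
    meets_one_mod (p ^ e) n k B \<and> (\<forall>e'. meets_one_mod (p ^ e') n k B \<longrightarrow> e' \<le> e)"

definition is_subfield :: "'f::field set \<Rightarrow> bool"
  where "is_subfield K \<longleftrightarrow> 0 \<in> K \<and> 1 \<in> K \<and>
    (\<forall>x\<in>K. \<forall>y\<in>K. x + y \<in> K \<and> x * y \<in> K) \<and> (\<forall>x\<in>K. - x \<in> K \<and> inverse x \<in> K)"

definition subspace_over :: "'f::field set \<Rightarrow> (nat \<Rightarrow> 'f) set \<Rightarrow> bool"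
  where "subspace_over K U \<longleftrightarrow> 0 \<in> U \<and>
    (\<forall>u\<in>U. \<forall>v\<in>U. u + v \<in> U) \<and> (\<forall>c\<in>K. \<forall>u\<in>U. fscale c u \<in> U)"

definition linear_set :: "nat \<Rightarrow> (nat \<Rightarrow> 'f::field) set set \<Rightarrow> bool"
  where "linear_set n S \<longleftrightarrow>
    (\<exists>K U. is_subfield K \<and> U \<subseteq> coord_space n \<and> subspace_over K U \<and>
      S = {fvec.span {u} | u. u \<in> U - {0}})"

end

theory Submission
  imports Defs "HOL-Computational_Algebra.Polynomial"
begin

text \<open>
  Write \<open>q = p ^ t\<close> and \<open>s = p ^ e\<close>. The theorem is proved for point sets \<open>B\<close> of an arbitrary
  \<open>N\<close>-dimensional space \<open>V\<close> with \<open>2 |B| < 3 (q ^ k + 1)\<close> which every subspace of codimension \<open>k\<close>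
  meets in \<open>1\<close> modulo \<open>s\<close> points (\<open>one_mod\<close>), by induction on \<open>N\<close> (\<open>one_mod_linear\<close>). This notion,
  unlike minimality, visibly survives projection. If \<open>N \<le> nstar + 1\<close>, embed \<open>V\<close> in \<open>PG(nstar, q)\<close>:
  there \<open>B\<close> becomes a small minimal blocking set (\<open>small_minimal_blocking\<close>), and the hypothesis
  applies. For larger \<open>N\<close> one has \<open>N \<ge> 2 k + 2\<close>, and \<open>B\<close> is projected from a point.

  Geometry is replaced throughout by one averaging argument (\<open>avg_subspace\<close>): if points carry
  nonnegative weights of total less than \<open>q ^ k\<close>, then through any other point there is a subspace of
  codimension \<open>k\<close> of weight less than \<open>1\<close>. With constant weights it yields tangent subspaces and
  shows that a line with two points of \<open>B\<close> has at least \<open>s + 1\<close> of them (\<open>secant\<close>).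

  Projection. Since secants are rich they are few, and some \<open>z\<close> lies on none of them. Projection from
  \<open>z\<close> is injective on \<open>B\<close> and keeps the counting property, so by induction the image is the point set
  of an additive group \<open>U\<close>. Lifting back means finding the scalar \<open>\<lambda> u\<close> for which \<open>u + \<lambda> u z\<close> spans a point
  of \<open>B\<close>. It satisfies \<open>\<lambda> (u + v) = \<lambda> u + \<lambda> v\<close> unless the plane spanned by \<open>z\<close> and the points over
  \<open>u\<close> and \<open>v\<close> contains points of \<open>B\<close> off their line. Such a plane contains at least \<open>s ^ 2\<close> of them, so
  for a suitable \<open>z\<close> few pairs are bad (\<open>centre_exists\<close>). An almost additive function can be repaired
  (\<open>additive_correction\<close>), and the group of all \<open>u + \<lambda>' u z\<close>, for the repaired \<open>\<lambda>'\<close>, has point set so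
  close to \<open>B\<close> that averaging forces the two to coincide (\<open>lift\<close>).

  The subfield. These counts work for all \<open>s \<ge> 7\<close> only because \<open>U\<close> may be taken linear over a subfield
  of order \<open>\<kappa> = p ^ d \<ge> s\<close>: then every point carries at least \<open>\<kappa> - 1\<close> nonzero vectors of \<open>U\<close> and
  \<open>|B| \<le> 7/6 q ^ k\<close>. Producing that subfield (\<open>subfield_structure\<close>) is the algebraic half of the
  proof. Call a point light if it contains only \<open>p\<close> vectors of \<open>U\<close>. At a light point \<open>P\<close> a tangent
  subspace \<open>T\<close> splits \<open>V\<close> into a subgroup of \<open>U\<close> and \<open>T\<close>; following the \<open>T\<close>-part of \<open>a z\<close> as the scalar \<open>a\<close>
  varies, modulo \<open>P\<close>, gives additive functions \<open>f\<close> on the field, and the richness of the secants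
  through \<open>P\<close> says that for every \<open>a\<close> at least \<open>s\<close> scalars \<open>c\<close> satisfy \<open>f (c a) = c f a\<close>. Such an \<open>f\<close> is
  linear over the field with \<open>p ^ d\<close> elements for some \<open>d \<ge> e\<close> (\<open>eigen_step_bound\<close>, read off from the
  Redei polynomial of \<open>f\<close>), and few \<open>a\<close> admit more than \<open>p ^ d\<close> such scalars (\<open>large_eigenspaces\<close>).
  Hence \<open>U + P\<close> is closed under the field with \<open>p ^ d\<close> elements. With \<open>d\<close> minimal this holds for almost
  all points \<open>P\<close> simultaneously, and the intersection of the sets \<open>U + P\<close> is the group wanted.
\<close>

section \<open>Subspaces over a subfield\<close>

lemma card_subfield_gt_1: assumes "is_subfield (K :: 'a::field set)" "finite K" shows "card K > 1"
proof -
  have "{0, 1} \<subseteq> K" using assms by (auto simp: is_subfield_def)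
  then have "card {0, 1::'a} \<le> card K" using assms card_mono by blast
  then show ?thesis by simp
qed

locale vec_space = vector_space scale
  for scale :: "'a::field \<Rightarrow> 'b::ab_group_add \<Rightarrow> 'b" (infixr \<open>*s\<close> 75)
begin

text \<open>One notion covers subspaces (\<open>K = UNIV\<close>), linear sets over a subfield, and additive groups (\<open>K\<close> the
  prime field).\<close>

definition Ksub :: "'a set \<Rightarrow> 'b set \<Rightarrow> bool" where
  "Ksub K U \<longleftrightarrow> 0 \<in> U \<and> (\<forall>x\<in>U. \<forall>y\<in>U. x + y \<in> U) \<and> (\<forall>c\<in>K. \<forall>x\<in>U. c *s x \<in> U)"

definition Kext :: "'a set \<Rightarrow> 'b \<Rightarrow> 'b set \<Rightarrow> 'b set" where
  "Kext K v U = (\<lambda>(c, x). x + c *s v) ` (K \<times> U)"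

lemma Ksub_zero: "Ksub K U \<Longrightarrow> 0 \<in> U"
  by (auto simp: Ksub_def)

lemma Ksub_add: "Ksub K U \<Longrightarrow> x \<in> U \<Longrightarrow> y \<in> U \<Longrightarrow> x + y \<in> U"
  by (auto simp: Ksub_def)

lemma Ksub_scale: "Ksub K U \<Longrightarrow> c \<in> K \<Longrightarrow> x \<in> U \<Longrightarrow> c *s x \<in> U"
  by (auto simp: Ksub_def)

lemma Ksub_minus: "is_subfield K \<Longrightarrow> Ksub K U \<Longrightarrow> x \<in> U \<Longrightarrow> - x \<in> U"
  using Ksub_scale[of K U "-1" x] by (auto simp: is_subfield_def)

lemma Ksub_diff: "is_subfield K \<Longrightarrow> Ksub K U \<Longrightarrow> x \<in> U \<Longrightarrow> y \<in> U \<Longrightarrow> x - y \<in> U"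
  using Ksub_add[of K U x "- y"] Ksub_minus[of K U y] by simp

lemma Ksub_UNIV: "Ksub UNIV U \<longleftrightarrow> subspace U"
  by (auto simp: Ksub_def subspace_def)

lemma Ksub_mono: "K \<subseteq> L \<Longrightarrow> Ksub L U \<Longrightarrow> Ksub K U"
  by (auto simp: Ksub_def)

lemma subspace_Ksub: "subspace U \<Longrightarrow> Ksub K U"
  by (auto simp: Ksub_def subspace_def)

lemma Ksub_Int: "Ksub K U \<Longrightarrow> Ksub K W \<Longrightarrow> Ksub K (U \<inter> W)"
  by (auto simp: Ksub_def)

lemma Kext_iff: "y \<in> Kext K v U \<longleftrightarrow> (\<exists>c\<in>K. \<exists>x\<in>U. y = x + c *s v)"
  by (auto simp: Kext_def)

lemma Ksub_Kext:
  assumes K: "is_subfield K" and U: "Ksub K U"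
  shows "Ksub K (Kext K v U)"
proof -
  have "0 \<in> Kext K v U"
    unfolding Kext_iff using K U Ksub_zero by (intro bexI[of _ 0]) (auto simp: is_subfield_def)
  moreover have "x + y \<in> Kext K v U" if "x \<in> Kext K v U" "y \<in> Kext K v U" for x y
  proof -
    obtain c d a b where *: "c \<in> K" "d \<in> K" "a \<in> U" "b \<in> U" "x = a + c *s v" "y = b + d *s v"
      using \<open>x \<in> Kext K v U\<close> \<open>y \<in> Kext K v U\<close> by (auto simp: Kext_iff)
    have "x + y = (a + b) + (c + d) *s v" using * by (simp add: scale_left_distrib algebra_simps)
    moreover have "a + b \<in> U" "c + d \<in> K" using K Ksub_add[OF U] * by (auto simp: is_subfield_def)
    ultimately show ?thesis unfolding Kext_iff by blast
  qed
  moreover have "e *s x \<in> Kext K v U" if "x \<in> Kext K v U" "e \<in> K" for x e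
  proof -
    obtain c a where *: "c \<in> K" "a \<in> U" "x = a + c *s v"
      using \<open>x \<in> Kext K v U\<close> by (auto simp: Kext_iff)
    have "e *s x = e *s a + (e * c) *s v" using * by (simp add: scale_right_distrib)
    moreover have "e *s a \<in> U" "e * c \<in> K" using K Ksub_scale[OF U] * that by (auto simp: is_subfield_def)
    ultimately show ?thesis unfolding Kext_iff by blast
  qed
  ultimately show ?thesis by (auto simp: Ksub_def)
qed

lemma Kext_superset: assumes "is_subfield K" shows "U \<subseteq> Kext K v U"
proof
  fix x assume "x \<in> U"
  moreover have "x = x + 0 *s v" "0 \<in> K" using assms by (auto simp: is_subfield_def)
  ultimately show "x \<in> Kext K v U" unfolding Kext_iff by blast
qed

lemma Kext_mem: "is_subfield K \<Longrightarrow> Ksub K U \<Longrightarrow> v \<in> Kext K v U"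
  unfolding Kext_iff by (intro bexI[of _ 1] bexI[of _ 0]) (auto simp: is_subfield_def Ksub_def)

lemma Kext_least: "Ksub K W \<Longrightarrow> U \<subseteq> W \<Longrightarrow> v \<in> W \<Longrightarrow> Kext K v U \<subseteq> W"
  by (auto simp: Kext_iff intro!: Ksub_add Ksub_scale)

lemma card_Kext:
  assumes K: "is_subfield K" and U: "Ksub K U" and v: "v \<notin> U"
  shows "card (Kext K v U) = card K * card U"
proof -
  have "inj_on (\<lambda>(c, x). x + c *s v) (K \<times> U)"
  proof (rule inj_onI, clarify)
    fix c x d y assume *: "c \<in> K" "x \<in> U" "d \<in> K" "y \<in> U" "x + c *s v = y + d *s v"
    have "c = d"
    proof (rule ccontr)
      assume "c \<noteq> d"
      have "(c - d) *s v = y - x" using *(5) by (simp add: scale_left_diff_distrib algebra_simps)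
      then have "inverse (c - d) *s (y - x) = inverse (c - d) *s ((c - d) *s v)" by simp
      also have "\<dots> = v" using \<open>c \<noteq> d\<close> by simp
      finally have e: "v = inverse (c - d) *s (y - x)" by simp
      have "c + - d \<in> K" using K * unfolding is_subfield_def by blast
      then have "inverse (c - d) \<in> K" using K unfolding is_subfield_def by simp
      moreover have "y - x \<in> U" using Ksub_diff[OF K U] * by auto
      ultimately have "v \<in> U"
        using Ksub_scale[OF U] e by metis
      then show False using v by simp
    qed
    then show "c = d \<and> x = y" using * by auto
  qed
  then show ?thesis unfolding Kext_def by (simp add: card_image card_cartesian_product)
qed

lemma finite_Kext: "finite K \<Longrightarrow> finite U \<Longrightarrow> finite (Kext K v U)"
  by (simp add: Kext_def)

text \<open>A maximal proper subspace above \<open>W\<close> becomes \<open>U\<close> as soon as one vector is added to it.\<close>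

lemma Ksub_hyperplane_over:
  assumes K: "is_subfield K" "finite K" and U: "Ksub K U" "finite U"
    and W: "Ksub K W" "W \<subset> U"
  obtains U1 where "Ksub K U1" "W \<subseteq> U1" "U1 \<subset> U" "card U = card K * card U1"
proof -
  let ?S = "{X. Ksub K X \<and> W \<subseteq> X \<and> X \<subset> U}"
  have "finite ?S" by (rule finite_subset[of _ "Pow U"]) (use U in auto)
  moreover have "W \<in> ?S" using W by auto
  ultimately obtain U1 where U1: "U1 \<in> ?S" and max: "\<And>X. X \<in> ?S \<Longrightarrow> U1 \<subseteq> X \<Longrightarrow> X = U1"
    using finite_has_maximal2[of ?S W] by (metis (no_types, lifting))
  obtain v where v: "v \<in> U" "v \<notin> U1" using U1 by auto
  have "Kext K v U1 \<subseteq> U" by (rule Kext_least[OF U(1)]) (use U1 v in auto)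
  moreover have "Kext K v U1 \<noteq> U1" using Kext_mem[of K U1 v] v U1 K by auto
  moreover have "Ksub K (Kext K v U1)" "U1 \<subseteq> Kext K v U1"
    using Ksub_Kext[of K U1 v] Kext_superset[of K U1 v] U1 K by auto
  moreover have "W \<subseteq> Kext K v U1" using U1 \<open>U1 \<subseteq> Kext K v U1\<close> by blast
  ultimately have "Kext K v U1 = U"
    using max[of "Kext K v U1"] unfolding psubset_eq mem_Collect_eq by blast
  then show ?thesis
    using that[of U1] U1 card_Kext[of K U1 v] v K by auto
qed

lemma Ksub_card_power_over:
  assumes K: "is_subfield K" "finite K" and W: "Ksub K W"
  shows "Ksub K U \<Longrightarrow> finite U \<Longrightarrow> W \<subseteq> U \<Longrightarrow> \<exists>j. card U = card K ^ j * card W"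
proof (induction "card U" arbitrary: U rule: less_induct)
  case less
  show ?case
  proof (cases "W = U")
    case True then show ?thesis by (intro exI[of _ 0]) auto
  next
    case False
    then obtain U1 where U1: "Ksub K U1" "W \<subseteq> U1" "U1 \<subset> U" "card U = card K * card U1"
      using Ksub_hyperplane_over[OF K less.prems(1,2) W] less.prems(3) by blast
    then obtain j where "card U1 = card K ^ j * card W"
      using less.hyps[of U1] less.prems by (meson finite_subset psubset_card_mono psubset_imp_subset)
    then show ?thesis using U1 by (intro exI[of _ "Suc j"]) auto
  qed
qed

lemma Ksub_trivial: "Ksub K {0}"
  by (auto simp: Ksub_def)

lemma Ksub_card_power:
  assumes K: "is_subfield K" "finite K" and "Ksub K U" "finite U"
  shows "\<exists>j. card U = card K ^ j"
  using Ksub_card_power_over[OF K Ksub_trivial assms(3,4)] Ksub_zero[OF assms(3)] by auto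

lemma Ksub_between:
  assumes K: "is_subfield K" "finite K" and W: "Ksub K W"
  shows "Ksub K U \<Longrightarrow> finite U \<Longrightarrow> W \<subseteq> U \<Longrightarrow> card U = card K ^ m * card W \<Longrightarrow> j \<le> m \<Longrightarrow>
    \<exists>X. Ksub K X \<and> W \<subseteq> X \<and> X \<subseteq> U \<and> card X = card K ^ j * card W"
proof (induction m arbitrary: U)
  case 0 then show ?case by auto
next
  case (Suc m)
  show ?case
  proof (cases "j = Suc m \<or> W = U")
    case True
    then consider "W = U" | "j = Suc m" by blast
    then show ?thesis
    proof cases
      assume "W = U"
      have "card U > 0" using Ksub_zero[OF Suc.prems(1)] Suc.prems(2) by (auto simp: card_gt_0_iff)
      moreover have "1 * card U = card K ^ Suc m * card U" using Suc.prems(4) \<open>W = U\<close> by simp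
      ultimately have "1 = card K ^ Suc m" by (metis mult_right_cancel neq0_conv)
      moreover have "card K ^ Suc m > 1" using card_subfield_gt_1[OF K] by (intro one_less_power) auto
      ultimately show ?thesis by simp
    next
      assume "j = Suc m" then show ?thesis using Suc.prems by (intro exI[of _ U]) auto
    qed
  next
    case False
    then have "W \<subset> U" using Suc.prems(3) by auto
    then obtain U1 where U1: "Ksub K U1" "W \<subseteq> U1" "U1 \<subset> U" "card U = card K * card U1"
      using Ksub_hyperplane_over[OF K Suc.prems(1,2) W] by blast
    have "card U1 = card K ^ m * card W" using U1 Suc.prems(4) card_subfield_gt_1[OF K] by auto
    moreover have "finite U1" using U1 Suc.prems(2) finite_subset by auto
    ultimately obtain X where "Ksub K X" "W \<subseteq> X" "X \<subseteq> U1" "card X = card K ^ j * card W"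
      using Suc.IH[OF U1(1) _ U1(2)] Suc.prems(5) False by auto
    then show ?thesis using U1 by blast
  qed
qed

lemma sum_of_disjoint_groups:
  assumes A: "Ksub K A" "finite A" and B: "Ksub K B" "finite B" and K: "is_subfield K"
    and AB: "A \<inter> B \<subseteq> {0}"
  shows "inj_on (\<lambda>(a, b). a + b) (A \<times> B)" "card ((\<lambda>(a, b). a + b) ` (A \<times> B)) = card A * card B"
proof -
  show inj: "inj_on (\<lambda>(a, b). a + b) (A \<times> B)"
  proof (rule inj_onI, clarify)
    fix a b a' b' assume *: "a \<in> A" "b \<in> B" "a' \<in> A" "b' \<in> B" "a + b = a' + b'"
    then have e: "a - a' = b' - b" by (simp add: algebra_simps)
    moreover have "a - a' \<in> A" "b' - b \<in> B" using * Ksub_diff[OF K] A B by auto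
    ultimately have "a - a' \<in> A \<inter> B" by auto
    then have "a - a' = 0" using AB by auto
    then show "a = a' \<and> b = b'" using e by auto
  qed
  show "card ((\<lambda>(a, b). a + b) ` (A \<times> B)) = card A * card B"
    using card_image[OF inj] by (simp add: card_cartesian_product)
qed

text \<open>Otherwise the sums \<open>a + b\<close> would be pairwise distinct, too many for \<open>V\<close>.\<close>

lemma groups_meet:
  assumes A: "Ksub K A" and B: "Ksub K B" and K: "is_subfield K"
    and V: "Ksub K V" "finite V" "A \<subseteq> V" "B \<subseteq> V" and c: "card V < card A * card B"
  shows "\<exists>x\<in>A \<inter> B. x \<noteq> 0"
proof (rule ccontr)
  assume "\<not> ?thesis"
  then have "A \<inter> B \<subseteq> {0}" by auto
  then have "card ((\<lambda>(a, b). a + b) ` (A \<times> B)) = card A * card B"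
    using sum_of_disjoint_groups(2)[of K A B] assms finite_subset by blast
  moreover have "(\<lambda>(a, b). a + b) ` (A \<times> B) \<subseteq> V" using V by (auto simp: Ksub_def)
  ultimately show False using card_mono[OF V(2)] c by (metis not_le)
qed

text \<open>The sums \<open>a + b\<close> are pairwise distinct and hence exhaust \<open>V\<close>.\<close>

lemma groups_complement:
  assumes A: "Ksub K A" and B: "Ksub K B" and K: "is_subfield K"
    and V: "Ksub K V" "finite V" "A \<subseteq> V" "B \<subseteq> V" and c: "card V = card A * card B"
    and AB: "A \<inter> B \<subseteq> {0}" and x: "x \<in> V"
  obtains a b where "a \<in> A" "b \<in> B" "x = a + b"
proof -
  have "card ((\<lambda>(a, b). a + b) ` (A \<times> B)) = card A * card B"
    using sum_of_disjoint_groups(2)[of K A B] assms finite_subset by blast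
  moreover have "(\<lambda>(a, b). a + b) ` (A \<times> B) \<subseteq> V" using V by (auto simp: Ksub_def)
  ultimately have "(\<lambda>(a, b). a + b) ` (A \<times> B) = V" using card_subset_eq[OF V(2)] c by metis
  then show ?thesis using x that by auto
qed

end

section \<open>Finite fields\<close>

lemma is_subfield_UNIV: "is_subfield UNIV"
  by (simp add: is_subfield_def)

text \<open>The parameter \<open>F\<close> lets interpretations name the field.\<close>

locale prime_power_field =
  fixes p t :: nat and F :: "'f::{field,finite} itself"
  assumes prime_p: "prime p" and card_F: "CARD('f) = p ^ t"
begin

lemma p_gt_1: "p > 1" using prime_p prime_gt_1_nat by simp

text \<open>The translation \<open>x \<mapsto> x + 1\<close> permutes the field, so it does not change the sum of all elements.\<close>

lemma of_nat_p: "(of_nat p :: 'f) = 0"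
proof -
  have "(\<Sum>x\<in>(UNIV::'f set). x + 1) = (\<Sum>x\<in>UNIV. x)"
    by (rule sum.reindex_bij_witness[of _ "\<lambda>x. x - 1" "\<lambda>x. x + 1"]) auto
  then have "(of_nat (p ^ t) :: 'f) = 0" by (simp add: sum.distrib card_F[symmetric])
  then show ?thesis by simp
qed

lemma t_pos: "t > 0"
proof (rule ccontr)
  assume "\<not> t > 0"
  then have "CARD('f) = 1" using card_F by simp
  then show False by (metis UNIV_I card_1_singletonE singletonD zero_neq_one)
qed

end

text \<open>The binomial theorem modulo \<open>p\<close>.\<close>

lemma freshman:
  fixes x y :: "'a::comm_ring_1"
  assumes "prime p" "(of_nat p :: 'a) = 0"
  shows "(x + y) ^ (p ^ i) = x ^ (p ^ i) + y ^ (p ^ i)"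
proof (induction i)
  case (Suc i)
  have main: "(a + b) ^ p = a ^ p + b ^ p" for a b :: 'a
  proof -
    have p: "p > 0" using assms prime_gt_0_nat by auto
    have "(a + b) ^ p = (\<Sum>k\<le>p. of_nat (p choose k) * a ^ k * b ^ (p - k))" by (rule binomial_ring)
    also have "\<dots> = (\<Sum>k\<in>{0,p}. of_nat (p choose k) * a ^ k * b ^ (p - k))"
    proof (rule sum.mono_neutral_right)
      show "\<forall>k\<in>{..p} - {0, p}. of_nat (p choose k) * a ^ k * b ^ (p - k) = 0"
      proof
        fix k assume "k \<in> {..p} - {0, p}"
        then have "p dvd (p choose k)" using dvd_choose_prime[of k p] assms(1) by auto
        then show "of_nat (p choose k) * a ^ k * b ^ (p - k) = 0" using assms(2) by (auto elim!: dvdE)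
      qed
    qed auto
    also have "\<dots> = a ^ p + b ^ p" using p by simp
    finally show ?thesis .
  qed
  have "(x + y) ^ (p ^ Suc i) = ((x + y) ^ (p ^ i)) ^ p" by (simp add: power_mult[symmetric] mult.commute)
  also have "\<dots> = x ^ (p ^ Suc i) + y ^ (p ^ Suc i)"
    by (simp only: Suc.IH main) (simp add: power_mult[symmetric] mult.commute)
  finally show ?case .
qed simp

lemma freshman_sum:
  fixes f :: "'b \<Rightarrow> 'a::comm_ring_1"
  assumes "prime p" "(of_nat p :: 'a) = 0"
  shows "(\<Sum>x\<in>A. f x) ^ (p ^ i) = (\<Sum>x\<in>A. f x ^ (p ^ i))"
  using prime_gt_0_nat[OF assms(1)]
  by (induction A rule: infinite_finite_induct) (auto simp: freshman[OF assms] power_0_left)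

lemma freshman_minus:
  fixes x :: "'a::comm_ring_1"
  assumes "prime p" "(of_nat p :: 'a) = 0"
  shows "(- x) ^ (p ^ i) = - (x ^ (p ^ i))"
  using freshman[OF assms, of x "-x" i] prime_gt_0_nat[OF assms(1)]
  by (simp add: eq_neg_iff_add_eq_0 add.commute power_0_left)

lemma freshman_diff:
  fixes x y :: "'a::comm_ring_1"
  assumes "prime p" "(of_nat p :: 'a) = 0"
  shows "(x - y) ^ (p ^ i) = x ^ (p ^ i) - y ^ (p ^ i)"
  using freshman[OF assms, of x "-y" i] freshman_minus[OF assms, of y i] by simp

text \<open>Multiplication by \<open>x \<noteq> 0\<close> permutes the nonzero elements, so it does not change their product.\<close>

lemma power_card_field: "(x::'f::{field,finite}) ^ CARD('f) = x"
proof (cases "x = 0")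
  case False
  have "(\<Prod>y\<in>UNIV-{0}. x * y) = (\<Prod>y\<in>UNIV-{0}. y)"
    by (rule prod.reindex_bij_witness[of _ "\<lambda>y. y / x" "\<lambda>y. x * y"]) (use False in auto)
  then have "x ^ (CARD('f) - 1) * (\<Prod>y\<in>UNIV-{0}. y) = (\<Prod>y\<in>UNIV-{0}. y)"
    by (simp add: prod.distrib)
  moreover have "(\<Prod>y\<in>UNIV-{0::'f}. y) \<noteq> 0" by simp
  ultimately have "x ^ (CARD('f) - 1) = 1" by simp
  moreover have "CARD('f) = Suc (CARD('f) - 1)" by simp
  ultimately show ?thesis by (metis power_Suc mult.right_neutral)
qed simp

section \<open>Additive polynomials\<close>

lemma char_of_nat:
  assumes p: "prime p" "(of_nat p :: 'a::{comm_ring_1}) = 0"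
  shows "(of_nat m :: 'a) = 0 \<longleftrightarrow> p dvd m"
proof
  assume m: "(of_nat m :: 'a) = 0"
  show "p dvd m"
  proof (rule ccontr)
    assume "\<not> p dvd m"
    then have "coprime p m" using p prime_imp_coprime_nat by blast
    then obtain x where "[m * x = 1] (mod p)" using cong_solve_coprime_nat[of m p] by (auto simp: coprime_commute)
    then have "m * x mod p = 1" using prime_gt_1_nat[OF p(1)] by (simp add: cong_def)
    then have "m * x = p * (m * x div p) + 1" by (metis mult_div_mod_eq)
    then have "(of_nat (m * x) :: 'a) = of_nat (p * (m * x div p) + 1)" by metis
    then show False using m p(2) by auto
  qed
qed (auto simp: p elim!: dvdE)

text \<open>Compare the coefficients of \<open>X ^ (p ^ a)\<close> in \<open>(1 + X) ^ (p ^ a m) = (1 + X ^ (p ^ a)) ^ m\<close>.\<close>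

lemma choose_p_power:
  assumes p: "prime p" "(of_nat p :: 'a::comm_ring_1) = 0"
  shows "(of_nat ((p ^ a * m) choose (p ^ a)) :: 'a) = of_nat m"
proof -
  have p': "(of_nat p :: 'a poly) = 0" using p by (simp add: of_nat_poly)
  let ?k = "p ^ a"
  have k: "?k > 0" using prime_gt_0_nat[OF p(1)] by simp
  have "[:1, 1:] ^ (?k * m) = ((1 + monom 1 1) ^ ?k) ^ m" for m :: nat
    by (simp add: power_mult monom_altdef one_pCons)
  also have "(1 + monom (1::'a) 1) ^ ?k = monom 1 ?k + 1"
    using freshman[OF p(1) p', of 1 "monom 1 1" a] by (simp add: monom_power)
  also have "(monom (1::'a) ?k + 1) ^ m = (\<Sum>i\<le>m. of_nat (m choose i) * monom 1 ?k ^ i * 1 ^ (m - i))" for m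
    by (rule binomial_ring)
  also have "\<dots> m = (\<Sum>i\<le>m. monom (of_nat (m choose i)) (?k * i))" for m
    by (intro sum.cong refl) (simp add: monom_power of_nat_monom mult_monom)
  finally have e: "[:1, 1::'a:] ^ (?k * m) = (\<Sum>i\<le>m. monom (of_nat (m choose i)) (?k * i))" for m .
  have "coeff ([:1, 1::'a:] ^ (?k * m)) ?k = of_nat ((?k * m) choose ?k)"
  proof (cases "m = 0")
    case True then show ?thesis using k by (simp add: binomial_eq_0)
  next
    case False then show ?thesis using k by (subst coeff_linear_poly_power) auto
  qed
  moreover have "coeff (\<Sum>i\<le>m. monom (of_nat (m choose i)::'a) (?k * i)) ?k = (\<Sum>i\<le>m. if i = 1 then of_nat m else 0)"
    unfolding coeff_sum by (intro sum.cong refl) (use k in auto)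
  moreover have "(\<Sum>i\<le>m. if i = 1 then of_nat m else (0::'a)) = of_nat m"
    by (cases "m = 0") (auto simp: sum.delta)
  ultimately show ?thesis using e by metis
qed

lemma poly_zero_on:
  fixes q :: "'a::idom poly"
  assumes "infinite A \<or> degree q < card A" "\<And>a. a \<in> A \<Longrightarrow> poly q a = 0"
  shows "q = 0"
proof (rule ccontr)
  assume "q \<noteq> 0"
  then have "finite {x. poly q x = 0}" "card {x. poly q x = 0} \<le> degree q"
    using poly_roots_finite card_poly_roots_bound by auto
  moreover have "A \<subseteq> {x. poly q x = 0}" using assms by auto
  ultimately show False using assms(1) card_mono[of "{x. poly q x = 0}" A] finite_subset[of A] by auto
qed

text \<open>Only the exponents \<open>p ^ i\<close> survive in a polynomial that acts additively on sufficiently many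
  points: comparing coefficients in \<open>g (X + b) = g X + g b\<close> kills the exponent \<open>N\<close> as soon as some
  \<open>N choose j\<close>, \<open>0 < j < N\<close>, is prime to \<open>p\<close>.\<close>

lemma additive_poly_exponents:
  fixes g :: "'a::idom poly"
  assumes p: "prime p" "(of_nat p :: 'a) = 0"
    and A: "infinite A \<or> degree g < card A" "0 \<in> A"
    and add: "\<And>a b. a \<in> A \<Longrightarrow> b \<in> A \<Longrightarrow> poly g (a + b) = poly g a + poly g b"
    and N: "coeff g N \<noteq> 0"
  shows "\<exists>i. N = p ^ i"
proof (rule ccontr)
  assume nex: "\<not> ?thesis"
  have "poly g (0 + 0) = poly g 0 + poly g 0" using add A by blast
  then have "poly g 0 = 0" by (metis add_cancel_right_right add_0_left)
  then have "N > 0" using N by (metis neq0_conv poly_0_coeff_0)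
  define a where "a = multiplicity p N"
  obtain m where m: "N = p ^ a * m" "\<not> p dvd m"
    using multiplicity_decompose'[of N p] \<open>N > 0\<close> p(1) a_def by (metis neq0_conv not_prime_unit)
  have "m \<noteq> 1" using nex m by auto
  moreover have "m \<noteq> 0" using m \<open>N > 0\<close> by auto
  ultimately have "m > 1" by simp
  define j where "j = p ^ a"
  have j: "j > 0" "j < N" using m \<open>m > 1\<close> prime_gt_0_nat[OF p(1)] by (auto simp: j_def)
  have nz: "(of_nat (N choose j) :: 'a) \<noteq> 0"
    using choose_p_power[OF p, of a m] m char_of_nat[OF p] by (simp add: j_def)
  define H where "H = (\<Sum>i\<le>degree g. monom (coeff g i * of_nat (i choose j)) (i - j))"
  have coeff_shift: "coeff (pcompose g [:b, 1:]) j = poly H b" for b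
  proof -
    have "pcompose g [:b, 1:] = (\<Sum>i\<le>degree g. smult (coeff g i) ([:b, 1:] ^ i))"
      by (simp add: pcompose_altdef poly_altdef degree_map_poly coeff_map_poly)
    then have "coeff (pcompose g [:b, 1:]) j = (\<Sum>i\<le>degree g. coeff g i * coeff ([:b, 1:] ^ i) j)"
      by (simp add: coeff_sum)
    also have "\<dots> = (\<Sum>i\<le>degree g. coeff g i * of_nat (i choose j) * b ^ (i - j))"
    proof (rule sum.cong[OF refl])
      fix i
      have "coeff ([:b, 1:] ^ i) j = of_nat (i choose j) * b ^ (i - j)"
      proof (cases "j \<le> i")
        case True then show ?thesis by (simp add: coeff_linear_poly_power)
      next
        case False
        then have "coeff ([:b, 1:] ^ i) j = 0" by (intro coeff_eq_0) (simp add: degree_linear_power)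
        then show ?thesis using False by (simp add: binomial_eq_0)
      qed
      then show "coeff g i * coeff ([:b, 1:] ^ i) j = coeff g i * of_nat (i choose j) * b ^ (i - j)" by simp
    qed
    also have "\<dots> = poly H b" by (simp add: H_def poly_sum poly_monom)
    finally show ?thesis .
  qed
  have "poly H b = coeff g j" if b: "b \<in> A" for b
  proof -
    define q where "q = pcompose g [:b, 1:] - g - [:poly g b:]"
    have "degree q \<le> degree g"
      unfolding q_def by (intro degree_diff_le) (auto simp: degree_pcompose)
    moreover have "poly q x = 0" if "x \<in> A" for x
      using add[OF b that] by (simp add: q_def poly_pcompose add.commute)
    ultimately have "q = 0" using A poly_zero_on[of A q] by auto
    then have "coeff (pcompose g [:b, 1:]) j = coeff (g + [:poly g b:]) j" by (simp add: q_def algebra_simps)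
    then show ?thesis using coeff_shift j by (simp add: coeff_pCons split: nat.splits)
  qed
  moreover have "degree (H - [:coeff g j:]) \<le> degree g"
    unfolding H_def by (intro degree_diff_le degree_sum_le) (auto intro: order.trans[OF degree_monom_le])
  ultimately have "H - [:coeff g j:] = 0"
    using A poly_zero_on[of A "H - [:coeff g j:]"] by auto
  then have "coeff H (N - j) = coeff [:coeff g j:] (N - j)" by simp
  also have "\<dots> = 0" using j by (simp add: coeff_pCons split: nat.splits)
  finally have "coeff H (N - j) = 0" .
  moreover have "coeff H (N - j) = (\<Sum>i\<le>degree g. if i = N then coeff g N * of_nat (N choose j) else 0)"
    unfolding H_def coeff_sum by (intro sum.cong refl) (use j in \<open>auto simp: binomial_eq_0_iff\<close>)
  moreover have "N \<le> degree g" using N le_degree by auto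
  ultimately show False using nz N by simp
qed

section \<open>Additive functions on a finite field\<close>

context prime_power_field
begin

definition additive_fun :: "('f \<Rightarrow> 'f) \<Rightarrow> bool" where
  "additive_fun f \<longleftrightarrow> (\<forall>x y. f (x + y) = f x + f y)"

lemma additive_0: "additive_fun f \<Longrightarrow> f 0 = 0"
  unfolding additive_fun_def by (metis add_cancel_right_right add_0_left)

lemma additive_minus: "additive_fun f \<Longrightarrow> f (- x) = - f x"
  using additive_0 unfolding additive_fun_def by (metis add.right_inverse add_eq_0_iff)

lemma additive_diff: "additive_fun f \<Longrightarrow> f (x - y) = f x - f y"
  using additive_minus unfolding additive_fun_def by (metis add_uminus_conv_diff)

lemma p_pow_inj: "p ^ i = p ^ j \<longleftrightarrow> i = j"
  using p_gt_1 by simp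

lemma p_pow_lt: "p ^ i < p ^ j \<longleftrightarrow> i < j"
  using p_gt_1 by simp

lemma q_gt_1: "p ^ t > 1"
  using one_less_power[OF p_gt_1 t_pos] .

lemma power_q: "(x::'f) ^ (p ^ t) = x"
  using power_card_field[of x] card_F by simp

lemma power_p_mod: "(x::'f) ^ (p ^ (i mod t)) = x ^ (p ^ i)"
proof -
  have "x ^ (p ^ (t * k)) = x" for x :: 'f and k
    by (induction k) (auto simp: power_add power_mult power_q)
  then have "x ^ (p ^ (t * (i div t) + i mod t)) = x ^ (p ^ (i mod t))"
    unfolding power_add[of p] power_mult[of x] by (rule arg_cong)
  then show ?thesis unfolding mult_div_mod_eq by (rule sym)
qed

text \<open>The polynomial \<open>1 - (X - a) ^ (q - 1)\<close> is the indicator function of \<open>a\<close>.\<close>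

lemma interpolation: "\<exists>P. degree P < p ^ t \<and> (\<forall>x. poly P x = (f x :: 'f))"
proof -
  define P where "P = (\<Sum>a\<in>UNIV. smult (f a) (1 - [:- a, 1:] ^ (p ^ t - 1)))"
  have "degree P \<le> p ^ t - 1" unfolding P_def
    by (intro degree_sum_le) (auto intro!: order.trans[OF degree_smult_le] degree_diff_le simp: degree_linear_power)
  moreover have "poly P x = f x" for x
  proof -
    have *: "(x - a) ^ (p ^ t - 1) = (if a = x then 0 else 1)" for a
    proof (cases "a = x")
      case False
      have "(x - a) * (x - a) ^ (p ^ t - 1) = (x - a) ^ Suc (p ^ t - 1)" by (rule power_Suc[symmetric])
      also have "Suc (p ^ t - 1) = p ^ t" using q_gt_1 by linarith
      also have "(x - a) ^ p ^ t = (x - a) * 1" using power_q by simp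
      finally have "(x - a) * (x - a) ^ (p ^ t - 1) = (x - a) * 1" .
      then show ?thesis using False by (metis mult_left_cancel right_minus_eq)
    next
      case True
      have "p ^ t - 1 > 0" using q_gt_1 by linarith
      then show ?thesis using True by (simp only: power_0_left) simp
    qed
    have "poly P x = (\<Sum>a\<in>UNIV. f a * (1 - (x - a) ^ (p ^ t - 1)))"
      by (simp add: P_def poly_sum)
    also have "\<dots> = (\<Sum>a\<in>UNIV. if a = x then f a else 0)" by (intro sum.cong refl) (simp add: * del: One_nat_def)
    finally show ?thesis by simp
  qed
  moreover have "p ^ t - 1 < p ^ t" using q_gt_1 by linarith
  ultimately show ?thesis using le_less_trans by blast
qed

lemma additive_fun_repr:
  assumes "additive_fun f"
  shows "\<exists>a. \<forall>x. f x = (\<Sum>j<t. a j * x ^ (p ^ j))"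
proof -
  obtain P where P: "degree P < p ^ t" "\<And>x. poly P x = f x" using interpolation[of f] by blast
  have ex: "\<exists>i. N = p ^ i" if "coeff P N \<noteq> 0" for N
    by (rule additive_poly_exponents[OF prime_p of_nat_p, of UNIV P N])
       (use P assms that card_F in \<open>auto simp: additive_fun_def\<close>)
  have "f x = (\<Sum>j<t. coeff P (p ^ j) * x ^ (p ^ j))" for x
  proof -
    have "f x = (\<Sum>N<p ^ t. coeff P N * x ^ N)"
      unfolding P(2)[symmetric] poly_altdef
      by (rule sum.mono_neutral_left) (use P in \<open>auto simp: not_le coeff_eq_0\<close>)
    also have "\<dots> = (\<Sum>N\<in>(\<lambda>j. p ^ j) ` {..<t}. coeff P N * x ^ N)"
    proof (rule sum.mono_neutral_right)
      show "\<forall>N\<in>{..<p ^ t} - (\<lambda>j. p ^ j) ` {..<t}. coeff P N * x ^ N = 0"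
      proof
        fix N assume N: "N \<in> {..<p ^ t} - (\<lambda>j. p ^ j) ` {..<t}"
        then have "\<nexists>i. N = p ^ i" using p_pow_lt by auto
        then show "coeff P N * x ^ N = 0" using ex by auto
      qed
    qed (use p_pow_lt in auto)
    also have "\<dots> = (\<Sum>j<t. coeff P (p ^ j) * x ^ (p ^ j))"
      by (subst sum.reindex) (auto simp: inj_on_def p_pow_inj)
    finally show ?thesis .
  qed
  then show ?thesis by (intro exI[of _ "\<lambda>j. coeff P (p ^ j)"]) auto
qed

lemma additive_repr_zero:
  assumes "\<And>x::'f. (\<Sum>j<t. a j * x ^ (p ^ j)) = 0" "j < t"
  shows "a j = 0"
proof -
  define P where "P = (\<Sum>j<t. monom (a j) (p ^ j))"
  have "degree P \<le> p ^ t - 1" unfolding P_def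
  proof (intro degree_sum_le)
    fix i assume "i \<in> {..<t}"
    then have "p ^ i < p ^ t" using p_pow_lt by auto
    then show "degree (monom (a i) (p ^ i)) \<le> p ^ t - 1"
      using degree_monom_le[of "a i" "p ^ i"] by linarith
  qed simp
  moreover have "poly P x = 0" for x using assms by (simp add: P_def poly_sum poly_monom)
  ultimately have "P = 0" using poly_zero_on[of UNIV P] card_F q_gt_1 by auto
  then have "coeff P (p ^ j) = 0" by simp
  moreover have "coeff P (p ^ j) = (\<Sum>i<t. if i = j then a i else 0)"
    unfolding P_def coeff_sum by (intro sum.cong refl) (simp add: p_pow_inj)
  ultimately show ?thesis using assms(2) by simp
qed

subsection \<open>The fixed fields of powers of Frobenius\<close>

definition Fix :: "nat \<Rightarrow> 'f set" where
  "Fix d = {x. x ^ (p ^ d) = x}"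

lemma is_subfield_Fix: "is_subfield (Fix d)"
  unfolding is_subfield_def Fix_def using p_gt_1
  by (auto simp: freshman[OF prime_p of_nat_p] freshman_minus[OF prime_p of_nat_p]
      power_mult_distrib power_inverse power_0_left)

lemma Fix_pow: "x \<in> Fix d \<Longrightarrow> x ^ (p ^ (d * k)) = x"
  by (induction k) (auto simp: Fix_def power_add power_mult)

lemma card_roots_pow:
  assumes "a n \<noteq> 0" "\<And>x. x \<in> A \<Longrightarrow> (\<Sum>i\<le>n. a i * (x::'f) ^ (p ^ (d * i))) = 0" "d > 0"
  shows "card A \<le> p ^ (d * n)"
proof -
  define P where "P = (\<Sum>i\<le>n. monom (a i) (p ^ (d * i)))"
  have "degree P \<le> p ^ (d * n)" unfolding P_def
  proof (intro degree_sum_le)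
    fix i assume "i \<in> {..n}"
    then have "p ^ (d * i) \<le> p ^ (d * n)" using p_gt_1 by (intro power_increasing) auto
    then show "degree (monom (a i) (p ^ (d * i))) \<le> p ^ (d * n)"
      using degree_monom_le[of "a i" "p ^ (d * i)"] by linarith
  qed simp
  moreover have "coeff P (p ^ (d * n)) = (\<Sum>i\<le>n. if i = n then a i else 0)"
    unfolding P_def coeff_sum by (intro sum.cong refl) (use assms(3) in \<open>auto simp: p_pow_inj\<close>)
  then have "P \<noteq> 0" using assms(1) by auto
  moreover have "A \<subseteq> {x. poly P x = 0}" using assms(2) by (auto simp: P_def poly_sum poly_monom)
  moreover have "finite {x. poly P x = 0}" using poly_roots_finite[OF \<open>P \<noteq> 0\<close>] .
  ultimately show ?thesis
    using card_poly_roots_bound[of P] card_mono[of "{x. poly P x = 0}" A] by linarith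
qed

text \<open>The trace onto the fixed field has a kernel of at most \<open>q / p ^ d\<close> elements, so the fixed
  field has at least \<open>p ^ d\<close>.\<close>

lemma card_Fix: assumes "d dvd t" shows "card (Fix d) = p ^ d"
proof (rule antisym)
  have d: "d > 0" using assms t_pos by (auto intro: gr0I)
  obtain n where n: "t = d * n" using assms by blast
  then have "n > 0" using t_pos by auto
  then obtain m where m: "n = Suc m" by (cases n) auto
  have "card (Fix d) \<le> p ^ (d * 1)"
    by (rule card_roots_pow[of "\<lambda>i. if i = 0 then -1 else 1"]) (use d in \<open>auto simp: Fix_def\<close>)
  then show "card (Fix d) \<le> p ^ d" by simp
  define T where "T x = (\<Sum>i\<le>m. x ^ (p ^ (d * i)))" for x :: 'f
  have "T x \<in> Fix d" for x
  proof -
    have "T x ^ (p ^ d) = (\<Sum>i\<le>m. x ^ (p ^ (d * Suc i)))"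
      unfolding T_def freshman_sum[OF prime_p of_nat_p]
      by (intro sum.cong refl) (simp add: power_mult[symmetric] power_add[symmetric] add.commute)
    also have "\<dots> = (\<Sum>i\<in>{1..n}. x ^ (p ^ (d * i)))"
      unfolding m by (rule sum.reindex_bij_witness[of _ "\<lambda>i. i - 1" Suc]) auto
    also have "\<dots> = (\<Sum>i\<in>{1..m}. x ^ (p ^ (d * i))) + x"
      using n m power_q[of x] by simp
    also have "\<dots> = T x" unfolding T_def
      by (simp add: atMost_atLeast0 sum.atLeast_Suc_atMost[of 0 m] add.commute)
    finally show ?thesis by (simp add: Fix_def)
  qed
  then have im: "range T \<subseteq> Fix d" by auto
  have sub: "T (x - y) = T x - T y" for x y
    by (simp add: T_def freshman_diff[OF prime_p of_nat_p] sum_subtractf)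
  have fib: "card (T -` {z}) \<le> p ^ (d * m)" for z
  proof (cases "T -` {z} = {}")
    case False
    then obtain x0 where x0: "T x0 = z" by auto
    have "T -` {z} = (\<lambda>x. x0 + x) ` (T -` {0})"
    proof (intro set_eqI iffI)
      fix x assume "x \<in> T -` {z}"
      then have "x - x0 \<in> T -` {0}" using sub x0 by auto
      then show "x \<in> (\<lambda>x. x0 + x) ` (T -` {0})" by (intro image_eqI[of _ _ "x - x0"]) auto
    next
      fix x assume "x \<in> (\<lambda>x. x0 + x) ` (T -` {0})"
      then obtain y where "x = x0 + y" "T y = 0" by auto
      then show "x \<in> T -` {z}" using sub[of x x0] x0 by auto
    qed
    then have "card (T -` {z}) \<le> card (T -` {0})" by (simp add: card_image_le)
    also have "\<dots> \<le> p ^ (d * m)"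
      by (rule card_roots_pow[of "\<lambda>i. 1"]) (use d in \<open>auto simp: T_def\<close>)
    finally show ?thesis .
  qed simp
  have "p ^ t = card (\<Union>z\<in>Fix d. T -` {z})"
    using im card_F by (metis (no_types, lifting) UN_I UNIV_I range_subsetD vimage_singleton_eq UNIV_eq_I)
  also have "\<dots> \<le> (\<Sum>z\<in>Fix d. card (T -` {z}))" by (rule card_UN_le) simp
  also have "\<dots> \<le> card (Fix d) * p ^ (d * m)" using sum_mono[of "Fix d" "\<lambda>z. card (T -` {z})" "\<lambda>_. p ^ (d * m)"] fib by simp
  finally have "p ^ (d * m) * p ^ d \<le> p ^ (d * m) * card (Fix d)" using n m by (simp add: power_add mult.commute)
  then show "p ^ d \<le> card (Fix d)" using p_gt_1 by simp
qed

lemma Fix_mono: "d dvd d' \<Longrightarrow> Fix d \<subseteq> Fix d'"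
  using Fix_pow unfolding dvd_def by (auto simp: Fix_def)

end

section \<open>Polynomials whose degrees are separated by base-p digits\<close>

lemma sum_powers_lt: "(p::nat) \<ge> 2 \<Longrightarrow> (\<Sum>i<m. p ^ i) < p ^ m"
proof (induction m)
  case (Suc m)
  have "p ^ m + p ^ m \<le> p * p ^ m" using Suc.prems by (metis mult_2 mult_le_mono1)
  then show ?case using Suc by simp
qed simp

text \<open>Uniqueness of base-\<open>p\<close> expansions: the largest exponent occurring in only one of the sums outweighs
  everything below it.\<close>

lemma sum_powers_inj:
  assumes p: "(p::nat) \<ge> 2" and fin: "finite S" "finite T" and eq: "(\<Sum>i\<in>S. p ^ i) = (\<Sum>i\<in>T. p ^ i)"
  shows "S = T"
proof (rule ccontr)
  assume "S \<noteq> T"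
  let ?D = "(S - T) \<union> (T - S)"
  have D: "finite ?D" "?D \<noteq> {}" using fin \<open>S \<noteq> T\<close> by auto
  define m where "m = Max ?D"
  have m: "m \<in> ?D" "\<And>i. i \<in> ?D \<Longrightarrow> i \<le> m" using D by (auto simp: m_def simp del: Un_iff Diff_iff)
  have aux: False if "m \<in> S" "m \<notin> T" "\<And>i. i \<in> (S - T) \<union> (T - S) \<Longrightarrow> i \<le> m"
     "(\<Sum>i\<in>S. p ^ i) = (\<Sum>i\<in>T. p ^ i)" "finite S" "finite T" for S T
  proof -
    have "T - S \<subseteq> {..<m}"
    proof
      fix i assume "i \<in> T - S"
      then have "i \<le> m" "i \<noteq> m" using that(1,3) by auto
      then show "i \<in> {..<m}" by simp
    qed
    then have "(\<Sum>i\<in>T - S. p ^ i) \<le> (\<Sum>i<m. p ^ i)" by (intro sum_mono2) auto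
    also have "\<dots> < p ^ m" by (rule sum_powers_lt[OF p])
    also have "\<dots> \<le> (\<Sum>i\<in>S - T. p ^ i)" using that by (intro member_le_sum) auto
    finally have "(\<Sum>i\<in>T - S. p ^ i) < (\<Sum>i\<in>S - T. p ^ i)" .
    moreover have "(\<Sum>i\<in>S. p ^ i) = (\<Sum>i\<in>S - T. p ^ i) + (\<Sum>i\<in>S \<inter> T. p ^ i)"
      using that(5) by (metis sum.Int_Diff add.commute)
    moreover have "(\<Sum>i\<in>T. p ^ i) = (\<Sum>i\<in>T - S. p ^ i) + (\<Sum>i\<in>S \<inter> T. p ^ i)"
      using that(6) by (metis sum.Int_Diff add.commute Int_commute)
    ultimately show False using that(4) by simp
  qed
  show False
  proof (cases "m \<in> S")
    case True then show False using aux[of S T] m eq fin by auto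
  next
    case False then show False using aux[of T S] m eq fin by auto
  qed
qed

text \<open>The degree of a nonzero \<open>c j\<close> turns out to be \<open>degree (c 0)\<close> minus a sum of distinct powers \<open>p ^ i\<close>,
  where \<open>j\<close> is among the exponents \<open>i\<close>, and all others have \<open>c i\<close> of larger degree. Such a set of
  exponents is determined by its sum, and \<open>j\<close> is recovered from it as the member with smallest degree.
  This is shown by induction from the top degree downwards: the left side of the relation for \<open>j\<close> has degree
  \<open>degree (c j) + p ^ j\<close>, so it is the degree of the unique leading \<open>c l\<close> on the right.\<close>

lemma degree_separation:
  fixes c :: "nat \<Rightarrow> 'a::idom poly" and a :: "nat \<Rightarrow> nat \<Rightarrow> 'a"
  assumes p: "(p::nat) \<ge> 2" and H: "finite H"
    and eq: "\<And>j. j \<in> H \<Longrightarrow> j \<noteq> 0 \<Longrightarrow> c j * monom 1 (p ^ j) = (\<Sum>l\<in>H. smult (a j l) (c l))"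
  shows "inj_on (\<lambda>l. degree (c l)) {l \<in> H. c l \<noteq> 0}"
proof -
  let ?S = "{l \<in> H. c l \<noteq> 0}"
  \<comment> \<open>\<open>S\<close> is the set of exponents that separate \<open>j\<close> from \<open>0\<close>; it is empty for \<open>j = 0\<close>.\<close>
  define P where "P j \<longleftrightarrow> (\<exists>S\<subseteq>?S. 0 \<notin> S \<and> degree (c j) + (\<Sum>i\<in>S. p ^ i) = degree (c 0) \<and>
      (j \<noteq> 0 \<longrightarrow> j \<in> S) \<and> (\<forall>i\<in>S. i \<noteq> j \<longrightarrow> degree (c i) > degree (c j)))" for j
  have distinct: "j = k" if Pj: "P j" and Pk: "P k" and jk: "degree (c j) = degree (c k)" for j k
  proof (rule ccontr)
    assume ne: "j \<noteq> k"
    obtain S where S: "S \<subseteq> ?S" "0 \<notin> S" "degree (c j) + (\<Sum>i\<in>S. p ^ i) = degree (c 0)"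
      "j \<noteq> 0 \<longrightarrow> j \<in> S" "\<forall>i\<in>S. i \<noteq> j \<longrightarrow> degree (c i) > degree (c j)"
      using Pj unfolding P_def by blast
    obtain T where T: "T \<subseteq> ?S" "0 \<notin> T" "degree (c k) + (\<Sum>i\<in>T. p ^ i) = degree (c 0)"
      "k \<noteq> 0 \<longrightarrow> k \<in> T" "\<forall>i\<in>T. i \<noteq> k \<longrightarrow> degree (c i) > degree (c k)"
      using Pk unfolding P_def by blast
    have "finite S" "finite T" using S T H finite_subset[of _ ?S] by auto
    moreover have "(\<Sum>i\<in>S. p ^ i) = (\<Sum>i\<in>T. p ^ i)" using S(3) T(3) jk by linarith
    ultimately have "S = T" using sum_powers_inj[OF p] by blast
    show False
    proof (cases "k = 0")
      case True
      then show False using ne S T \<open>S = T\<close> jk by force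
    next
      case False
      then show False using ne S T \<open>S = T\<close> jk by force
    qed
  qed
  have "P j" if "j \<in> ?S" for j
  proof -
    define M where "M = (\<Sum>l\<in>H. degree (c l))"
    have M: "degree (c l) \<le> M" if "l \<in> ?S" for l
      unfolding M_def using that H by (intro member_le_sum) auto
    show ?thesis using that
    proof (induction "M - degree (c j)" arbitrary: j rule: less_induct)
      case less
      have IH: "P l" if "l \<in> ?S" "degree (c l) > degree (c j)" for l
        using less.hyps[of l] that M[of l] by auto
      show ?case
      proof (cases "j = 0")
        case True then show ?thesis unfolding P_def by (intro exI[of _ "{}"]) auto
      next
        case False
        let ?R = "\<Sum>l\<in>H. smult (a j l) (c l)"
        have R: "?R = c j * monom 1 (p ^ j)" using eq less.prems False by auto
        have cj: "c j \<noteq> 0" using less.prems by auto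
        have dR: "degree ?R = degree (c j) + p ^ j"
          unfolding R using cj by (simp add: degree_mult_eq degree_monom_eq)
        define Hi where "Hi = {l \<in> ?S. degree (c l) > degree (c j) \<and> a j l \<noteq> 0}"
        have finHi: "finite Hi" using H by (simp add: Hi_def)
        have "Hi \<noteq> {}"
        proof
          assume "Hi = {}"
          then have "degree (smult (a j l) (c l)) \<le> degree (c j)" if "l \<in> H" for l
            using that by (cases "c l = 0 \<or> a j l = 0") (auto simp: Hi_def not_less)
          then have "degree ?R \<le> degree (c j)" using H by (intro degree_sum_le) auto
          then show False using dR p by simp
        qed
        then obtain l0 where l0: "l0 \<in> Hi" "\<And>l. l \<in> Hi \<Longrightarrow> degree (c l) \<le> degree (c l0)"
        proof -
          have "Max ((\<lambda>l. degree (c l)) ` Hi) \<in> (\<lambda>l. degree (c l)) ` Hi"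
            using finHi \<open>Hi \<noteq> {}\<close> by (intro Max_in) auto
          then obtain l where "l \<in> Hi" "degree (c l) = Max ((\<lambda>l. degree (c l)) ` Hi)" by auto
          then show thesis using that[of l] finHi by simp
        qed
        have small: "degree (c l) < degree (c l0)" if "l \<in> H" "c l \<noteq> 0" "a j l \<noteq> 0" "l \<noteq> l0" for l
        proof (cases "l \<in> Hi")
          case True
          have "degree (c l) \<noteq> degree (c l0)"
            using distinct[of l l0] IH[of l] IH[of l0] True l0(1) that by (auto simp: Hi_def)
          then show ?thesis using l0(2)[OF True] by simp
        next
          case False
          then show ?thesis using that l0(1) by (auto simp: Hi_def)
        qed
        have "degree ?R \<le> degree (c l0)"
        proof (intro degree_sum_le H)
          fix l assume "l \<in> H"
          then show "degree (smult (a j l) (c l)) \<le> degree (c l0)"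
            using small[of l] by (cases "l = l0"; cases "c l = 0 \<or> a j l = 0") auto
        qed
        moreover have "coeff ?R (degree (c l0)) = (\<Sum>l\<in>H. if l = l0 then a j l0 * lead_coeff (c l0) else 0)"
          unfolding coeff_sum
        proof (rule sum.cong[OF refl])
          fix l assume "l \<in> H"
          then show "coeff (smult (a j l) (c l)) (degree (c l0)) = (if l = l0 then a j l0 * lead_coeff (c l0) else 0)"
            using small[of l] by (cases "l = l0"; cases "c l = 0 \<or> a j l = 0") (auto simp: coeff_eq_0)
        qed
        then have "coeff ?R (degree (c l0)) \<noteq> 0" using l0(1) H by (auto simp: Hi_def)
        ultimately have d0: "degree (c l0) = degree (c j) + p ^ j"
          using dR le_degree by (metis le_antisym)
        obtain S where S: "S \<subseteq> ?S" "0 \<notin> S" "degree (c l0) + (\<Sum>i\<in>S. p ^ i) = degree (c 0)"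
          "\<forall>i\<in>S. i \<noteq> l0 \<longrightarrow> degree (c i) > degree (c l0)"
          using IH[of l0] l0(1) unfolding P_def Hi_def by blast
        have big: "degree (c i) > degree (c j)" if "i \<in> S" for i
          using S(4) that d0 p by (cases "i = l0") (auto intro: less_trans)
        then have "j \<notin> S" by auto
        moreover have "finite S" using S(1) H finite_subset[of _ ?S] by auto
        ultimately have "degree (c j) + (\<Sum>i\<in>insert j S. p ^ i) = degree (c 0)" using S(3) d0 by simp
        then show ?thesis unfolding P_def
          using S(1,2) less.prems False big by (intro exI[of _ "insert j S"]) auto
      qed
    qed
  qed
  then show ?thesis using distinct by (auto simp: inj_on_def)
qed

section \<open>Steps modulo \<open>t\<close>\<close>

text \<open>The residues that sums of elements of \<open>J\<close> leave modulo \<open>t\<close>.\<close>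

inductive_set reach :: "nat \<Rightarrow> nat set \<Rightarrow> nat set" for t :: nat and J :: "nat set" where
  zero: "0 \<in> reach t J"
| step: "l \<in> reach t J \<Longrightarrow> j \<in> J \<Longrightarrow> (l + j) mod t \<in> reach t J"

text \<open>The greatest common divisor of \<open>t\<close> and \<open>J\<close>, in the form in which it arises: as a residue reached from
  \<open>0\<close>. The search over positive \<open>d\<close> makes the value \<open>t\<close>, not \<open>0\<close>, when only \<open>0\<close> is reached.\<close>

definition step_gcd :: "nat \<Rightarrow> nat set \<Rightarrow> nat" where
  "step_gcd t J = (LEAST d. d > 0 \<and> d mod t \<in> reach t J)"

lemma reach_lt: "l \<in> reach t J \<Longrightarrow> t > 0 \<Longrightarrow> l < t"
  by (induction rule: reach.induct) auto

lemma reach_add: "b \<in> reach t J \<Longrightarrow> a \<in> reach t J \<Longrightarrow> (a + b) mod t \<in> reach t J"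
proof (induction rule: reach.induct)
  case zero
  then show ?case by (induction rule: reach.induct) (auto intro: reach.intros)
next
  case (step l j)
  then have "((a + l) mod t + j) mod t \<in> reach t J" by (blast intro: reach.step)
  moreover have "((a + l) mod t + j) mod t = (a + (l + j) mod t) mod t"
    by (metis add.assoc mod_add_left_eq mod_add_right_eq)
  ultimately show ?case by simp
qed

lemma step_gcd_props:
  assumes t: "t > 0"
  shows "step_gcd t J > 0" "step_gcd t J mod t \<in> reach t J" "step_gcd t J dvd t"
    "j \<in> J \<Longrightarrow> step_gcd t J dvd j"
proof -
  let ?d = "step_gcd t J"
  have "t > 0 \<and> t mod t \<in> reach t J" using t reach.zero by simp
  then have "?d > 0 \<and> ?d mod t \<in> reach t J" unfolding step_gcd_def by (rule LeastI)
  then show d: "?d > 0" "?d mod t \<in> reach t J" by auto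
  have mult: "(n * ?d) mod t \<in> reach t J" for n
  proof (induction n)
    case 0 then show ?case using reach.zero by simp
  next
    case (Suc n)
    have "(((n * ?d) mod t) + (?d mod t)) mod t \<in> reach t J" by (rule reach_add[OF d(2) Suc])
    then show ?case by (metis add.commute mod_add_eq mult_Suc)
  qed
  have dv: "?d dvd m" if m: "m mod t \<in> reach t J" for m
  proof (rule ccontr)
    assume nd: "\<not> ?d dvd m"
    let ?a = "m div ?d" and ?r = "m mod ?d"
    have r: "?r > 0" "?r < ?d" using nd d by (auto simp: dvd_eq_mod_eq_0)
    have "m + ?a * (t - 1) * ?d = ?r + ?a * ?d * t"
    proof -
      have "m = ?a * ?d + ?r" by (simp only: div_mult_mod_eq)
      moreover have "?a * ?d + ?a * (t - 1) * ?d = ?a * ?d * t" using t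
        by (cases t) (auto simp: algebra_simps)
      ultimately show ?thesis by linarith
    qed
    then have "(m mod t + (?a * (t - 1) * ?d) mod t) mod t = ?r mod t"
      by (metis mod_add_eq mod_mult_self1)
    moreover have "(m mod t + (?a * (t - 1) * ?d) mod t) mod t \<in> reach t J"
      by (rule reach_add[OF mult m])
    ultimately have "?r mod t \<in> reach t J" by simp
    then show False using r not_less_Least[of ?r "\<lambda>d. d > 0 \<and> d mod t \<in> reach t J"]
      unfolding step_gcd_def by blast
  qed
  show "?d dvd t" using dv[of t] reach.zero by simp
  show "?d dvd j" if "j \<in> J"
    using dv[of j] reach.step[OF reach.zero that] by simp
qed

section \<open>The Redei polynomial of an additive function\<close>

lemma poly_of_nat_zero: "(of_nat p :: 'a::comm_ring_1) = 0 \<Longrightarrow> (of_nat p :: 'a poly) = 0"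
  by (simp add: of_nat_poly)

text \<open>For a polynomial in \<open>X\<close> with coefficients in \<open>F[Y]\<close> the sum of \<open>N\<close> and the degree of the \<open>N\<close>-th
  coefficient is bounded by the total degree, which is subadditive.\<close>

lemma total_degree_prod:
  fixes r :: "'b \<Rightarrow> 'a::idom poly poly"
  assumes "finite A" "\<And>x N. x \<in> A \<Longrightarrow> coeff (r x) N \<noteq> 0 \<Longrightarrow> degree (coeff (r x) N) + N \<le> 1"
  shows "coeff (\<Prod>x\<in>A. r x) N \<noteq> 0 \<Longrightarrow> degree (coeff (\<Prod>x\<in>A. r x) N) + N \<le> card A"
  using assms
proof (induction A arbitrary: N rule: finite_induct)
  case empty
  then show ?case by (cases N) (auto simp: coeff_1)
next
  case (insert a A)
  let ?P = "\<Prod>x\<in>A. r x"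
  have IH: "degree (coeff ?P M) + M \<le> card A" if "coeff ?P M \<noteq> 0" for M
    using insert.IH[OF that] insert.prems(2) by auto
  have "coeff (r a * ?P) N = (\<Sum>i\<le>N. coeff (r a) i * coeff ?P (N - i))" by (rule coeff_mult)
  then have c: "coeff (\<Prod>x\<in>insert a A. r x) N = (\<Sum>i\<le>N. coeff (r a) i * coeff ?P (N - i))"
    using insert.hyps by simp
  have t: "coeff (r a) i * coeff ?P (N - i) = 0 \<or> degree (coeff (r a) i * coeff ?P (N - i)) + N \<le> Suc (card A)" if "i \<le> N" for i
  proof (cases "coeff (r a) i = 0 \<or> coeff ?P (N - i) = 0")
    case False
    then have "degree (coeff (r a) i) + i \<le> 1" "degree (coeff ?P (N - i)) + (N - i) \<le> card A"
      using insert.prems(2)[of a i] IH by auto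
    then show ?thesis using that False by (simp add: degree_mult_eq)
  qed auto
  obtain i where "i \<le> N" "coeff (r a) i * coeff ?P (N - i) \<noteq> 0"
    using insert.prems(1) unfolding c by (meson atMost_iff sum.not_neutral_contains_not_neutral)
  then have "N \<le> Suc (card A)" using t by fastforce
  moreover have "degree (\<Sum>i\<le>N. coeff (r a) i * coeff ?P (N - i)) \<le> Suc (card A) - N"
  proof (intro degree_sum_le)
    fix i assume "i \<in> {..N}"
    then show "degree (coeff (r a) i * coeff ?P (N - i)) \<le> Suc (card A) - N"
      using t[of i] by auto
  qed simp
  ultimately show ?case unfolding c using insert.hyps by simp
qed

lemma coeff_eval_prod:
  fixes r :: "'b \<Rightarrow> 'a::comm_ring_1 poly poly" and u :: "'b \<Rightarrow> 'a poly"
  assumes "finite A" "\<And>x N. x \<in> A \<Longrightarrow> poly (coeff (r x) N) y = coeff (u x) N"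
  shows "poly (coeff (\<Prod>x\<in>A. r x) N) y = coeff (\<Prod>x\<in>A. u x) N"
  using assms
proof (induction A arbitrary: N rule: finite_induct)
  case empty
  then show ?case by (cases N) (auto simp: coeff_1)
next
  case (insert a A)
  then show ?case by (simp add: coeff_mult poly_sum)
qed

lemma coeff_dvd_prod:
  fixes u :: "'b \<Rightarrow> 'a::comm_ring_1 poly"
  assumes "finite A" "\<And>x N. x \<in> A \<Longrightarrow> coeff (u x) N \<noteq> 0 \<Longrightarrow> (k::nat) dvd N"
  shows "coeff (\<Prod>x\<in>A. u x) N \<noteq> 0 \<Longrightarrow> k dvd N"
  using assms
proof (induction A arbitrary: N rule: finite_induct)
  case empty
  then show ?case by (cases N) (auto simp: coeff_1)
next
  case (insert a A)
  have "(\<Sum>i\<le>N. coeff (u a) i * coeff (\<Prod>x\<in>A. u x) (N - i)) \<noteq> 0"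
    using insert.prems(1) insert.hyps by (simp add: coeff_mult)
  then obtain i where i: "i \<le> N" "coeff (u a) i * coeff (\<Prod>x\<in>A. u x) (N - i) \<noteq> 0"
    by (meson atMost_iff sum.not_neutral_contains_not_neutral)
  then have "coeff (u a) i \<noteq> 0" "coeff (\<Prod>x\<in>A. u x) (N - i) \<noteq> 0" by auto
  then have "k dvd i" "k dvd N - i" using insert.prems(2)[of a i] insert.IH insert.prems(2) by auto
  then have "k dvd i + (N - i)" by (rule dvd_add)
  then show ?case using i(1) by simp
qed

context prime_power_field
begin

lemma of_nat_p_poly: "(of_nat p :: 'f poly) = 0"
  by (rule poly_of_nat_zero[OF of_nat_p])

definition lin_form :: "('f \<Rightarrow> 'f) \<Rightarrow> 'f \<Rightarrow> 'f poly" where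
  "lin_form f x = [:- f x, x:]"

text \<open>The polynomial \<open>R(X, Y) = \<Prod>\<^sub>x (X - (x Y - f x))\<close>, as a polynomial in \<open>X\<close> with coefficients in
  \<open>F[Y]\<close>; \<open>redei_at f y\<close> is \<open>R(X, y)\<close>. Its value at \<open>Y = y\<close> records the fibres of \<open>x \<mapsto> x y - f x\<close>, whose
  kernel is \<open>eigen f y\<close>.\<close>

definition redei :: "('f \<Rightarrow> 'f) \<Rightarrow> 'f poly poly" where
  "redei f = (\<Prod>x\<in>UNIV. [:- lin_form f x, 1:])"

definition redei_at :: "('f \<Rightarrow> 'f) \<Rightarrow> 'f \<Rightarrow> 'f poly" where
  "redei_at f y = (\<Prod>x\<in>UNIV. [:- (x * y - f x), 1:])"

definition eigen :: "('f \<Rightarrow> 'f) \<Rightarrow> 'f \<Rightarrow> 'f set" where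
  "eigen f y = {x. f x = x * y}"

lemma degree_redei: "degree (redei f) = p ^ t"
  unfolding redei_def by (subst degree_prod_eq_sum_degree) (auto simp: card_F)

lemma lead_coeff_redei: "coeff (redei f) (p ^ t) = 1"
proof -
  have "lead_coeff (redei f) = 1" unfolding redei_def by (simp add: lead_coeff_prod)
  then show ?thesis by (simp add: degree_redei)
qed

lemma poly_redei: "poly (redei f) z = (\<Prod>x\<in>UNIV. z - lin_form f x)"
  by (simp add: redei_def poly_prod)

lemma poly_redei_lin_form: "poly (redei f) (lin_form f x) = 0"
  unfolding poly_redei by (rule prod_zero) auto

lemma lin_form_add: "additive_fun f \<Longrightarrow> lin_form f (x + y) = lin_form f x + lin_form f y"
  by (simp add: lin_form_def additive_fun_def)

lemma lin_form_power: "lin_form f x ^ (p ^ i) = monom (x ^ (p ^ i)) (p ^ i) - [:f x ^ (p ^ i):]"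
proof -
  have "lin_form f x = monom x 1 - [:f x:]" by (simp add: lin_form_def monom_altdef)
  then show ?thesis
    by (simp only: freshman_diff[OF prime_p of_nat_p_poly]) (simp add: monom_power poly_const_pow)
qed

lemma poly_redei_shift: "additive_fun f \<Longrightarrow> poly (redei f) (z + lin_form f h) = poly (redei f) z"
  unfolding poly_redei
  by (rule prod.reindex_bij_witness[of _ "\<lambda>x. x + h" "\<lambda>x. x - h"]) (auto simp: lin_form_add additive_diff lin_form_def)

lemma monic_diff_degree:
  fixes a b :: "'a::comm_ring_1 poly"
  assumes "degree a = n" "degree b = n" "coeff a n = coeff b n" "n > 0"
  shows "degree (a - b) < n"
proof (rule ccontr)
  assume "\<not> degree (a - b) < n"
  moreover have "degree (a - b) \<le> n" using assms by (intro degree_diff_le) auto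
  ultimately have "degree (a - b) = n" by simp
  then have "coeff (a - b) n \<noteq> 0" using assms(4) by (metis leading_coeff_0_iff degree_0 neq0_conv)
  then show False using assms(3) by simp
qed

text \<open>The roots \<open>x Y - f x\<close> form a group, so translation by one of them preserves \<open>R\<close>. Hence
  \<open>R(X + b) - R(X) - R(b)\<close>, whose degree in \<open>X\<close> is less than \<open>q\<close>, vanishes at \<open>q\<close> points.\<close>

lemma poly_redei_additive:
  assumes f: "additive_fun f"
  shows "poly (redei f) (a + b) = poly (redei f) a + poly (redei f) b"
proof -
  define q where "q = pcompose (redei f) [:b, 1:] - redei f - [:poly (redei f) b:]"
  have "degree (pcompose (redei f) [:b, 1:] - redei f) < p ^ t"
  proof (rule monic_diff_degree)
    have "lead_coeff (pcompose (redei f) [:b, 1:]) = lead_coeff (redei f)"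
      by (subst lead_coeff_comp) auto
    then show "coeff (pcompose (redei f) [:b, 1:]) (p ^ t) = coeff (redei f) (p ^ t)"
      by (simp add: degree_pcompose degree_redei)
  qed (use p_gt_1 in \<open>auto simp: degree_pcompose degree_redei\<close>)
  then have "degree q < p ^ t"
    unfolding q_def by (rule degree_diff_less) (use p_gt_1 in auto)
  moreover have "card (range (lin_form f)) = p ^ t"
    by (subst card_image) (auto simp: inj_on_def lin_form_def card_F)
  moreover have "poly q z = 0" if "z \<in> range (lin_form f)" for z
    using that poly_redei_shift[OF f, of b] by (auto simp: q_def poly_pcompose poly_redei_lin_form add.commute)
  ultimately have "q = 0" using poly_zero_on[of "range (lin_form f)" q] by auto
  then have "poly q a = 0" by simp
  then show ?thesis by (simp add: q_def poly_pcompose add.commute algebra_simps)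
qed

lemma infinite_UNIV_poly: "infinite (UNIV :: 'f poly set)"
proof
  assume fin: "finite (UNIV :: 'f poly set)"
  have "inj (\<lambda>n. monom (1::'f) n)" by (auto simp: inj_on_def monom_eq_iff')
  then have "finite (UNIV :: nat set)" using fin finite_imageD[of "\<lambda>n. monom (1::'f) n" UNIV] by (metis finite_subset subset_UNIV)
  then show False by simp
qed

lemma redei_exponents:
  assumes f: "additive_fun f" and N: "coeff (redei f) N \<noteq> 0"
  shows "\<exists>i\<le>t. N = p ^ i"
proof -
  obtain i where i: "N = p ^ i"
    using additive_poly_exponents[OF prime_p of_nat_p_poly, of UNIV "redei f" N]
      infinite_UNIV_poly poly_redei_additive[OF f] N by auto
  have "p ^ i \<le> p ^ t" using le_degree[OF N] by (simp add: degree_redei i)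
  then show ?thesis using i p_gt_1 by auto
qed

lemma redei_degree: "coeff (redei f) N \<noteq> 0 \<Longrightarrow> degree (coeff (redei f) N) + N \<le> p ^ t"
  unfolding redei_def card_F[symmetric]
  by (rule total_degree_prod) (auto simp: lin_form_def coeff_pCons split: nat.splits if_splits)

lemma redei_eval: "poly (coeff (redei f) N) y = coeff (redei_at f y) N"
  unfolding redei_def redei_at_def
  by (rule coeff_eval_prod) (auto simp: lin_form_def coeff_pCons algebra_simps split: nat.splits)

lemma prod_linear_UNIV: "(\<Prod>z\<in>UNIV. [:- z, 1:]) = (monom 1 (p ^ t) - monom 1 1 :: 'f poly)"
proof -
  let ?P = "\<Prod>z\<in>UNIV. [:- z, 1:] :: 'f poly" and ?Q = "monom 1 (p ^ t) :: 'f poly"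
  have "degree ?P = p ^ t" by (subst degree_prod_eq_sum_degree) (auto simp: card_F)
  moreover have "lead_coeff ?P = 1" by (simp add: lead_coeff_prod)
  ultimately have "degree (?P - ?Q) < p ^ t"
    by (intro monic_diff_degree) (use p_gt_1 in \<open>auto simp: degree_monom_eq\<close>)
  moreover have "degree (monom 1 1 :: 'f poly) < p ^ t" using q_gt_1 by (simp add: degree_monom_eq)
  ultimately have "degree (?P - ?Q + monom 1 1) < p ^ t" by (intro degree_add_less)
  moreover have "poly (?P - ?Q + monom 1 1) x = 0" for x
  proof -
    have "poly ?P x = 0" unfolding poly_prod by (rule prod_zero) auto
    then show ?thesis by (simp add: poly_monom power_q)
  qed
  ultimately have "?P - ?Q + monom 1 1 = 0" using poly_zero_on[of UNIV "?P - ?Q + monom 1 1"] card_F by auto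
  then show ?thesis by (simp add: algebra_simps)
qed

lemma eigen_Ksub:
  assumes "additive_fun f"
  shows "0 \<in> eigen f y" "a \<in> eigen f y \<Longrightarrow> b \<in> eigen f y \<Longrightarrow> a - b \<in> eigen f y"
  using assms by (auto simp: eigen_def additive_0 additive_diff algebra_simps)

text \<open>If \<open>x \<mapsto> x y - f x\<close> is injective, it permutes the field.\<close>

lemma redei_at_inj:
  assumes f: "additive_fun f" and e: "card (eigen f y) = 1"
  shows "redei_at f y = monom 1 (p ^ t) - monom 1 1"
proof -
  have e0: "eigen f y = {0}" using e eigen_Ksub(1)[OF f] by (metis card_1_singletonE singletonD)
  have "inj (\<lambda>x. x * y - f x)"
  proof (rule injI)
    fix a b assume "a * y - f a = b * y - f b"
    then have "a - b \<in> eigen f y" by (auto simp: eigen_def additive_diff[OF f] algebra_simps)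
    then show "a = b" using e0 by auto
  qed
  then have "bij (\<lambda>x. x * y - f x)" by (simp add: bij_def finite_UNIV_inj_surj)
  then have "redei_at f y = (\<Prod>z\<in>UNIV. [:- z, 1:])"
    unfolding redei_at_def by (rule prod.reindex_bij_betw)
  then show ?thesis by (simp add: prod_linear_UNIV)
qed

lemma redei_at_power:
  assumes f: "additive_fun f"
  shows "redei_at f y = (\<Prod>z\<in>range (\<lambda>x. x * y - f x). [:- z, 1:]) ^ card (eigen f y)"
    and "card (range (\<lambda>x. x * y - f x)) * card (eigen f y) = p ^ t"
proof -
  let ?h = "\<lambda>x. x * y - f x"
  have fib: "card {x. ?h x = z} = card (eigen f y)" if z: "z \<in> range ?h" for z
  proof -
    obtain x0 where x0: "z = ?h x0" using z by auto
    have "{x. ?h x = z} = (\<lambda>x. x0 + x) ` eigen f y"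
    proof (intro set_eqI iffI)
      fix x assume "x \<in> {x. ?h x = z}"
      then have "x - x0 \<in> eigen f y" using x0 by (auto simp: eigen_def additive_diff[OF f] algebra_simps)
      then show "x \<in> (\<lambda>x. x0 + x) ` eigen f y" by (intro image_eqI[of _ _ "x - x0"]) auto
    next
      fix x assume "x \<in> (\<lambda>x. x0 + x) ` eigen f y"
      then show "x \<in> {x. ?h x = z}" using f x0 by (auto simp: eigen_def additive_fun_def algebra_simps)
    qed
    then show ?thesis by (simp add: card_image)
  qed
  have "redei_at f y = (\<Prod>z\<in>range ?h. \<Prod>x\<in>{x\<in>UNIV. ?h x = z}. [:- (?h x), 1:])"
    unfolding redei_at_def by (rule prod.image_gen) simp
  also have "\<dots> = (\<Prod>z\<in>range ?h. [:- z, 1:] ^ card (eigen f y))"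
  proof (rule prod.cong[OF refl])
    fix z assume z: "z \<in> range ?h"
    have "(\<Prod>x\<in>{x\<in>UNIV. ?h x = z}. [:- (?h x), 1:]) = (\<Prod>x\<in>{x. ?h x = z}. [:- z, 1:])"
      by (rule prod.cong) auto
    then show "(\<Prod>x\<in>{x\<in>UNIV. ?h x = z}. [:- (?h x), 1:]) = [:- z, 1:] ^ card (eigen f y)"
      using fib[OF z] by simp
  qed
  finally show "redei_at f y = (\<Prod>z\<in>range ?h. [:- z, 1:]) ^ card (eigen f y)"
    by (simp add: prod_power_distrib)
  have "p ^ t = (\<Sum>z\<in>range ?h. \<Sum>x\<in>{x\<in>UNIV. ?h x = z}. 1)"
    unfolding card_F[symmetric] card_eq_sum by (rule sum.image_gen) simp
  also have "\<dots> = (\<Sum>z\<in>range ?h. card (eigen f y))" by (rule sum.cong[OF refl]) (simp add: fib)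
  finally show "card (range ?h) * card (eigen f y) = p ^ t" by simp
qed

lemma card_eigen_pow:
  assumes f: "additive_fun f"
  shows "\<exists>w\<le>t. card (eigen f y) = p ^ w"
proof -
  have "card (eigen f y) dvd p ^ t" using redei_at_power(2)[OF f, of y] by (metis dvd_triv_right)
  then show ?thesis using divides_primepow_nat[OF prime_p] by blast
qed

text \<open>By \<open>redei_at_power\<close>, \<open>R(X, y)\<close> is a power whose exponent is the size of the eigenspace, itself a power
  of \<open>p\<close>; so it is a polynomial in \<open>X ^ card (eigen f y)\<close>.\<close>

lemma redei_at_exponents:
  assumes f: "additive_fun f" and N: "coeff (redei_at f y) N \<noteq> 0"
  shows "card (eigen f y) dvd N"
proof -
  obtain w where w: "card (eigen f y) = p ^ w" using card_eigen_pow[OF f] by blast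
  have "redei_at f y = (\<Prod>z\<in>range (\<lambda>x. x * y - f x). [:- z, 1:] ^ (p ^ w))"
    using redei_at_power(1)[OF f, of y] w by (simp add: prod_power_distrib)
  moreover have "[:- z, 1:] ^ (p ^ w) = monom 1 (p ^ w) - [:z ^ (p ^ w):]" for z :: 'f
  proof -
    have "[:- z, 1:] = monom 1 1 - [:z:]" by (simp add: monom_altdef)
    then show ?thesis
      by (simp only: freshman_diff[OF prime_p of_nat_p_poly]) (simp add: monom_power poly_const_pow)
  qed
  ultimately have e: "redei_at f y = (\<Prod>z\<in>range (\<lambda>x. x * y - f x). monom 1 (p ^ w) - [:z ^ (p ^ w):])" by simp
  have "p ^ w dvd N"
    by (rule coeff_dvd_prod[OF _ _ N[unfolded e]]) (auto simp: coeff_pCons split: if_splits nat.splits)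
  then show ?thesis using w by simp
qed

end

section \<open>Additive functions with large eigenspaces\<close>

lemma vec_space_mult: "vec_space ((*) :: 'f::field \<Rightarrow> 'f \<Rightarrow> 'f)"
  by unfold_locales (auto simp: algebra_simps)

text \<open>Here \<open>s\<close> eigenspaces have order \<open>k\<close>, while \<open>m\<close> larger ones have order at least \<open>k ^ 2\<close> and contain
  \<open>x\<close> nonzero vectors altogether; \<open>t1\<close> counts all nonzero vectors, and \<open>t3\<close> bounds the number of
  eigenspaces from below.\<close>

lemma eigen_count_arith:
  fixes k q s m x :: real
  assumes k: "k > 1" and t1: "q - 1 = x + s * (k - 1)" and t2: "m * (k ^ 2 - 1) \<le> x" and t3: "q \<le> k * (m + s)"
  shows "x \<le> q / k + q / k ^ 2"
proof -
  have xe: "x = (q - 1) - s * (k - 1)" using t1 by simp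
  have e1: "k * (x - m * (k - 1)) = k * (q - 1) - (k - 1) * (k * (m + s))" unfolding xe by algebra
  have e2: "k * (q - 1) - (k - 1) * (k * (m + s)) \<le> k * (q - 1) - (k - 1) * q"
    using mult_left_mono[OF t3, of "k - 1"] k by simp
  have u: "k * x \<le> q - k + k * (m * (k - 1))" using e1 e2 by (simp only: algebra_simps)
  have e3: "(k + 1) * (k * (m * (k - 1))) = k * (m * (k ^ 2 - 1))" by algebra
  have v: "(k + 1) * (k * (m * (k - 1))) \<le> k * x" unfolding e3 using t2 k by (simp add: mult_left_mono)
  have e4: "(k + 1) * (k * x) \<le> (k + 1) * (q - k + k * (m * (k - 1)))" using u k by (intro mult_left_mono) auto
  have e5: "(k + 1) * (q - k) \<le> (k + 1) * q" using k by simp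
  have "(k + 1) * (k * x) \<le> (k + 1) * q + k * x" using e4 e5 v by (simp only: distrib_left)
  then have "x * k\<^sup>2 \<le> q * (k + 1)" by (simp add: algebra_simps power2_eq_square)
  then have "x \<le> q * (k + 1) / k ^ 2" using k by (simp add: pos_le_divide_eq)
  also have "\<dots> = q / k + q / k ^ 2" using k by (simp add: add_divide_distrib distrib_left power2_eq_square)
  finally show ?thesis .
qed

lemma smult_sum_right: "smult c (\<Sum>x\<in>A. g x) = (\<Sum>x\<in>A. smult c (g x))"
  by (induction A rule: infinite_finite_induct) (auto simp: smult_add_right)

lemma smult_sum_left: "smult (\<Sum>x\<in>A. c x) g = (\<Sum>x\<in>A. smult (c x) g)"
  by (induction A rule: infinite_finite_induct) (auto simp: smult_add_left)

text \<open>Terms of distinct degrees cannot cancel.\<close>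

lemma sum_distinct_degrees:
  fixes C :: "nat \<Rightarrow> 'a::idom poly"
  assumes H: "finite H" and inj: "inj_on (\<lambda>l. degree (C l)) {l \<in> H. C l \<noteq> 0}"
    and l: "l \<in> H" "C l \<noteq> 0" "b l \<noteq> 0"
  shows "(\<Sum>l\<in>H. smult (b l) (C l)) \<noteq> 0"
proof -
  let ?A = "{l \<in> H. C l \<noteq> 0 \<and> b l \<noteq> 0}"
  have A: "finite ?A" "?A \<noteq> {}" using H l by auto
  obtain m where m: "m \<in> ?A" "\<And>i. i \<in> ?A \<Longrightarrow> degree (C i) \<le> degree (C m)"
  proof -
    have "Max ((\<lambda>l. degree (C l)) ` ?A) \<in> (\<lambda>l. degree (C l)) ` ?A"
      using A by (intro Max_in) auto
    then obtain l where "l \<in> ?A" "degree (C l) = Max ((\<lambda>l. degree (C l)) ` ?A)" by auto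
    then show thesis using that[of l] A by simp
  qed
  have "coeff (\<Sum>l\<in>H. smult (b l) (C l)) (degree (C m)) = (\<Sum>l\<in>H. if l = m then b m * lead_coeff (C m) else 0)"
    unfolding coeff_sum
  proof (rule sum.cong[OF refl])
    fix i assume i: "i \<in> H"
    show "coeff (smult (b i) (C i)) (degree (C m)) = (if i = m then b m * lead_coeff (C m) else 0)"
    proof (cases "i = m \<or> C i = 0 \<or> b i = 0")
      case False
      then have "degree (C i) \<noteq> degree (C m)" using inj i m(1) by (auto simp: inj_on_def)
      then have "degree (C i) < degree (C m)" using m(2)[of i] i False by simp
      then show ?thesis using False by (simp add: coeff_eq_0)
    qed auto
  qed
  then have "coeff (\<Sum>l\<in>H. smult (b l) (C l)) (degree (C m)) \<noteq> 0" using m(1) H by auto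
  then show ?thesis by (metis coeff_0)
qed

context prime_power_field
begin

text \<open>Raising to the power \<open>p ^ l\<close> rotates the exponents \<open>p ^ j\<close> cyclically, since \<open>x ^ q = x\<close>.\<close>

lemma additive_fun_power:
  fixes f :: "'f \<Rightarrow> 'f"
  assumes a: "\<And>x. f x = (\<Sum>j<t. a j * x ^ (p ^ j))" and l: "l < t"
  shows "f x ^ (p ^ l) = (\<Sum>j<t. a ((j + t - l) mod t) ^ (p ^ l) * x ^ (p ^ j))"
proof -
  have "f x ^ (p ^ l) = (\<Sum>i<t. a i ^ (p ^ l) * x ^ (p ^ ((i + l) mod t)))"
  proof -
    have "f x ^ (p ^ l) = (\<Sum>i<t. (a i * x ^ (p ^ i)) ^ (p ^ l))"
      unfolding a by (rule freshman_sum[OF prime_p of_nat_p])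
    also have "\<dots> = (\<Sum>i<t. a i ^ (p ^ l) * x ^ (p ^ ((i + l) mod t)))"
      by (intro sum.cong refl) (simp only: power_mult_distrib power_p_mod power_add power_mult)
    finally show ?thesis .
  qed
  also have "\<dots> = (\<Sum>j<t. a ((j + t - l) mod t) ^ (p ^ l) * x ^ (p ^ j))"
  proof (rule sum.reindex_bij_witness[of _ "\<lambda>j. (j + t - l) mod t" "\<lambda>i. (i + l) mod t"])
    fix i assume "i \<in> {..<t}"
    then have "i < t" by simp
    have "((i + l) mod t + t - l) mod t = i"
    proof (cases "i + l < t")
      case True then show ?thesis using l by simp
    next
      case False
      then have "(i + l) mod t = i + l - t" using l \<open>i < t\<close> by (simp add: mod_if)
      then show ?thesis using l False \<open>i < t\<close> by simp
    qed
    then show "((i + l) mod t + t - l) mod t = i"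
      "a (((i + l) mod t + t - l) mod t) ^ p ^ l * x ^ p ^ ((i + l) mod t) = a i ^ p ^ l * x ^ p ^ ((i + l) mod t)" by auto
  next
    fix j assume "j \<in> {..<t}"
    then have "j < t" by simp
    have "((j + t - l) mod t + l) mod t = (j + t - l + l) mod t" by (simp add: mod_add_left_eq)
    also have "\<dots> = j" using l \<open>j < t\<close> by simp
    finally show "((j + t - l) mod t + l) mod t = j" .
  qed (use t_pos in auto)
  finally show ?thesis .
qed

text \<open>The coefficient of \<open>X ^ (p ^ i)\<close> in the Redei polynomial, \<open>0 < i < e\<close>, vanishes at every \<open>y\<close> and has
  degree less than \<open>q\<close> in \<open>Y\<close>, so it is zero. What remains of \<open>R(x Y - f x, Y) = 0\<close> is, for fixed \<open>Y\<close>,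
  an additive polynomial identity in \<open>x\<close>. Comparing coefficients gives linear relations between the
  coefficients \<open>C l\<close> of \<open>R\<close> of the form required by \<open>degree_separation\<close>, with indices \<open>0\<close> and
  \<open>e \<le> l < t\<close>. Since the degrees are distinct, nothing cancels: if \<open>C l \<noteq> 0\<close> and \<open>a j \<noteq> 0\<close> then also
  the \<open>C\<close> with index \<open>(l + j) mod t\<close> is nonzero. So every residue reachable from \<open>0\<close> by steps in the
  support of \<open>a\<close> is \<open>0\<close> or at least \<open>e\<close>.\<close>

lemma eigen_step_bound:
  assumes f: "additive_fun f" and a: "\<And>x. f x = (\<Sum>j<t. a j * x ^ (p ^ j))"
    and e: "e \<ge> 1" and w: "\<And>y. card (eigen f y) = 1 \<or> p ^ e dvd card (eigen f y)"
  shows "e \<le> step_gcd t {j. j < t \<and> a j \<noteq> 0}"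
proof -
  let ?J = "{j. j < t \<and> a j \<noteq> 0}"
  let ?R = "redei f"
  have "{0, 1} \<subseteq> eigen f (f 1)" using additive_0[OF f] by (auto simp: eigen_def)
  then have "card {0, 1::'f} \<le> card (eigen f (f 1))" by (intro card_mono) auto
  then have c1: "card (eigen f (f 1)) > 1" by simp
  then have dv1: "p ^ e dvd card (eigen f (f 1))" using w[of "f 1"] by auto
  obtain w1 where w1: "w1 \<le> t" "card (eigen f (f 1)) = p ^ w1" using card_eigen_pow[OF f] by blast
  have et: "e \<le> t" using dv1 w1 power_dvd_imp_le[of p e w1] p_gt_1 by simp
  have van: "coeff ?R (p ^ i) = 0" if i: "0 < i" "i < e" for i
  proof (rule ccontr)
    assume nz: "coeff ?R (p ^ i) \<noteq> 0"
    \<comment> \<open>On a trivial eigenspace \<open>R(X, y) = X ^ q - X\<close>; otherwise all exponents are divisible by \<open>p ^ e\<close>.\<close>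
    have "poly (coeff ?R (p ^ i)) y = 0" for y
    proof (rule ccontr)
      assume "poly (coeff ?R (p ^ i)) y \<noteq> 0"
      then have n: "coeff (redei_at f y) (p ^ i) \<noteq> 0" by (simp add: redei_eval)
      from w[of y] show False
      proof
        assume "card (eigen f y) = 1"
        then have e1: "redei_at f y = monom 1 (p ^ t) - monom 1 (p ^ 0)" using redei_at_inj[OF f] by simp
        have "i = t \<or> i = 0" using n unfolding e1 coeff_diff coeff_monom p_pow_inj by (auto split: if_splits)
        then show False using i et by auto
      next
        assume "p ^ e dvd card (eigen f y)"
        then have "p ^ e dvd p ^ i" using redei_at_exponents[OF f n] dvd_trans by blast
        then show False using i p_gt_1 power_dvd_imp_le by (metis not_le)
      qed
    qed
    moreover have "degree (coeff ?R (p ^ i)) < p ^ t"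
      using redei_degree[OF nz] p_gt_1 by (metis add_le_same_cancel1 le_neq_implies_less le_add1 le_trans linorder_not_le power_eq_0_iff not_one_less_zero le_zero_eq)
    ultimately show False using nz poly_zero_on[of UNIV "coeff ?R (p ^ i)"] card_F by auto
  qed
  define r1 where "r1 = coeff ?R 1"
  \<comment> \<open>The leading term \<open>(x Y - f x) ^ q = x Y ^ q - f x\<close> contributes the \<open>1\<close>.\<close>
  define C where "C l = (if l = 0 then r1 + 1 else coeff ?R (p ^ l))" for l
  define H where "H = insert 0 {e..<t}"
  have finH: "finite H" by (simp add: H_def)
  define b where "b j l = a ((j + t - l) mod t) ^ (p ^ l)" for j l
  have rel: "r1 * lin_form f x + (\<Sum>i\<in>{e..<t}. C i * (monom (x ^ (p ^ i)) (p ^ i) - [:f x ^ (p ^ i):])) + (monom x (p ^ t) - [:f x:]) = 0" for x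
  proof -
    have "0 = (\<Sum>N\<le>p ^ t. coeff ?R N * lin_form f x ^ N)"
      using poly_redei_lin_form[of f x] unfolding poly_altdef degree_redei by simp
    also have "\<dots> = (\<Sum>N\<in>(\<lambda>i. p ^ i) ` insert 0 {e..t}. coeff ?R N * lin_form f x ^ N)"
    proof (rule sum.mono_neutral_right)
      show "(\<lambda>i. p ^ i) ` insert 0 {e..t} \<subseteq> {..p ^ t}"
        using p_gt_1 by (auto intro: power_increasing)
      show "\<forall>N\<in>{..p ^ t} - (\<lambda>i. p ^ i) ` insert 0 {e..t}. coeff ?R N * lin_form f x ^ N = 0"
      proof
        fix N assume N: "N \<in> {..p ^ t} - (\<lambda>i. p ^ i) ` insert 0 {e..t}"
        have "coeff ?R N = 0"
        proof (rule ccontr)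
          assume "coeff ?R N \<noteq> 0"
          then obtain i where i: "i \<le> t" "N = p ^ i" using redei_exponents[OF f] by blast
          have "i \<notin> insert 0 {e..t}" using N i(2) by blast
          then have "0 < i" "i < e" using i(1) by auto
          then show False using van[of i] i(2) \<open>coeff ?R N \<noteq> 0\<close> by simp
        qed
        then show "coeff ?R N * lin_form f x ^ N = 0" by simp
      qed
    qed simp
    also have "\<dots> = (\<Sum>i\<in>insert 0 {e..t}. coeff ?R (p ^ i) * lin_form f x ^ (p ^ i))"
      by (subst sum.reindex) (auto simp: inj_on_def p_pow_inj)
    also have "insert 0 {e..t} = insert 0 (insert t {e..<t})" using et by auto
    also have "(\<Sum>i\<in>insert 0 (insert t {e..<t}). coeff ?R (p ^ i) * lin_form f x ^ (p ^ i)) =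
        r1 * lin_form f x + (lin_form f x ^ (p ^ t) + (\<Sum>i\<in>{e..<t}. coeff ?R (p ^ i) * lin_form f x ^ (p ^ i)))"
      using e t_pos lead_coeff_redei[of f] by (simp add: r1_def)
    also have "(\<Sum>i\<in>{e..<t}. coeff ?R (p ^ i) * lin_form f x ^ (p ^ i)) =
        (\<Sum>i\<in>{e..<t}. C i * (monom (x ^ (p ^ i)) (p ^ i) - [:f x ^ (p ^ i):]))"
      by (intro sum.cong refl) (use e in \<open>auto simp: C_def lin_form_power\<close>)
    also have "lin_form f x ^ (p ^ t) = monom x (p ^ t) - [:f x:]" by (simp add: lin_form_power power_q)
    finally show ?thesis by (simp add: algebra_simps)
  qed
  \<comment> \<open>\<open>E j\<close> collects what multiplies \<open>x ^ (p ^ j)\<close> once the powers of \<open>f x\<close> are expanded.\<close>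
  define G where "G j = (if j = 0 then r1 * monom 1 1 + monom 1 (p ^ t) else if e \<le> j then C j * monom 1 (p ^ j) else 0)" for j
  define E where "E j = G j - (\<Sum>l\<in>H. smult (b j l) (C l))" for j
  have Ex: "(\<Sum>j<t. smult (x ^ (p ^ j)) (E j)) = 0" for x
  proof -
    have "(\<Sum>j<t. smult (x ^ (p ^ j)) (G j)) = (\<Sum>j\<in>insert 0 {e..<t}. smult (x ^ (p ^ j)) (G j))"
      by (rule sum.mono_neutral_right) (use t_pos e in \<open>auto simp: G_def\<close>)
    also have "\<dots> = smult x (r1 * monom 1 1 + monom 1 (p ^ t)) + (\<Sum>j\<in>{e..<t}. smult (x ^ (p ^ j)) (C j * monom 1 (p ^ j)))"
      using e by (simp add: G_def cong: sum.cong_simp)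
    also have "(\<Sum>j\<in>{e..<t}. smult (x ^ (p ^ j)) (C j * monom 1 (p ^ j))) = (\<Sum>j\<in>{e..<t}. C j * monom (x ^ (p ^ j)) (p ^ j))"
      by (intro sum.cong refl) (simp add: mult_smult_right[symmetric] smult_monom)
    also have "smult x (r1 * monom 1 1 + monom 1 (p ^ t)) = r1 * monom x 1 + monom x (p ^ t)"
      by (simp add: smult_add_right mult_smult_right[symmetric] smult_monom)
    finally have A: "(\<Sum>j<t. smult (x ^ (p ^ j)) (G j)) = r1 * monom x 1 + monom x (p ^ t) + (\<Sum>j\<in>{e..<t}. C j * monom (x ^ (p ^ j)) (p ^ j))" .
    have "(\<Sum>j<t. smult (x ^ (p ^ j)) (\<Sum>l\<in>H. smult (b j l) (C l))) = (\<Sum>l\<in>H. \<Sum>j<t. smult (b j l * x ^ (p ^ j)) (C l))"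
      by (subst sum.swap) (simp add: smult_sum_right mult.commute)
    also have "\<dots> = (\<Sum>l\<in>H. smult (f x ^ (p ^ l)) (C l))"
    proof (rule sum.cong[OF refl])
      fix l assume "l \<in> H"
      then have "l < t" using t_pos by (auto simp: H_def)
      then show "(\<Sum>j<t. smult (b j l * x ^ (p ^ j)) (C l)) = smult (f x ^ (p ^ l)) (C l)"
        using additive_fun_power[OF a, of l x] by (simp add: b_def smult_sum_left)
    qed
    also have "\<dots> = smult (f x) (r1 + 1) + (\<Sum>l\<in>{e..<t}. smult (f x ^ (p ^ l)) (C l))"
      using e by (simp add: H_def C_def)
    finally have B: "(\<Sum>j<t. smult (x ^ (p ^ j)) (\<Sum>l\<in>H. smult (b j l) (C l))) = smult (f x) (r1 + 1) + (\<Sum>l\<in>{e..<t}. smult (f x ^ (p ^ l)) (C l))" .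
    have "(\<Sum>j<t. smult (x ^ (p ^ j)) (E j)) = (\<Sum>j<t. smult (x ^ (p ^ j)) (G j)) - (\<Sum>j<t. smult (x ^ (p ^ j)) (\<Sum>l\<in>H. smult (b j l) (C l)))"
      by (simp add: E_def smult_diff_right sum_subtractf)
    also have "\<dots> = r1 * lin_form f x + (\<Sum>i\<in>{e..<t}. C i * (monom (x ^ (p ^ i)) (p ^ i) - [:f x ^ (p ^ i):])) + (monom x (p ^ t) - [:f x:])"
    proof -
      have "lin_form f x = monom x 1 - [:f x:]" by (simp add: lin_form_def monom_altdef)
      moreover have "(\<Sum>i\<in>{e..<t}. C i * (monom (x ^ (p ^ i)) (p ^ i) - [:f x ^ (p ^ i):])) =
         (\<Sum>j\<in>{e..<t}. C j * monom (x ^ (p ^ j)) (p ^ j)) - (\<Sum>l\<in>{e..<t}. smult (f x ^ (p ^ l)) (C l))"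
        unfolding sum_subtractf[symmetric] by (intro sum.cong refl) (simp add: right_diff_distrib)
      moreover have "r1 * (monom x 1 - [:f x:]) = r1 * monom x 1 - smult (f x) r1" by (simp add: right_diff_distrib)
      moreover have "smult (f x) (r1 + 1) = smult (f x) r1 + [:f x:]" by (simp add: smult_add_right)
      ultimately show ?thesis unfolding A B by simp
    qed
    also have "\<dots> = 0" by (rule rel)
    finally show ?thesis .
  qed
  have E0: "E j = 0" if "j < t" for j
  proof (rule poly_eqI)
    fix n
    have "(\<Sum>j<t. coeff (E j) n * x ^ (p ^ j)) = 0" for x
    proof -
      have "coeff (\<Sum>j<t. smult (x ^ (p ^ j)) (E j)) n = (\<Sum>j<t. coeff (E j) n * x ^ (p ^ j))"
        by (simp add: coeff_sum mult.commute)
      then show ?thesis by (simp add: Ex)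
    qed
    from additive_repr_zero[OF this that] show "coeff (E j) n = coeff 0 n" by simp
  qed
  have eqH: "C j * monom 1 (p ^ j) = (\<Sum>l\<in>H. smult (b j l) (C l))" if "j \<in> H" "j \<noteq> 0" for j
    using E0[of j] that by (simp add: E_def G_def H_def)
  have inj: "inj_on (\<lambda>l. degree (C l)) {l \<in> H. C l \<noteq> 0}"
    by (rule degree_separation[OF _ finH eqH]) (use p_gt_1 in auto)
  have C0: "C 0 \<noteq> 0"
  proof
    assume "C 0 = 0"
    then have "poly (r1 + 1) (f 1) = 0" by (simp add: C_def)
    moreover have "coeff (redei_at f (f 1)) 1 = 0"
      using redei_at_exponents[OF f, of "f 1" 1] c1 by auto
    then have "poly r1 (f 1) = 0" by (simp add: r1_def redei_eval)
    ultimately show False by simp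
  qed
  have reach: "l \<in> {l \<in> H. C l \<noteq> 0}" if "l \<in> reach t ?J" for l
    using that
  proof (induction rule: reach.induct)
    case zero then show ?case using C0 by (simp add: H_def)
  next
    case (step l j)
    let ?k = "(l + j) mod t"
    have kt: "?k < t" using t_pos by simp
    have lt: "l < t" using step.IH t_pos by (auto simp: H_def)
    show ?case
    proof (cases "?k = 0")
      case True then show ?thesis using C0 by (simp add: H_def)
    next
      case False
      have "(?k + t - l) mod t = j"
      proof (cases "l + j < t")
        case True then show ?thesis using step.hyps by simp
      next
        case False
        have jt: "j < t" using step.hyps by simp
        then have "l + j - t < t" using lt by linarith
        then have "?k = l + j - t" using False by (simp add: mod_if)
        then show ?thesis using False jt by simp
      qed
      then have "b ?k l \<noteq> 0" using step.hyps by (simp add: b_def)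
      then have nz: "(\<Sum>l\<in>H. smult (b ?k l) (C l)) \<noteq> 0"
        using step.IH by (intro sum_distinct_degrees[OF finH inj, of l]) auto
      have "G ?k = (\<Sum>l\<in>H. smult (b ?k l) (C l))" using E0[OF kt] by (simp add: E_def)
      then have "G ?k \<noteq> 0" using nz by simp
      then have "e \<le> ?k" "C ?k \<noteq> 0" using False by (auto simp: G_def split: if_splits)
      then show ?thesis using kt by (simp add: H_def)
    qed
  qed
  let ?d = "step_gcd t ?J"
  have d: "?d > 0" "?d mod t \<in> reach t ?J" "?d dvd t"
    using step_gcd_props[OF t_pos] by auto
  have "?d \<le> t" using d(3) t_pos by (simp add: dvd_imp_le)
  show ?thesis
  proof (cases "?d = t")
    case True then show ?thesis using et by simp
  next
    case False
    then have "?d \<in> H" using reach[OF d(2)] \<open>?d \<le> t\<close> by simp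
    then show ?thesis using d(1) by (simp add: H_def)
  qed
qed

subsection \<open>The number of large eigenspaces\<close>

text \<open>For \<open>x \<noteq> 0\<close> these scalars carry \<open>x\<close> to the members of the eigenspace containing \<open>x\<close>
  (\<open>card_comm_set\<close>).\<close>

definition comm_set :: "('f \<Rightarrow> 'f) \<Rightarrow> 'f \<Rightarrow> 'f set" where
  "comm_set f x = {c. f (c * x) = c * f x}"

lemma card_comm_set:
  assumes "x \<noteq> 0" shows "card (comm_set f x) = card (eigen f (f x / x))"
proof -
  have "eigen f (f x / x) = (\<lambda>c. c * x) ` comm_set f x"
  proof (intro set_eqI iffI)
    fix z assume "z \<in> eigen f (f x / x)"
    then have "z / x \<in> comm_set f x" using assms by (auto simp: eigen_def comm_set_def)
    then show "z \<in> (\<lambda>c. c * x) ` comm_set f x" using assms by (intro image_eqI[of _ _ "z / x"]) auto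
  qed (use assms in \<open>auto simp: eigen_def comm_set_def\<close>)
  then show ?thesis using assms by (simp add: card_image inj_on_def)
qed

lemma Fix_linear:
  assumes a: "\<And>x. f x = (\<Sum>j<t. a j * x ^ (p ^ j))"
    and d: "\<And>j. j < t \<Longrightarrow> a j \<noteq> 0 \<Longrightarrow> d dvd j" and c: "c \<in> Fix d"
  shows "f (c * x) = c * f x"
proof -
  have "a j * (c * x) ^ (p ^ j) = c * (a j * x ^ (p ^ j))" if jt: "j < t" for j
  proof (cases "a j = 0")
    case False
    then obtain k where "j = d * k" using d[OF jt] by blast
    then have "c ^ (p ^ j) = c" using Fix_pow[OF c] by simp
    then show ?thesis by (simp add: power_mult_distrib)
  qed simp
  then show ?thesis unfolding a sum_distrib_left by (intro sum.cong refl) auto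
qed

text \<open>All eigenspaces are vector spaces over the field with \<open>\<kappa> = p ^ d\<close> elements, and they partition the nonzero
  elements. One of order exactly \<open>\<kappa>\<close> exists, as otherwise \<open>eigen_step_bound\<close> would apply with
  \<open>Suc d\<close>. At the corresponding \<open>y0\<close> the polynomial \<open>R(X, y0) = L(X) ^ \<kappa>\<close> has a coefficient in degree \<open>N\<close>,
  \<open>q / \<kappa> \<le> N < q\<close>, that does not vanish. As an element of \<open>F[Y]\<close> that coefficient has degree at most
  \<open>q - N\<close> but vanishes wherever the eigenspace is trivial. So there are at least \<open>q / \<kappa>\<close> nontrivial
  eigenspaces, which leaves little room for large ones.\<close>

lemma large_eigenspaces:
  assumes f: "additive_fun f" and a: "\<And>x. f x = (\<Sum>j<t. a j * x ^ (p ^ j))"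
    and d: "d = step_gcd t {j. j < t \<and> a j \<noteq> 0}"
  shows "real (card {x. x \<noteq> 0 \<and> card (comm_set f x) > p ^ d}) \<le> real (p ^ t) / p ^ d + real (p ^ t) / (p ^ d) ^ 2"
proof -
  have dp: "d > 0" "d dvd t" "\<And>j. j < t \<Longrightarrow> a j \<noteq> 0 \<Longrightarrow> d dvd j"
    using step_gcd_props[OF t_pos, where J = "{j. j < t \<and> a j \<noteq> 0}"] by (auto simp: d)
  define \<kappa> where "\<kappa> = p ^ d"
  have k1: "\<kappa> > 1" using one_less_power[OF p_gt_1 dp(1)] by (simp add: \<kappa>_def)
  have cFix: "card (Fix d) = \<kappa>" using card_Fix[OF dp(2)] by (simp add: \<kappa>_def)
  have Ks: "vec_space.Ksub (*) (Fix d) (eigen f y)" for y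
  proof -
    have "c * z \<in> eigen f y" if "c \<in> Fix d" "z \<in> eigen f y" for c z
      using Fix_linear[OF a dp(3) that(1), of z] that(2) by (simp add: eigen_def)
    moreover have "z + z' \<in> eigen f y" if "z \<in> eigen f y" "z' \<in> eigen f y" for z z'
      using f that by (simp add: eigen_def additive_fun_def distrib_right)
    ultimately show ?thesis using eigen_Ksub(1)[OF f] by (auto simp: vec_space.Ksub_def[OF vec_space_mult])
  qed
  have cards: "\<exists>m. card (eigen f y) = \<kappa> ^ m" for y
    using vec_space.Ksub_card_power[OF vec_space_mult is_subfield_Fix _ Ks, of y] cFix by auto
  have big: "\<kappa> ^ 2 \<le> card (eigen f y) \<and> p ^ Suc d dvd card (eigen f y)" if "card (eigen f y) \<noteq> 1" "card (eigen f y) \<noteq> \<kappa>" for y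
  proof -
    obtain m where m: "card (eigen f y) = \<kappa> ^ m" using cards by blast
    then have "m \<noteq> 0" "m \<noteq> 1" using that by auto
    then have "m \<ge> 2" by simp
    then have "\<kappa> ^ 2 \<le> \<kappa> ^ m" using k1 by (intro power_increasing) auto
    moreover have "d * 2 \<le> d * m" using \<open>m \<ge> 2\<close> by simp
    then have "Suc d \<le> d * m" using dp(1) by linarith
    then have "p ^ Suc d dvd p ^ (d * m)" by (rule le_imp_power_dvd)
    ultimately show ?thesis using m by (simp add: \<kappa>_def power_mult)
  qed
  obtain y0 where y0: "card (eigen f y0) = \<kappa>"
  proof (rule ccontr)
    assume "\<not> thesis"
    then have "\<And>y. card (eigen f y) \<noteq> \<kappa>" using that by blast
    then have "\<And>y. card (eigen f y) = 1 \<or> p ^ Suc d dvd card (eigen f y)" using big by blast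
    from eigen_step_bound[OF f a _ this] show False using d by simp
  qed
  define D where "D = {y. card (eigen f y) \<noteq> 1}"
  have Dbound: "p ^ t \<le> \<kappa> * card D"
  proof -
    define I where "I = range (\<lambda>x. x * y0 - f x)"
    define L where "L = (\<Prod>z\<in>I. [:- z, 1:])"
    have RL: "redei_at f y0 = L ^ \<kappa>" and In: "card I * \<kappa> = p ^ t"
      using redei_at_power[OF f, of y0] y0 by (auto simp: L_def I_def)
    have dL: "degree L = card I" unfolding L_def by (subst degree_prod_eq_sum_degree) auto
    show ?thesis
    proof (cases "card I \<ge> 2")
      case False
      moreover have "card I \<noteq> 0" using In q_gt_1 by (metis mult_0 less_nat_zero_code)
      ultimately have "card I = 1" by linarith
      then have "p ^ t = \<kappa>" using In by simp
      moreover have "y0 \<in> D" using y0 k1 by (simp add: D_def)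
      then have "card D \<ge> 1" by (auto simp: Suc_le_eq card_gt_0_iff)
      ultimately show ?thesis by simp
    next
      case True
      let ?X = "monom 1 (p ^ t) :: 'f poly"
      let ?G = "redei_at f y0 - ?X"
      have dR: "degree (redei_at f y0) = p ^ t" "lead_coeff (redei_at f y0) = 1"
        unfolding redei_at_def by (subst degree_prod_eq_sum_degree) (auto simp: card_F lead_coeff_prod)
      have dG: "degree ?G < p ^ t"
        by (rule monic_diff_degree) (use dR p_gt_1 in \<open>auto simp: degree_monom_eq\<close>)
      \<comment> \<open>Otherwise \<open>L\<close> divides \<open>L ^ \<kappa> - (X ^ q - X)\<close>, of smaller degree, whence \<open>R(X, y0) = X ^ q - X\<close>.\<close>
      have nG: "card I \<le> degree ?G"
      proof (rule ccontr)
        assume "\<not> card I \<le> degree ?G"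
        moreover have "degree (monom 1 1 :: 'f poly) < card I" using True by (simp add: degree_monom_eq)
        ultimately have "degree (?G + monom 1 1) < degree L" unfolding dL by (intro degree_add_less) auto
        moreover have "L dvd (\<Prod>z\<in>UNIV. [:- z, 1:])" unfolding L_def by (rule prod_dvd_prod_subset) auto
        then have "L dvd ?X - monom 1 1" by (simp add: prod_linear_UNIV)
        moreover have "L dvd L ^ \<kappa>" using k1 by (simp add: dvd_power)
        ultimately have "?G + monom 1 1 = 0"
          unfolding RL by (metis (no_types, lifting) diff_add_eq diff_diff_eq2 dvd_diff dvd_imp_degree_le not_le)
        then have "redei_at f y0 = ?X - monom 1 1" by (simp add: algebra_simps)
        then have "coeff (redei_at f y0) 1 \<noteq> 0" using q_gt_1 t_pos p_gt_1 by simp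
        then have "\<kappa> dvd 1" using redei_at_exponents[OF f, of y0 1] y0 by simp
        then show False using k1 by simp
      qed
      define N where "N = degree ?G"
      have N: "N \<ge> 2" "N < p ^ t" using nG dG True by (auto simp: N_def)
      have "?G \<noteq> 0" using N(1) by (auto simp: N_def)
      then have "coeff ?G N \<noteq> 0" unfolding N_def by (rule leading_coeff_neq_0)
      then have "coeff (redei_at f y0) N \<noteq> 0" using N by simp
      then have nz: "coeff (redei f) N \<noteq> 0" by (metis redei_eval poly_0)
      have "- D \<subseteq> {y. poly (coeff (redei f) N) y = 0}"
      proof
        fix y assume "y \<in> - D"
        then have "redei_at f y = ?X - monom 1 1" using redei_at_inj[OF f] by (simp add: D_def)
        then show "y \<in> {y. poly (coeff (redei f) N) y = 0}" using N by (simp add: redei_eval)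
      qed
      then have "card (- D) \<le> card {y. poly (coeff (redei f) N) y = 0}" by (intro card_mono) auto
      also have "\<dots> \<le> degree (coeff (redei f) N)" by (rule card_poly_roots_bound[OF nz])
      finally have "card (- D) + N \<le> p ^ t" using redei_degree[OF nz] by simp
      moreover have "card (- D) + card D = p ^ t"
        by (metis card_F Compl_partition2 card_Un_disjoint compl_inf_bot finite inf_commute)
      ultimately have "card I \<le> card D" using nG N_def by simp
      then show ?thesis using In by (metis mult.commute mult_le_mono1)
    qed
  qed
  define S where "S = {y. card (eigen f y) = \<kappa>}"
  define M where "M = D - S"
  have SD: "S \<subseteq> D" using k1 by (auto simp: S_def D_def)
  define X where "X = {x. x \<noteq> 0 \<and> card (comm_set f x) > p ^ d}"
  have part: "card (\<Union>y\<in>A. eigen f y - {0}) = (\<Sum>y\<in>A. card (eigen f y) - 1)" for A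
  proof -
    have "card (\<Union>y\<in>A. eigen f y - {0}) = (\<Sum>y\<in>A. card (eigen f y - {0}))"
      by (rule card_UN_disjoint) (auto simp: eigen_def)
    then show ?thesis using eigen_Ksub(1)[OF f] by simp
  qed
  have cov: "x \<in> eigen f (f x / x)" "f x / x \<in> D" if "x \<noteq> 0" for x
  proof -
    show x: "x \<in> eigen f (f x / x)" using that by (simp add: eigen_def)
    show "f x / x \<in> D"
    proof (rule ccontr)
      assume "f x / x \<notin> D"
      then have "card (eigen f (f x / x)) = 1" by (simp add: D_def)
      then obtain z where "eigen f (f x / x) = {z}" by (rule card_1_singletonE)
      then show False using x that eigen_Ksub(1)[OF f, of "f x / x"] by simp
    qed
  qed
  have eq_y: "y = f x / x" if "x \<in> eigen f y" "x \<noteq> 0" for x y using that by (simp add: eigen_def)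
  have "X = (\<Union>y\<in>M. eigen f y - {0})"
  proof (intro set_eqI iffI)
    fix x assume "x \<in> X"
    then have x: "x \<noteq> 0" "card (eigen f (f x / x)) > \<kappa>" by (auto simp: X_def card_comm_set \<kappa>_def)
    then have "f x / x \<in> M" using cov by (auto simp: M_def S_def)
    then show "x \<in> (\<Union>y\<in>M. eigen f y - {0})" using cov x by blast
  next
    fix x assume "x \<in> (\<Union>y\<in>M. eigen f y - {0})"
    then obtain y where y: "y \<in> M" "x \<in> eigen f y" "x \<noteq> 0" by auto
    then have "\<kappa> ^ 2 \<le> card (eigen f y)" using big by (auto simp: M_def S_def D_def)
    moreover have "\<kappa> < \<kappa> ^ 2" using k1 by (simp add: power2_eq_square)
    ultimately show "x \<in> X" using y eq_y[of x y] by (auto simp: X_def card_comm_set \<kappa>_def)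
  qed
  then have cX: "card X = (\<Sum>y\<in>M. card (eigen f y) - 1)" using part by simp
  have "UNIV - {0} = (\<Union>y\<in>D. eigen f y - {0})" using cov by blast
  then have "card (UNIV - {0::'f}) = (\<Sum>y\<in>D. card (eigen f y) - 1)" using part by simp
  also have "\<dots> = (\<Sum>y\<in>M. card (eigen f y) - 1) + (\<Sum>y\<in>S. card (eigen f y) - 1)"
    unfolding M_def by (rule sum.subset_diff[OF SD]) simp
  also have "(\<Sum>y\<in>S. card (eigen f y) - 1) = card S * (\<kappa> - 1)" by (simp add: S_def)
  finally have tot: "p ^ t - 1 = card X + card S * (\<kappa> - 1)" using cX card_F by (simp add: card_Diff_singleton)
  have "card M * (\<kappa> ^ 2 - 1) = (\<Sum>y\<in>M. \<kappa> ^ 2 - 1)" by simp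
  also have "\<dots> \<le> (\<Sum>y\<in>M. card (eigen f y) - 1)"
    by (rule sum_mono) (use big in \<open>auto simp: M_def S_def D_def diff_le_mono\<close>)
  finally have mX: "card M * (\<kappa> ^ 2 - 1) \<le> card X" using cX by simp
  have "card D = card M + card S" unfolding M_def using SD by (simp add: card_Diff_subset card_mono finite_subset)
  then have dS: "p ^ t \<le> \<kappa> * (card M + card S)" using Dbound by simp
  define k q x m s where "k = real \<kappa>" and "q = real (p ^ t)" and "x = real (card X)" and "m = real (card M)" and "s = real (card S)"
  have k: "k > 1" using k1 by (simp add: k_def)
  have t1: "q - 1 = x + s * (k - 1)"
    using arg_cong[OF tot, of real] q_gt_1 k1 by (simp add: q_def x_def s_def k_def of_nat_diff)
  have "real (card M * (\<kappa> ^ 2 - 1)) \<le> real (card X)" using mX by (simp only: of_nat_le_iff)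
  moreover have "real (\<kappa> ^ 2 - 1) = k ^ 2 - 1" using k1 by (simp add: k_def of_nat_diff)
  ultimately have t2: "m * (k ^ 2 - 1) \<le> x" by (simp add: m_def x_def)
  have "real (p ^ t) \<le> real (\<kappa> * (card M + card S))" using dS by (simp only: of_nat_le_iff)
  then have t3: "q \<le> k * (m + s)" by (simp add: q_def k_def m_def s_def)
  have "x \<le> q / k + q / k ^ 2" by (rule eigen_count_arith[OF k t1 t2 t3])
  then show ?thesis unfolding X_def[symmetric] by (simp add: x_def q_def k_def \<kappa>_def)
qed

end

section \<open>Points and subspaces\<close>

interpretation fv: vec_space "fscale :: 'f::field \<Rightarrow> (nat \<Rightarrow> 'f) \<Rightarrow> nat \<Rightarrow> 'f"
  by (rule vec_space.intro) (rule fvec.vector_space_axioms)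

text \<open>The linear set of \<open>U\<close>; for a subspace, the set of its points.\<close>

definition pts :: "(nat \<Rightarrow> 'f::field) set \<Rightarrow> (nat \<Rightarrow> 'f) set set" where
  "pts U = {fvec.span {u} | u. u \<in> U - {0}}"

lemma pts_iff: "P \<in> pts U \<longleftrightarrow> (\<exists>u\<in>U. u \<noteq> 0 \<and> P = fvec.span {u})"
  by (auto simp: pts_def)

lemma pts_mono: "U \<subseteq> V \<Longrightarrow> pts U \<subseteq> pts V"
  by (auto simp: pts_def)

lemma finite_pts: "finite U \<Longrightarrow> finite (pts U)"
  unfolding pts_def by (simp add: setcompr_eq_image)

lemma span_le_iff: "fvec.subspace T \<Longrightarrow> fvec.span {x} \<subseteq> T \<longleftrightarrow> x \<in> T"
  by (metis fvec.span_base fvec.span_minimal insertI1 empty_subsetI insert_subset subsetD)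

lemma mem_span_singleton: "y \<in> fvec.span {x} \<longleftrightarrow> (\<exists>c. y = fscale c x)"
  by (auto simp: fvec.span_singleton)

lemma mem_span_self: "x \<in> fvec.span {x}"
  by (simp add: fvec.span_base)

lemma span_eq_point:
  assumes "x \<in> fvec.span {y}" "x \<noteq> 0"
  shows "fvec.span {x} = fvec.span {y}"
proof -
  obtain c where c: "x = fscale c y" using assms by (auto simp: mem_span_singleton)
  then have "c \<noteq> 0" using assms by auto
  then have "y = fscale (inverse c) x" using c by simp
  then have "y \<in> fvec.span {x}" by (auto simp: mem_span_singleton)
  then show ?thesis using assms
    by (metis fvec.span_span fvec.subspace_span span_le_iff subset_antisym)
qed

lemma point_eq: "P \<in> pts V \<Longrightarrow> x \<in> P \<Longrightarrow> x \<noteq> 0 \<Longrightarrow> P = fvec.span {x}"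
  by (auto simp: pts_iff span_eq_point)

lemma point_subspace: "P \<in> pts V \<Longrightarrow> fvec.subspace P"
  by (auto simp: pts_iff)

lemma point_le: assumes "P \<in> pts V" "fvec.subspace V" shows "P \<subseteq> V"
proof -
  obtain u where "u \<in> V" "P = fvec.span {u}" using assms by (auto simp: pts_iff)
  then show ?thesis using span_le_iff[OF assms(2), of u] by simp
qed

lemma point_gen: assumes "P \<in> pts V" obtains x where "x \<in> P" "x \<noteq> 0" "x \<in> V" "P = fvec.span {x}"
  using assms mem_span_self by (auto simp: pts_iff)

lemma points_Int: assumes "P \<in> pts V" "R \<in> pts V'" "P \<noteq> R" shows "P \<inter> R \<subseteq> {0}"
proof
  fix x assume x: "x \<in> P \<inter> R"
  show "x \<in> {0}"
  proof (rule ccontr)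
    assume "x \<notin> {0}"
    then have "P = fvec.span {x}" "R = fvec.span {x}" using x point_eq[OF assms(1)] point_eq[OF assms(2)] by auto
    then show False using assms(3) by simp
  qed
qed

lemma point_le_iff: "P \<in> pts V \<Longrightarrow> fvec.subspace T \<Longrightarrow> x \<in> P \<Longrightarrow> x \<noteq> 0 \<Longrightarrow> P \<subseteq> T \<longleftrightarrow> x \<in> T"
  using point_eq span_le_iff by metis

text \<open>The subspace spanned by \<open>W\<close> and \<open>v\<close>, for a subspace \<open>W\<close>.\<close>

abbreviation ext :: "(nat \<Rightarrow> 'f::field) \<Rightarrow> (nat \<Rightarrow> 'f) set \<Rightarrow> (nat \<Rightarrow> 'f) set" where
  "ext \<equiv> fv.Kext UNIV"

lemma subspace_ext: "fvec.subspace W \<Longrightarrow> fvec.subspace (ext v W)"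
  using fv.Ksub_Kext[OF is_subfield_UNIV] by (simp add: fv.Ksub_UNIV)

lemma ext_superset: "W \<subseteq> ext v W"
  by (rule fv.Kext_superset[OF is_subfield_UNIV])

lemma ext_mem: "fvec.subspace W \<Longrightarrow> v \<in> ext v W"
  using fv.Kext_mem[OF is_subfield_UNIV] by (simp add: fv.Ksub_UNIV)

lemma ext_least: "fvec.subspace X \<Longrightarrow> W \<subseteq> X \<Longrightarrow> v \<in> X \<Longrightarrow> ext v W \<subseteq> X"
  using fv.Kext_least[of UNIV X W v] by (simp add: fv.Ksub_UNIV)

lemma ext_exchange:
  assumes W: "fvec.subspace W" and x: "x \<in> ext v W" "x \<notin> W"
  shows "v \<in> ext x W"
proof -
  obtain c w where cw: "w \<in> W" "x = w + fscale c v" using x(1) by (auto simp: fv.Kext_iff)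
  then have "c \<noteq> 0" using x(2) by auto
  have "fscale c v = x - w" using cw by simp
  then have "fscale (inverse c) (fscale c v) = fscale (inverse c) (x - w)" by simp
  then have "v = fscale (inverse c) (x - w)" using \<open>c \<noteq> 0\<close> by simp
  moreover have "x \<in> ext x W" "w \<in> ext x W" using ext_mem[OF W] ext_superset cw by blast+
  ultimately show ?thesis
    using subspace_ext[OF W] by (simp add: fvec.subspace_scale fvec.subspace_diff)
qed

context prime_power_field
begin

definition q :: nat where "q = p ^ t"

text \<open>Dimension is measured by cardinality, which suits the counting.\<close>

definition vs :: "nat \<Rightarrow> (nat \<Rightarrow> 'f) set \<Rightarrow> bool" where
  "vs N V \<longleftrightarrow> fvec.subspace V \<and> finite V \<and> card V = q ^ N"

lemma q_UNIV: "card (UNIV :: 'f set) = q" by (simp add: card_F q_def)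

lemma q_gt: "q > 1" using q_gt_1 by (simp add: q_def)

lemma rq: "real q > 1" using q_gt by simp

lemma rq_pow: "n > 0 \<Longrightarrow> real q ^ n > 1" using rq by (simp add: one_less_power)

lemma vsD: "vs N V \<Longrightarrow> fvec.subspace V" "vs N V \<Longrightarrow> finite V" "vs N V \<Longrightarrow> card V = q ^ N"
  by (auto simp: vs_def)

lemma vs_exists: "fvec.subspace V \<Longrightarrow> finite V \<Longrightarrow> \<exists>N. vs N V"
  using fv.Ksub_card_power[OF is_subfield_UNIV _ , of V] by (auto simp: vs_def fv.Ksub_UNIV q_UNIV)

lemma vs_inj: "vs N V \<Longrightarrow> vs M V \<Longrightarrow> N = M"
  using power_inject_exp[OF q_gt, of N M] by (simp add: vs_def)

lemma vs_0: "vs 0 {0}"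
  by (auto simp: vs_def)

lemma vs_ext: "vs N W \<Longrightarrow> v \<notin> W \<Longrightarrow> vs (Suc N) (ext v W)"
  using fv.card_Kext[OF is_subfield_UNIV, of W v] subspace_ext[of W v] fv.finite_Kext[of UNIV W v]
  by (auto simp: vs_def fv.Ksub_UNIV q_UNIV)

lemma vs_point: "P \<in> pts V \<Longrightarrow> vs 1 P"
proof -
  assume "P \<in> pts V"
  then obtain x where x: "x \<noteq> 0" "P = fvec.span {x}" by (auto simp: pts_iff)
  have "ext x {0} = P"
    using x by (auto simp: fv.Kext_iff mem_span_singleton)
  then show ?thesis using vs_ext[OF vs_0, of x] x by simp
qed

lemma vs_le: assumes "vs N W" "vs M V" "W \<subseteq> V" shows "N \<le> M"
proof -
  have "q ^ N \<le> q ^ M" using card_mono[OF vsD(2)[OF assms(2)] assms(3)] assms by (simp add: vs_def)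
  then show ?thesis by (rule power_le_imp_le_exp[OF q_gt])
qed

lemma vs_eq: "vs N W \<Longrightarrow> vs N V \<Longrightarrow> W \<subseteq> V \<Longrightarrow> W = V"
  using card_subset_eq[of V W] by (auto simp: vs_def)

lemma vs_between:
  assumes "vs N W" "vs M V" "W \<subseteq> V" "N \<le> j" "j \<le> M"
  shows "\<exists>X. vs j X \<and> W \<subseteq> X \<and> X \<subseteq> V"
proof -
  have c: "card V = card (UNIV :: 'f set) ^ (M - N) * card W"
    using assms by (simp add: vs_def q_UNIV power_add[symmetric])
  have le: "j - N \<le> M - N" using assms by simp
  have K: "fv.Ksub UNIV W" "fv.Ksub UNIV V" "finite V" using assms by (auto simp: vs_def fv.Ksub_UNIV)
  obtain X where X: "fv.Ksub UNIV X" "W \<subseteq> X" "X \<subseteq> V" "card X = card (UNIV :: 'f set) ^ (j - N) * card W"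
    using fv.Ksub_between[OF is_subfield_UNIV finite K(1) K(2,3) assms(3) c le] by blast
  have "card X = q ^ j" using X(4) assms by (simp add: vs_def q_UNIV power_add[symmetric])
  then show ?thesis using X finite_subset[OF X(3) K(3)] by (auto simp: vs_def fv.Ksub_UNIV)
qed

section \<open>Averaging over subspaces\<close>

text \<open>If \<open>x\<close> generates \<open>P\<close>, the exchange property shows that these \<open>v\<close> are the vectors of \<open>ext x W\<close> outside
  \<open>W\<close>.\<close>

lemma card_ext_through:
  assumes V: "fvec.subspace V" and W: "vs a W" "W \<subseteq> V" and P: "P \<in> pts V" "\<not> P \<subseteq> W"
  shows "card {v \<in> V - W. P \<subseteq> ext v W} = q ^ Suc a - q ^ a"
proof -
  have sW: "fvec.subspace W" using W(1) by (rule vsD)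
  obtain x where x: "x \<in> P" "x \<noteq> 0" "x \<in> V" "P = fvec.span {x}"
    using point_gen[OF P(1)] by metis
  have xW: "x \<notin> W" using P(2) x(4) span_le_iff[OF sW] by metis
  have "{v \<in> V - W. P \<subseteq> ext v W} = ext x W - W"
  proof (intro set_eqI iffI)
    fix v assume v: "v \<in> {v \<in> V - W. P \<subseteq> ext v W}"
    then have "x \<in> ext v W" using x(1) by auto
    then show "v \<in> ext x W - W" using ext_exchange[OF sW _ xW] v by auto
  next
    fix v assume v: "v \<in> ext x W - W"
    then have "x \<in> ext v W" using ext_exchange[OF sW] by auto
    moreover have "v \<in> V" using v ext_least[OF V W(2) x(3)] by auto
    ultimately show "v \<in> {v \<in> V - W. P \<subseteq> ext v W}"
      using v x(4) span_le_iff[OF subspace_ext[OF sW]] by auto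
  qed
  then have "card {v \<in> V - W. P \<subseteq> ext v W} = card (ext x W - W)" by simp
  also have "\<dots> = q ^ Suc a - q ^ a"
    using card_Diff_subset[OF vsD(2)[OF W(1)] ext_superset[of W x]] vs_ext[OF W(1) xW] W(1) by (simp add: vs_def)
  finally show ?thesis .
qed

text \<open>Double counting: every point outside \<open>W\<close> lies in \<open>ext v W\<close> for the same number of \<open>v\<close>.\<close>

lemma avg_step:
  fixes c :: "(nat \<Rightarrow> 'f) set \<Rightarrow> real"
  assumes V: "vs N V" and W: "vs a W" "W \<subseteq> V" and aN: "a < N"
    and B: "finite B" "\<And>P. P \<in> B \<Longrightarrow> P \<in> pts V \<and> \<not> P \<subseteq> W"
  shows "\<exists>v\<in>V - W. (real q ^ (N - a) - 1) * sum c {P \<in> B. P \<subseteq> ext v W} \<le> (real q - 1) * sum c B"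
proof (rule ccontr)
  assume "\<not> ?thesis"
  then have gt: "(real q ^ (N - a) - 1) * sum c {P \<in> B. P \<subseteq> ext v W} > (real q - 1) * sum c B" if "v \<in> V - W" for v
    using that by (auto simp: not_le)
  have fV: "finite V" "finite W" using V W by (auto simp: vs_def)
  have cVW: "real (card (V - W)) = (real q ^ (N - a) - 1) * real q ^ a"
  proof -
    have "card (V - W) = q ^ N - q ^ a" using card_Diff_subset[OF fV(2) W(2)] V W by (simp add: vs_def)
    moreover have "q ^ a \<le> q ^ N" using aN q_gt by (intro power_increasing) auto
    ultimately have "real (card (V - W)) = real q ^ N - real q ^ a" by (simp add: of_nat_diff)
    also have "real q ^ N = real q ^ (N - a) * real q ^ a" using aN by (simp add: power_add[symmetric])
    finally show ?thesis by (simp add: algebra_simps)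
  qed
  have pos: "real q ^ (N - a) - 1 > 0" using aN rq_pow[of "N - a"] by simp
  have "card (V - W) > 0" using cVW pos q_gt by (metis mult_pos_pos of_nat_0_less_iff zero_less_power of_nat_1 of_nat_less_iff less_trans zero_less_one)
  then have ne: "V - W \<noteq> {}" by (metis card.empty less_irrefl)
  have cnt: "real (card {v \<in> V - W. P \<subseteq> ext v W}) = (real q - 1) * real q ^ a" if PB: "P \<in> B" for P
  proof -
    have "P \<in> pts V" "\<not> P \<subseteq> W" using B(2)[OF PB] by auto
    then have "card {v \<in> V - W. P \<subseteq> ext v W} = q ^ Suc a - q ^ a"
      by (rule card_ext_through[OF vsD(1)[OF V] W])
    then show ?thesis using q_gt by (simp add: of_nat_diff algebra_simps)
  qed
  have "(\<Sum>v\<in>V - W. sum c {P \<in> B. P \<subseteq> ext v W}) = (\<Sum>v\<in>V - W. \<Sum>P\<in>B. if P \<subseteq> ext v W then c P else 0)"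
    by (intro sum.cong refl sum.inter_filter B)
  also have "\<dots> = (\<Sum>P\<in>B. \<Sum>v\<in>V - W. if P \<subseteq> ext v W then c P else 0)" by (rule sum.swap)
  also have "\<dots> = (\<Sum>P\<in>B. c P * ((real q - 1) * real q ^ a))"
  proof (rule sum.cong[OF refl])
    fix P assume P: "P \<in> B"
    have "(\<Sum>v\<in>V - W. if P \<subseteq> ext v W then c P else 0) = (\<Sum>v\<in>{v \<in> V - W. P \<subseteq> ext v W}. c P)"
      by (rule sum.inter_filter[symmetric]) (use fV in auto)
    then show "(\<Sum>v\<in>V - W. if P \<subseteq> ext v W then c P else 0) = c P * ((real q - 1) * real q ^ a)"
      using cnt[OF P] by simp
  qed
  also have "\<dots> = (real q - 1) * real q ^ a * sum c B" by (simp add: sum_distrib_right[symmetric] mult.commute)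
  finally have tot: "(\<Sum>v\<in>V - W. sum c {P \<in> B. P \<subseteq> ext v W}) = (real q - 1) * real q ^ a * sum c B" .
  have "(\<Sum>v\<in>V - W. (real q - 1) * sum c B) < (\<Sum>v\<in>V - W. (real q ^ (N - a) - 1) * sum c {P \<in> B. P \<subseteq> ext v W})"
    by (rule sum_strict_mono) (use gt ne fV in auto)
  then have "real (card (V - W)) * ((real q - 1) * sum c B) < (real q ^ (N - a) - 1) * ((real q - 1) * real q ^ a * sum c B)"
    unfolding sum_distrib_left[symmetric] tot by (simp add: mult.left_commute)
  then show False unfolding cVW by (simp add: algebra_simps)
qed

text \<open>A random subspace of codimension \<open>N - b\<close> through \<open>W\<close> contains a given point outside \<open>W\<close>
  with probability \<open>(q ^ (b - a) - 1) / (q ^ (N - a) - 1)\<close>.\<close>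

lemma avg_exact:
  fixes c :: "(nat \<Rightarrow> 'f) set \<Rightarrow> real"
  assumes V: "vs N V" and c: "\<And>P. c P \<ge> 0"
  shows "vs a W \<Longrightarrow> W \<subseteq> V \<Longrightarrow> b \<le> N \<Longrightarrow> a + m = b \<Longrightarrow> finite B \<Longrightarrow> (\<And>P. P \<in> B \<Longrightarrow> P \<in> pts V \<and> \<not> P \<subseteq> W) \<Longrightarrow>
    \<exists>T. vs b T \<and> W \<subseteq> T \<and> T \<subseteq> V \<and>
      (real q ^ (N - a) - 1) * sum c {P \<in> B. P \<subseteq> T} \<le> (real q ^ m - 1) * sum c B"
proof (induction m arbitrary: a W B)
  case 0
  then have "{P \<in> B. P \<subseteq> W} = {}" by auto
  then show ?case using 0 by (intro exI[of _ W]) (auto simp del: Collect_empty_eq)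
next
  case (Suc m)
  have aN: "a < N" using Suc.prems by simp
  obtain v where v: "v \<in> V - W" "(real q ^ (N - a) - 1) * sum c {P \<in> B. P \<subseteq> ext v W} \<le> (real q - 1) * sum c B"
    using avg_step[OF V Suc.prems(1,2) aN Suc.prems(5,6)] by blast
  let ?W = "ext v W"
  let ?B = "{P \<in> B. \<not> P \<subseteq> ?W}"
  have W': "vs (Suc a) ?W" "?W \<subseteq> V"
    using vs_ext[OF Suc.prems(1), of v] ext_least[OF vsD(1)[OF V] Suc.prems(2), of v] v(1) by auto
  have B': "finite ?B" "\<And>P. P \<in> ?B \<Longrightarrow> P \<in> pts V \<and> \<not> P \<subseteq> ?W" using Suc.prems(5,6) by auto
  have m': "Suc a + m = b" using Suc.prems(4) by simp
  obtain T where T: "vs b T" "?W \<subseteq> T" "T \<subseteq> V"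
    "(real q ^ (N - Suc a) - 1) * sum c {P \<in> ?B. P \<subseteq> T} \<le> (real q ^ m - 1) * sum c ?B"
    using Suc.IH[OF W' Suc.prems(3) m' B'] by blast
  define S S1 w2 where "S = sum c B" and "S1 = sum c {P \<in> B. P \<subseteq> ?W}" and "w2 = sum c {P \<in> ?B. P \<subseteq> T}"
  have "sum c ({P \<in> B. P \<subseteq> ?W} \<union> ?B) = sum c {P \<in> B. P \<subseteq> ?W} + sum c ?B"
    by (rule sum.union_disjoint) (use Suc.prems(5) in auto)
  moreover have "{P \<in> B. P \<subseteq> ?W} \<union> ?B = B" by auto
  ultimately have SB: "sum c ?B = S - S1" by (simp add: S_def S1_def)
  have "{P \<in> B. P \<subseteq> T} = {P \<in> B. P \<subseteq> ?W} \<union> {P \<in> ?B. P \<subseteq> T}" using T(2) by auto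
  moreover have "sum c ({P \<in> B. P \<subseteq> ?W} \<union> {P \<in> ?B. P \<subseteq> T}) = sum c {P \<in> B. P \<subseteq> ?W} + sum c {P \<in> ?B. P \<subseteq> T}"
    by (rule sum.union_disjoint) (use Suc.prems(5) in auto)
  ultimately have ST: "sum c {P \<in> B. P \<subseteq> T} = S1 + w2" by (simp only: S1_def w2_def)
  have "(real q ^ (N - a) - 1) * (S1 + w2) \<le> (real q ^ Suc m - 1) * S"
  proof (cases "N - Suc a = 0")
    case True
    then have "?W = V" using W' V aN vs_eq[of N ?W V] by (metis Suc_leI diff_is_0_eq le_antisym)
    then have "{P \<in> ?B. P \<subseteq> T} = {}" using T(3) by auto
    then have "w2 = 0" by (simp add: w2_def del: Collect_empty_eq)
    moreover have "m = 0" using True Suc.prems by simp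
    ultimately show ?thesis using v(2) by (simp add: S1_def S_def)
  next
    case False
    define A b' Q where "A = real q ^ (N - Suc a) - 1" and "b' = real q ^ m - 1" and "Q = real q"
    have Q1: "Q > 1" using q_gt by (simp add: Q_def)
    have A: "A > 0" using False Q1 by (simp add: A_def Q_def one_less_power)
    have bA: "b' \<le> A" unfolding A_def b'_def using Suc.prems Q1 by (simp add: Q_def power_increasing)
    have NA: "real q ^ (N - a) - 1 = Q * A + (Q - 1)"
      using aN by (simp add: A_def Q_def algebra_simps Suc_diff_Suc flip: power_Suc)
    have v': "(Q * A + (Q - 1)) * S1 \<le> (Q - 1) * S" using v(2) NA by (simp add: S1_def S_def Q_def)
    have T': "A * w2 \<le> b' * (S - S1)" using T(4) SB by (simp add: A_def b'_def w2_def)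
    have "A * ((Q * A + (Q - 1)) * (S1 + w2)) = (Q * A + (Q - 1)) * (A * S1) + (Q * A + (Q - 1)) * (A * w2)"
      by (simp add: algebra_simps)
    also have "\<dots> \<le> (Q * A + (Q - 1)) * (A * S1) + (Q * A + (Q - 1)) * (b' * (S - S1))"
      using T' Q1 A by (intro add_left_mono mult_left_mono) auto
    also have "\<dots> = (A - b') * ((Q * A + (Q - 1)) * S1) + (Q * A + (Q - 1)) * b' * S" by (simp add: algebra_simps)
    also have "\<dots> \<le> (A - b') * ((Q - 1) * S) + (Q * A + (Q - 1)) * b' * S"
      using v' bA by (intro add_right_mono mult_left_mono) auto
    also have "\<dots> = A * ((Q * (b' + 1) - 1) * S)" by (simp add: algebra_simps)
    finally have "(Q * A + (Q - 1)) * (S1 + w2) \<le> (Q * (b' + 1) - 1) * S" using A by simp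
    then show ?thesis unfolding NA by (simp add: b'_def Q_def)
  qed
  then show ?case using T W' ext_superset[of W v] ST by (intro exI[of _ T]) (auto simp: S_def)
qed

text \<open>The form in which averaging is used: a subspace of codimension \<open>k\<close> through \<open>W\<close> carries at most a
  fraction \<open>1 / q ^ k\<close> of the weight.\<close>

lemma avg_subspace:
  fixes c :: "(nat \<Rightarrow> 'f) set \<Rightarrow> real"
  assumes V: "vs N V" and W: "vs a W" "W \<subseteq> V" and b: "a \<le> b" "b + k = N"
    and B: "finite B" "\<And>P. P \<in> B \<Longrightarrow> P \<in> pts V \<and> \<not> P \<subseteq> W" and c: "\<And>P. c P \<ge> 0"
  obtains T where "vs b T" "W \<subseteq> T" "T \<subseteq> V" "real q ^ k * sum c {P \<in> B. P \<subseteq> T} \<le> sum c B"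
proof -
  obtain T where T: "vs b T" "W \<subseteq> T" "T \<subseteq> V"
      "(real q ^ (N - a) - 1) * sum c {P \<in> B. P \<subseteq> T} \<le> (real q ^ (b - a) - 1) * sum c B"
    using avg_exact[where c = c and b = b and m = "b - a" and B = B, OF V c W] b B by auto
  let ?w = "sum c {P \<in> B. P \<subseteq> T}"
  have nn: "sum c B \<ge> 0" using c by (intro sum_nonneg) auto
  have "real q ^ k * ?w \<le> sum c B"
  proof (cases "N = a")
    case True
    then have "b = a" using b by simp
    then have "T = W" using T(1,2) W(1) vs_eq[of a W T] by simp
    then have "{P \<in> B. P \<subseteq> T} = {}" using B(2) by auto
    then show ?thesis using nn by (simp del: Collect_empty_eq)
  next
    case False
    then have pos: "real q ^ (N - a) - 1 > 0" using b rq_pow[of "N - a"] by simp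
    have "real q ^ k * (real q ^ (b - a) - 1) = real q ^ (N - a) - real q ^ k"
      using b by (simp add: algebra_simps power_add[symmetric])
    moreover have "real q ^ k \<ge> 1" using q_gt by (intro one_le_power) auto
    ultimately have le: "real q ^ k * (real q ^ (b - a) - 1) \<le> real q ^ (N - a) - 1" by simp
    have "(real q ^ (N - a) - 1) * (real q ^ k * ?w) \<le> real q ^ k * ((real q ^ (b - a) - 1) * sum c B)"
      using mult_left_mono[OF T(4), of "real q ^ k"] by (simp add: mult.left_commute)
    also have "\<dots> \<le> (real q ^ (N - a) - 1) * sum c B"
      using mult_right_mono[OF le nn] by (simp add: mult.assoc)
    finally show ?thesis using pos by simp
  qed
  then show ?thesis using that T by blast
qed

end

section \<open>Point sets meeting subspaces in 1 mod s points\<close>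

lemma cong_one_dvd: "n \<ge> 1 \<Longrightarrow> [n = 1] (mod s) \<longleftrightarrow> s dvd n - (1::nat)"
  using cong_altdef_nat[of 1 n s] by simp

lemma points_in_iff: "P \<in> points_in B T \<longleftrightarrow> P \<in> B \<and> P \<subseteq> T"
  by (simp add: points_in_def)

definition join :: "(nat \<Rightarrow> 'f::field) set \<Rightarrow> (nat \<Rightarrow> 'f) set \<Rightarrow> (nat \<Rightarrow> 'f) set" where
  "join P R = fvec.span (P \<union> R)"

lemma join_upper: "P \<subseteq> join P R" "R \<subseteq> join P R"
  using fvec.span_superset[of "P \<union> R"] by (auto simp: join_def)

lemma join_least: "fvec.subspace T \<Longrightarrow> P \<subseteq> T \<Longrightarrow> R \<subseteq> T \<Longrightarrow> join P R \<subseteq> T"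
  unfolding join_def by (intro fvec.span_minimal) auto

lemma join_commute: "join P R = join R P"
  by (simp add: join_def Un_commute)

lemma subspace_join: "fvec.subspace (join P R)"
  by (simp add: join_def fvec.subspace_span)

context prime_power_field
begin

lemma join_ext:
  assumes "fvec.subspace W" "x \<noteq> 0"
  shows "join W (fvec.span {x}) = ext x W"
proof
  show "join W (fvec.span {x}) \<subseteq> ext x W"
    using join_least[OF subspace_ext[OF assms(1)] ext_superset[of W x], of "fvec.span {x}"]
      span_le_iff[OF subspace_ext[OF assms(1)]] ext_mem[OF assms(1)] by simp
  show "ext x W \<subseteq> join W (fvec.span {x})"
    using ext_least[OF subspace_join join_upper(1)[of W "fvec.span {x}"], of x]
      join_upper(2)[of "fvec.span {x}" W] mem_span_self[of x] by blast
qed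

lemma vs_join_point:
  assumes W: "vs N W" and R: "R \<in> pts V" "\<not> R \<subseteq> W"
  shows "vs (Suc N) (join W R)"
proof -
  obtain x where x: "x \<noteq> 0" "R = fvec.span {x}" using R(1) by (auto simp: pts_iff)
  have sW: "fvec.subspace W" using W by (rule vsD)
  have "x \<notin> W" using R(2) x(2) span_le_iff[OF sW] by simp
  then show ?thesis using vs_ext[OF W] join_ext[OF sW x(1)] x(2) by simp
qed

lemma point_not_le:
  fixes P R :: "(nat \<Rightarrow> 'f) set"
  shows "P \<in> pts V \<Longrightarrow> R \<in> pts V' \<Longrightarrow> P \<noteq> R \<Longrightarrow> \<not> R \<subseteq> P"
  using vs_eq[OF vs_point[of R V'] vs_point[of P V]] by blast

lemma vs_join: "P \<in> pts V \<Longrightarrow> R \<in> pts V' \<Longrightarrow> P \<noteq> R \<Longrightarrow> vs 2 (join P R)"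
  using vs_join_point[OF vs_point, of P V R V'] point_not_le[of P V R V'] by (simp add: numeral_2_eq_2)

lemma line_eq_join:
  assumes "P \<in> pts V" "R \<in> pts V'" "P \<noteq> R" "vs 2 L" "P \<subseteq> L" "R \<subseteq> L"
  shows "L = join P R"
  using vs_eq[OF vs_join[OF assms(1-3)] assms(4)] join_least[OF vsD(1)[OF assms(4)] assms(5,6)] by simp

lemma card_pts:
  assumes "vs N V"
  shows "card (pts V) * (q - 1) = q ^ N - 1"
proof -
  have fin: "finite V" "finite (pts V)" using assms finite_pts by (auto simp: vs_def)
  have c: "card (P - {0}) = q - 1" if "P \<in> pts V" for P
    using vs_point[OF that] fvec.subspace_0[OF point_subspace[OF that]] by (simp add: vs_def)
  have "V - {0} = (\<Union>P\<in>pts V. P - {0})"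
  proof
    show "V - {0} \<subseteq> (\<Union>P\<in>pts V. P - {0})"
      using mem_span_self by (fastforce simp: pts_iff)
    show "(\<Union>P\<in>pts V. P - {0}) \<subseteq> V - {0}" using point_le vsD(1)[OF assms] by blast
  qed
  then have "card (V - {0}) = (\<Sum>P\<in>pts V. card (P - {0}))"
  proof (simp only:, intro card_UN_disjoint)
    show "\<forall>i\<in>pts V. finite (i - {0})" using fin point_le[OF _ vsD(1)[OF assms]] finite_subset by blast
    show "\<forall>i\<in>pts V. \<forall>j\<in>pts V. i \<noteq> j \<longrightarrow> (i - {0}) \<inter> (j - {0}) = {}"
      using points_Int by blast
  qed (rule fin)
  also have "\<dots> = card (pts V) * (q - 1)" using c by simp
  finally show ?thesis
    using assms fvec.subspace_0[OF vsD(1)[OF assms]] by (simp add: vs_def)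
qed

text \<open>The case of constant weights.\<close>

lemma avg_card:
  assumes "vs N V" "vs a W" "W \<subseteq> V" "a \<le> b" "b + k = N" "finite B"
    "\<And>P. P \<in> B \<Longrightarrow> P \<in> pts V \<and> \<not> P \<subseteq> W"
  obtains T where "vs b T" "W \<subseteq> T" "T \<subseteq> V" "q ^ k * card {P \<in> B. P \<subseteq> T} \<le> card B"
proof -
  obtain T where T: "vs b T" "W \<subseteq> T" "T \<subseteq> V" "real q ^ k * (\<Sum>P\<in>{P \<in> B. P \<subseteq> T}. 1) \<le> (\<Sum>P\<in>B. 1)"
    using avg_subspace[OF assms(1-7), of "\<lambda>_. 1"] by auto
  then have "real (q ^ k * card {P \<in> B. P \<subseteq> T}) \<le> real (card B)" by simp
  then show thesis using that T by (simp only: of_nat_le_iff)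
qed

text \<open>The last condition is \<open>|B| < 3 (q ^ k + 1) / 2\<close>, cleared of denominators.\<close>

definition one_mod :: "nat \<Rightarrow> nat \<Rightarrow> nat \<Rightarrow> (nat \<Rightarrow> 'f) set \<Rightarrow> (nat \<Rightarrow> 'f) set set \<Rightarrow> bool" where
  "one_mod s k N V B \<longleftrightarrow> vs N V \<and> B \<subseteq> pts V \<and>
     (\<forall>T. vs (N - k) T \<longrightarrow> T \<subseteq> V \<longrightarrow> [card (points_in B T) = 1] (mod s)) \<and>
     2 * card B < 3 * q ^ k + 3"

end

locale small_set_one_mod = prime_power_field p t F
  for p t :: nat and F :: "'f::{field,finite} itself" +
  fixes s k N :: nat and V :: "(nat \<Rightarrow> 'f) set" and B :: "(nat \<Rightarrow> 'f) set set"
  assumes one_mod: "one_mod s k N V B" and k1: "1 \<le> k" and kN: "k + 2 \<le> N" and s7: "7 \<le> s"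
begin

lemma V: "vs N V" and BV: "B \<subseteq> pts V" and small: "2 * card B < 3 * q ^ k + 3"
  and cong: "vs (N - k) T \<Longrightarrow> T \<subseteq> V \<Longrightarrow> [card (points_in B T) = 1] (mod s)"
  using one_mod by (auto simp: one_mod_def)

lemma finB: "finite B"
  using finite_pts[OF vsD(2)[OF V]] BV finite_subset by blast

lemma subV: "fvec.subspace V" using V by (rule vsD)

lemma in_pts: "P \<in> B \<Longrightarrow> P \<in> pts V" using BV by auto

lemma B_le: "P \<in> B \<Longrightarrow> P \<subseteq> V" using point_le[OF in_pts subV] .

lemma fin_points_in: "finite (points_in B T)"
  using finB by (simp add: points_in_def)

lemma points_pos:
  assumes "vs (N - k) T" "T \<subseteq> V" shows "card (points_in B T) \<ge> 1"
proof (rule ccontr)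
  assume "\<not> ?thesis"
  then have "card (points_in B T) = 0" by simp
  then have "[0 = 1] (mod s)" using cong[OF assms] by simp
  then show False using s7 by (simp add: cong_def)
qed

lemma points_dvd: "vs (N - k) T \<Longrightarrow> T \<subseteq> V \<Longrightarrow> s dvd card (points_in B T) - 1"
  using cong_one_dvd points_pos cong by blast

text \<open>An average \<open>(N - k)\<close>-space through \<open>P\<close> contains fewer than \<open>s\<close> other points of \<open>B\<close>, and their number
  is divisible by \<open>s\<close>.\<close>

lemma tangent:
  assumes P: "P \<in> B"
  obtains T where "vs (N - k) T" "P \<subseteq> T" "T \<subseteq> V" "points_in B T = {P}"
proof -
  have nle: "R \<in> pts V \<and> \<not> R \<subseteq> P" if "R \<in> B - {P}" for R
    using that in_pts point_not_le[OF in_pts[OF P]] by auto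
  obtain T where T: "vs (N - k) T" "P \<subseteq> T" "T \<subseteq> V" "q ^ k * card {R \<in> B - {P}. R \<subseteq> T} \<le> card (B - {P})"
    using avg_card[OF V vs_point[OF in_pts[OF P]] B_le[OF P], of "N - k" k "B - {P}"] nle kN finB by auto
  let ?E = "{R \<in> B - {P}. R \<subseteq> T}"
  have e: "points_in B T = insert P ?E" using P T(2) by (auto simp: points_in_def)
  then have "card (points_in B T) - 1 = card ?E" using finB by simp
  then have d: "s dvd card ?E" using points_dvd[OF T(1,3)] by simp
  have "card ?E = 0"
  proof (rule ccontr)
    assume "card ?E \<noteq> 0"
    then have "7 \<le> card ?E" using d s7 dvd_imp_le[of s "card ?E"] by linarith
    then have "q ^ k * 7 \<le> q ^ k * card ?E" by simp
    also have "\<dots> \<le> card B - 1" using T(4) P finB by simp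
    finally have "q ^ k * 7 \<le> card B" by simp
    moreover have "q ^ k \<ge> 1" using q_gt by simp
    ultimately show False using small by linarith
  qed
  moreover have "finite ?E" using finB by simp
  ultimately have "?E = {}" by (simp only: card_0_eq)
  then have "points_in B T = {P}" using e by (simp only:)
  then show thesis by (rule that[OF T(1-3)])
qed

lemma line_extra:
  assumes L: "vs 2 L" "L \<subseteq> V" and two: "2 \<le> card (points_in B L)"
  obtains T E where "vs (N - k) T" "L \<subseteq> T" "T \<subseteq> V" "points_in B T = points_in B L \<union> E"
    "card E \<le> 1" "E = {R \<in> B. \<not> R \<subseteq> L \<and> R \<subseteq> T}"
proof -
  let ?B = "{R \<in> B. \<not> R \<subseteq> L}"
  obtain T where T: "vs (N - k) T" "L \<subseteq> T" "T \<subseteq> V" "q ^ k * card {R \<in> ?B. R \<subseteq> T} \<le> card ?B"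
  proof -
    have nle: "R \<in> pts V \<and> \<not> R \<subseteq> L" if "R \<in> ?B" for R using that in_pts by blast
    have f: "finite ?B" using finB by simp
    have h: "2 \<le> N - k" "N - k + k = N" using kN by auto
    show thesis by (rule avg_card[OF V L h f nle]) (auto intro: that)
  qed
  let ?E = "{R \<in> B. \<not> R \<subseteq> L \<and> R \<subseteq> T}"
  have E: "{R \<in> ?B. R \<subseteq> T} = ?E" by auto
  have "?B = B - points_in B L" by (auto simp: points_in_def)
  then have "card ?B = card B - card (points_in B L)"
    using card_Diff_subset[OF fin_points_in, of L B] by (auto simp: points_in_def)
  moreover have "card (points_in B L) \<le> card B" by (rule card_mono[OF finB]) (auto simp: points_in_def)
  ultimately have "card ?B + 2 \<le> card B" using two by linarith
  moreover have "q ^ k * card ?E \<le> card ?B" using T(4) by (simp only: E)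
  ultimately have a: "2 * (q ^ k * card ?E) < 3 * q ^ k" using small by linarith
  have "card ?E \<le> 1"
  proof (rule ccontr)
    assume "\<not> card ?E \<le> 1"
    then have "q ^ k * 2 \<le> q ^ k * card ?E" by (intro mult_le_mono2) simp
    then show False using a by linarith
  qed
  moreover have "points_in B T = points_in B L \<union> ?E" using T(2) by (auto simp: points_in_def)
  ultimately show thesis using that[OF T(1-3)] by blast
qed

text \<open>A line with at least two points of \<open>B\<close> lies in an \<open>(N - k)\<close>-dimensional subspace with at most
  one further point of \<open>B\<close>; a further point would span with each point of the line a line with
  exactly two points, which is impossible by the same argument.\<close>

lemma secant:
  assumes P: "P \<in> B" and R: "R \<in> B" and PR: "P \<noteq> R"
  shows "s + 1 \<le> card (points_in B (join P R))"
proof -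
  have two: "2 \<le> card (points_in B (join P R))" if "P \<in> B" "R \<in> B" "P \<noteq> R" for P R
  proof -
    have "{P, R} \<subseteq> points_in B (join P R)" using that join_upper[where P=P and R=R] by (simp add: points_in_def)
    then have "card {P, R} \<le> card (points_in B (join P R))" by (rule card_mono[OF fin_points_in])
    then show ?thesis using that by simp
  qed
  have line: "vs 2 (join P R)" "join P R \<subseteq> V" if "P \<in> B" "R \<in> B" "P \<noteq> R" for P R
    using vs_join[OF in_pts[OF that(1)] in_pts[OF that(2)] that(3)]
      join_least[OF subV B_le[OF that(1)] B_le[OF that(2)]] by auto
  let ?L = "join P R"
  obtain T E where T: "vs (N - k) T" "?L \<subseteq> T" "T \<subseteq> V" "points_in B T = points_in B ?L \<union> E"
    "card E \<le> 1" "E = {R' \<in> B. \<not> R' \<subseteq> ?L \<and> R' \<subseteq> T}"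
    using line_extra[OF line[OF P R PR] two[OF P R PR]] by blast
  have finE: "finite E" using T(6) finB by simp
  have cT: "card (points_in B T) = card (points_in B ?L) + card E"
    unfolding T(4) using finE fin_points_in by (intro card_Un_disjoint) (auto simp: T(6) points_in_def)
  have "E = {}"
  proof (rule ccontr)
    assume "E \<noteq> {}"
    then have "card E \<noteq> 0" using finE by simp
    then have "card E = 1" using T(5) by linarith
    then obtain X where X: "E = {X}" by (rule card_1_singletonE)
    have XE: "X \<in> E" unfolding X by simp
    have XB: "X \<in> B" "\<not> X \<subseteq> ?L" "X \<subseteq> T" using XE unfolding T(6) by auto
    have PX: "P \<noteq> X" using XB(2) join_upper(1)[of P R] by blast
    let ?M = "join P X"
    have MT: "?M \<subseteq> T" by (rule join_least[OF vsD(1)[OF T(1)] _ XB(3)]) (use T(2) join_upper(1)[of P R] in blast)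
    have pM: "points_in B ?M = {P, X}"
    proof
      show "{P, X} \<subseteq> points_in B ?M" using P XB(1) join_upper[where P=P and R=X] by (simp add: points_in_def)
      show "points_in B ?M \<subseteq> {P, X}"
      proof
        fix Y assume "Y \<in> points_in B ?M"
        then have Y: "Y \<in> B" "Y \<subseteq> ?M" by (auto simp: points_in_def)
        show "Y \<in> {P, X}"
        proof (rule ccontr)
          assume nY: "Y \<notin> {P, X}"
          have "Y \<in> points_in B T" unfolding points_in_iff using Y MT by blast
          then have "Y \<in> points_in B ?L" using nY unfolding T(4) X by blast
          then have YL: "Y \<subseteq> ?L" by (simp add: points_in_def)
          then have "?L = join P Y" using line_eq_join[OF in_pts[OF P] in_pts[OF Y(1)] _ line(1)[OF P R PR] join_upper(1) YL] nY by blast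
          moreover have "?M = join P Y" using line_eq_join[OF in_pts[OF P] in_pts[OF Y(1)] _ line(1)[OF P XB(1) PX] join_upper(1) Y(2)] nY by blast
          ultimately show False using XB(2) join_upper(2)[where P=P and R=X] by simp
        qed
      qed
    qed
    obtain T' E' where T': "vs (N - k) T'" "?M \<subseteq> T'" "T' \<subseteq> V" "points_in B T' = points_in B ?M \<union> E'"
      "card E' \<le> 1" "E' = {R' \<in> B. \<not> R' \<subseteq> ?M \<and> R' \<subseteq> T'}"
      by (rule line_extra[OF line[OF P XB(1) PX] two[OF P XB(1) PX]])
    have "card (points_in B ?M \<union> E') = card (points_in B ?M) + card E'"
      using T'(6) finB fin_points_in by (intro card_Un_disjoint) (auto simp: points_in_def)
    then have "card (points_in B T') = 2 + card E'" unfolding T'(4) using pM PX by simp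
    then have "s dvd 1 + card E'" using points_dvd[OF T'(1,3)] by simp
    then have "s \<le> 1 + card E'" by (rule dvd_imp_le) simp
    then show False using T'(5) s7 by simp
  qed
  then have "s dvd card (points_in B ?L) - 1" using points_dvd[OF T(1,3)] cT by simp
  then have "s \<le> card (points_in B ?L) - 1" using two[OF P R PR] by (intro dvd_imp_le) auto
  then show ?thesis using two[OF P R PR] by linarith
qed

text \<open>A random \<open>(N - k)\<close>-space contains a given point with probability less than \<open>1 / q ^ k\<close>.\<close>

lemma size_gt: "q ^ k < card B"
proof (rule ccontr)
  assume "\<not> ?thesis"
  then have le: "real (card B) \<le> real q ^ k" by (simp add: not_less flip: of_nat_power)
  have nz: "P \<in> pts V \<and> \<not> P \<subseteq> {0}" if "P \<in> B" for P
    using in_pts[OF that] point_gen[OF in_pts[OF that]] by (metis singletonD subsetD)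
  have N: "0 + (N - k) = N - k" by simp
  have sub0: "{0} \<subseteq> V" using fvec.subspace_0[OF subV] by simp
  have "\<exists>T. vs (N - k) T \<and> {0} \<subseteq> T \<and> T \<subseteq> V \<and>
    (real q ^ (N - 0) - 1) * sum (\<lambda>_. 1) {P \<in> B. P \<subseteq> T} \<le> (real q ^ (N - k) - 1) * sum (\<lambda>_. 1) B"
    by (rule avg_exact[where c = "\<lambda>_. 1" and B = B, OF V zero_le_one vs_0 sub0 diff_le_self N finB nz])
  then obtain T where T: "vs (N - k) T" "T \<subseteq> V"
    "(real q ^ (N - 0) - 1) * sum (\<lambda>_. 1) {P \<in> B. P \<subseteq> T} \<le> (real q ^ (N - k) - 1) * sum (\<lambda>_. 1) B"
    by blast
  have "1 \<le> card {P \<in> B. P \<subseteq> T}" using points_pos[OF T(1,2)] by (simp add: points_in_def)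
  then have "1 \<le> real (card {P \<in> B. P \<subseteq> T})" by simp
  then have "(real q ^ N - 1) * 1 \<le> (real q ^ N - 1) * real (card {P \<in> B. P \<subseteq> T})"
    using rq_pow[of N] kN by (intro mult_left_mono) auto
  also have "\<dots> \<le> (real q ^ (N - k) - 1) * real (card B)" using T(3) by simp
  also have "\<dots> \<le> (real q ^ (N - k) - 1) * real q ^ k"
    using le rq_pow[of "N - k"] kN by (intro mult_left_mono) auto
  also have "\<dots> = real q ^ N - real q ^ k"
    using kN by (simp add: left_diff_distrib power_add[symmetric])
  finally show False using rq_pow[of k] k1 by simp
qed

lemma two_points: assumes "P \<in> B" shows "\<exists>R\<in>B. R \<noteq> P"
proof (rule ccontr)
  assume "\<not> (\<exists>R\<in>B. R \<noteq> P)"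
  then have "B \<subseteq> {P}" by blast
  then have "card B \<le> card {P}" by (intro card_mono) auto
  moreover have "q ^ k \<ge> 1" using q_gt by simp
  ultimately show False using size_gt by simp
qed

text \<open>A line has only \<open>q + 1\<close> points.\<close>

lemma s_le_q: "s \<le> q"
proof -
  have "B \<noteq> {}" using size_gt by (metis card.empty less_nat_zero_code)
  then obtain P where P: "P \<in> B" by blast
  obtain R where R: "R \<in> B" "R \<noteq> P" using two_points[OF P] by blast
  have L: "vs 2 (join P R)" by (rule vs_join[OF in_pts[OF P] in_pts[OF R(1)]]) (use R(2) in blast)
  have "points_in B (join P R) \<subseteq> pts (join P R)"
  proof
    fix Y assume "Y \<in> points_in B (join P R)"
    then have Y: "Y \<in> pts V" "Y \<subseteq> join P R" using in_pts by (auto simp: points_in_def)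
    obtain y where "y \<in> Y" "y \<noteq> 0" "Y = fvec.span {y}" using point_gen[OF Y(1)] by metis
    then show "Y \<in> pts (join P R)" using Y(2) unfolding pts_iff by blast
  qed
  then have "card (points_in B (join P R)) \<le> card (pts (join P R))"
    by (rule card_mono[OF finite_pts[OF vsD(2)[OF L]]])
  then have "s + 1 \<le> card (pts (join P R))" using secant[OF P R(1)] R(2) by auto
  then have "(s + 1) * (q - 1) \<le> q ^ 2 - 1" using card_pts[OF L] by (metis mult_le_mono1)
  also have "q ^ 2 - 1 = (q + 1) * (q - 1)"
    using q_gt by (cases q) (simp_all add: power2_eq_square)
  finally have "s + 1 \<le> q + 1" using q_gt by (metis mult_le_cancel2 zero_less_diff)
  then show ?thesis by simp
qed

end

section \<open>Linear sets\<close>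

text \<open>Take \<open>U1\<close> maximal among the subspaces avoiding \<open>u\<close>. A vector \<open>w\<close> outside \<open>U1\<close> can be exchanged for \<open>u\<close>,
  as \<open>u\<close> lies in the subspace spanned by \<open>U1\<close> and \<open>w\<close>.\<close>

lemma (in vec_space) Ksub_complement_of:
  assumes K: "is_subfield K" "finite K" and U: "Ksub K U" "finite U" and u: "u \<in> U" "u \<noteq> 0"
  obtains U1 where "Ksub K U1" "U1 \<subseteq> U" "u \<notin> U1" "card U = card K * card U1" "Kext K u U1 = U"
proof -
  let ?S = "{X. Ksub K X \<and> X \<subseteq> U \<and> u \<notin> X}"
  have "finite ?S" by (rule finite_subset[of _ "Pow U"]) (use U in auto)
  moreover have "{0} \<in> ?S" using Ksub_trivial Ksub_zero[OF U(1)] u by auto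
  ultimately obtain U1 where U1: "U1 \<in> ?S" and max: "\<And>X. X \<in> ?S \<Longrightarrow> U1 \<subseteq> X \<Longrightarrow> X = U1"
    using finite_has_maximal2[of ?S "{0}"] by (metis (no_types, lifting))
  have KU1: "Ksub K U1" "U1 \<subseteq> U" "u \<notin> U1" using U1 by auto
  have "Kext K u U1 = U"
  proof (rule antisym)
    show "Kext K u U1 \<subseteq> U" by (rule Kext_least[OF U(1) KU1(2) u(1)])
    show "U \<subseteq> Kext K u U1"
    proof
      fix w assume w: "w \<in> U"
      show "w \<in> Kext K u U1"
      proof (rule ccontr)
        assume nw: "w \<notin> Kext K u U1"
        have "u \<notin> Kext K w U1"
        proof
          assume "u \<in> Kext K w U1"
          then obtain c x where cx: "c \<in> K" "x \<in> U1" "u = x + c *s w" by (auto simp: Kext_iff)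
          then have "c \<noteq> 0" using KU1(3) by auto
          have "inverse c *s (c *s w) = inverse c *s (u - x)" using cx(3) by simp
          then have "w = inverse c *s (u - x)" using \<open>c \<noteq> 0\<close> by simp
          moreover have "inverse c \<in> K" using K(1) cx(1) by (simp add: is_subfield_def)
          moreover have "u - x \<in> Kext K u U1"
            by (rule Ksub_diff[OF K(1) Ksub_Kext[OF K(1) KU1(1)] Kext_mem[OF K(1) KU1(1)] subsetD[OF Kext_superset[OF K(1)] cx(2)]])
          ultimately show False using nw Ksub_scale[OF Ksub_Kext[OF K(1) KU1(1), of u]] by blast
        qed
        moreover have "Kext K w U1 \<subseteq> U" by (rule Kext_least[OF U(1) KU1(2) w])
        ultimately have "Kext K w U1 \<in> ?S" using Ksub_Kext[OF K(1) KU1(1)] by blast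
        then have "Kext K w U1 = U1" using max Kext_superset[OF K(1)] by blast
        then have "w \<in> U1" using Kext_mem[OF K(1) KU1(1), of w] by simp
        then show False using nw Kext_superset[OF K(1), of U1 u] by blast
      qed
    qed
  qed
  then show thesis using that[OF KU1] card_Kext[OF K(1) KU1(1,3)] by simp
qed

text \<open>Points of a linear set are counted through the vectors of \<open>U\<close> lying on them.\<close>

definition vecs :: "(nat \<Rightarrow> 'f::field) set \<Rightarrow> (nat \<Rightarrow> 'f) set set \<Rightarrow> (nat \<Rightarrow> 'f) set" where
  "vecs U X = {u \<in> U. u \<noteq> 0 \<and> fvec.span {u} \<in> X}"

lemma vecs_pts: "vecs U (pts U) = U - {0}"
  by (auto simp: vecs_def pts_iff)

lemma point_of_U: "P \<in> pts U \<Longrightarrow> \<exists>u\<in>P \<inter> U. u \<noteq> 0 \<and> P = fvec.span {u}"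
  using mem_span_self by (fastforce simp: pts_iff)

lemma card_vecs_ge:
  assumes fin: "finite U" and X: "X \<subseteq> pts U" and w: "\<And>P. P \<in> X \<Longrightarrow> w + 1 \<le> card (P \<inter> U)"
  shows "w * card X \<le> card (vecs U X)"
proof -
  have finX: "finite X" using finite_pts[OF fin] X finite_subset by blast
  have eq: "vecs U X = (\<Union>P\<in>X. P \<inter> U - {0})"
  proof (intro set_eqI iffI)
    fix u assume "u \<in> vecs U X"
    then show "u \<in> (\<Union>P\<in>X. P \<inter> U - {0})" using mem_span_self[of u] by (auto simp: vecs_def)
  next
    fix u assume "u \<in> (\<Union>P\<in>X. P \<inter> U - {0})"
    then obtain P where "P \<in> X" "u \<in> P" "u \<in> U" "u \<noteq> 0" by auto
    moreover have "P = fvec.span {u}" using point_eq[of P U u] calculation X by blast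
    ultimately show "u \<in> vecs U X" by (auto simp: vecs_def)
  qed
  have "w * card X = (\<Sum>P\<in>X. w)" by simp
  also have "\<dots> \<le> (\<Sum>P\<in>X. card (P \<inter> U - {0}))"
  proof (rule sum_mono)
    fix P assume P: "P \<in> X"
    have "card (P \<inter> U) - 1 \<le> card (P \<inter> U - {0})" using fin by (simp add: card_Diff_singleton_if)
    then show "w \<le> card (P \<inter> U - {0})" using w[OF P] by simp
  qed
  also have "\<dots> = card (vecs U X)" unfolding eq
  proof (rule card_UN_disjoint[symmetric, OF finX])
    show "\<forall>i\<in>X. finite (i \<inter> U - {0})" using fin by simp
    show "\<forall>i\<in>X. \<forall>j\<in>X. i \<noteq> j \<longrightarrow> (i \<inter> U - {0}) \<inter> (j \<inter> U - {0}) = {}"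
      using points_Int X by blast
  qed
  finally show ?thesis .
qed

lemma card_vecs_Un:
  assumes "finite U" "X \<inter> Y = {}"
  shows "card (vecs U (X \<union> Y)) = card (vecs U X) + card (vecs U Y)"
proof -
  have "vecs U (X \<union> Y) = vecs U X \<union> vecs U Y" by (auto simp: vecs_def)
  then show ?thesis using assms by (simp, intro card_Un_disjoint) (auto simp: vecs_def)
qed

context prime_power_field
begin

lemma Fix_finite: "finite (Fix d)" by simp

lemma Ksub_weight:
  assumes d: "d dvd t" and U: "fv.Ksub (Fix d) U" "finite U" and P: "P \<in> pts U"
  obtains j where "card (P \<inter> U) = (p ^ d) ^ Suc j"
proof -
  have "fv.Ksub (Fix d) (P \<inter> U)" by (intro fv.Ksub_Int U fv.subspace_Ksub point_subspace[OF P])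
  then obtain j where j: "card (P \<inter> U) = (p ^ d) ^ j"
    using fv.Ksub_card_power[OF is_subfield_Fix Fix_finite, of d "P \<inter> U"] U(2) card_Fix[OF d] by auto
  obtain u where u: "u \<in> P \<inter> U" "u \<noteq> 0" using point_of_U[OF P] by blast
  have "{0, u} \<subseteq> P \<inter> U" using u(1) fv.Ksub_zero[OF U(1)] fvec.subspace_0[OF point_subspace[OF P]] by simp
  then have "card {0, u} \<le> card (P \<inter> U)" using U(2) by (intro card_mono) auto
  then have "2 \<le> card (P \<inter> U)" using u(2) by simp
  then have "j \<noteq> 0" using j by (cases j) auto
  then show thesis using that[of "j - 1"] j by simp
qed

lemma Ksub_weight_ge:
  assumes d: "d dvd t" and U: "fv.Ksub (Fix d) U" "finite U" and P: "P \<in> pts U"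
  shows "p ^ d \<le> card (P \<inter> U)"
proof -
  obtain j where "card (P \<inter> U) = (p ^ d) ^ Suc j" using Ksub_weight[OF assms] .
  moreover have "(p ^ d) ^ j \<ge> 1" using p_gt_1 by (simp add: one_le_power)
  ultimately show ?thesis by simp
qed

lemma vecs_mass:
  assumes d: "d dvd t" and U: "fv.Ksub (Fix d) U" "finite U" and X: "X \<subseteq> pts U"
  shows "(p ^ d - 1) * card X \<le> card (vecs U X)"
proof (rule card_vecs_ge[OF U(2) X])
  fix P assume "P \<in> X"
  then have "p ^ d \<le> card (P \<inter> U)" using Ksub_weight_ge[OF d U] X by blast
  moreover have "p ^ d \<ge> 1" using p_gt_1 by (simp add: one_le_power)
  ultimately show "p ^ d - 1 + 1 \<le> card (P \<inter> U)" by simp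
qed

lemma Fix_power_q: assumes "d dvd t" shows "q ^ k = (p ^ d) ^ (t div d * k)"
proof -
  have "d * (t div d) = t" using assms by simp
  then have "q ^ k = (p ^ (d * (t div d))) ^ k" by (simp only: q_def)
  then show ?thesis by (simp only: power_mult)
qed

end

context small_set_one_mod
begin

lemma U_sub_V:
  assumes "pts U \<subseteq> pts V" "u \<in> U" shows "u \<in> V"
proof (cases "u = 0")
  case True then show ?thesis using fvec.subspace_0[OF subV] by simp
next
  case False
  then have "fvec.span {u} \<in> pts U" using assms(2) unfolding pts_iff by blast
  then have "fvec.span {u} \<in> pts V" using assms(1) by blast
  then show ?thesis using point_le[OF _ subV] mem_span_self by blast
qed

lemma large_group_blocks:
  assumes K: "is_subfield K" and U: "fv.Ksub K U" "U \<subseteq> V" "q ^ k < card U"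
    and T: "vs (N - k) T" "T \<subseteq> V"
  obtains P where "P \<in> pts U" "P \<subseteq> T"
proof -
  have "card V = q ^ k * q ^ (N - k)" using V kN by (simp add: vs_def power_add[symmetric])
  also have "\<dots> < card U * card T" using U(3) vsD(3)[OF T(1)] q_gt by simp
  finally have "card V < card U * card T" .
  then obtain x where x: "x \<in> U \<inter> T" "x \<noteq> 0"
    using fv.groups_meet[OF U(1) fv.subspace_Ksub[OF vsD(1)[OF T(1)]] K fv.subspace_Ksub[OF subV] vsD(2)[OF V] U(2) T(2)] by blast
  have "fvec.span {x} \<in> pts U" using x by (auto simp: pts_iff)
  moreover have "fvec.span {x} \<subseteq> T" using x span_le_iff[OF vsD(1)[OF T(1)]] by simp
  ultimately show thesis by (rule that)
qed

lemma blocking_subset_eq: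
  assumes B': "B' \<subseteq> B" and bl: "\<And>T. vs (N - k) T \<Longrightarrow> T \<subseteq> V \<Longrightarrow> \<exists>P\<in>B'. P \<subseteq> T"
  shows "B' = B"
proof
  show "B \<subseteq> B'"
  proof
    fix P assume P: "P \<in> B"
    obtain T where T: "vs (N - k) T" "P \<subseteq> T" "T \<subseteq> V" "points_in B T = {P}" using tangent[OF P] .
    obtain R where R: "R \<in> B'" "R \<subseteq> T" using bl[OF T(1,3)] by blast
    then have "R \<in> points_in B T" using B' by (auto simp: points_in_def)
    then show "P \<in> B'" using T(4) R(1) by simp
  qed
qed (rule B')

text \<open>Take \<open>U\<close> minimal. If it were larger, a subgroup of index \<open>p ^ d\<close> would still meet every \<open>(N - k)\<close>-space
  for reasons of size, hence would represent a subset of \<open>B\<close> that blocks all of them. Tangents show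
  that such a subset is \<open>B\<close> itself.\<close>

lemma normal_form:
  assumes d: "d dvd t" "d > 0" and U0: "fv.Ksub (Fix d) U0" "B = pts U0"
  obtains U where "fv.Ksub (Fix d) U" "B = pts U" "card U = p ^ d * q ^ k" "U \<subseteq> V"
proof -
  let ?S = "{U. U \<subseteq> V \<and> fv.Ksub (Fix d) U \<and> B = pts U}"
  have UV: "U \<subseteq> V" if "B = pts U" for U using U_sub_V[of U] BV that by blast
  have fS: "finite ?S" by (rule finite_subset[of _ "Pow V"]) (use vsD(2)[OF V] in auto)
  have "U0 \<in> ?S" using U0 UV by blast
  then obtain U where "U \<in> ?S" and min: "\<And>X. X \<in> ?S \<Longrightarrow> X \<subseteq> U \<Longrightarrow> X = U"
    using finite_has_minimal2[OF fS] by (metis (no_types, lifting))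
  then have U: "U \<subseteq> V" "fv.Ksub (Fix d) U" "B = pts U" by auto
  have finU: "finite U" using U(1) vsD(2)[OF V] finite_subset by blast
  have k1': "p ^ d > 1" using one_less_power[OF p_gt_1 d(2)] .
  obtain j where j: "card U = (p ^ d) ^ j"
    using fv.Ksub_card_power[OF is_subfield_Fix Fix_finite U(2) finU] card_Fix[OF d(1)] by auto
  have "(p ^ d - 1) * card B \<le> card (vecs U (pts U))"
    using vecs_mass[OF d(1) U(2) finU, of "pts U"] U(3) by simp
  also have "\<dots> = card U - 1" unfolding vecs_pts using fv.Ksub_zero[OF U(2)] by simp
  finally have m: "(p ^ d - 1) * card B \<le> card U - 1" .
  have "1 * card B \<le> (p ^ d - 1) * card B" using k1' by (intro mult_le_mono1) linarith
  then have "q ^ k < card U" using m size_gt by linarith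
  then have "(p ^ d) ^ (t div d * k) < (p ^ d) ^ j" using Fix_power_q[OF d(1), of k] j by simp
  then have ij: "t div d * k < j" using power_less_imp_less_exp[OF k1'] by blast
  have "(p ^ d) ^ Suc (t div d * k) \<le> (p ^ d) ^ j"
    using ij k1' by (intro power_increasing) auto
  then have ge: "p ^ d * q ^ k \<le> card U" using Fix_power_q[OF d(1), of k] j by simp
  have "card U \<le> p ^ d * q ^ k"
  proof (rule ccontr)
    assume gt: "\<not> card U \<le> p ^ d * q ^ k"
    have "{0} \<subset> U" using fv.Ksub_zero[OF U(2)] \<open>q ^ k < card U\<close> q_gt
      by (metis card.empty card_insert_disjoint empty_iff finite.emptyI insert_subset empty_subsetI psubsetI less_one nat_neq_iff not_less_eq one_le_power less_imp_le_nat not_less One_nat_def)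
    then obtain U1 where U1: "fv.Ksub (Fix d) U1" "U1 \<subset> U" "card U = card (Fix d) * card U1"
      using fv.Ksub_hyperplane_over[OF is_subfield_Fix Fix_finite U(2) finU fv.Ksub_trivial] by metis
    have "p ^ d * q ^ k < p ^ d * card U1" using gt U1(3) card_Fix[OF d(1)] by (simp only: not_le)
    then have c1: "q ^ k < card U1" using mult_less_cancel1 by blast
    have U1V: "U1 \<subseteq> V" using U1(2) U(1) by blast
    have "pts U1 = B"
    proof (rule blocking_subset_eq)
      show "pts U1 \<subseteq> B" using pts_mono[of U1 U] U1(2) U(3) by blast
      show "\<exists>P\<in>pts U1. P \<subseteq> T" if "vs (N - k) T" "T \<subseteq> V" for T
        using large_group_blocks[OF is_subfield_Fix U1(1) U1V c1 that] by blast
    qed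
    then have "U1 = U" using min[of U1] U1(1,2) U1V by blast
    then show False using U1(2) by blast
  qed
  then show thesis using that[OF U(2,3) _ U(1)] ge by simp
qed

end

locale linear_small_set = small_set_one_mod p t F s k N V B
  for p t :: nat and F :: "'f::{field,finite} itself"
  and s k N :: nat and V :: "(nat \<Rightarrow> 'f) set" and B :: "(nat \<Rightarrow> 'f) set set" +
  fixes e :: nat and U :: "(nat \<Rightarrow> 'f) set"
  assumes s_pow: "s = p ^ e" and KU: "fv.Ksub (Fix 1) U" and BU: "B = pts U" and cardU: "card U = p * q ^ k"
begin

lemma UV: "U \<subseteq> V" using U_sub_V[of U] BV BU by blast
lemma finU: "finite U" using UV vsD(2)[OF V] finite_subset by blast
lemma cardF1: "card (Fix 1) = p" using card_Fix[of 1] by simp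
lemma U0: "0 \<in> U" by (rule fv.Ksub_zero[OF KU])
lemma U_add: "x \<in> U \<Longrightarrow> y \<in> U \<Longrightarrow> x + y \<in> U" by (rule fv.Ksub_add[OF KU])
lemma U_diff: "x \<in> U \<Longrightarrow> y \<in> U \<Longrightarrow> x - y \<in> U" by (rule fv.Ksub_diff[OF is_subfield_Fix KU])
lemma span_in_B: "u \<in> U \<Longrightarrow> u \<noteq> 0 \<Longrightarrow> fvec.span {u} \<in> B" unfolding BU pts_iff by blast

text \<open>The fewest vectors of \<open>U\<close> that a point can carry.\<close>

definition light :: "(nat \<Rightarrow> 'f) set \<Rightarrow> bool" where
  "light P \<longleftrightarrow> P \<in> B \<and> card (P \<inter> U) = p"

text \<open>A heavy point uses up at least \<open>p ^ 2 - 1\<close> of the nonzero vectors of \<open>U\<close>, a light one \<open>p - 1\<close>.\<close>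

lemma heavy_bound: "p * (p - 1) * card {P \<in> B. \<not> light P} + (p - 1) * card B < p * q ^ k"
proof -
  let ?H = "{P \<in> B. \<not> light P}" and ?L = "{P \<in> B. light P}"
  have "(p ^ 2 - 1) * card ?H \<le> card (vecs U ?H)"
  proof (rule card_vecs_ge[OF finU])
    fix P assume P: "P \<in> ?H"
    then have "P \<in> pts U" using BU by simp
    then obtain j where j: "card (P \<inter> U) = (p ^ 1) ^ Suc j" using Ksub_weight[OF _ KU finU] by (metis one_dvd)
    have "j \<noteq> 0" using P j by (auto simp: light_def)
    then have "p ^ 2 \<le> p ^ Suc j" using p_gt_1 by (intro power_increasing) auto
    moreover have "p ^ 2 > 0" using p_gt_1 by simp
    ultimately show "p ^ 2 - 1 + 1 \<le> card (P \<inter> U)" using j by simp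
  qed (use BU in blast)
  moreover have "(p ^ 1 - 1) * card ?L \<le> card (vecs U ?L)"
    by (rule vecs_mass[OF _ KU finU]) (use BU in auto)
  moreover have "card (vecs U (?H \<union> ?L)) = card (vecs U ?H) + card (vecs U ?L)"
    by (rule card_vecs_Un[OF finU]) blast
  moreover have "?H \<union> ?L = pts U" using BU by blast
  moreover have "card (vecs U (pts U)) = p * q ^ k - 1" unfolding vecs_pts using U0 cardU finU by simp
  ultimately have le: "(p ^ 2 - 1) * card ?H + (p - 1) * card ?L \<le> p * q ^ k - 1" by simp
  have "card B = card ?H + card ?L"
  proof -
    have "card (?H \<union> ?L) = card ?H + card ?L" by (rule card_Un_disjoint) (use finB in auto)
    moreover have "?H \<union> ?L = B" by blast
    ultimately show ?thesis by simp
  qed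
  moreover have "p ^ 2 - 1 = p * (p - 1) + (p - 1)" using p_gt_1 by (cases p) (auto simp: power2_eq_square)
  ultimately have "p * (p - 1) * card ?H + (p - 1) * card B \<le> p * q ^ k - 1"
    using le by (simp add: add_mult_distrib distrib_left)
  moreover have "p * q ^ k > 0" using p_gt_1 q_gt by simp
  ultimately show ?thesis by linarith
qed

text \<open>The multiples of \<open>y\<close> that lie in \<open>U\<close> modulo \<open>P\<close>; they describe how \<open>U\<close> meets the line joining \<open>P\<close> to the
  point of \<open>y\<close>.\<close>

definition line_scalars :: "(nat \<Rightarrow> 'f) set \<Rightarrow> (nat \<Rightarrow> 'f) \<Rightarrow> 'f set" where
  "line_scalars P y = {c. \<exists>v\<in>U. v - fscale c y \<in> P}"

text \<open>The group \<open>U\<close> meets the line in one coset of \<open>P \<inter> U\<close> for each such scalar. The \<open>s + 1\<close> points of \<open>B\<close> on the line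
  need more than \<open>(p - 1) s\<close> vectors, and the number of vectors is a power of \<open>p\<close>.\<close>

lemma line_scalars_card:
  assumes P: "light P" and y: "y \<in> U" "y \<notin> P"
  shows "card (U \<inter> join P (fvec.span {y})) = p * card (line_scalars P y)" "s \<le> card (line_scalars P y)"
proof -
  have PB: "P \<in> B" and cP: "card (P \<inter> U) = p" using P by (auto simp: light_def)
  have Pp: "P \<in> pts V" using in_pts[OF PB] .
  have sP: "fvec.subspace P" using point_subspace[OF Pp] .
  have y0: "y \<noteq> 0" using y(2) fvec.subspace_0[OF sP] by blast
  let ?R = "fvec.span {y}"
  let ?L = "join P ?R"
  have L: "?L = ext y P" by (rule join_ext[OF sP y0])
  have eq: "U \<inter> ?L = (\<Union>c\<in>line_scalars P y. {v \<in> U. v - fscale c y \<in> P})"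
  proof (intro set_eqI iffI)
    fix v assume v: "v \<in> U \<inter> ?L"
    then have "v \<in> ext y P" unfolding L by blast
    then obtain c x where "x \<in> P" "v = x + fscale c y" unfolding fv.Kext_iff by blast
    then have "v - fscale c y \<in> P" by simp
    then show "v \<in> (\<Union>c\<in>line_scalars P y. {v \<in> U. v - fscale c y \<in> P})" using v unfolding line_scalars_def by blast
  next
    fix v assume "v \<in> (\<Union>c\<in>line_scalars P y. {v \<in> U. v - fscale c y \<in> P})"
    then obtain c where c: "v \<in> U" "v - fscale c y \<in> P" by blast
    have "v = (v - fscale c y) + fscale c y" by simp
    then have "v \<in> ext y P" unfolding fv.Kext_iff using c(2) by blast
    then show "v \<in> U \<inter> ?L" using c(1) L by blast
  qed
  have fib: "card {v \<in> U. v - fscale c y \<in> P} = p" if c: "c \<in> line_scalars P y" for c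
  proof -
    obtain v0 where v0: "v0 \<in> U" "v0 - fscale c y \<in> P" using c unfolding line_scalars_def by blast
    have "{v \<in> U. v - fscale c y \<in> P} = (\<lambda>x. v0 + x) ` (P \<inter> U)"
    proof (intro set_eqI iffI)
      fix v assume v: "v \<in> {v \<in> U. v - fscale c y \<in> P}"
      have "(v - fscale c y) - (v0 - fscale c y) \<in> P" by (rule fvec.subspace_diff[OF sP _ v0(2)]) (use v in simp)
      then have "v - v0 \<in> P \<inter> U" using v v0 U_diff by simp
      then show "v \<in> (\<lambda>x. v0 + x) ` (P \<inter> U)" by (intro image_eqI[of _ _ "v - v0"]) auto
    next
      fix v assume "v \<in> (\<lambda>x. v0 + x) ` (P \<inter> U)"
      then obtain x where x: "x \<in> P" "x \<in> U" "v = v0 + x" by blast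
      have "(v0 - fscale c y) + x \<in> P" using fvec.subspace_add[OF sP v0(2) x(1)] .
      then show "v \<in> {v \<in> U. v - fscale c y \<in> P}" using x U_add[OF v0(1) x(2)] by (simp add: algebra_simps)
    qed
    then show ?thesis using cP by (simp add: card_image)
  qed
  have "card (U \<inter> ?L) = (\<Sum>c\<in>line_scalars P y. card {v \<in> U. v - fscale c y \<in> P})"
    unfolding eq
  proof (rule card_UN_disjoint)
    show "\<forall>i\<in>line_scalars P y. finite {v \<in> U. v - fscale i y \<in> P}" using finU by simp
    show "\<forall>i\<in>line_scalars P y. \<forall>j\<in>line_scalars P y. i \<noteq> j \<longrightarrow> {v \<in> U. v - fscale i y \<in> P} \<inter> {v \<in> U. v - fscale j y \<in> P} = {}"
    proof (intro ballI impI equals0I)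
      fix i j v assume ij: "i \<noteq> j" and v: "v \<in> {v \<in> U. v - fscale i y \<in> P} \<inter> {v \<in> U. v - fscale j y \<in> P}"
      have "(v - fscale j y) - (v - fscale i y) \<in> P" by (rule fvec.subspace_diff[OF sP]) (use v in auto)
      moreover have "(v - fscale j y) - (v - fscale i y) = fscale (i - j) y" by (simp add: fun_eq_iff fscale_def algebra_simps)
      ultimately have "fscale (inverse (i - j)) (fscale (i - j) y) \<in> P" using fvec.subspace_scale[OF sP] by metis
      then have "y \<in> P" using ij by simp
      then show False using y(2) by blast
    qed
  qed simp
  then show c: "card (U \<inter> ?L) = p * card (line_scalars P y)" using fib by simp
  have RB: "?R \<in> B" using span_in_B[OF y(1) y0] .
  have PR: "P \<noteq> ?R" using y(2) mem_span_self[of y] by blast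
  have Lsub: "fvec.subspace ?L" by (rule subspace_join)
  have "points_in B ?L \<subseteq> pts (U \<inter> ?L)"
  proof
    fix X assume "X \<in> points_in B ?L"
    then have X: "X \<in> pts U" "X \<subseteq> ?L" using BU by (auto simp: points_in_def)
    then obtain x where "x \<in> X \<inter> U" "x \<noteq> 0" "X = fvec.span {x}" using point_of_U by blast
    then show "X \<in> pts (U \<inter> ?L)" using X(2) unfolding pts_iff by blast
  qed
  moreover have "finite (pts (U \<inter> ?L))" using finU by (intro finite_pts) simp
  ultimately have "s + 1 \<le> card (pts (U \<inter> ?L))" using secant[OF PB RB PR] card_mono by (meson le_trans)
  moreover have KL: "fv.Ksub (Fix 1) (U \<inter> ?L)" by (rule fv.Ksub_Int[OF KU fv.subspace_Ksub[OF Lsub]])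
  have "(p ^ 1 - 1) * card (pts (U \<inter> ?L)) \<le> card (vecs (U \<inter> ?L) (pts (U \<inter> ?L)))"
    by (rule vecs_mass[OF _ KL]) (use finU in auto)
  then have "(p - 1) * card (pts (U \<inter> ?L)) \<le> card (U \<inter> ?L) - 1"
    unfolding vecs_pts using fv.Ksub_zero[OF KL] finU by simp
  ultimately have "(p - 1) * (s + 1) \<le> card (U \<inter> ?L) - 1" by (meson le_trans mult_le_mono2)
  moreover have "(p - 1) * (s + 1) = (p - 1) * s + (p - 1)" by simp
  ultimately have "(p - 1) * s < card (U \<inter> ?L)" using p_gt_1 by linarith
  then have gt: "(p - 1) * s < p * card (line_scalars P y)" using c by simp
  obtain j where j: "card (U \<inter> ?L) = p ^ j"
    using fv.Ksub_card_power[OF is_subfield_Fix Fix_finite KL] finU cardF1 by auto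
  have "1 * s \<le> (p - 1) * s" using p_gt_1 by (intro mult_le_mono1) linarith
  then have "p ^ e < p ^ j" using gt c j s_pow by linarith
  then have "Suc e \<le> j" using p_pow_lt by (simp add: Suc_le_eq)
  then have "p ^ Suc e \<le> p ^ j" using p_gt_1 by (intro power_increasing) auto
  then have "p * s \<le> p * card (line_scalars P y)" using c j s_pow by simp
  then show "s \<le> card (line_scalars P y)" using p_gt_1 by simp
qed

end

section \<open>The field attached to a light point\<close>

lemma reach_no0: "l \<in> reach t J \<Longrightarrow> t > 0 \<Longrightarrow> l \<in> reach t (J - {0})"
proof (induction rule: reach.induct)
  case zero then show ?case by (intro reach.zero)
next
  case (step l j)
  then have l: "l \<in> reach t (J - {0})" by simp
  show ?case
  proof (cases "j = 0")
    case True
    then show ?thesis using l reach_lt[OF l step.prems] by simp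
  next
    case False
    then show ?thesis using reach.step[OF l, of j] step.hyps by simp
  qed
qed

lemma reach_mono: "l \<in> reach t J \<Longrightarrow> J \<subseteq> J' \<Longrightarrow> l \<in> reach t J'"
  by (induction rule: reach.induct) (auto intro: reach.intros)

lemma step_gcd_no0:
  assumes "t > 0" "J - {0} = J' - {0}" shows "step_gcd t J = step_gcd t J'"
proof -
  have "reach t J = reach t (J - {0})" for J using reach_no0[OF _ assms(1)] reach_mono[of _ t "J - {0}" J] by blast
  then have "reach t J = reach t J'" using assms(2) by metis
  then show ?thesis by (simp add: step_gcd_def)
qed

text \<open>Finitely many nonvanishing conditions, each satisfied by some member of a linear family, are
  satisfied simultaneously as soon as the field is larger than their number.\<close>

lemma generic_member:
  fixes A :: "'j \<Rightarrow> 'g \<Rightarrow> 'z \<Rightarrow> 'f::{field,finite}"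
  assumes comb: "\<And>c \<phi> \<psi>. \<phi> \<in> S \<Longrightarrow> \<psi> \<in> S \<Longrightarrow> cmb c \<phi> \<psi> \<in> S"
    and lin: "\<And>j c \<phi> \<psi> z. j \<in> J \<Longrightarrow> \<phi> \<in> S \<Longrightarrow> \<psi> \<in> S \<Longrightarrow> z \<in> Z \<Longrightarrow> A j (cmb c \<phi> \<psi>) z = A j \<phi> z + c * A j \<psi> z"
    and ne: "S \<noteq> {}" and fin: "finite J" and card: "card J < CARD('f)"
    and ex: "\<And>j. j \<in> J \<Longrightarrow> \<exists>\<psi>\<in>S. \<exists>z\<in>Z. A j \<psi> z \<noteq> 0"
  shows "\<exists>\<phi>\<in>S. \<forall>j\<in>J. \<exists>z\<in>Z. A j \<phi> z \<noteq> 0"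
proof -
  have "finite I \<Longrightarrow> I \<subseteq> J \<Longrightarrow> \<exists>\<phi>\<in>S. \<forall>j\<in>I. \<exists>z\<in>Z. A j \<phi> z \<noteq> 0" for I
  proof (induction I rule: finite_induct)
    case empty then show ?case using ne by auto
  next
    case (insert i I)
    then obtain \<phi> where \<phi>: "\<phi> \<in> S" "\<And>j. j \<in> I \<Longrightarrow> \<exists>z\<in>Z. A j \<phi> z \<noteq> 0" by auto
    obtain \<psi> where \<psi>: "\<psi> \<in> S" "\<exists>z\<in>Z. A i \<psi> z \<noteq> 0" using ex[of i] insert.prems by auto
    have "\<exists>z. z \<in> Z \<and> (A j \<phi> z \<noteq> 0 \<or> A j \<psi> z \<noteq> 0)" if "j \<in> insert i I" for j
      using \<phi>(2) \<psi>(2) that by blast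
    then obtain w where w: "\<And>j. j \<in> insert i I \<Longrightarrow> w j \<in> Z \<and> (A j \<phi> (w j) \<noteq> 0 \<or> A j \<psi> (w j) \<noteq> 0)"
      by metis
    define bad where "bad = (\<lambda>j. - A j \<phi> (w j) / A j \<psi> (w j)) ` insert i I"
    have "card bad \<le> card (insert i I)" unfolding bad_def using insert.hyps by (intro card_image_le) auto
    also have "\<dots> \<le> card J" using insert.prems fin by (intro card_mono) auto
    finally have "bad \<noteq> UNIV" using card by auto
    then obtain c where c: "c \<notin> bad" by auto
    have "A j (cmb c \<phi> \<psi>) (w j) \<noteq> 0" if j: "j \<in> insert i I" for j
    proof
      assume "A j (cmb c \<phi> \<psi>) (w j) = 0"
      then have e: "A j \<phi> (w j) + c * A j \<psi> (w j) = 0" using lin[of j \<phi> \<psi> "w j" c] w[OF j] \<phi> \<psi> j insert.prems by auto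
      then have "A j \<psi> (w j) \<noteq> 0" using w[OF j] by auto
      then have "c = - A j \<phi> (w j) / A j \<psi> (w j)" using e by (simp add: field_simps eq_neg_iff_add_eq_0)
      then show False using c j unfolding bad_def by blast
    qed
    then show ?case using comb[OF \<phi>(1) \<psi>(1)] w by blast
  qed
  then show ?thesis using fin by blast
qed

context prime_power_field
begin

text \<open>The coefficients of an additive function, a polynomial in \<open>x, x ^ p, x ^ (p ^ 2), \<dots>\<close>.\<close>

definition lin_coeff :: "('f \<Rightarrow> 'f) \<Rightarrow> nat \<Rightarrow> 'f" where
  "lin_coeff f = (SOME a. \<forall>x. f x = (\<Sum>j<t. a j * x ^ (p ^ j)))"

lemma lin_coeff_repr_ex: "\<exists>a. \<forall>x. f x = (\<Sum>j<t. a j * x ^ (p ^ j)) \<Longrightarrow> f x = (\<Sum>j<t. lin_coeff f j * x ^ (p ^ j))"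
  unfolding lin_coeff_def by (rule someI2_ex[where Q = "\<lambda>a. f x = (\<Sum>j<t. a j * x ^ (p ^ j))"]) auto

lemma lin_coeff_repr: "additive_fun f \<Longrightarrow> f x = (\<Sum>j<t. lin_coeff f j * x ^ (p ^ j))"
  by (rule lin_coeff_repr_ex[OF additive_fun_repr])

lemma lin_coeff_unique:
  assumes "\<And>x. f x = (\<Sum>j<t. a j * x ^ (p ^ j))" "j < t"
  shows "lin_coeff f j = a j"
proof -
  have "f x = (\<Sum>j<t. lin_coeff f j * x ^ (p ^ j))" for x by (rule lin_coeff_repr_ex) (use assms in blast)
  then have e: "(\<Sum>j<t. lin_coeff f j * x ^ (p ^ j)) = (\<Sum>j<t. a j * x ^ (p ^ j))" for x
    using assms(1)[of x] by (rule trans[OF sym])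
  have "(\<Sum>j<t. (lin_coeff f j - a j) * x ^ (p ^ j)) = 0" for x
    unfolding left_diff_distrib sum_subtractf e by simp
  from additive_repr_zero[OF this assms(2)] show ?thesis by simp
qed

lemma lin_coeff_comb:
  assumes "additive_fun f" "additive_fun g" "j < t"
  shows "lin_coeff (\<lambda>x. f x + c * g x) j = lin_coeff f j + c * lin_coeff g j"
proof (rule lin_coeff_unique[OF _ assms(3)])
  fix x
  show "f x + c * g x = (\<Sum>j<t. (lin_coeff f j + c * lin_coeff g j) * x ^ (p ^ j))"
  proof -
    have "(\<Sum>j<t. (lin_coeff f j + c * lin_coeff g j) * x ^ (p ^ j)) = (\<Sum>j<t. lin_coeff f j * x ^ (p ^ j)) + c * (\<Sum>j<t. lin_coeff g j * x ^ (p ^ j))"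
      by (simp add: distrib_right sum.distrib sum_distrib_left mult.assoc)
    then show ?thesis using lin_coeff_repr[OF assms(1), of x] lin_coeff_repr[OF assms(2), of x] by presburger
  qed
qed

lemma lin_coeff_scale:
  assumes "additive_fun f" "j < t"
  shows "lin_coeff (\<lambda>x. f (x * b)) j = lin_coeff f j * b ^ (p ^ j)"
proof (rule lin_coeff_unique[OF _ assms(2)])
  fix x
  show "f (x * b) = (\<Sum>j<t. lin_coeff f j * b ^ (p ^ j) * x ^ (p ^ j))"
  proof -
    have "(\<Sum>j<t. lin_coeff f j * b ^ (p ^ j) * x ^ (p ^ j)) = (\<Sum>j<t. lin_coeff f j * (x * b) ^ (p ^ j))"
      by (simp add: power_mult_distrib mult_ac)
    then show ?thesis using lin_coeff_repr[OF assms(1), of "x * b"] by presburger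
  qed
qed

text \<open>The scalar form of \<open>eigen_step_bound\<close>: orders of eigenspaces are powers of \<open>p\<close>, so a lower bound
  \<open>p ^ e\<close> means divisibility.\<close>

lemma comm_step_bound:
  assumes f: "additive_fun f" and e: "e \<ge> 1" and w: "\<And>x. x \<noteq> 0 \<Longrightarrow> p ^ e \<le> card (comm_set f x)"
  shows "e \<le> step_gcd t {j. j < t \<and> lin_coeff f j \<noteq> 0}"
proof (rule eigen_step_bound[OF f lin_coeff_repr[OF f] e])
  fix y
  show "card (eigen f y) = 1 \<or> p ^ e dvd card (eigen f y)"
  proof (cases "eigen f y \<subseteq> {0}")
    case True
    then have "eigen f y = {0}" using eigen_Ksub(1)[OF f] by blast
    then show ?thesis by simp
  next
    case False
    then obtain x where x: "x \<in> eigen f y" "x \<noteq> 0" by blast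
    then have y: "f x / x = y" by (simp add: eigen_def)
    have le: "p ^ e \<le> card (eigen f y)" using w[OF x(2)] card_comm_set[OF x(2), of f] unfolding y by simp
    obtain j where j: "card (eigen f y) = p ^ j" using card_eigen_pow[OF f, of y] by metis
    have "e \<le> j" using le unfolding j by (rule power_le_imp_le_exp[OF p_gt_1])
    then show ?thesis using j by (simp add: le_imp_power_dvd)
  qed
qed

text \<open>A bound for the proportion of vectors on lines through a light point that meet \<open>U\<close> in more than the
  generic number of vectors: the first summand comes from \<open>large_eigenspaces\<close>, the second from the
  vectors at which some coefficient vanishes accidentally.\<close>

definition long_density :: "nat \<Rightarrow> real" where
  "long_density d = real q / (real q - 1) * (1 / real (p ^ d) + 1 / real (p ^ d) ^ 2) + (real (t div d) - 1) / real q"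

end

text \<open>At a light point \<open>P\<close> with generator \<open>u\<close> fix a complement \<open>U1\<close> of \<open>u\<close> in \<open>U\<close> and a tangent subspace \<open>T\<close>. By size,
  \<open>V\<close> is the direct sum of the group \<open>U1\<close> and \<open>T\<close> (\<open>split_ex\<close>).\<close>

locale light_point = linear_small_set p t F s k N V B e U
  for p t :: nat and F :: "'f::{field,finite} itself"
  and s k N :: nat and V :: "(nat \<Rightarrow> 'f) set" and B :: "(nat \<Rightarrow> 'f) set set"
  and e :: nat and U :: "(nat \<Rightarrow> 'f) set" +
  fixes P :: "(nat \<Rightarrow> 'f) set" and u :: "nat \<Rightarrow> 'f" and U1 T :: "(nat \<Rightarrow> 'f) set"
  assumes lP: "light P" and u: "u \<in> P" "u \<in> U" "u \<noteq> 0"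
    and U1: "fv.Ksub (Fix 1) U1" "U1 \<subseteq> U" "u \<notin> U1" "card U = card (Fix 1) * card U1" "fv.Kext (Fix 1) u U1 = U"
    and T: "vs (N - k) T" "P \<subseteq> T" "T \<subseteq> V" "points_in B T = {P}"
begin

lemma PB: "P \<in> B" using lP by (simp add: light_def)
lemma Psp: "P = fvec.span {u}" by (rule point_eq[OF in_pts[OF PB] u(1,3)])
lemma sP: "fvec.subspace P" by (rule point_subspace[OF in_pts[OF PB]])
lemma sT: "fvec.subspace T" using T(1) by (rule vsD)
lemma U1V: "U1 \<subseteq> V" using U1(2) UV by blast
lemma cardU1: "card U1 = q ^ k" using U1(4) cardU cardF1 p_gt_1 by simp

lemma TU: "x \<in> T \<Longrightarrow> x \<in> U \<Longrightarrow> x \<in> P"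
proof (cases "x = 0")
  case True then show ?thesis using fvec.subspace_0[OF sP] by simp
next
  case False
  assume x: "x \<in> T" "x \<in> U"
  have "fvec.span {x} \<subseteq> T" using span_le_iff[OF sT] x(1) by blast
  then have "fvec.span {x} \<in> points_in B T" using span_in_B[OF x(2) False] by (simp add: points_in_def)
  then show ?thesis using T(4) mem_span_self[of x] by simp
qed

lemma PU1: "x \<in> P \<Longrightarrow> x \<in> U1 \<Longrightarrow> x = 0"
proof (rule ccontr)
  assume x: "x \<in> P" "x \<in> U1" "x \<noteq> 0"
  have inj: "inj_on (\<lambda>c. fscale c u) (Fix 1)"
  proof (rule inj_onI)
    fix c c' assume "fscale c u = fscale c' u"
    then show "c = c'" using u(3) fvec.scale_right_imp_eq by blast
  qed
  have "(\<lambda>c. fscale c u) ` Fix 1 \<subseteq> P \<inter> U"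
    using fvec.subspace_scale[OF sP u(1)] fv.Ksub_scale[OF KU _ u(2)] by blast
  moreover have "card ((\<lambda>c. fscale c u) ` Fix 1) = card (P \<inter> U)"
    using card_image[OF inj] cardF1 lP by (simp add: light_def)
  moreover have "finite (P \<inter> U)" using finU by simp
  ultimately have "(\<lambda>c. fscale c u) ` Fix 1 = P \<inter> U" using card_subset_eq by blast
  moreover have "x \<in> P \<inter> U" using x U1(2) by blast
  ultimately obtain c where c: "c \<in> Fix 1" "x = fscale c u" by blast
  then have "c \<noteq> 0" using x(3) by auto
  then have "fscale (inverse c) x = u" using c(2) by simp
  moreover have "inverse c \<in> Fix 1" using is_subfield_Fix[of 1] c(1) by (simp add: is_subfield_def)
  ultimately have "u \<in> U1" using fv.Ksub_scale[OF U1(1), of "inverse c" x] x(2) by simp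
  then show False using U1(3) by simp
qed

lemma TU1: "x \<in> T \<Longrightarrow> x \<in> U1 \<Longrightarrow> x = 0"
  using TU PU1 U1(2) by blast

lemma split_ex: "z \<in> V \<Longrightarrow> \<exists>y. y \<in> U1 \<and> z - y \<in> T"
proof -
  assume z: "z \<in> V"
  have c: "card V = card U1 * card T" using V T(1) kN cardU1 by (simp add: vs_def power_add[symmetric])
  have "U1 \<inter> T \<subseteq> {0}" using TU1 by blast
  then obtain a b where "a \<in> U1" "b \<in> T" "z = a + b"
    using fv.groups_complement[OF U1(1) fv.subspace_Ksub[OF sT] is_subfield_Fix fv.subspace_Ksub[OF subV] vsD(2)[OF V] U1V T(3) c _ z] by blast
  then show ?thesis by (intro exI[of _ a]) simp
qed

definition U1_part :: "(nat \<Rightarrow> 'f) \<Rightarrow> (nat \<Rightarrow> 'f)" where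
  "U1_part z = (SOME y. y \<in> U1 \<and> z - y \<in> T)"

definition T_part :: "(nat \<Rightarrow> 'f) \<Rightarrow> (nat \<Rightarrow> 'f)" where
  "T_part z = z - U1_part z"

lemma U1_part: "z \<in> V \<Longrightarrow> U1_part z \<in> U1" "z \<in> V \<Longrightarrow> T_part z \<in> T"
  using someI_ex[OF split_ex[of z]] by (auto simp: U1_part_def T_part_def)

lemma U1_part_unique: assumes "y \<in> U1" "z - y \<in> T" "z \<in> V" shows "U1_part z = y"
proof -
  have "(z - y) - T_part z \<in> T" by (rule fvec.subspace_diff[OF sT assms(2) U1_part(2)[OF assms(3)]])
  moreover have "(z - y) - T_part z = U1_part z - y" by (simp add: T_part_def)
  moreover have "U1_part z - y \<in> U1" by (rule fv.Ksub_diff[OF is_subfield_Fix U1(1) U1_part(1)[OF assms(3)] assms(1)])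
  ultimately show ?thesis using TU1[of "U1_part z - y"] by simp
qed

lemma T_part_add: assumes "z \<in> V" "z' \<in> V" shows "T_part (z + z') = T_part z + T_part z'"
proof -
  have "U1_part (z + z') = U1_part z + U1_part z'"
  proof (rule U1_part_unique)
    show "U1_part z + U1_part z' \<in> U1" by (rule fv.Ksub_add[OF U1(1) U1_part(1)[OF assms(1)] U1_part(1)[OF assms(2)]])
    have "T_part z + T_part z' \<in> T" by (rule fvec.subspace_add[OF sT U1_part(2)[OF assms(1)] U1_part(2)[OF assms(2)]])
    then show "z + z' - (U1_part z + U1_part z') \<in> T" by (simp add: T_part_def algebra_simps)
  qed (rule fvec.subspace_add[OF subV assms])
  then show ?thesis by (simp add: T_part_def)
qed

text \<open>The linear functionals vanishing on \<open>P\<close>. They replace the passage to the quotient by \<open>P\<close>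
  (\<open>Phi_separates\<close>).\<close>

definition Phi :: "((nat \<Rightarrow> 'f) \<Rightarrow> 'f) set" where
  "Phi = {\<phi>. (\<forall>x y. \<phi> (x + y) = \<phi> x + \<phi> y) \<and> (\<forall>c x. \<phi> (fscale c x) = c * \<phi> x) \<and> \<phi> u = 0}"

lemma Phi_add: "\<phi> \<in> Phi \<Longrightarrow> \<phi> (x + y) = \<phi> x + \<phi> y"
  and Phi_scale: "\<phi> \<in> Phi \<Longrightarrow> \<phi> (fscale c x) = c * \<phi> x"
  by (auto simp: Phi_def)

lemma Phi_P: assumes "\<phi> \<in> Phi" "x \<in> P" shows "\<phi> x = 0"
proof -
  obtain c where "x = fscale c u" using assms(2) Psp by (auto simp: mem_span_singleton)
  then show ?thesis using assms(1) by (simp add: Phi_def)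
qed

lemma Phi_comb: "\<phi> \<in> Phi \<Longrightarrow> \<psi> \<in> Phi \<Longrightarrow> (\<lambda>x. \<phi> x + c * \<psi> x) \<in> Phi"
  by (simp add: Phi_def algebra_simps)

lemma Phi_separates: assumes "\<And>\<phi>. \<phi> \<in> Phi \<Longrightarrow> \<phi> x = 0" shows "x \<in> P"
proof -
  obtain i0 where i0: "u i0 \<noteq> 0" using u(3) by (auto simp: fun_eq_iff)
  have h: "x i = (x i0 / u i0) * u i" for i
  proof -
    have "(\<lambda>x. x i - (x i0 / u i0) * u i) \<in> Phi"
      using i0 by (simp add: Phi_def fscale_def field_simps)
    from assms[OF this] show ?thesis by simp
  qed
  have "x = fscale (x i0 / u i0) u"
  proof (rule ext)
    show "x i = fscale (x i0 / u i0) u i" for i unfolding fscale_def by (rule h)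
  qed
  then show ?thesis using fvec.subspace_scale[OF sP u(1), of "x i0 / u i0"] by metis
qed

text \<open>The \<open>T\<close>-part of \<open>a z\<close>, seen by \<open>\<phi>\<close>, as a function of the scalar \<open>a\<close>. If \<open>U\<close> were a subspace, all these
  functions would be linear.\<close>

definition line_fun :: "((nat \<Rightarrow> 'f) \<Rightarrow> 'f) \<Rightarrow> (nat \<Rightarrow> 'f) \<Rightarrow> 'f \<Rightarrow> 'f" where
  "line_fun \<phi> z a = \<phi> (T_part (fscale a z))"

lemma scale_V: "z \<in> V \<Longrightarrow> fscale a z \<in> V"
  by (rule fvec.subspace_scale[OF subV])

lemma line_fun_additive: "\<phi> \<in> Phi \<Longrightarrow> z \<in> V \<Longrightarrow> additive_fun (line_fun \<phi> z)"
  unfolding additive_fun_def line_fun_def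
  using T_part_add[OF scale_V scale_V] Phi_add by (metis fvec.scale_left_distrib)

text \<open>If \<open>c y\<close> lies in \<open>U\<close> modulo \<open>P\<close>, where \<open>y\<close> is the \<open>U1\<close>-part of \<open>a z\<close>, then multiplying the decomposition of
  \<open>a z\<close> by \<open>c\<close> gives that of \<open>c a z\<close> up to a vector of \<open>U \<inter> T \<subseteq> P\<close>, which \<open>\<phi>\<close> does not see.\<close>

lemma line_scalars_comm:
  assumes \<phi>: "\<phi> \<in> Phi" and z: "z \<in> V" and nT: "fscale a z \<notin> T"
  shows "U1_part (fscale a z) \<notin> P" "line_scalars P (U1_part (fscale a z)) \<subseteq> comm_set (line_fun \<phi> z) a"
proof -
  let ?w = "fscale a z"
  have w: "?w \<in> V" by (rule scale_V[OF z])
  show nP: "U1_part ?w \<notin> P"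
  proof
    assume "U1_part ?w \<in> P"
    then have "U1_part ?w = 0" using PU1 U1_part(1)[OF w] by blast
    then show False using U1_part(2)[OF w] nT by (simp add: T_part_def)
  qed
  show "line_scalars P (U1_part ?w) \<subseteq> comm_set (line_fun \<phi> z) a"
  proof
    fix c assume "c \<in> line_scalars P (U1_part ?w)"
    then obtain y' where y': "y' \<in> U" "y' - fscale c (U1_part ?w) \<in> P" unfolding line_scalars_def by blast
    have cw: "fscale c ?w \<in> V" by (rule scale_V[OF w])
    have "fscale c (T_part ?w) - (y' - fscale c (U1_part ?w)) \<in> T"
      by (rule fvec.subspace_diff[OF sT fvec.subspace_scale[OF sT U1_part(2)[OF w]] subsetD[OF T(2) y'(2)]])
    moreover have e1: "fscale c (T_part ?w) - (y' - fscale c (U1_part ?w)) = fscale c ?w - y'"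
      by (simp add: T_part_def fvec.scale_right_diff_distrib)
    ultimately have "fscale c ?w - y' \<in> T" by simp
    then have inT: "T_part (fscale c ?w) - (fscale c ?w - y') \<in> T" by (rule fvec.subspace_diff[OF sT U1_part(2)[OF cw]])
    have e2: "T_part (fscale c ?w) - (fscale c ?w - y') = y' - U1_part (fscale c ?w)" unfolding T_part_def by simp
    have eU: "y' - U1_part (fscale c ?w) \<in> U" using U_diff[OF y'(1)] U1_part(1)[OF cw] U1(2) by blast
    have inP: "T_part (fscale c ?w) - (fscale c ?w - y') \<in> P"
      using TU[OF inT[unfolded e2] eU] unfolding e2 .
    have "T_part (fscale c ?w) = (T_part (fscale c ?w) - (fscale c ?w - y')) + (fscale c (T_part ?w) + (fscale c (U1_part ?w) - y'))"
      by (simp add: T_part_def fvec.scale_right_diff_distrib)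
    moreover have "fscale c (U1_part ?w) - y' \<in> P"
      using fvec.subspace_neg[OF sP y'(2)] by simp
    ultimately have "\<phi> (T_part (fscale c ?w)) = 0 + (c * \<phi> (T_part ?w) + 0)"
      using Phi_P[OF \<phi> inP] Phi_P[OF \<phi>] Phi_add[OF \<phi>] Phi_scale[OF \<phi>] by metis
    then show "c \<in> comm_set (line_fun \<phi> z) a" by (simp add: comm_set_def line_fun_def)
  qed
qed

text \<open>If \<open>a z\<close> lies in \<open>T\<close>, all scalars qualify; otherwise the secant through \<open>P\<close> and the point of the
  \<open>U1\<close>-part of \<open>a z\<close> supplies them.\<close>

lemma comm_large:
  assumes \<phi>: "\<phi> \<in> Phi" and z: "z \<in> V" and a: "a \<noteq> 0"
  shows "p ^ e \<le> card (comm_set (line_fun \<phi> z) a)"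
proof (cases "fscale a z \<in> T")
  case False
  have "U1_part (fscale a z) \<in> U" using U1_part(1)[OF scale_V[OF z]] U1(2) by blast
  then have "s \<le> card (line_scalars P (U1_part (fscale a z)))" using line_scalars_card(2)[OF lP] line_scalars_comm(1)[OF \<phi> z False] by blast
  also have "\<dots> \<le> card (comm_set (line_fun \<phi> z) a)" by (rule card_mono[OF _ line_scalars_comm(2)[OF \<phi> z False]]) simp
  finally show ?thesis using s_pow by simp
next
  case True
  have r: "T_part x = x" if "x \<in> T" "x \<in> V" for x
  proof -
    have "U1_part x = 0" by (rule U1_part_unique) (use that fv.Ksub_zero[OF U1(1)] in auto)
    then show ?thesis by (simp add: T_part_def)
  qed
  have "c \<in> comm_set (line_fun \<phi> z) a" for c
  proof -
    have "fscale c (fscale a z) \<in> T" by (rule fvec.subspace_scale[OF sT True])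
    then have "T_part (fscale c (fscale a z)) = fscale c (fscale a z)" "T_part (fscale a z) = fscale a z"
      using r True scale_V z by auto
    then show ?thesis using Phi_scale[OF \<phi>, of c "fscale a z"] by (simp add: comm_set_def line_fun_def)
  qed
  then have "comm_set (line_fun \<phi> z) a = UNIV" by blast
  then show ?thesis using s_le_q s_pow by (simp add: q_UNIV)
qed

definition A :: "nat \<Rightarrow> ((nat \<Rightarrow> 'f) \<Rightarrow> 'f) \<Rightarrow> (nat \<Rightarrow> 'f) \<Rightarrow> 'f" where
  "A j \<phi> z = lin_coeff (line_fun \<phi> z) j"

definition J :: "nat set" where
  "J = {j. j < t \<and> (\<exists>\<phi>\<in>Phi. \<exists>z\<in>V. A j \<phi> z \<noteq> 0)}"

definition d :: nat where
  "d = step_gcd t J"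

lemma d_props: "d > 0" "d dvd t" "j \<in> J \<Longrightarrow> d dvd j"
  unfolding d_def using step_gcd_props[OF t_pos] by auto

lemma e_pos: "e \<ge> 1"
  using s_pow s7 by (cases e) auto

lemma A_comb: "j < t \<Longrightarrow> \<phi> \<in> Phi \<Longrightarrow> \<psi> \<in> Phi \<Longrightarrow> z \<in> V \<Longrightarrow> A j (\<lambda>x. \<phi> x + c * \<psi> x) z = A j \<phi> z + c * A j \<psi> z"
  unfolding A_def using lin_coeff_comb[OF line_fun_additive[of \<phi> z] line_fun_additive[of \<psi> z], of j c] by (simp add: line_fun_def[abs_def])

lemma A_add: assumes "j < t" "\<phi> \<in> Phi" "z \<in> V" "z' \<in> V" shows "A j \<phi> (z + z') = A j \<phi> z + A j \<phi> z'"
proof -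
  have "line_fun \<phi> (z + z') = (\<lambda>x. line_fun \<phi> z x + 1 * line_fun \<phi> z' x)"
    using assms by (simp add: fun_eq_iff line_fun_def fvec.scale_right_distrib T_part_add scale_V Phi_add)
  then show ?thesis unfolding A_def using lin_coeff_comb[OF line_fun_additive[OF assms(2,3)] line_fun_additive[OF assms(2,4)] assms(1), of 1] by simp
qed

lemma A_scale: assumes "j < t" "\<phi> \<in> Phi" "z \<in> V" shows "A j \<phi> (fscale b z) = A j \<phi> z * b ^ (p ^ j)"
proof -
  have "line_fun \<phi> (fscale b z) = (\<lambda>x. line_fun \<phi> z (x * b))" by (simp add: fun_eq_iff line_fun_def)
  then show ?thesis unfolding A_def using lin_coeff_scale[OF line_fun_additive[OF assms(2,3)] assms(1)] by simp
qed

text \<open>Although \<open>A j \<phi>\<close> is only semilinear in \<open>z\<close>, its zeros form a subspace.\<close>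

lemma vanishing_card:
  assumes j: "j < t" and \<phi>: "\<phi> \<in> Phi" and ex: "\<exists>z\<in>V. A j \<phi> z \<noteq> 0"
  shows "card {z \<in> V. A j \<phi> z = 0} \<le> q ^ (N - 1)"
proof -
  let ?Z = "{z \<in> V. A j \<phi> z = 0}"
  have "A j \<phi> (fscale 0 0) = A j \<phi> 0 * 0 ^ (p ^ j)" by (rule A_scale[OF j \<phi> fvec.subspace_0[OF subV]])
  then have "A j \<phi> 0 = 0" using p_gt_1 by (simp add: power_0_left)
  then have "fvec.subspace ?Z"
    using A_add[OF j \<phi>] A_scale[OF j \<phi>] fvec.subspace_0[OF subV] fvec.subspace_add[OF subV] scale_V
    by (simp add: fvec.subspace_def)
  moreover have fin: "finite ?Z" using vsD(2)[OF V] by simp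
  ultimately obtain M where M: "vs M ?Z" using vs_exists by blast
  have "M \<le> N" by (rule vs_le[OF M V]) blast
  moreover have "M \<noteq> N"
  proof
    assume "M = N"
    then have "?Z = V" using vs_eq[of N ?Z V] M V by blast
    then show False using ex by blast
  qed
  ultimately have "M \<le> N - 1" by simp
  then have "q ^ M \<le> q ^ (N - 1)" using q_gt by (intro power_increasing) auto
  then show ?thesis using M by (simp add: vs_def)
qed

end

lemma sum_card_swap:
  assumes "finite A" "finite B"
  shows "(\<Sum>a\<in>A. card {b \<in> B. R a b}) = (\<Sum>b\<in>B. card {a \<in> A. R a b})"
proof -
  have "(\<Sum>a\<in>A. card {b \<in> B. R a b}) = (\<Sum>a\<in>A. \<Sum>b\<in>B. if R a b then 1 else 0)"
    using assms by (intro sum.cong refl) (simp add: sum.If_cases Int_def)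
  also have "\<dots> = (\<Sum>b\<in>B. \<Sum>a\<in>A. if R a b then 1 else 0)" by (rule sum.swap)
  also have "\<dots> = (\<Sum>b\<in>B. card {a \<in> A. R a b})"
    using assms by (intro sum.cong refl) (simp add: sum.If_cases Int_def)
  finally show ?thesis .
qed

lemma (in prime_power_field) t_lt: "t < p ^ t"
proof -
  have "t < 2 ^ t" by (rule less_exp)
  also have "(2::nat) ^ t \<le> p ^ t" by (rule power_mono) (use p_gt_1 in auto)
  finally show ?thesis .
qed

context light_point
begin

lemma J_fin: "finite J" "J - {0} \<subseteq> (\<lambda>i. d * i) ` {1..<t div d}"
proof -
  show "finite J" by (rule finite_subset[of _ "{..<t}"]) (auto simp: J_def)
  show "J - {0} \<subseteq> (\<lambda>i. d * i) ` {1..<t div d}"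
  proof
    fix j assume j: "j \<in> J - {0}"
    then obtain i where i: "j = d * i" using d_props(3) by blast
    obtain m where m: "t = d * m" using d_props(2) by blast
    have "j < t" using j by (simp add: J_def)
    then have "d * i < d * m" using i m by (simp only:)
    then have "i < m" by simp
    moreover have "i \<noteq> 0" using j i by auto
    moreover have "t div d = m" using m d_props(1) by (metis nonzero_mult_div_cancel_left less_numeral_extra(3))
    ultimately show "j \<in> (\<lambda>i. d * i) ` {1..<t div d}" using i by (intro image_eqI[of _ _ i]) auto
  qed
qed

lemma Phi_zero: "(\<lambda>_. 0) \<in> Phi" by (simp add: Phi_def)

text \<open>There are fewer than \<open>q\<close> conditions, so one functional can witness all exponents at once.\<close>

lemma generic_phi: "\<exists>\<phi>\<in>Phi. \<forall>j\<in>J. \<exists>z\<in>V. A j \<phi> z \<noteq> 0"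
proof (rule generic_member[where cmb = "\<lambda>c \<phi> \<psi> x. \<phi> x + c * \<psi> x"])
  show "card J < CARD('f)"
  proof -
    have "card J \<le> card {..<t}" by (rule card_mono) (auto simp: J_def)
    also have "\<dots> < p ^ t" using t_lt by simp
    finally show ?thesis by (simp add: card_F)
  qed
  show "A j (\<lambda>x. \<phi> x + c * \<psi> x) z = A j \<phi> z + c * A j \<psi> z" if "j \<in> J" "\<phi> \<in> Phi" "\<psi> \<in> Phi" "z \<in> V" for j c \<phi> \<psi> z
    using A_comb that by (simp add: J_def)
qed (use Phi_comb Phi_zero J_fin in \<open>auto simp: J_def\<close>)

definition phi :: "(nat \<Rightarrow> 'f) \<Rightarrow> 'f" where
  "phi = (SOME \<phi>. \<phi> \<in> Phi \<and> (\<forall>j\<in>J. \<exists>z\<in>V. A j \<phi> z \<noteq> 0))"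

lemma phi: "phi \<in> Phi" "j \<in> J \<Longrightarrow> \<exists>z\<in>V. A j phi z \<noteq> 0"
  using someI_ex[of "\<lambda>\<phi>. \<phi> \<in> Phi \<and> (\<forall>j\<in>J. \<exists>z\<in>V. A j \<phi> z \<noteq> 0)"] generic_phi
  unfolding phi_def[symmetric] by blast+

text \<open>Leaving out the exponent \<open>0\<close>, which does not affect the greatest common divisor, is what makes
  \<open>card_degenerate\<close> sharp enough.\<close>

definition degenerate :: "(nat \<Rightarrow> 'f) set" where
  "degenerate = (\<Union>j\<in>J - {0}. {z \<in> V. A j phi z = 0})"

lemma card_degenerate: "card degenerate \<le> (t div d - 1) * q ^ (N - 1)"
proof -
  have "card degenerate \<le> (\<Sum>j\<in>J - {0}. card {z \<in> V. A j phi z = 0})"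
    unfolding degenerate_def by (rule card_UN_le) (use J_fin in simp)
  also have "\<dots> \<le> (\<Sum>j\<in>J - {0}. q ^ (N - 1))"
  proof (rule sum_mono)
    fix j assume j: "j \<in> J - {0}"
    then have "j < t" by (simp add: J_def)
    then show "card {z \<in> V. A j phi z = 0} \<le> q ^ (N - 1)"
      using vanishing_card[OF _ phi(1) phi(2)] j by blast
  qed
  also have "\<dots> = card (J - {0}) * q ^ (N - 1)" by simp
  also have "card (J - {0}) \<le> card ((\<lambda>i. d * i) ` {1..<t div d})"
    by (rule card_mono[OF _ J_fin(2)]) simp
  also have "\<dots> \<le> card {1..<t div d}" by (rule card_image_le) simp
  also have "card {1..<t div d} = t div d - 1" by simp
  finally show ?thesis by simp
qed

lemma generic_z: assumes "z \<in> V" "z \<notin> degenerate" shows "step_gcd t {j. j < t \<and> lin_coeff (line_fun phi z) j \<noteq> 0} = d"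
proof -
  have "{j. j < t \<and> lin_coeff (line_fun phi z) j \<noteq> 0} - {0} = J - {0}"
    using assms phi(1) unfolding degenerate_def J_def A_def by blast
  then show ?thesis unfolding d_def by (rule step_gcd_no0[OF t_pos])
qed

text \<open>At a nondegenerate \<open>z\<close> the single function \<open>line_fun phi z\<close> already has all exponents relevant to \<open>d\<close>.\<close>

lemma e_le_d: "e \<le> d"
proof -
  have "t div d - 1 < q"
  proof -
    have "t div d - 1 \<le> t" by (meson diff_le_self div_le_dividend le_trans)
    also have "\<dots> < p ^ t" using t_lt by simp
    finally show ?thesis by (simp add: q_def)
  qed
  then have "(t div d - 1) * q ^ (N - 1) < q * q ^ (N - 1)" using q_gt by simp
  also have "q * q ^ (N - 1) = q ^ N" using kN by (cases N) auto
  finally have "card degenerate < card V" using card_degenerate vsD(3)[OF V] by linarith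
  moreover have "degenerate \<subseteq> V" unfolding degenerate_def by blast
  ultimately obtain z where z: "z \<in> V" "z \<notin> degenerate" by (metis nat_neq_iff subset_antisym subsetI)
  show ?thesis
    using comm_step_bound[OF line_fun_additive[OF phi(1) z(1)] e_pos comm_large[OF phi(1) z(1)]] generic_z[OF z] by simp
qed

definition plusP :: "(nat \<Rightarrow> 'f) set" where
  "plusP = {x + y | x y. x \<in> U \<and> y \<in> P}"

text \<open>For \<open>y \<in> U\<close> the \<open>T\<close>-part of \<open>y\<close> lies in \<open>P\<close>, so all \<open>line_fun \<phi> y\<close> vanish at \<open>1\<close>. Being linear over the field
  with \<open>p ^ d\<close> elements they vanish at \<open>c\<close> too, so the \<open>T\<close>-part of \<open>c y\<close> lies in \<open>P\<close> as well.\<close>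

lemma field_invariant: "fv.Ksub (Fix d) plusP"
proof -
  have key: "fscale c y \<in> plusP" if y: "y \<in> U" and c: "c \<in> Fix d" for c y
  proof -
    have yV: "y \<in> V" using y UV by blast
    have cy: "fscale c y \<in> V" by (rule scale_V[OF yV])
    have "T_part y \<in> P"
    proof (rule TU[OF U1_part(2)[OF yV]])
      show "T_part y \<in> U" unfolding T_part_def using U_diff[OF y] U1_part(1)[OF yV] U1(2) by blast
    qed
    have "T_part (fscale c y) \<in> P"
    proof (rule Phi_separates)
      fix \<phi> assume \<phi>: "\<phi> \<in> Phi"
      have "line_fun \<phi> y (c * 1) = c * line_fun \<phi> y 1"
      proof (rule Fix_linear[OF lin_coeff_repr[OF line_fun_additive[OF \<phi> yV]] _ c])
        fix j assume "j < t" "lin_coeff (line_fun \<phi> y) j \<noteq> 0"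
        then have "j \<in> J" unfolding J_def A_def using \<phi> yV by blast
        then show "d dvd j" by (rule d_props(3))
      qed
      moreover have "\<phi> (T_part y) = 0" by (rule Phi_P[OF \<phi> \<open>T_part y \<in> P\<close>])
      ultimately show "\<phi> (T_part (fscale c y)) = 0" by (simp add: line_fun_def)
    qed
    moreover have "fscale c y = U1_part (fscale c y) + T_part (fscale c y)" by (simp add: T_part_def)
    moreover have "U1_part (fscale c y) \<in> U" using U1_part(1)[OF cy] U1(2) by blast
    ultimately show ?thesis unfolding plusP_def by blast
  qed
  have "0 + 0 \<in> plusP" unfolding plusP_def using U0 fvec.subspace_0[OF sP] by blast
  moreover have "x + y \<in> plusP" if "x \<in> plusP" "y \<in> plusP" for x y
  proof -
    obtain a b a' b' where ab: "a \<in> U" "b \<in> P" "x = a + b" "a' \<in> U" "b' \<in> P" "y = a' + b'"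
      using \<open>x \<in> plusP\<close> \<open>y \<in> plusP\<close> unfolding plusP_def by blast
    have "x + y = (a + a') + (b + b')" using ab by (simp add: algebra_simps)
    then show ?thesis unfolding plusP_def using U_add[OF ab(1,4)] fvec.subspace_add[OF sP ab(2,5)] by blast
  qed
  moreover have "fscale c x \<in> plusP" if cd: "c \<in> Fix d" and xp: "x \<in> plusP" for c x
  proof -
    obtain a b where ab: "a \<in> U" "b \<in> P" "x = a + b" using xp unfolding plusP_def by blast
    obtain a' b' where ab': "a' \<in> U" "b' \<in> P" "fscale c a = a' + b'" using key[OF ab(1) cd] unfolding plusP_def by blast
    have "fscale c x = a' + (b' + fscale c b)" using ab ab' by (simp add: fvec.scale_right_distrib add.assoc)
    moreover have "b' + fscale c b \<in> P" by (rule fvec.subspace_add[OF sP ab'(2) fvec.subspace_scale[OF sP ab(2)]])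
    ultimately show ?thesis unfolding plusP_def using ab'(1) by blast
  qed
  ultimately show ?thesis unfolding fv.Ksub_def by simp
qed

definition long1 :: "(nat \<Rightarrow> 'f) set" where
  "long1 = {y \<in> U1. y \<notin> P \<and> card (line_scalars P y) > p ^ d}"

text \<open>Count the pairs \<open>(z, a)\<close> such that the \<open>U1\<close>-part of \<open>a z\<close> is on a long line. For fixed \<open>a \<noteq> 0\<close> their
  number is the same, \<open>card T\<close> for each such \<open>U1\<close>-part; for fixed nondegenerate \<open>z\<close> it is bounded by
  \<open>large_eigenspaces\<close>.\<close>

lemma long1_bound: "real (card long1) \<le> real q ^ k * long_density d"
proof -
  let ?k = "real (p ^ d)" and ?q = "real q"
  let ?G = "?q / ?k + ?q / ?k ^ 2"
  have fin: "finite V" "finite U1" "finite T" "finite long1"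
    using vsD(2)[OF V] U1V T(3) finite_subset[of _ V] by (auto simp: long1_def intro: finite_subset)
  have cnt: "real (card {a. a \<noteq> 0 \<and> U1_part (fscale a z) \<in> long1}) \<le> ?G" if z: "z \<in> V" "z \<notin> degenerate" for z
  proof -
    have "{a. a \<noteq> 0 \<and> U1_part (fscale a z) \<in> long1} \<subseteq> {a. a \<noteq> 0 \<and> card (comm_set (line_fun phi z) a) > p ^ d}"
    proof (intro subsetI CollectI conjI; elim CollectE conjE)
      fix a :: 'f assume a: "a \<noteq> 0" "U1_part (fscale a z) \<in> long1"
      have nT: "fscale a z \<notin> T"
      proof
        assume "fscale a z \<in> T"
        then have "U1_part (fscale a z) = 0" using fv.Ksub_zero[OF U1(1)] scale_V[OF z(1)] by (intro U1_part_unique) auto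
        then show False using a(2) fvec.subspace_0[OF sP] by (simp add: long1_def)
      qed
      have "card (line_scalars P (U1_part (fscale a z))) \<le> card (comm_set (line_fun phi z) a)"
        by (rule card_mono[OF _ line_scalars_comm(2)[OF phi(1) z(1) nT]]) simp
      then show "p ^ d < card (comm_set (line_fun phi z) a)" using a(2) by (simp add: long1_def)
    qed
    then have "card {a. a \<noteq> 0 \<and> U1_part (fscale a z) \<in> long1} \<le> card {a. a \<noteq> 0 \<and> card (comm_set (line_fun phi z) a) > p ^ d}"
      by (intro card_mono) auto
    then have "real (card {a. a \<noteq> 0 \<and> U1_part (fscale a z) \<in> long1}) \<le> real (card {a. a \<noteq> 0 \<and> card (comm_set (line_fun phi z) a) > p ^ d})"
      by (simp only: of_nat_le_iff)
    also have "\<dots> \<le> real (p ^ t) / real (p ^ d) + real (p ^ t) / real (p ^ d) ^ 2"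
      using large_eigenspaces[OF line_fun_additive[OF phi(1) z(1)] lin_coeff_repr[OF line_fun_additive[OF phi(1) z(1)]] generic_z[OF z, symmetric]] by simp
    finally show ?thesis by (simp only: q_def)
  qed
  have cnt0: "card {a::'f. a \<noteq> 0 \<and> U1_part (fscale a z) \<in> long1} \<le> q - 1" for z
  proof -
    have "card {a::'f. a \<noteq> 0 \<and> U1_part (fscale a z) \<in> long1} \<le> card (UNIV - {0::'f})" by (intro card_mono) auto
    then show ?thesis by (simp add: q_UNIV card_Diff_singleton)
  qed
  define D where "D = {z \<in> V. U1_part z \<in> long1}"
  have cD: "card long1 * card T \<le> card D"
  proof -
    have inj: "inj_on (\<lambda>(y, w). y + w) (long1 \<times> T)"
    proof (rule inj_on_subset)
      show "inj_on (\<lambda>(y, w). y + w) (U1 \<times> T)"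
        by (rule fv.sum_of_disjoint_groups(1)[OF U1(1) fin(2) fv.subspace_Ksub[OF sT] fin(3) is_subfield_Fix]) (use TU1 in blast)
    qed (auto simp: long1_def)
    have "(\<lambda>(y, w). y + w) ` (long1 \<times> T) \<subseteq> D"
    proof (clarify)
      fix y w assume yw: "y \<in> long1" "w \<in> T"
      then have y1: "y \<in> U1" by (simp add: long1_def)
      have v: "y + w \<in> V" by (rule fvec.subspace_add[OF subV]) (use y1 U1V yw(2) T(3) in auto)
      have "U1_part (y + w) = y" by (rule U1_part_unique[OF y1 _ v]) (use yw(2) in simp)
      then show "y + w \<in> D" using yw(1) v by (simp add: D_def)
    qed
    then have "card ((\<lambda>(y, w). y + w) ` (long1 \<times> T)) \<le> card D" using fin by (intro card_mono) (auto simp: D_def)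
    then show ?thesis using card_image[OF inj] by (simp add: card_cartesian_product)
  qed
  have cDa: "card {z \<in> V. U1_part (fscale a z) \<in> long1} = card D" if a: "a \<noteq> 0" for a
  proof -
    have "{z \<in> V. U1_part (fscale a z) \<in> long1} = (\<lambda>z. fscale (inverse a) z) ` D"
    proof (intro set_eqI iffI)
      fix z assume "z \<in> {z \<in> V. U1_part (fscale a z) \<in> long1}"
      then have "fscale a z \<in> D" using scale_V by (simp add: D_def)
      moreover have "z = fscale (inverse a) (fscale a z)" using a by simp
      ultimately show "z \<in> (\<lambda>z. fscale (inverse a) z) ` D" by blast
    next
      fix z assume "z \<in> (\<lambda>z. fscale (inverse a) z) ` D"
      then obtain w where w: "w \<in> D" "z = fscale (inverse a) w" by blast
      then have "fscale a z = w" using a by simp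
      moreover have "z \<in> V" using w scale_V by (simp add: D_def)
      ultimately show "z \<in> {z \<in> V. U1_part (fscale a z) \<in> long1}" using w(1) by (simp add: D_def)
    qed
    moreover have "inj_on (\<lambda>z. fscale (inverse a) z) D"
      by (rule inj_onI) (metis a fvec.scale_left_imp_eq fvec.scale_cancel_left inverse_nonzero_iff_nonzero)
    ultimately show ?thesis by (simp add: card_image)
  qed
  have "(\<Sum>a\<in>UNIV - {0::'f}. card {z \<in> V. U1_part (fscale a z) \<in> long1}) = (q - 1) * card D"
    using cDa by (simp add: q_UNIV card_Diff_singleton)
  moreover have "(\<Sum>a\<in>UNIV - {0::'f}. card {z \<in> V. U1_part (fscale a z) \<in> long1}) = (\<Sum>z\<in>V. card {a \<in> UNIV - {0::'f}. U1_part (fscale a z) \<in> long1})"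
    by (rule sum_card_swap) (use fin in auto)
  ultimately have dc: "(q - 1) * card D = (\<Sum>z\<in>V. card {a::'f. a \<noteq> 0 \<and> U1_part (fscale a z) \<in> long1})" by simp
  have ZV: "degenerate \<subseteq> V" unfolding degenerate_def by blast
  have G0: "?G \<ge> 0" using p_gt_1 by simp
  have "(?q - 1) * real (card D) = real ((q - 1) * card D)" using q_gt by (simp add: of_nat_diff)
  also have "\<dots> = (\<Sum>z\<in>V. real (card {a::'f. a \<noteq> 0 \<and> U1_part (fscale a z) \<in> long1}))" unfolding dc by simp
  also have "\<dots> = (\<Sum>z\<in>V - degenerate. real (card {a::'f. a \<noteq> 0 \<and> U1_part (fscale a z) \<in> long1})) + (\<Sum>z\<in>degenerate. real (card {a::'f. a \<noteq> 0 \<and> U1_part (fscale a z) \<in> long1}))"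
    by (rule sum.subset_diff[OF ZV fin(1)])
  also have "\<dots> \<le> (\<Sum>z\<in>V. ?G) + (\<Sum>z\<in>degenerate. ?q - 1)"
  proof (rule add_mono)
    have "(\<Sum>z\<in>V - degenerate. real (card {a::'f. a \<noteq> 0 \<and> U1_part (fscale a z) \<in> long1})) \<le> (\<Sum>z\<in>V - degenerate. ?G)"
      by (rule sum_mono) (use cnt in blast)
    also have "\<dots> \<le> (\<Sum>z\<in>V. ?G)" using G0 fin(1) by (intro sum_mono2) auto
    finally show "(\<Sum>z\<in>V - degenerate. real (card {a::'f. a \<noteq> 0 \<and> U1_part (fscale a z) \<in> long1})) \<le> (\<Sum>z\<in>V. ?G)" .
    show "(\<Sum>z\<in>degenerate. real (card {a::'f. a \<noteq> 0 \<and> U1_part (fscale a z) \<in> long1})) \<le> (\<Sum>z\<in>degenerate. ?q - 1)"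
    proof (rule sum_mono)
      fix z
      have "real (card {a::'f. a \<noteq> 0 \<and> U1_part (fscale a z) \<in> long1}) \<le> real (q - 1)" using cnt0 by (simp only: of_nat_le_iff)
      then show "real (card {a::'f. a \<noteq> 0 \<and> U1_part (fscale a z) \<in> long1}) \<le> ?q - 1" using q_gt by (simp add: of_nat_diff)
    qed
  qed
  also have "\<dots> = ?q ^ N * ?G + real (card degenerate) * (?q - 1)" using vsD(3)[OF V] by simp
  also have "\<dots> \<le> ?q ^ N * ?G + ((real (t div d) - 1) * ?q ^ (N - 1)) * (?q - 1)"
  proof (intro add_left_mono mult_right_mono)
    have "d \<le> t" using d_props(2) t_pos by (simp add: dvd_imp_le)
    then have "1 \<le> t div d" using d_props(1) by (simp add: Suc_le_eq div_greater_zero_iff)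
    then have "real ((t div d - 1) * q ^ (N - 1)) = (real (t div d) - 1) * ?q ^ (N - 1)" by (simp add: of_nat_diff)
    then show "real (card degenerate) \<le> (real (t div d) - 1) * ?q ^ (N - 1)" using card_degenerate by (metis of_nat_le_iff)
  qed (use rq in simp)
  finally have main: "(?q - 1) * real (card D) \<le> ?q ^ N * ?G + ((real (t div d) - 1) * ?q ^ (N - 1)) * (?q - 1)" .
  have qN: "?q ^ N = ?q ^ k * ?q ^ (N - k)" using kN by (simp add: power_add[symmetric])
  have qN1: "?q ^ (N - 1) = ?q ^ N / ?q" using kN rq by (cases N) auto
  have pos: "?q ^ (N - k) > 0" "?q - 1 > 0" using rq by auto
  have "real (card long1) * ?q ^ (N - k) \<le> real (card D)"
    using cD vsD(3)[OF T(1)] by (metis of_nat_le_iff of_nat_mult of_nat_power)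
  then have "(?q - 1) * (real (card long1) * ?q ^ (N - k)) \<le> (?q - 1) * real (card D)"
    using pos(2) by (intro mult_left_mono) auto
  also have "\<dots> \<le> (?q - 1) * (?q ^ k * long_density d * ?q ^ (N - k))"
  proof -
    have "(?q - 1) * (?q ^ k * long_density d * ?q ^ (N - k)) = ?q ^ N * ((?q - 1) * long_density d)" unfolding qN by (simp add: mult_ac)
    also have "(?q - 1) * long_density d = ?q * (1 / ?k + 1 / ?k ^ 2) + (?q - 1) * ((real (t div d) - 1) / ?q)"
      unfolding long_density_def using pos(2) by (simp add: distrib_left)
    also have "?q * (1 / ?k + 1 / ?k ^ 2) = ?G" by (simp add: distrib_left)
    also have "?q ^ N * (?G + (?q - 1) * ((real (t div d) - 1) / ?q)) = ?q ^ N * ?G + ((real (t div d) - 1) * ?q ^ (N - 1)) * (?q - 1)"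
      unfolding qN1 by (simp add: distrib_left mult_ac)
    finally show ?thesis using main by simp
  qed
  finally have "real (card long1) * ?q ^ (N - k) \<le> (?q ^ k * long_density d) * ?q ^ (N - k)" using pos(2) by simp
  then show ?thesis using pos(1) by simp
qed

text \<open>Every vector of \<open>U\<close> differs from one of \<open>U1\<close> by one of \<open>p\<close> multiples of \<open>u\<close>, which does not change the
  line through \<open>P\<close>.\<close>

lemma long_bound: "real (card {y \<in> U. y \<notin> P \<and> card (line_scalars P y) > p ^ d}) \<le> real p * (real q ^ k * long_density d)"
proof -
  let ?L = "{y \<in> U. y \<notin> P \<and> card (line_scalars P y) > p ^ d}"
  have fin: "finite long1" using finU U1(2) finite_subset[of U1 U] by (auto simp: long1_def intro: finite_subset)
  have "?L \<subseteq> (\<lambda>(c, x). x + fscale c u) ` (Fix 1 \<times> long1)"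
  proof
    fix y assume y: "y \<in> ?L"
    then have "y \<in> fv.Kext (Fix 1) u U1" using U1(5) by simp
    then obtain c x where cx: "c \<in> Fix 1" "x \<in> U1" "y = x + fscale c u" unfolding fv.Kext_iff by blast
    have cu: "fscale c u \<in> P" by (rule fvec.subspace_scale[OF sP u(1)])
    have "x \<notin> P"
    proof
      assume "x \<in> P"
      then have "y \<in> P" using fvec.subspace_add[OF sP _ cu] cx(3) by blast
      then show False using y by simp
    qed
    moreover have "line_scalars P x = line_scalars P y"
    proof -
      have "v - fscale b x \<in> P \<longleftrightarrow> v - fscale b y \<in> P" for v b
      proof -
        have w: "fscale b (fscale c u) \<in> P" by (rule fvec.subspace_scale[OF sP cu])
        have e1: "v - fscale b x = (v - fscale b y) + fscale b (fscale c u)"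
          unfolding cx(3) fvec.scale_right_distrib by simp
        have e2: "v - fscale b y = (v - fscale b x) - fscale b (fscale c u)"
          unfolding cx(3) fvec.scale_right_distrib by simp
        show ?thesis
        proof
          assume "v - fscale b x \<in> P"
          then show "v - fscale b y \<in> P" unfolding e2 using fvec.subspace_diff[OF sP _ w] by blast
        next
          assume "v - fscale b y \<in> P"
          then show "v - fscale b x \<in> P" unfolding e1 using fvec.subspace_add[OF sP _ w] by blast
        qed
      qed
      then show ?thesis unfolding line_scalars_def by blast
    qed
    ultimately have "x \<in> long1" using y cx(2) by (simp add: long1_def)
    then show "y \<in> (\<lambda>(c, x). x + fscale c u) ` (Fix 1 \<times> long1)"
      using cx by (intro image_eqI[of _ _ "(c, x)"]) auto
  qed
  then have "card ?L \<le> card ((\<lambda>(c, x). x + fscale c u) ` (Fix 1 \<times> long1))" using fin by (intro card_mono) auto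
  also have "\<dots> \<le> card (Fix 1 \<times> long1)" using fin by (intro card_image_le) auto
  also have "\<dots> = p * card long1" using cardF1 by (simp add: card_cartesian_product)
  finally have "real (card ?L) \<le> real (p * card long1)" by (simp only: of_nat_le_iff)
  also have "\<dots> \<le> real p * (real q ^ k * long_density d)" using long1_bound by (simp add: mult_left_mono)
  finally show ?thesis .
qed

end

context linear_small_set
begin

section \<open>The subfield attached to a linear set\<close>

definition invariant_mod :: "nat \<Rightarrow> (nat \<Rightarrow> 'f) set \<Rightarrow> bool" where
  "invariant_mod d P \<longleftrightarrow> fv.Ksub (Fix d) {x + y | x y. x \<in> U \<and> y \<in> P}"

lemma light_field:
  assumes lP: "light P"
  obtains d where "d > 0" "d dvd t" "e \<le> d" "invariant_mod d P"
    "real (card {y \<in> U. y \<notin> P \<and> card (line_scalars P y) > p ^ d}) \<le> real p * (real q ^ k * long_density d)"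
proof -
  have PB: "P \<in> B" using lP by (simp add: light_def)
  then have "P \<in> pts U" using BU by simp
  then obtain u where u: "u \<in> P" "u \<in> U" "u \<noteq> 0" using point_of_U by blast
  obtain U1 where U1: "fv.Ksub (Fix 1) U1" "U1 \<subseteq> U" "u \<notin> U1" "card U = card (Fix 1) * card U1" "fv.Kext (Fix 1) u U1 = U"
    using fv.Ksub_complement_of[OF is_subfield_Fix Fix_finite KU finU u(2,3)] by metis
  obtain T where T: "vs (N - k) T" "P \<subseteq> T" "T \<subseteq> V" "points_in B T = {P}" using tangent[OF PB] .
  interpret light_point p t F s k N V B e U P u U1 T
    by unfold_locales (use lP u U1 T in auto)
  show thesis
    using that[OF d_props(1,2) e_le_d _ long_bound] field_invariant unfolding invariant_mod_def plusP_def by blast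
qed

lemma small_real: "real (card B) < 3/2 * real q ^ k + 3/2"
proof -
  have "real (2 * card B) < real (3 * q ^ k + 3)" using small by (simp only: of_nat_less_iff)
  then show ?thesis by simp
qed

lemma small_heavy: "real p * (real p - 1) * real (card {P \<in> B. \<not> light P}) < real q ^ k"
proof -
  have "p * (p - 1) * card {P \<in> B. \<not> light P} + (p - 1) * q ^ k \<le> p * (p - 1) * card {P \<in> B. \<not> light P} + (p - 1) * card B"
    using size_gt by (intro add_left_mono mult_le_mono2) simp
  also have "\<dots> < p * q ^ k" by (rule heavy_bound)
  also have "p * q ^ k = (p - 1) * q ^ k + q ^ k" using p_gt_1 by (cases p) auto
  finally have "p * (p - 1) * card {P \<in> B. \<not> light P} < q ^ k" by simp
  then have "real (p * (p - 1) * card {P \<in> B. \<not> light P}) < real (q ^ k)" by (simp only: of_nat_less_iff)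
  then show ?thesis using p_gt_1 by (simp add: of_nat_diff)
qed

text \<open>When \<open>d\<close> is a proper divisor of \<open>t\<close>, \<open>q\<close> is at least \<open>(p ^ d) ^ 2\<close>; this absorbs the corrections in
  \<open>long_density\<close>.\<close>

lemma long_density_bound:
  assumes d: "d > 0" "d dvd t" "d \<noteq> t"
  shows "(p ^ d) ^ 2 \<le> q" "long_density d \<le> 1 / (real (p ^ d) - 1) + 1 / real (p ^ d) ^ 2"
proof -
  define \<kappa> where "\<kappa> = p ^ d"
  have k1: "\<kappa> > 1" unfolding \<kappa>_def by (rule one_less_power[OF p_gt_1 d(1)])
  obtain m where m: "t = d * m" using d(2) by blast
  have tm: "t div d = m" using m d(1) by simp
  have "m \<noteq> 0" "m \<noteq> 1" using m d(3) t_pos by auto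
  then have m2: "m \<ge> 2" by simp
  obtain n where n: "m = Suc (Suc n)" using m2 by (metis Suc_le_D numeral_2_eq_2 Suc_le_mono)
  have qk: "q = \<kappa> ^ m"
  proof -
    have "p ^ t = p ^ (d * m)" using m by (rule arg_cong)
    also have "\<dots> = \<kappa> ^ m" unfolding \<kappa>_def by (rule power_mult)
    finally show ?thesis by (simp only: q_def)
  qed
  have "\<kappa> ^ 2 \<le> \<kappa> ^ m" using k1 m2 by (intro power_increasing) auto
  then show kq: "(p ^ d) ^ 2 \<le> q" using qk by (simp add: \<kappa>_def)
  define K Q where "K = real \<kappa>" and "Q = real q"
  have K: "K > 1" using k1 by (simp add: K_def)
  have KQ: "K ^ 2 \<le> Q" using kq unfolding K_def Q_def \<kappa>_def by (metis of_nat_le_iff of_nat_power)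
  have K2: "K ^ 2 > 1" using K by (simp add: one_less_power)
  have "Suc n \<le> \<kappa> ^ n"
  proof -
    have "n < 2 ^ n" by (rule less_exp)
    also have "(2::nat) ^ n \<le> \<kappa> ^ n" by (rule power_mono) (use k1 in auto)
    finally show ?thesis by simp
  qed
  then have "real (Suc n) \<le> K ^ n" unfolding K_def by (metis of_nat_le_iff of_nat_power)
  moreover have "Q = K ^ n * K ^ 2" unfolding Q_def K_def qk n by (simp add: power2_eq_square mult_ac)
  moreover have Kn: "K ^ n > 0" using K by simp
  ultimately have "real (Suc n) * K ^ 2 \<le> Q" using K by (simp add: mult_right_mono del: of_nat_Suc)
  moreover have "Q > 0" using KQ K2 by linarith
  ultimately have b: "(real m - 1) / Q \<le> 1 / K ^ 2"
    using K K2 by (simp add: n divide_simps)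
  have "Q / (Q - 1) \<le> K ^ 2 / (K ^ 2 - 1)"
    using KQ K2 by (simp add: field_simps)
  then have "Q / (Q - 1) * (1 / K + 1 / K ^ 2) \<le> K ^ 2 / (K ^ 2 - 1) * (1 / K + 1 / K ^ 2)"
    using K by (intro mult_right_mono) auto
  also have "\<dots> = 1 / (K - 1)"
  proof -
    have "K ^ 2 * (1 / K + 1 / K ^ 2) = K + 1" using K by (simp add: distrib_left power2_eq_square)
    moreover have "K ^ 2 - 1 = (K - 1) * (K + 1)" by (simp add: algebra_simps power2_eq_square)
    ultimately have "K ^ 2 / (K ^ 2 - 1) * (1 / K + 1 / K ^ 2) = (K + 1) / ((K - 1) * (K + 1))" by simp
    also have "\<dots> = 1 / (K - 1)" using K by simp
    finally show ?thesis .
  qed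
  finally have a: "Q / (Q - 1) * (1 / K + 1 / K ^ 2) \<le> 1 / (K - 1)" .
  have "long_density d = Q / (Q - 1) * (1 / K + 1 / K ^ 2) + (real m - 1) / Q"
    unfolding long_density_def Q_def K_def \<kappa>_def tm ..
  then show "long_density d \<le> 1 / (real (p ^ d) - 1) + 1 / real (p ^ d) ^ 2" using a b unfolding K_def \<kappa>_def by linarith
qed

text \<open>Heavy points and light points on long lines (\<open>h\<close> and \<open>nl\<close> of them) are so few that, counted with
  weight \<open>1\<close> and together with weight \<open>1 / (s + 1)\<close> for every point of \<open>B\<close>, they stay within the budget
  for averaging.\<close>

lemma few_exceptional:
  assumes d: "d > 0" "d dvd t" "e \<le> d"
    and NL: "d = t \<Longrightarrow> nl = 0" "(real p - 1) * nl \<le> real p * (real q ^ k * long_density d)"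
    and h: "real p * (real p - 1) * h < real q ^ k" and nl: "nl \<ge> 0"
  shows "h + nl + real (card B) / (real s + 1) < real q ^ k"
proof -
  define x where "x = real q ^ k"
  have bB: "real (card B) < 3/2 * x + 3/2" using small_real unfolding x_def .
  have p2: "real p \<ge> 2" using p_gt_1 by simp
  have q7: "real q \<ge> 7" using s_le_q s7 by simp
  have xq: "x \<ge> real q" unfolding x_def using q7 k1 by (intro self_le_power) auto
  have ks: "p ^ d \<ge> s" using d(3) s_pow p_gt_1 by (simp add: power_increasing)
  have s7': "real s \<ge> 7" using s7 by simp
  show ?thesis
  proof (cases "d = t")
    case True
    have "2 * h \<le> real p * (real p - 1) * h \<or> h < 0"
    proof (cases "h < 0")
      case False
      have "2 * 1 \<le> real p * (real p - 1)" using p2 by (intro mult_mono) auto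
      then have "2 * h \<le> real p * (real p - 1) * h" using False by (intro mult_right_mono) auto
      then show ?thesis ..
    qed simp
    then have "2 * h < x" using h xq q7 unfolding x_def by linarith
    moreover have "real (card B) / (real s + 1) \<le> real (card B) / 8" using s7' by (intro divide_left_mono) auto
    ultimately show ?thesis using NL(1)[OF True] bB xq q7 unfolding x_def by linarith
  next
    case False
    define K where "K = real (p ^ d)"
    have KQ: "K ^ 2 \<le> real q" using long_density_bound(1)[OF d(1,2) False] unfolding K_def by (metis of_nat_le_iff of_nat_power)
    have Ks: "K \<ge> real s" using ks unfolding K_def by (simp only: of_nat_le_iff)
    have Lm: "long_density d \<le> 1 / (K - 1) + 1 / K ^ 2" using long_density_bound(2)[OF d(1,2) False] unfolding K_def .
    show ?thesis
    proof (cases "p = 2")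
      case True
      have "e \<ge> 3"
      proof (rule ccontr)
        assume "\<not> e \<ge> 3"
        then have "(2::nat) ^ e \<le> 2 ^ 2" by (intro power_increasing) auto
        then show False using s_pow s7 True by simp
      qed
      then have "(2::nat) ^ 3 \<le> 2 ^ e" by (intro power_increasing) auto
      then have "8 \<le> s" using s_pow True by simp
      then have s8: "real s \<ge> 8" by simp
      then have K8: "K \<ge> 8" using Ks by simp
      have "8 ^ 2 \<le> K ^ 2" using K8 by (intro power_mono) auto
      then have q64: "x \<ge> 64" using KQ xq by simp
      have "1 / (K - 1) \<le> 1 / 7" using K8 by (intro divide_left_mono) auto
      moreover have "1 / K ^ 2 \<le> 1 / 64" using \<open>8 ^ 2 \<le> K ^ 2\<close> by (intro divide_left_mono) auto
      ultimately have "long_density d \<le> 1 / 7 + 1 / 64" using Lm by linarith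
      then have "x * long_density d \<le> x * (1 / 7 + 1 / 64)" using q64 by (intro mult_left_mono) auto
      then have "nl \<le> 2 * (x * (1 / 7 + 1 / 64))" using NL(2) True unfolding x_def by simp
      moreover have "2 * h < x" using h True unfolding x_def by simp
      moreover have "real (card B) / (real s + 1) \<le> real (card B) / 9" using s8 by (intro divide_left_mono) auto
      moreover have "2 * (x * (1 / 7 + 1 / 64)) = 71 / 224 * x" by simp
      ultimately show ?thesis using bB q64 unfolding x_def[symmetric] by linarith
    next
      case False
      then have p3: "real p \<ge> 3" using p_gt_1 by simp
      have K7: "K \<ge> 7" using Ks s7' by simp
      have "7 ^ 2 \<le> K ^ 2" using K7 by (intro power_mono) auto
      then have q49: "x \<ge> 49" using KQ xq by simp
      have "1 / (K - 1) \<le> 1 / 6" using K7 by (intro divide_left_mono) auto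
      moreover have "1 / K ^ 2 \<le> 1 / 49" using \<open>7 ^ 2 \<le> K ^ 2\<close> by (intro divide_left_mono) auto
      ultimately have "long_density d \<le> 1 / 6 + 1 / 49" using Lm by linarith
      then have xl: "x * long_density d \<le> x * (1 / 6 + 1 / 49)" using q49 by (intro mult_left_mono) auto
      have "(real p - 1) * nl \<le> real p * (x * long_density d)" using NL(2) unfolding x_def .
      also have "\<dots> \<le> real p * (x * (1 / 6 + 1 / 49))" by (rule mult_left_mono[OF xl]) simp
      also have "\<dots> \<le> ((real p - 1) * (3/2)) * (x * (1 / 6 + 1 / 49))"
        using p3 q49 by (intro mult_right_mono) auto
      finally have "(real p - 1) * nl \<le> (real p - 1) * (3/2 * (x * (1 / 6 + 1 / 49)))" by (simp only: mult.assoc)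
      then have "nl \<le> 3/2 * (x * (1 / 6 + 1 / 49))" using p3 by (subst (asm) mult_le_cancel_left_pos) auto
      moreover have "6 * h \<le> x"
      proof (cases "h < 0")
        case True then show ?thesis using q49 by simp
      next
        case False
        have "3 * 2 \<le> real p * (real p - 1)" using p3 by (intro mult_mono) auto
        then have "6 * h \<le> real p * (real p - 1) * h" using False by (intro mult_right_mono) auto
        then show ?thesis using h unfolding x_def by simp
      qed
      moreover have "real (card B) / (real s + 1) \<le> real (card B) / 8" using s7' by (intro divide_left_mono) auto
      moreover have "3/2 * (x * (1 / 6 + 1 / 49)) = 55 / 196 * x" by simp
      ultimately show ?thesis using bB q49 unfolding x_def[symmetric] by linarith
    qed
  qed
qed

text \<open>Let \<open>d\<close> be minimal among the exponents attached to light points, attained at \<open>P0\<close>. A light point \<open>P\<close>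
  for which \<open>U + P\<close> is not closed under \<open>Fix d\<close> has a larger exponent, so the line joining it to
  \<open>P0\<close> is long. By \<open>few_exceptional\<close> almost all points \<open>P\<close> are therefore in the class \<open>?C\<close> of those for which
  \<open>U + P\<close> is closed under \<open>Fix d\<close>. Put \<open>U'\<close> equal to the intersection of these \<open>U + P\<close>. A point \<open>X\<close> of
  \<open>U'\<close> outside \<open>B\<close> would lie on an \<open>(N - k)\<close>-space tangent to \<open>B\<close> at a point \<open>P\<close> of the class, and
  writing a generator of \<open>X\<close> as a sum from \<open>U + P\<close> would produce a second point there.\<close>

theorem subfield_structure:
  obtains d U' where "d > 0" "d dvd t" "e \<le> d" "fv.Ksub (Fix d) U'" "B = pts U'"
proof -
  let ?H = "{P \<in> B. \<not> light P}"
  let ?ok = "\<lambda>d P. light P \<and> d > 0 \<and> d dvd t \<and> e \<le> d \<and> invariant_mod d P \<and>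
    real (card {y \<in> U. y \<notin> P \<and> card (line_scalars P y) > p ^ d}) \<le> real p * (real q ^ k * long_density d)"
  have ok: "\<exists>d. ?ok d P" if lP: "light P" for P
  proof -
    show ?thesis by (rule light_field[OF lP]) (intro exI conjI lP)
  qed
  have "\<exists>P. light P"
  proof (rule ccontr)
    assume "\<not> (\<exists>P. light P)"
    then have "?H = B" by blast
    then have "real p * (real p - 1) * real (card B) < real q ^ k" using small_heavy by simp
    moreover have "2 * 1 \<le> real p * (real p - 1)" using p_gt_1 by (intro mult_mono) auto
    then have "1 * real (card B) \<le> real p * (real p - 1) * real (card B)" by (intro mult_right_mono) auto
    moreover have "real (q ^ k) < real (card B)" using size_gt by (simp only: of_nat_less_iff)
    ultimately show False unfolding of_nat_power by linarith
  qed
  then obtain P1 where P1: "light P1" ..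
  obtain d1 where d1: "?ok d1 P1" using ok[OF P1] ..
  define d where "d = (LEAST d. \<exists>P. ?ok d P)"
  have dP: "\<exists>P. ?ok d P" unfolding d_def by (rule LeastI[of "\<lambda>d. \<exists>P. ?ok d P" d1]) (rule exI[of _ P1], rule d1)
  have dmin: "d \<le> d'" if "?ok d' P" for d' P
    unfolding d_def by (rule Least_le) (rule exI[of _ P], rule that)
  obtain P0 where "?ok d P0" using dP by blast
  then have P0: "light P0" "d > 0" "d dvd t" "e \<le> d" "invariant_mod d P0"
    "real (card {y \<in> U. y \<notin> P0 \<and> card (line_scalars P0 y) > p ^ d}) \<le> real p * (real q ^ k * long_density d)" by auto
  let ?long = "{y \<in> U. y \<notin> P0 \<and> card (line_scalars P0 y) > p ^ d}"
  let ?NL = "{P \<in> B. light P \<and> \<not> invariant_mod d P}"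
  let ?C = "{P \<in> B. invariant_mod d P}"
  have P0B: "P0 \<in> B" using P0(1) by (simp add: light_def)
  have sub: "fvec.subspace P" if "P \<in> B" for P using point_subspace[OF in_pts[OF that]] .
  obtain u0 where u0: "u0 \<in> P0" "u0 \<in> U" "u0 \<noteq> 0" "P0 = fvec.span {u0}" using point_of_U[of P0 U] P0B BU by blast
  have NLlong: "vecs U ?NL \<subseteq> ?long"
  proof
    fix v assume v: "v \<in> vecs U ?NL"
    define P where "P = fvec.span {v}"
    have vU: "v \<in> U" "v \<noteq> 0" and P: "P \<in> B" "light P" "\<not> invariant_mod d P" using v by (auto simp: vecs_def P_def)
    have PP0: "P \<noteq> P0" using P0(5) P(3) by blast
    have vP0: "v \<notin> P0"
    proof
      assume "v \<in> P0"
      then have "P0 = fvec.span {v}" using point_eq[OF in_pts[OF P0B]] vU(2) by blast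
      then show False using PP0 P_def by simp
    qed
    have u0P: "u0 \<notin> P"
    proof
      assume "u0 \<in> P"
      then have "P = fvec.span {u0}" using point_eq[OF in_pts[OF P(1)]] u0(3) by blast
      then show False using PP0 u0(4) by simp
    qed
    obtain d' where d': "?ok d' P" using ok[OF P(2)] by blast
    have "d \<le> d'" by (rule dmin[OF d'])
    have "p * card (line_scalars P0 v) = p * card (line_scalars P u0)"
      using line_scalars_card(1)[OF P0(1) vU(1) vP0, folded P_def] line_scalars_card(1)[OF P(2) u0(2) u0P, folded u0(4)]
      unfolding join_commute[of P0 P] by (rule trans[OF sym])
    then have ceq: "card (line_scalars P0 v) = card (line_scalars P u0)" using p_gt_1 by simp
    have "Fix d' \<subseteq> line_scalars P u0"
    proof
      fix c assume c: "c \<in> Fix d'"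
      have K: "fv.Ksub (Fix d') {x + y | x y. x \<in> U \<and> y \<in> P}" using d' unfolding invariant_mod_def by blast
      have "u0 + 0 \<in> {x + y | x y. x \<in> U \<and> y \<in> P}" using u0(2) fvec.subspace_0[OF sub[OF P(1)]] by blast
      then have "fscale c u0 \<in> {x + y | x y. x \<in> U \<and> y \<in> P}" using fv.Ksub_scale[OF K c] by simp
      then obtain x y where xy: "x \<in> U" "y \<in> P" "fscale c u0 = x + y" by blast
      have "x - fscale c u0 = - y" using xy(3) by simp
      then have "x - fscale c u0 \<in> P" using fvec.subspace_neg[OF sub[OF P(1)] xy(2)] by simp
      then show "c \<in> line_scalars P u0" unfolding line_scalars_def using xy(1) by blast
    qed
    then have "card (Fix d') \<le> card (line_scalars P u0)" by (intro card_mono) auto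
    then have le: "p ^ d' \<le> card (line_scalars P0 v)" using card_Fix[of d'] d' ceq by simp
    have "card (line_scalars P0 v) > p ^ d"
    proof (rule ccontr)
      assume "\<not> card (line_scalars P0 v) > p ^ d"
      then have "p ^ d' \<le> p ^ d" using le by simp
      then have "d' \<le> d" by (rule power_le_imp_le_exp[OF p_gt_1])
      then have "d' = d" using \<open>d \<le> d'\<close> by simp
      then show False using d' P(3) by blast
    qed
    then show "v \<in> ?long" using vU(1) vP0 by blast
  qed
  have NLcard: "(p - 1) * card ?NL \<le> card ?long"
  proof -
    have "(p ^ 1 - 1) * card ?NL \<le> card (vecs U ?NL)"
      by (rule vecs_mass[OF _ KU finU]) (use BU in auto)
    also have "\<dots> \<le> card ?long" by (rule card_mono[OF _ NLlong]) (use finU in simp)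
    finally show ?thesis by simp
  qed
  have cNC: "card (B - ?C) \<le> card ?H + card ?NL"
  proof -
    have "card (B - ?C) \<le> card (?H \<union> ?NL)" by (rule card_mono) (use finB in auto)
    also have "\<dots> \<le> card ?H + card ?NL" by (rule card_Un_le)
    finally show ?thesis .
  qed
  have few: "real (card ?H) + real (card ?NL) + real (card B) / (real s + 1) < real q ^ k"
  proof (rule few_exceptional[OF P0(2,3,4)])
    show "real (card ?NL) = 0" if "d = t"
    proof -
      have "?long = {}"
      proof (rule equals0I)
        fix y assume y: "y \<in> ?long"
        have "card (line_scalars P0 y) \<le> card (UNIV :: 'f set)" by (intro card_mono) auto
        then show False using y that by (simp add: card_F)
      qed
      then have "(p - 1) * card ?NL = 0" using NLcard by (simp only: card.empty le_0_eq)
      then show ?thesis using p_gt_1 by simp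
    qed
    have "real ((p - 1) * card ?NL) \<le> real (card ?long)" using NLcard by (simp only: of_nat_le_iff)
    then show "(real p - 1) * real (card ?NL) \<le> real p * (real q ^ k * long_density d)" using P0(6) p_gt_1 by (simp add: of_nat_diff)
  qed (use small_heavy in auto)
  define W where "W P = {a + b | a b. a \<in> U \<and> b \<in> P}" for P
  define U' where "U' = {x \<in> V. \<forall>P\<in>?C. x \<in> W P}"
  have U'I: "x \<in> U'" if "x \<in> V" "\<And>P. P \<in> ?C \<Longrightarrow> x \<in> W P" for x using that unfolding U'_def by blast
  have U'D: "x \<in> W P" if "x \<in> U'" "P \<in> ?C" for x P using that unfolding U'_def by blast
  have U'V: "x \<in> V" if "x \<in> U'" for x using that unfolding U'_def by blast
  have KC: "fv.Ksub (Fix d) (W P)" if "P \<in> ?C" for P using that unfolding invariant_mod_def W_def by blast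
  have KU': "fv.Ksub (Fix d) U'"
    unfolding fv.Ksub_def
  proof (intro conjI ballI)
    show "0 \<in> U'" by (rule U'I[OF fvec.subspace_0[OF subV] fv.Ksub_zero[OF KC]])
    show "x + y \<in> U'" if xy: "x \<in> U'" "y \<in> U'" for x y
      by (rule U'I[OF fvec.subspace_add[OF subV U'V[OF xy(1)] U'V[OF xy(2)]] fv.Ksub_add[OF KC U'D[OF xy(1)] U'D[OF xy(2)]]])
    show "fscale c x \<in> U'" if cx: "c \<in> Fix d" "x \<in> U'" for c x
      by (rule U'I[OF fvec.subspace_scale[OF subV U'V[OF cx(2)]] fv.Ksub_scale[OF KC cx(1) U'D[OF cx(2)]]])
  qed
  have UU': "U \<subseteq> U'"
  proof
    fix x assume x: "x \<in> U"
    show "x \<in> U'"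
    proof (rule U'I)
      show "x \<in> V" using x UV by blast
      fix P assume P: "P \<in> ?C"
      have "0 \<in> P" by (rule fvec.subspace_0[OF sub]) (use P in blast)
      then have "x + 0 \<in> W P" using x unfolding W_def by blast
      then show "x \<in> W P" by simp
    qed
  qed
  have "pts U' \<subseteq> B"
  proof
    fix X assume X: "X \<in> pts U'"
    show "X \<in> B"
    proof (rule ccontr)
      assume XB: "X \<notin> B"
      obtain x where x: "x \<in> U'" "x \<noteq> 0" "X = fvec.span {x}" using X by (auto simp: pts_iff)
      have xV: "x \<in> V" by (rule U'V[OF x(1)])
      have XV: "X \<in> pts V" using x xV by (auto simp: pts_iff)
      define c where "c P = (if P \<in> ?C then 1 / (real s + 1) else 1)" for P
      have c0: "c P \<ge> 0" for P by (simp add: c_def)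
      have nle: "P \<in> pts V \<and> \<not> P \<subseteq> X" if "P \<in> B" for P
        using in_pts[OF that] point_not_le[OF XV in_pts[OF that]] XB that by blast
      have h1: "1 \<le> N - k" "N - k + k = N" using kN by auto
      obtain T where T: "vs (N - k) T" "X \<subseteq> T" "T \<subseteq> V" "real q ^ k * sum c {P \<in> B. P \<subseteq> T} \<le> sum c B"
        by (rule avg_subspace[OF V vs_point[OF XV] point_le[OF XV subV] h1 finB nle c0])
      have "sum c B = sum c (B - ?C) + sum c ?C"
        by (rule sum.subset_diff) (use finB in auto)
      also have "sum c (B - ?C) = real (card (B - ?C))"
      proof -
        have "sum c (B - ?C) = (\<Sum>P\<in>B - ?C. 1)" by (rule sum.cong) (auto simp: c_def)
        then show ?thesis by simp
      qed
      also have "sum c ?C = real (card ?C) * (1 / (real s + 1))"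
      proof -
        have "sum c ?C = (\<Sum>P\<in>?C. 1 / (real s + 1))" by (rule sum.cong) (auto simp: c_def)
        then show ?thesis by simp
      qed
      also have "real (card (B - ?C)) + real (card ?C) * (1 / (real s + 1)) \<le> real (card ?H) + real (card ?NL) + real (card B) / (real s + 1)"
      proof -
        have "card ?C \<le> card B" by (rule card_mono[OF finB]) blast
        then have "real (card ?C) * (1 / (real s + 1)) \<le> real (card B) * (1 / (real s + 1))" by (intro mult_right_mono) auto
        moreover have "real (card (B - ?C)) \<le> real (card ?H + card ?NL)" using cNC by (simp only: of_nat_le_iff)
        ultimately show ?thesis by simp
      qed
      also have "\<dots> < real q ^ k" by (rule few)
      finally have "real q ^ k * sum c {P \<in> B. P \<subseteq> T} < real q ^ k * 1" using T(4) by linarith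
      then have lt1: "sum c {P \<in> B. P \<subseteq> T} < 1" using rq by simp
      have allC: "P \<in> ?C" if P: "P \<in> B" "P \<subseteq> T" for P
      proof (rule ccontr)
        assume "P \<notin> ?C"
        then have "c P = 1" unfolding c_def by (rule if_not_P)
        moreover have "c P \<le> sum c {P \<in> B. P \<subseteq> T}" by (rule member_le_sum) (use P finB c0 in auto)
        ultimately show False using lt1 by simp
      qed
      have "sum c {P \<in> B. P \<subseteq> T} = (\<Sum>P\<in>{P \<in> B. P \<subseteq> T}. 1 / (real s + 1))"
        by (rule sum.cong[OF refl]) (use allC in \<open>auto simp: c_def\<close>)
      then have "real (card (points_in B T)) / (real s + 1) < 1" using lt1 by (simp add: points_in_def)
      then have "real (card (points_in B T)) < real (s + 1)" by (simp add: divide_less_eq)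
      then have "card (points_in B T) < s + 1" by (simp only: of_nat_less_iff)
      moreover have "s dvd card (points_in B T) - 1" by (rule points_dvd[OF T(1,3)])
      ultimately have "card (points_in B T) - 1 = 0" using points_pos[OF T(1,3)] by (metis dvd_imp_le add.commute gr0I less_diff_conv2 not_le plus_1_eq_Suc Suc_eq_plus1)
      then have "card (points_in B T) = 1" using points_pos[OF T(1,3)] by simp
      then obtain P where P: "points_in B T = {P}" by (rule card_1_singletonE)
      then have PB: "P \<in> B" "P \<subseteq> T" by (auto simp: points_in_def)
      have sT: "fvec.subspace T" by (rule vsD(1)[OF T(1)])
      have "x \<in> W P" by (rule U'D[OF x(1) allC[OF PB]])
      then obtain a b where ab: "a \<in> U" "b \<in> P" "x = a + b" unfolding W_def by blast
      have xT: "x \<in> T" using x(3) T(2) mem_span_self by blast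
      have "x - b \<in> T" by (rule fvec.subspace_diff[OF sT xT]) (use PB(2) ab(2) in blast)
      then have aT: "a \<in> T" using ab(3) by simp
      have "a \<in> P"
      proof (cases "a = 0")
        case True then show ?thesis using fvec.subspace_0[OF sub[OF PB(1)]] by simp
      next
        case False
        have "fvec.span {a} \<in> points_in B T"
          using span_in_B[OF ab(1) False] span_le_iff[OF sT, of a] aT by (simp add: points_in_def)
        then show ?thesis using P mem_span_self[of a] by simp
      qed
      then have "x \<in> P" using fvec.subspace_add[OF sub[OF PB(1)] _ ab(2)] ab(3) by simp
      then have "P = X" using point_eq[OF in_pts[OF PB(1)] _ x(2)] x(3) by simp
      then show False using PB(1) XB by simp
    qed
  qed
  moreover have "B \<subseteq> pts U'" using BU pts_mono[OF UU'] by simp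
  ultimately show thesis using that[OF P0(2,3,4) KU'] by blast
qed

end

section \<open>A good centre of projection\<close>

definition pairs :: "'a set \<Rightarrow> ('a \<times> 'a) set" where
  "pairs X = (SIGMA P:X. X - {P})"

lemma card_pairs: "finite X \<Longrightarrow> card (pairs X) = card X * (card X - 1)"
  unfolding pairs_def by (subst card_SigmaI) auto

lemma finite_pairs: "finite X \<Longrightarrow> finite (pairs X)"
  unfolding pairs_def by auto

lemma in_pairs: "(P, R) \<in> pairs X \<longleftrightarrow> P \<in> X \<and> R \<in> X \<and> P \<noteq> R"
  unfolding pairs_def by auto

context small_set_one_mod
begin

lemma line:
  assumes "P \<in> B" "R \<in> B" "P \<noteq> R"
  shows "vs 2 (join P R)" "join P R \<subseteq> V"
  using vs_join[OF in_pts[OF assms(1)] in_pts[OF assms(2)] assms(3)]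
    join_least[OF subV B_le[OF assms(1)] B_le[OF assms(2)]] by auto

lemma line_eq:
  assumes "vs 2 L" "P \<in> B" "R \<in> B" "P \<noteq> R" "P \<subseteq> L" "R \<subseteq> L"
  shows "join P R = L"
  using line_eq_join[OF in_pts[OF assms(2)] in_pts[OF assms(3)] assms(4,1,5,6)] by simp

definition on_secant :: "(nat \<Rightarrow> 'f) set" where
  "on_secant = {z \<in> V. \<exists>P\<in>B. \<exists>R\<in>B. P \<noteq> R \<and> z \<in> join P R}"

text \<open>Each vector on a secant is counted by at least \<open>s (s + 1)\<close> ordered pairs of points of \<open>B\<close>.\<close>

lemma card_on_secant: "s * (s + 1) * card on_secant \<le> card B ^ 2 * q ^ 2"
proof -
  have fin: "finite V" "finite on_secant" "finite (pairs B)"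
    using vsD(2)[OF V] finite_pairs[OF finB] finite_subset[of on_secant V] unfolding on_secant_def by auto
  let ?n = "\<lambda>z. card {PR \<in> pairs B. z \<in> join (fst PR) (snd PR)}"
  have ge: "s * (s + 1) \<le> ?n z" if z: "z \<in> on_secant" for z
  proof -
    obtain P R where PR: "P \<in> B" "R \<in> B" "P \<noteq> R" "z \<in> join P R" using z unfolding on_secant_def by blast
    let ?X = "points_in B (join P R)"
    have X: "s + 1 \<le> card ?X" by (rule secant[OF PR(1-3)])
    have "pairs ?X \<subseteq> {PR \<in> pairs B. z \<in> join (fst PR) (snd PR)}"
    proof (intro subsetI CollectI conjI)
      fix x assume "x \<in> pairs ?X"
      then obtain P' R' where x: "x = (P', R')" "P' \<in> ?X" "R' \<in> ?X" "P' \<noteq> R'" unfolding pairs_def by blast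
      then have b: "P' \<in> B" "P' \<subseteq> join P R" "R' \<in> B" "R' \<subseteq> join P R" by (auto simp: points_in_def)
      show "x \<in> pairs B" using x b by (simp add: in_pairs)
      show "z \<in> join (fst x) (snd x)"
        using line_eq[OF line(1)[OF PR(1-3)] b(1,3) x(4) b(2,4)] PR(4) x(1) by simp
    qed
    then have "card (pairs ?X) \<le> ?n z" by (intro card_mono) (use fin in auto)
    moreover have "(s + 1) * s \<le> card (pairs ?X)"
      unfolding card_pairs[OF fin_points_in] by (rule mult_le_mono) (use X in auto)
    ultimately show ?thesis by (simp only: mult.commute)
  qed
  have "s * (s + 1) * card on_secant = (\<Sum>z\<in>on_secant. s * (s + 1))" by simp
  also have "\<dots> \<le> (\<Sum>z\<in>on_secant. ?n z)" by (rule sum_mono) (rule ge)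
  also have "\<dots> \<le> (\<Sum>z\<in>V. ?n z)" by (rule sum_mono2) (use fin in \<open>auto simp: on_secant_def\<close>)
  also have "\<dots> = (\<Sum>PR\<in>pairs B. card {z \<in> V. z \<in> join (fst PR) (snd PR)})"
    by (rule sum_card_swap[OF fin(1,3)])
  also have "\<dots> = (\<Sum>PR\<in>pairs B. q ^ 2)"
  proof (rule sum.cong[OF refl])
    fix x assume "x \<in> pairs B"
    then obtain P R where x: "x = (P, R)" "P \<in> B" "R \<in> B" "P \<noteq> R" unfolding pairs_def by blast
    have "{z \<in> V. z \<in> join P R} = join P R" using line(2)[OF x(2-4)] by blast
    then show "card {z \<in> V. z \<in> join (fst x) (snd x)} = q ^ 2" using vsD(3)[OF line(1)[OF x(2-4)]] x(1) by simp
  qed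
  also have "\<dots> = card B * (card B - 1) * q ^ 2" by (simp add: card_pairs[OF finB])
  also have "\<dots> \<le> card B ^ 2 * q ^ 2" by (simp add: power2_eq_square)
  finally show ?thesis .
qed

text \<open>Joining the extra point \<open>Y\<close> to each of the \<open>s + 1\<close> or more points of the line gives secants with \<open>s - 1\<close> further
  points each, disjoint and off the line; altogether \<open>1 + (s + 1) (s - 1) = s ^ 2\<close>.\<close>

lemma plane_extra:
  assumes L: "P \<in> B" "R \<in> B" "P \<noteq> R" and M: "fvec.subspace M" "join P R \<subseteq> M"
    and Y: "Y \<in> B" "Y \<subseteq> M" "\<not> Y \<subseteq> join P R"
  shows "s ^ 2 \<le> card {Y \<in> B. \<not> Y \<subseteq> join P R \<and> Y \<subseteq> M}"
proof -
  let ?L = "join P R"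
  let ?E = "{Y \<in> B. \<not> Y \<subseteq> ?L \<and> Y \<subseteq> M}"
  let ?X = "points_in B ?L"
  define A where "A X = points_in B (join Y X) - {Y, X}" for X
  have XD: "X \<in> B" "X \<subseteq> ?L" "X \<noteq> Y" if "X \<in> ?X" for X using that Y(3) by (auto simp: points_in_def)
  have YX: "vs 2 (join Y X)" if "X \<in> ?X" for X by (rule line(1)[OF Y(1) XD(1)[OF that]]) (use XD(3)[OF that] in blast)
  have AD: "Z \<in> B" "Z \<subseteq> join Y X" "Z \<noteq> Y" "Z \<noteq> X" if "Z \<in> A X" for Z X using that by (auto simp: A_def points_in_def)
  have not_L: False if X: "X \<in> ?X" and Z: "Z \<in> B" "Z \<noteq> X" "Z \<subseteq> ?L" "Z \<subseteq> join Y X" for X Z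
  proof -
    have "join X Z = ?L" by (rule line_eq[OF line(1)[OF L] XD(1)[OF X] Z(1) _ XD(2)[OF X] Z(3)]) (use Z(2) in blast)
    moreover have "join X Z = join Y X" by (rule line_eq[OF YX[OF X] XD(1)[OF X] Z(1) _ join_upper(2) Z(4)]) (use Z(2) in blast)
    ultimately show False using Y(3) join_upper(1)[of Y X] by simp
  qed
  have cA: "s - 1 \<le> card (A X)" if X: "X \<in> ?X" for X
  proof -
    have "s + 1 \<le> card (points_in B (join Y X))" by (rule secant[OF Y(1) XD(1)[OF X]]) (use XD(3)[OF X] in blast)
    moreover have "card (points_in B (join Y X)) - card {Y, X} \<le> card (A X)" unfolding A_def by (rule diff_card_le_card_Diff) simp
    moreover have "card {Y, X} \<le> 2" by (simp add: card_insert_if)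
    ultimately show ?thesis by linarith
  qed
  have AE: "A X \<subseteq> ?E - {Y}" if X: "X \<in> ?X" for X
  proof
    fix Z assume Z: "Z \<in> A X"
    have "join Y X \<subseteq> M" by (rule join_least[OF M(1) Y(2)]) (use XD(2)[OF X] M(2) in blast)
    then have "Z \<subseteq> M" using AD(2)[OF Z] by blast
    moreover have "\<not> Z \<subseteq> ?L" using not_L[OF X AD(1,4)[OF Z] _ AD(2)[OF Z]] by blast
    ultimately show "Z \<in> ?E - {Y}" using AD(1,3)[OF Z] by blast
  qed
  have disj: "A X \<inter> A X' = {}" if X: "X \<in> ?X" "X' \<in> ?X" "X \<noteq> X'" for X X'
  proof (rule equals0I)
    fix Z assume "Z \<in> A X \<inter> A X'"
    then have Z: "Z \<in> A X" "Z \<in> A X'" by auto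
    have "join Y Z = join Y X" by (rule line_eq[OF YX[OF X(1)] Y(1) AD(1)[OF Z(1)] _ join_upper(1) AD(2)[OF Z(1)]]) (use AD(3)[OF Z(1)] in blast)
    moreover have "join Y Z = join Y X'" by (rule line_eq[OF YX[OF X(2)] Y(1) AD(1)[OF Z(1)] _ join_upper(1) AD(2)[OF Z(2)]]) (use AD(3)[OF Z(1)] in blast)
    ultimately have "X' \<subseteq> join Y X" using join_upper(2)[of X' Y] by simp
    then show False using not_L[OF X(1) XD(1)[OF X(2)] _ XD(2)[OF X(2)]] X(3) by blast
  qed
  have finE: "finite ?E" using finB by simp
  have "(s + 1) * (s - 1) \<le> card ?X * (s - 1)" using secant[OF L] by (rule mult_le_mono1)
  also have "\<dots> = (\<Sum>X\<in>?X. s - 1)" by simp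
  also have "\<dots> \<le> (\<Sum>X\<in>?X. card (A X))" by (rule sum_mono) (rule cA)
  also have "\<dots> = card (\<Union>X\<in>?X. A X)"
    by (rule card_UN_disjoint[symmetric]) (use fin_points_in disj in \<open>auto simp: A_def\<close>)
  also have "\<dots> \<le> card (?E - {Y})" by (rule card_mono) (use finE AE in auto)
  also have "\<dots> = card ?E - 1" using Y finE by (intro card_Diff_singleton) auto
  finally have "(s + 1) * (s - 1) \<le> card ?E - 1" .
  moreover have "card ?E \<ge> 1" using Y finE by (metis (mono_tags, lifting) card_gt_0_iff mem_Collect_eq empty_iff Suc_le_eq One_nat_def)
  moreover have "s ^ 2 = (s + 1) * (s - 1) + 1" using s7 by (cases s) (auto simp: power2_eq_square)
  ultimately show ?thesis by linarith
qed

definition bad :: "(nat \<Rightarrow> 'f) \<Rightarrow> (nat \<Rightarrow> 'f) set \<times> (nat \<Rightarrow> 'f) set \<Rightarrow> bool" where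
  "bad z PR \<longleftrightarrow> (\<exists>Y\<in>B. \<not> Y \<subseteq> join (fst PR) (snd PR) \<and> Y \<subseteq> ext z (join (fst PR) (snd PR)))"

text \<open>Each plane through the line with extra points has at least \<open>s ^ 2\<close> of them, so there are few such
  planes.\<close>

lemma bad_centres:
  assumes L: "P \<in> B" "R \<in> B" "P \<noteq> R"
  shows "s ^ 2 * card {z \<in> V - join P R. bad z (P, R)} \<le> card B * (q ^ 3 - q ^ 2)"
proof -
  let ?L = "join P R"
  let ?Z = "{z \<in> V - ?L. bad z (P, R)}"
  let ?E = "{Y \<in> B. \<not> Y \<subseteq> ?L}"
  have sL: "fvec.subspace ?L" by (rule subspace_join)
  have fin: "finite (V - ?L)" "finite ?E" using vsD(2)[OF V] finB by auto
  have ge: "s ^ 2 \<le> card {Y \<in> ?E. Y \<subseteq> ext z ?L}" if z: "z \<in> ?Z" for z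
  proof -
    obtain Y where Y: "Y \<in> B" "Y \<subseteq> ext z ?L" "\<not> Y \<subseteq> ?L" using z by (auto simp: bad_def)
    have "s ^ 2 \<le> card {Y \<in> B. \<not> Y \<subseteq> ?L \<and> Y \<subseteq> ext z ?L}"
      by (rule plane_extra[OF L subspace_ext[OF sL] ext_superset Y])
    also have "{Y \<in> B. \<not> Y \<subseteq> ?L \<and> Y \<subseteq> ext z ?L} = {Y \<in> ?E. Y \<subseteq> ext z ?L}" by blast
    finally show ?thesis .
  qed
  have "s ^ 2 * card ?Z = (\<Sum>z\<in>?Z. s ^ 2)" by simp
  also have "\<dots> \<le> (\<Sum>z\<in>?Z. card {Y \<in> ?E. Y \<subseteq> ext z ?L})" by (rule sum_mono) (rule ge)
  also have "\<dots> \<le> (\<Sum>z\<in>V - ?L. card {Y \<in> ?E. Y \<subseteq> ext z ?L})" by (rule sum_mono2) (use fin in auto)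
  also have "\<dots> = (\<Sum>Y\<in>?E. card {z \<in> V - ?L. Y \<subseteq> ext z ?L})" by (rule sum_card_swap[OF fin])
  also have "\<dots> = (\<Sum>Y\<in>?E. q ^ 3 - q ^ 2)"
  proof (rule sum.cong[OF refl])
    fix Y assume "Y \<in> ?E"
    then have Y: "Y \<in> pts V" "\<not> Y \<subseteq> ?L" using in_pts by auto
    show "card {z \<in> V - ?L. Y \<subseteq> ext z ?L} = q ^ 3 - q ^ 2"
      using card_ext_through[OF subV line[OF L] Y] by (simp add: numeral_3_eq_3 numeral_2_eq_2)
  qed
  also have "\<dots> \<le> card B * (q ^ 3 - q ^ 2)" by (simp add: card_mono[OF finB])
  finally show ?thesis .
qed

text \<open>Averages over the vectors \<open>z\<close> off all secants. The constant 45 is what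
  \<open>s ^ 2 (1 - (7 / 6) ^ 2 / (s (s + 1))) > 45\<close> allows for \<open>s \<ge> 7\<close>.\<close>

lemma centre_exists:
  assumes N: "2 * k + 2 \<le> N"
  shows "\<exists>z\<in>V. z \<notin> on_secant"
    and "6 * card B \<le> 7 * q ^ k \<Longrightarrow>
      \<exists>z\<in>V - on_secant. 45 * card {PR \<in> pairs B. bad z PR} * q ^ k \<le> card B ^ 3"
proof -
  define Q b G where "Q = real q ^ k" and "b = real (card B)" and "G = real q ^ 2"
  define S where "S = real (card on_secant)"
  have fin: "finite V" "finite on_secant" using vsD(2)[OF V] finite_subset[of on_secant V] unfolding on_secant_def by auto
  have SV: "on_secant \<subseteq> V" unfolding on_secant_def by blast
  have Q1: "Q \<ge> 1" unfolding Q_def using rq by (intro one_le_power) simp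
  have G1: "G \<ge> 1" unfolding G_def using rq by (intro one_le_power) simp
  have b3: "b \<le> 3 * Q"
  proof -
    have "real (2 * card B) < real (3 * q ^ k + 3)" using small by (simp only: of_nat_less_iff)
    then show ?thesis using Q1 unfolding b_def Q_def by simp
  qed
  have b0: "b > 0" using size_gt unfolding b_def by simp
  have S56: "56 * S \<le> b ^ 2 * G"
  proof -
    have "7 * (7 + 1) \<le> s * (s + 1)" using s7 by (intro mult_le_mono) auto
    then have "56 * card on_secant \<le> s * (s + 1) * card on_secant" by (intro mult_le_mono1) simp
    then have "56 * card on_secant \<le> card B ^ 2 * q ^ 2" using card_on_secant by linarith
    then have "real (56 * card on_secant) \<le> real (card B ^ 2 * q ^ 2)" by (simp only: of_nat_le_iff)
    then show ?thesis unfolding S_def b_def G_def by simp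
  qed
  have VN: "Q ^ 2 * G \<le> real (card V)"
  proof -
    have "q ^ (2 * k + 2) \<le> q ^ N" using N q_gt by (intro power_increasing) auto
    then have "real (q ^ (2 * k + 2)) \<le> real (card V)" unfolding vsD(3)[OF V] by (simp only: of_nat_le_iff)
    moreover have "real q ^ (2 * k + 2) = (real q ^ k) ^ 2 * real q ^ 2"
      by (simp only: power_mult[symmetric] power_add mult.commute[of 2])
    ultimately show ?thesis unfolding Q_def G_def by (simp only: of_nat_power)
  qed
  have cD: "real (card (V - on_secant)) = real (card V) - S"
    using card_Diff_subset[OF fin(2) SV] card_mono[OF fin(1) SV] unfolding S_def by (simp add: of_nat_diff)
  show "\<exists>z\<in>V. z \<notin> on_secant"
  proof (rule ccontr)
    assume "\<not> ?thesis"
    then have "V - on_secant = {}" by blast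
    then have "real (card V) = S" using cD by (simp only: card.empty of_nat_0)
    then have "56 * (Q ^ 2 * G) \<le> b ^ 2 * G" using VN S56 by linarith
    also have "\<dots> \<le> (3 * Q) ^ 2 * G" using b3 b0 G1 by (intro mult_right_mono power_mono) auto
    finally have "56 * (Q ^ 2 * G) \<le> 9 * (Q ^ 2 * G)" by (simp add: power_mult_distrib)
    moreover have "Q ^ 2 * G > 0" using Q1 G1 by simp
    ultimately show False by linarith
  qed
  assume six: "6 * card B \<le> 7 * q ^ k"
  have b7: "6 * b \<le> 7 * Q"
  proof -
    have "real (6 * card B) \<le> real (7 * q ^ k)" using six by (simp only: of_nat_le_iff)
    then show ?thesis unfolding b_def Q_def by simp
  qed
  show "\<exists>z\<in>V - on_secant. 45 * card {PR \<in> pairs B. bad z PR} * q ^ k \<le> card B ^ 3"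
  proof (rule ccontr)
    assume neg: "\<not> ?thesis"
    let ?n = "\<lambda>z. card {PR \<in> pairs B. bad z PR}"
    have gt: "b ^ 3 \<le> 45 * Q * real (?n z)" if "z \<in> V - on_secant" for z
    proof -
      have "card B ^ 3 \<le> 45 * ?n z * q ^ k" using neg that by (meson not_le order.strict_implies_order)
      then have "real (card B ^ 3) \<le> real (45 * ?n z * q ^ k)" by (simp only: of_nat_le_iff)
      then show ?thesis unfolding b_def Q_def by (simp add: mult_ac)
    qed
    have fP: "finite (pairs B)" by (rule finite_pairs[OF finB])
    have fD: "finite (V - on_secant)" using fin(1) by simp
    have "(\<Sum>z\<in>V - on_secant. s ^ 2 * ?n z) = s ^ 2 * (\<Sum>PR\<in>pairs B. card {z \<in> V - on_secant. bad z PR})"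
      unfolding sum_distrib_left[symmetric] sum_card_swap[OF fD fP] ..
    also have "\<dots> = (\<Sum>PR\<in>pairs B. s ^ 2 * card {z \<in> V - on_secant. bad z PR})" by (rule sum_distrib_left)
    also have "\<dots> \<le> (\<Sum>PR\<in>pairs B. card B * (q ^ 3 - q ^ 2))"
    proof (rule sum_mono)
      fix x assume "x \<in> pairs B"
      then obtain P R where x: "x = (P, R)" "P \<in> B" "R \<in> B" "P \<noteq> R" unfolding pairs_def by blast
      have "card {z \<in> V - on_secant. bad z x} \<le> card {z \<in> V - join P R. bad z (P, R)}"
        by (rule card_mono) (use fin x in \<open>auto simp: on_secant_def\<close>)
      then have "s ^ 2 * card {z \<in> V - on_secant. bad z x} \<le> s ^ 2 * card {z \<in> V - join P R. bad z (P, R)}" by simp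
      also have "\<dots> \<le> card B * (q ^ 3 - q ^ 2)" by (rule bad_centres[OF x(2-4)])
      finally show "s ^ 2 * card {z \<in> V - on_secant. bad z x} \<le> card B * (q ^ 3 - q ^ 2)" .
    qed
    also have "\<dots> = card (pairs B) * (card B * (q ^ 3 - q ^ 2))" by simp
    also have "\<dots> \<le> (card B * card B) * (card B * (q ^ 3 - q ^ 2))"
      unfolding card_pairs[OF finB] by (intro mult_le_mono1 mult_le_mono2) simp
    also have "\<dots> \<le> (card B * card B) * (card B * (q ^ k * q ^ 2))"
    proof (intro mult_le_mono2)
      have "q ^ 1 \<le> q ^ k" using k1 q_gt by (intro power_increasing) auto
      then have "q ^ 1 * q ^ 2 \<le> q ^ k * q ^ 2" by (rule mult_le_mono1)
      moreover have "q ^ 3 = q ^ 1 * q ^ 2" by (simp add: power3_eq_cube power2_eq_square)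
      ultimately show "q ^ 3 - q ^ 2 \<le> q ^ k * q ^ 2" by linarith
    qed
    finally have "real (\<Sum>z\<in>V - on_secant. s ^ 2 * ?n z) \<le> real ((card B * card B) * (card B * (q ^ k * q ^ 2)))"
      by (simp only: of_nat_le_iff)
    then have up: "(\<Sum>z\<in>V - on_secant. real s ^ 2 * real (?n z)) \<le> b ^ 3 * Q * G"
      unfolding b_def Q_def G_def by (simp add: power3_eq_cube mult_ac)
    have s49: "49 \<le> real s ^ 2"
    proof -
      have "7 ^ 2 \<le> real s ^ 2" using s7 by (intro power_mono) auto
      then show ?thesis by simp
    qed
    have "49 * (b ^ 3 * real (card (V - on_secant))) = (\<Sum>z\<in>V - on_secant. 49 * b ^ 3)" by simp
    also have "\<dots> \<le> (\<Sum>z\<in>V - on_secant. 45 * Q * (real s ^ 2 * real (?n z)))"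
    proof (rule sum_mono)
      fix z assume z: "z \<in> V - on_secant"
      have "49 * b ^ 3 \<le> 49 * (45 * Q * real (?n z))" using gt[OF z] by simp
      also have "\<dots> \<le> real s ^ 2 * (45 * Q * real (?n z))" using s49 Q1 by (intro mult_right_mono) auto
      also have "\<dots> = 45 * Q * (real s ^ 2 * real (?n z))" by (simp only: mult_ac)
      finally show "49 * b ^ 3 \<le> 45 * Q * (real s ^ 2 * real (?n z))" .
    qed
    also have "\<dots> = 45 * Q * (\<Sum>z\<in>V - on_secant. real s ^ 2 * real (?n z))" by (simp only: sum_distrib_left)
    also have "\<dots> \<le> 45 * Q * (b ^ 3 * Q * G)" using up Q1 by (intro mult_left_mono) auto
    also have "\<dots> = b ^ 3 * (45 * (Q ^ 2 * G))" by (simp add: power2_eq_square)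
    finally have "b ^ 3 * (49 * real (card (V - on_secant))) \<le> b ^ 3 * (45 * (Q ^ 2 * G))" by (simp only: mult_ac)
    then have fin1: "49 * real (card (V - on_secant)) \<le> 45 * (Q ^ 2 * G)" using b0 by simp
    have "(6 * b) ^ 2 * G \<le> (7 * Q) ^ 2 * G" using b7 b0 G1 by (intro mult_right_mono power_mono) auto
    then have "36 * (b ^ 2 * G) \<le> 49 * (Q ^ 2 * G)" by (simp add: power_mult_distrib)
    then have "36 * 56 * S \<le> 49 * (Q ^ 2 * G)" using S56 by linarith
    moreover have "Q ^ 2 * G > 0" using Q1 G1 by simp
    ultimately show False using fin1 cD VN by linarith
  qed
qed

end

section \<open>Repairing an almost additive function\<close>

text \<open>For fixed \<open>a\<close> the difference \<open>lam (a + x) - lam x\<close> takes the value \<open>lam a\<close> for more than 4/5 of all \<open>x\<close> if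
  \<open>a\<close> is in \<open>T\<close>. As \<open>T + T = U\<close>, it takes a single value \<open>m a\<close> for more than 3/5 of all \<open>x\<close>, whatever
  \<open>a\<close>. Majorities of 4/5, 3/5 and 3/5 have a common \<open>x\<close>, which gives \<open>m (a + b) = m a + m b\<close> first for
  \<open>a\<close> in \<open>T\<close> and then for all sums of two elements of \<open>T\<close>.\<close>

lemma (in vec_space) additive_correction:
  fixes lam :: "'b \<Rightarrow> 'a"
  assumes K: "is_subfield K" and U: "Ksub K U" "finite U"
    and hom: "\<And>c x. c \<in> K \<Longrightarrow> x \<in> U \<Longrightarrow> lam (c *s x) = c * lam x"
    and T: "T \<subseteq> U" "\<And>u. u \<in> T \<Longrightarrow> 5 * card {w \<in> U. lam (u + w) \<noteq> lam u + lam w} < card U" "card U < 2 * card T"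
  obtains m where "\<And>x y. x \<in> U \<Longrightarrow> y \<in> U \<Longrightarrow> m (x + y) = m x + m y"
    "\<And>c x. c \<in> K \<Longrightarrow> x \<in> U \<Longrightarrow> m (c *s x) = c * m x" "\<And>x. x \<in> T \<Longrightarrow> m x = lam x"
proof -
  define D where "D a c = {x \<in> U. lam (a + x) - lam x \<noteq> c}" for a c
  have finD: "finite (D a c)" for a c using U(2) by (simp add: D_def)
  note add = Ksub_add[OF U(1)]
  have cover: "card (D (a + b) (c + c')) \<le> card (D a c) + card (D b c')" if ab: "a \<in> U" "b \<in> U" for a b c c'
  proof -
    have "D (a + b) (c + c') \<subseteq> {x \<in> U. b + x \<in> D a c} \<union> D b c'"
    proof
      fix x assume "x \<in> D (a + b) (c + c')"
      then have x: "x \<in> U" "lam (a + b + x) - lam x \<noteq> c + c'" by (auto simp: D_def)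
      show "x \<in> {x \<in> U. b + x \<in> D a c} \<union> D b c'"
      proof (rule ccontr)
        assume "x \<notin> {x \<in> U. b + x \<in> D a c} \<union> D b c'"
        then have "lam (a + (b + x)) - lam (b + x) = c" "lam (b + x) - lam x = c'"
          using x(1) add[OF ab(2) x(1)] by (auto simp: D_def)
        then have "lam (a + (b + x)) - lam x = c + c'" by (simp add: algebra_simps)
        then show False using x(2) by (simp add: add.assoc)
      qed
    qed
    then have "card (D (a + b) (c + c')) \<le> card ({x \<in> U. b + x \<in> D a c} \<union> D b c')"
      by (intro card_mono) (use U(2) finD in auto)
    also have "\<dots> \<le> card {x \<in> U. b + x \<in> D a c} + card (D b c')" by (rule card_Un_le)
    also have "card {x \<in> U. b + x \<in> D a c} \<le> card (D a c)"
      by (rule card_inj_on_le[where f = "\<lambda>x. b + x"]) (use finD in \<open>auto intro: inj_onI\<close>)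
    finally show ?thesis by simp
  qed
  have excl: "c = c'" if small: "card (D a c) + card (D a c') < card U" for a c c'
  proof (rule ccontr)
    assume ne: "c \<noteq> c'"
    \<comment> \<open>No \<open>x\<close> can give both values.\<close>
    have "U \<subseteq> D a c \<union> D a c'" using ne by (auto simp: D_def)
    then have "card U \<le> card (D a c \<union> D a c')" by (intro card_mono) (use finD in auto)
    also have "\<dots> \<le> card (D a c) + card (D a c')" by (rule card_Un_le)
    finally show False using small by simp
  qed
  have DT: "5 * card (D u (lam u)) < card U" if "u \<in> T" for u
  proof -
    have "D u (lam u) = {w \<in> U. lam (u + w) \<noteq> lam u + lam w}" by (auto simp: D_def algebra_simps)
    then show ?thesis using T(2)[OF that] by simp
  qed
  have split: "\<exists>u\<in>T. \<exists>v\<in>T. a = u + v" if a: "a \<in> U" for a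
  proof (rule ccontr)
    assume no: "\<not> ?thesis"
    have finT: "finite T" using T(1) U(2) finite_subset by blast
    have "T \<inter> (\<lambda>x. a - x) ` T = {}"
    proof (rule equals0I)
      fix x assume "x \<in> T \<inter> (\<lambda>x. a - x) ` T"
      then obtain y where y: "x \<in> T" "y \<in> T" "x = a - y" by blast
      then have "a = x + y" by simp
      then show False using no y(1,2) by blast
    qed
    then have "card (T \<union> (\<lambda>x. a - x) ` T) = card T + card ((\<lambda>x. a - x) ` T)"
      using finT by (intro card_Un_disjoint) auto
    also have "card ((\<lambda>x. a - x) ` T) = card T" by (rule card_image) (auto intro: inj_onI)
    finally have "2 * card T = card (T \<union> (\<lambda>x. a - x) ` T)" by simp
    also have "\<dots> \<le> card U" by (rule card_mono[OF U(2)]) (use T(1) Ksub_diff[OF K U(1) a] in blast)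
    finally show False using T(3) by simp
  qed
  define m where "m a = (SOME c. 5 * card (D a c) < 2 * card U)" for a
  have m: "5 * card (D a (m a)) < 2 * card U" if a: "a \<in> U" for a
  proof -
    obtain u v where uv: "u \<in> T" "v \<in> T" "a = u + v" using split[OF a] by blast
    have "card (D a (lam u + lam v)) \<le> card (D u (lam u)) + card (D v (lam v))"
      unfolding uv(3) by (rule cover) (use uv T(1) in auto)
    then have "5 * card (D a (lam u + lam v)) < 2 * card U" using DT[OF uv(1)] DT[OF uv(2)] by linarith
    then show ?thesis unfolding m_def by (rule someI)
  qed
  have mT: "m u = lam u" if u: "u \<in> T" for u
  proof (rule excl[of u])
    show "card (D u (m u)) + card (D u (lam u)) < card U" using m[of u] DT[OF u] u T(1) by fastforce
  qed
  have step: "m (u + b) = m u + m b" if u: "u \<in> T" and b: "b \<in> U" for u b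
  proof (rule excl[of "u + b"])
    have uU: "u \<in> U" using u T(1) by blast
    have "card (D (u + b) (m u + m b)) \<le> card (D u (m u)) + card (D b (m b))" by (rule cover[OF uU b])
    then show "card (D (u + b) (m (u + b))) + card (D (u + b) (m u + m b)) < card U"
      using m[OF add[OF uU b]] m[OF b] DT[OF u] mT[OF u] by simp
  qed
  have madd: "m (x + y) = m x + m y" if xy: "x \<in> U" "y \<in> U" for x y
  proof -
    obtain u v where uv: "u \<in> T" "v \<in> T" "x = u + v" using split[OF xy(1)] by blast
    have vU: "v \<in> U" using uv(2) T(1) by blast
    have "m (x + y) = m (u + (v + y))" using uv(3) by (simp add: add.assoc)
    also have "\<dots> = m u + (m v + m y)" using step[OF uv(1) add[OF vU xy(2)]] step[OF uv(2) xy(2)] by simp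
    also have "\<dots> = m x + m y" using step[OF uv(1) vU] uv(3) by (simp add: add.assoc)
    finally show ?thesis .
  qed
  have mhom: "m (c *s x) = c * m x" if cx: "c \<in> K" "x \<in> U" for c x
  proof (cases "c = 0")
    case True
    have "m (0 + 0) = m 0 + m 0" by (rule madd) (use Ksub_zero[OF U(1)] in auto)
    then have "m 0 = 0" by (metis add_0_left add_cancel_left_left)
    then show ?thesis using True by simp
  next
    case False
    have ic: "inverse c \<in> K" using K cx(1) by (auto simp: is_subfield_def)
    have "card (D (c *s x) (c * m x)) \<le> card (D x (m x))"
    proof (rule card_inj_on_le[where f = "\<lambda>y. inverse c *s y"])
      show "inj_on (\<lambda>y. inverse c *s y) (D (c *s x) (c * m x))"
        by (rule inj_onI) (use False in simp)
      show "(\<lambda>y. inverse c *s y) ` D (c *s x) (c * m x) \<subseteq> D x (m x)"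
      proof
        fix w assume "w \<in> (\<lambda>y. inverse c *s y) ` D (c *s x) (c * m x)"
        then obtain y where y: "y \<in> U" "lam (c *s x + y) - lam y \<noteq> c * m x" "w = inverse c *s y" by (auto simp: D_def)
        have w: "w \<in> U" unfolding y(3) by (rule Ksub_scale[OF U(1) ic y(1)])
        have yw: "y = c *s w" using y(3) False by simp
        have "lam (c *s x + y) = c * lam (x + w)" using hom[OF cx(1) add[OF cx(2) w]] yw by (simp add: scale_right_distrib)
        moreover have "lam y = c * lam w" using hom[OF cx(1) w] yw by simp
        ultimately have "c * (lam (x + w) - lam w) \<noteq> c * m x" using y(2) by (simp add: right_diff_distrib)
        then show "w \<in> D x (m x)" using w by (auto simp: D_def)
      qed
    qed (rule finD)
    then have "card (D (c *s x) (m (c *s x))) + card (D (c *s x) (c * m x)) < card U"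
      using m[OF Ksub_scale[OF U(1) cx]] m[OF cx(2)] by linarith
    then show ?thesis by (rule excl)
  qed
  show thesis by (rule that[OF madd mhom mT])
qed

section \<open>Projection from a point off all secants\<close>

text \<open>The hyperplane \<open>H\<close> is a model of the quotient of \<open>V\<close> by \<open>z\<close>.\<close>

locale projection = small_set_one_mod p t F s k N V B
  for p t :: nat and F :: "'f::{field,finite} itself"
  and s k N :: nat and V :: "(nat \<Rightarrow> 'f) set" and B :: "(nat \<Rightarrow> 'f) set set" +
  fixes z :: "nat \<Rightarrow> 'f" and H :: "(nat \<Rightarrow> 'f) set"
  assumes z: "z \<in> V" "z \<notin> on_secant" and H: "vs (N - 1) H" "H \<subseteq> V" "z \<notin> H" "ext z H = V"
begin

lemma sH: "fvec.subspace H" by (rule vsD(1)[OF H(1)])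

lemma z_line: "P \<in> B \<Longrightarrow> R \<in> B \<Longrightarrow> P \<noteq> R \<Longrightarrow> z \<notin> join P R"
  using z unfolding on_secant_def by blast

lemma z_point: assumes "P \<in> B" shows "z \<notin> P"
proof -
  obtain R where "R \<in> B" "R \<noteq> P" using two_points[OF assms] by blast
  then show ?thesis using z_line[OF assms, of R] join_upper(1)[of P R] by blast
qed

lemma multiple_z: assumes "fvec.subspace W" "z \<notin> W" "fscale c z \<in> W" shows "c = 0"
proof (rule ccontr)
  assume "c \<noteq> 0"
  have "fscale (inverse c) (fscale c z) \<in> W" by (rule fvec.subspace_scale[OF assms(1,3)])
  then show False using \<open>c \<noteq> 0\<close> assms(2) by simp
qed

lemma split_H: assumes "x \<in> V" obtains h c where "h \<in> H" "x = h + fscale c z"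
  using assms unfolding H(4)[symmetric] fv.Kext_iff by blast

text \<open>The projection of \<open>P\<close> from \<open>z\<close> onto \<open>H\<close>.\<close>

definition bar :: "(nat \<Rightarrow> 'f) set \<Rightarrow> (nat \<Rightarrow> 'f) set" where
  "bar P = ext z P \<inter> H"

lemma bar_point:
  assumes P: "P \<in> B"
  obtains h c where "h \<in> H" "h \<noteq> 0" "h + fscale c z \<in> P" "bar P = fvec.span {h}"
proof -
  obtain x where x: "x \<in> P" "x \<noteq> 0" "x \<in> V" "P = fvec.span {x}" using point_gen[OF in_pts[OF P]] by metis
  have sP: "fvec.subspace P" by (rule point_subspace[OF in_pts[OF P]])
  obtain h c where h: "h \<in> H" "x = h + fscale c z" using split_H[OF x(3)] .
  have h0: "h \<noteq> 0"
  proof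
    assume "h = 0"
    then have xc: "x = fscale c z" using h(2) by simp
    then have "c = 0" using multiple_z[OF sP z_point[OF P]] x(1) by simp
    then show False using xc x(2) by simp
  qed
  have "bar P = fvec.span {h}"
  proof
    show "bar P \<subseteq> fvec.span {h}"
    proof
      fix y assume y: "y \<in> bar P"
      then have "y \<in> ext z P" by (simp add: bar_def)
      then obtain w d where wd: "w \<in> P" "y = w + fscale d z" unfolding fv.Kext_iff by blast
      obtain a where a: "w = fscale a x" using wd(1) x(4) mem_span_singleton by blast
      have e: "y = fscale a h + fscale (a * c + d) z"
        unfolding wd(2) a h(2) by (simp add: fvec.scale_right_distrib fvec.scale_left_distrib)
      have ah: "fscale a h \<in> H" by (rule fvec.subspace_scale[OF sH h(1)])
      have "y - fscale a h \<in> H" using y ah fvec.subspace_diff[OF sH] by (simp add: bar_def)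
      then have "fscale (a * c + d) z \<in> H" using e by simp
      then have "a * c + d = 0" by (rule multiple_z[OF sH H(3)])
      then have "y = fscale a h" using e by simp
      then show "y \<in> fvec.span {h}" unfolding mem_span_singleton by blast
    qed
    have "h = x + fscale (- c) z" using h(2) by simp
    then have "h \<in> ext z P" unfolding fv.Kext_iff using x(1) by blast
    then have "fvec.span {h} \<subseteq> ext z P" using span_le_iff[OF subspace_ext[OF sP]] by simp
    moreover have "fvec.span {h} \<subseteq> H" using span_le_iff[OF sH] h(1) by simp
    ultimately show "fvec.span {h} \<subseteq> bar P" unfolding bar_def by blast
  qed
  then show thesis using that h h0 x(1) by simp
qed

text \<open>Otherwise a nonzero multiple of \<open>z\<close> is a difference of vectors of \<open>P\<close> and \<open>R\<close>, which puts \<open>z\<close> on a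
  secant or in a point of \<open>B\<close>.\<close>

lemma lift_unique:
  assumes P: "P \<in> B" "u + fscale a z \<in> P" and R: "R \<in> B" "u + fscale b z \<in> R"
  shows "a = b"
proof -
  have d: "(u + fscale a z) - (u + fscale b z) = fscale (a - b) z" by (simp add: fvec.scale_left_diff_distrib)
  have "a - b = 0"
  proof (cases "P = R")
    case True
    have sP: "fvec.subspace P" by (rule point_subspace[OF in_pts[OF P(1)]])
    have "fscale (a - b) z \<in> P" using fvec.subspace_diff[OF sP P(2)] R(2) True unfolding d[symmetric] by blast
    then show ?thesis by (rule multiple_z[OF sP z_point[OF P(1)]])
  next
    case False
    have "fscale (a - b) z \<in> join P R" unfolding d[symmetric]
      by (rule fvec.subspace_diff[OF subspace_join]) (use P(2) R(2) join_upper[where P=P and R=R] in auto)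
    then show ?thesis by (rule multiple_z[OF subspace_join z_line[OF P(1) R(1) False]])
  qed
  then show ?thesis by simp
qed

lemma lift_nonzero: assumes "u \<in> H" "u \<noteq> 0" shows "u + fscale c z \<noteq> 0"
proof
  assume 0: "u + fscale c z = 0"
  then have "fscale c z = - u" by (simp add: add_eq_0_iff)
  then have "fscale c z \<in> H" using fvec.subspace_neg[OF sH assms(1)] by simp
  then have "c = 0" by (rule multiple_z[OF sH H(3)])
  then show False using 0 assms(2) by simp
qed

lemma bar_lift:
  assumes P: "P \<in> B" and u: "u \<in> H" "u \<noteq> 0" "bar P = fvec.span {u}"
  obtains c where "u + fscale c z \<in> P"
proof -
  obtain h c where h: "h \<in> H" "h \<noteq> 0" "h + fscale c z \<in> P" "bar P = fvec.span {h}" using bar_point[OF P] .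
  have "u \<in> fvec.span {h}" using u(3) h(4) mem_span_self[of u] by simp
  then obtain a where a: "u = fscale a h" unfolding mem_span_singleton by blast
  have "fscale a (h + fscale c z) \<in> P" by (rule fvec.subspace_scale[OF point_subspace[OF in_pts[OF P]] h(3)])
  then have "u + fscale (a * c) z \<in> P" using a by (simp add: fvec.scale_right_distrib)
  then show thesis by (rule that)
qed

lemma inj_bar: "inj_on bar B"
proof (rule inj_onI)
  fix P R assume PR: "P \<in> B" "R \<in> B" "bar P = bar R"
  obtain h c where h: "h \<in> H" "h \<noteq> 0" "h + fscale c z \<in> P" "bar P = fvec.span {h}" using bar_point[OF PR(1)] .
  obtain c' where c': "h + fscale c' z \<in> R" using bar_lift[OF PR(2) h(1,2)] h(4) PR(3) by auto
  have "c = c'" by (rule lift_unique[OF PR(1) h(3) PR(2) c'])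
  then show "P = R"
    using point_eq[OF in_pts[OF PR(1)] h(3) lift_nonzero[OF h(1,2)]] point_eq[OF in_pts[OF PR(2)] c' lift_nonzero[OF h(1,2)]] by simp
qed

lemma bar_le_iff:
  assumes P: "P \<in> B" and T: "fvec.subspace T" "T \<subseteq> H"
  shows "bar P \<subseteq> T \<longleftrightarrow> P \<subseteq> ext z T"
proof
  assume a: "bar P \<subseteq> T"
  obtain h c where h: "h \<in> H" "h \<noteq> 0" "h + fscale c z \<in> P" "bar P = fvec.span {h}" using bar_point[OF P] .
  have "h \<in> T" using a h(4) mem_span_self[of h] by blast
  then have "h + fscale c z \<in> ext z T" unfolding fv.Kext_iff by blast
  then show "P \<subseteq> ext z T"
    using point_le_iff[OF in_pts[OF P] subspace_ext[OF T(1)] h(3) lift_nonzero[OF h(1,2)]] by simp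
next
  assume a: "P \<subseteq> ext z T"
  show "bar P \<subseteq> T"
  proof
    fix y assume y: "y \<in> bar P"
    have "ext z P \<subseteq> ext z T" by (rule ext_least[OF subspace_ext[OF T(1)] a ext_mem[OF T(1)]])
    then have "y \<in> ext z T" "y \<in> H" using y by (auto simp: bar_def)
    then obtain w c where w: "w \<in> T" "y = w + fscale c z" unfolding fv.Kext_iff by blast
    have "y - w \<in> H" by (rule fvec.subspace_diff[OF sH \<open>y \<in> H\<close>]) (use w(1) T(2) in blast)
    then have "fscale c z \<in> H" using w(2) by simp
    then have "c = 0" by (rule multiple_z[OF sH H(3)])
    then show "y \<in> T" using w by simp
  qed
qed

text \<open>The preimage of a subspace \<open>T\<close> of \<open>H\<close> is spanned by \<open>T\<close> and \<open>z\<close>, has the same codimension, and contains the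
  points of \<open>B\<close> over those in \<open>T\<close>.\<close>

lemma one_mod_bar: "one_mod s k (N - 1) H (bar ` B)"
  unfolding one_mod_def
proof (intro conjI allI impI H(1))
  show "bar ` B \<subseteq> pts H"
  proof (clarify)
    fix P assume "P \<in> B"
    then obtain h c where "h \<in> H" "h \<noteq> 0" "bar P = fvec.span {h}" using bar_point by metis
    then show "bar P \<in> pts H" unfolding pts_iff by blast
  qed
  show "2 * card (bar ` B) < 3 * q ^ k + 3" using small card_image[OF inj_bar] by simp
next
  fix T assume T: "vs (N - 1 - k) T" "T \<subseteq> H"
  have sT: "fvec.subspace T" by (rule vsD(1)[OF T(1)])
  have zT: "z \<notin> T" using T(2) H(3) by blast
  have "Suc (N - 1 - k) = N - k" using kN by simp
  then have v: "vs (N - k) (ext z T)" using vs_ext[OF T(1) zT] by simp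
  have le: "ext z T \<subseteq> V" by (rule ext_least[OF subV _ z(1)]) (use T(2) H(2) in blast)
  have "points_in (bar ` B) T = bar ` points_in B (ext z T)"
    using bar_le_iff[OF _ sT T(2)] by (auto simp: points_in_def)
  moreover have "inj_on bar (points_in B (ext z T))" by (rule inj_on_subset[OF inj_bar]) (auto simp: points_in_def)
  ultimately have "card (points_in (bar ` B) T) = card (points_in B (ext z T))" by (simp add: card_image)
  then show "[card (points_in (bar ` B) T) = 1] (mod s)" using cong[OF v le] by simp
qed

section \<open>Lifting the linear structure\<close>

text \<open>The height of the point of \<open>B\<close> above \<open>u\<close>. The value at \<open>0\<close> is chosen so that \<open>lam\<close> is homogeneous.\<close>

definition lam :: "(nat \<Rightarrow> 'f) \<Rightarrow> 'f" where
  "lam u = (if u = 0 then 0 else THE c. \<exists>P\<in>B. u + fscale c z \<in> P)"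

lemma lam_eq: assumes "u \<noteq> 0" "P \<in> B" "u + fscale c z \<in> P" shows "lam u = c"
proof -
  have "(THE c. \<exists>P\<in>B. u + fscale c z \<in> P) = c"
    by (rule the_equality) (use assms lift_unique in blast)+
  then show ?thesis using assms(1) by (simp add: lam_def)
qed

lemma lam_lift:
  assumes P: "P \<in> B" and u: "u \<in> H" "u \<noteq> 0" "bar P = fvec.span {u}"
  shows "u + fscale (lam u) z \<in> P"
proof -
  obtain c where c: "u + fscale c z \<in> P" using bar_lift[OF assms] .
  then show ?thesis using lam_eq[OF u(2) P c] by simp
qed

lemma lam_scale:
  assumes u: "u \<in> H" "u \<noteq> 0 \<Longrightarrow> fvec.span {u} \<in> bar ` B"
  shows "lam (fscale c u) = c * lam u"
proof (cases "u = 0 \<or> c = 0")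
  case True then show ?thesis by (auto simp: lam_def)
next
  case False
  then obtain P where P: "P \<in> B" "bar P = fvec.span {u}" using u(2) by auto
  have "fscale c (u + fscale (lam u) z) \<in> P"
    by (rule fvec.subspace_scale[OF point_subspace[OF in_pts[OF P(1)]] lam_lift[OF P(1) u(1) _ P(2)]]) (use False in blast)
  then have "fscale c u + fscale (c * lam u) z \<in> P" by (simp add: fvec.scale_right_distrib)
  then show ?thesis by (rule lam_eq[rotated 2]) (use False P in auto)
qed

text \<open>If \<open>(P, R)\<close> is not bad, the point of \<open>B\<close> above \<open>u + v\<close> lies on the line joining \<open>P\<close> and \<open>R\<close>, and so does the
  sum of the lifts of \<open>u\<close> and \<open>v\<close>. Their difference is a multiple of \<open>z\<close>, which is off that line.\<close>

lemma lam_add: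
  assumes u: "u \<in> H" "u \<noteq> 0" "bar P = fvec.span {u}" and v: "v \<in> H" "v \<noteq> 0" "bar R = fvec.span {v}"
    and PR: "P \<in> B" "R \<in> B" "P \<noteq> R \<Longrightarrow> \<not> bad z (P, R)"
    and uv: "u + v \<noteq> 0 \<Longrightarrow> fvec.span {u + v} \<in> bar ` B"
  shows "lam (u + v) = lam u + lam v"
proof (cases "P = R")
  case True
  have "v \<in> fvec.span {u}" using u(3) v(3) True mem_span_self[of v] by simp
  then obtain c where c: "v = fscale c u" unfolding mem_span_singleton by blast
  have uv': "u + v = fscale (1 + c) u" using c by (simp add: fvec.scale_left_distrib)
  have "fvec.span {u} \<in> bar ` B" using u(3) PR(1) by force
  then have "lam (fscale d u) = d * lam u" for d using lam_scale[OF u(1)] by blast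
  then show ?thesis unfolding uv' unfolding c by (simp add: distrib_right)
next
  case False
  show ?thesis
  proof (cases "u + v = 0")
    case True
    then have "v = fscale (- 1) u" by (simp add: eq_neg_iff_add_eq_0 add.commute)
    moreover have "fvec.span {u} \<in> bar ` B" using u(3) PR(1) by force
    ultimately have "lam v = - lam u" using lam_scale[OF u(1), of "- 1"] by simp
    then show ?thesis using True by (simp add: lam_def)
  next
    case nz: False
    let ?J = "join P R"
    obtain Y where Y: "Y \<in> B" "bar Y = fvec.span {u + v}" using uv[OF nz] by force
    have uvH: "u + v \<in> H" by (rule fvec.subspace_add[OF sH u(1) v(1)])
    define w where "w = u + v + fscale (lam (u + v)) z"
    have wY: "w \<in> Y" unfolding w_def by (rule lam_lift[OF Y(1) uvH nz Y(2)])
    have w0: "w \<noteq> 0" unfolding w_def by (rule lift_nonzero[OF uvH nz])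
    have su: "u + fscale (lam u) z \<in> ?J" using lam_lift[OF PR(1) u] join_upper(1)[of P R] by blast
    have sv: "v + fscale (lam v) z \<in> ?J" using lam_lift[OF PR(2) v] join_upper(2)[of R P] by blast
    define x where "x = (u + fscale (lam u) z) + (v + fscale (lam v) z)"
    have xJ: "x \<in> ?J" unfolding x_def by (rule fvec.subspace_add[OF subspace_join su sv])
    have wx: "w = x + fscale (lam (u + v) - (lam u + lam v)) z"
      unfolding w_def x_def by (simp add: fvec.scale_left_diff_distrib fvec.scale_left_distrib algebra_simps)
    have "w \<in> ext z ?J" unfolding fv.Kext_iff using wx xJ by blast
    then have "Y \<subseteq> ext z ?J" using point_le_iff[OF in_pts[OF Y(1)] subspace_ext[OF subspace_join] wY w0] by simp
    then have "Y \<subseteq> ?J" using PR(3)[OF False] Y(1) unfolding bad_def by auto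
    then have "w - x \<in> ?J" using fvec.subspace_diff[OF subspace_join _ xJ] wY by blast
    then have "fscale (lam (u + v) - (lam u + lam v)) z \<in> ?J" using wx by simp
    then have "lam (u + v) - (lam u + lam v) = 0" by (rule multiple_z[OF subspace_join z_line[OF PR(1,2) False]])
    then show ?thesis by simp
  qed
qed

end

context projection
begin

text \<open>With \<open>x = b / Q\<close> between \<open>1\<close> and \<open>7 / 6\<close>, the claim is that \<open>x - 16/45 x ^ 3 \<ge> 3/5\<close>, and the convex
  function \<open>x ^ 3\<close> lies below its chord.\<close>

lemma typical_arith:
  fixes b Q a :: real
  assumes "Q > 0" "Q \<le> b" "6 * b \<le> 7 * Q" "45 * Q ^ 2 * a \<le> 16 * b ^ 3"
  shows "3 * Q \<le> 5 * (b - a)"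
proof -
  define x where "x = b / Q"
  have b: "b = x * Q" using assms(1) by (simp add: x_def)
  have x: "1 \<le> x" "6 * x \<le> 7" using assms(1-3) unfolding b by (simp_all add: mult_le_cancel_right)
  have "0 \<le> (x - 1) * (7 - 6 * x) * (6 * x + 13)" using x by (intro mult_nonneg_nonneg) auto
  also have "\<dots> = 127 * x - 91 - 36 * x ^ 3" by (simp add: algebra_simps power3_eq_cube)
  finally have "27 \<le> 45 * x - 16 * x ^ 3" using x by simp
  then have "Q ^ 3 * 27 \<le> Q ^ 3 * (45 * x - 16 * x ^ 3)" using assms(1) by (intro mult_left_mono) auto
  also have "\<dots> = 45 * Q ^ 2 * b - 16 * b ^ 3" unfolding b by (simp add: algebra_simps power3_eq_cube power2_eq_square)
  also have "\<dots> \<le> 45 * Q ^ 2 * b - 45 * Q ^ 2 * a" using assms(4) by simp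
  finally have "(9 * Q ^ 2) * (3 * Q) \<le> (9 * Q ^ 2) * (5 * (b - a))" by (simp add: algebra_simps power3_eq_cube power2_eq_square)
  then show ?thesis using assms(1) by (simp add: mult_le_cancel_left_pos)
qed

text \<open>A point \<open>P\<close> is typical if at least \<open>15/16 q ^ k\<close> points form a pair with it that is not bad; at least
  \<open>3/5 q ^ k\<close> points are typical. Since \<open>\<kappa> = p ^ d \<ge> 7\<close> and each point carries \<open>\<kappa> - 1\<close> or more
  of the \<open>\<kappa> q ^ k\<close> vectors of \<open>U\<close>, the hypotheses of \<open>additive_correction\<close> hold for the set \<open>T\<close> of vectors
  on typical points. Let \<open>U'\<close> be the graph of the corrected function. The set \<open>E\<close> of points of \<open>U'\<close> outside
  \<open>B\<close> has at most \<open>17/30 q ^ k\<close> elements, as their vectors come from outside \<open>T\<close>. So total weight below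
  \<open>q ^ k\<close> remains when points of \<open>E\<close> get weight \<open>1\<close> and points of \<open>B\<close> weight \<open>1 / s\<close>: through each point \<open>X\<close>
  there is an \<open>(N - k)\<close>-space without further points of \<open>E\<close> and with fewer than \<open>s\<close> further points of \<open>B\<close>
  (\<open>sparse\<close>). If \<open>X\<close> is in \<open>B\<close>, that space is tangent to \<open>B\<close>, and as it meets \<open>U'\<close> for reasons of size, \<open>X\<close> is
  a point of \<open>U'\<close>. If \<open>X\<close> is in \<open>E\<close>, its only points of \<open>U'\<close> are \<open>X\<close> and one point of \<open>B\<close>, which is
  impossible: a group is not the union of two proper subgroups.\<close>

theorem lift:
  assumes d: "d dvd t" "d > 0" "7 \<le> p ^ d"
    and U: "fv.Ksub (Fix d) U" "bar ` B = pts U" "card U = p ^ d * q ^ k" "U \<subseteq> H"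
    and six: "6 * card B \<le> 7 * q ^ k"
    and few: "45 * card {PR \<in> pairs B. bad z PR} * q ^ k \<le> card B ^ 3"
  shows "\<exists>U'. fv.Ksub (Fix d) U' \<and> B = pts U'"
proof -
  define \<kappa> Q b where "\<kappa> = real (p ^ d)" and "Q = real q ^ k" and "b = real (card B)"
  have k7: "\<kappa> \<ge> 7" using d(3) unfolding \<kappa>_def by (metis of_nat_le_iff of_nat_numeral)
  have km: "real (p ^ d - 1) = \<kappa> - 1" using d(3) unfolding \<kappa>_def by (simp add: of_nat_diff)
  have Q1: "Q \<ge> 1" unfolding Q_def using rq by (intro one_le_power) simp
  have bQ: "Q \<le> b" "6 * b \<le> 7 * Q"
  proof -
    have "real (q ^ k) \<le> real (card B)" using size_gt by (simp only: of_nat_le_iff less_imp_le)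
    then show "Q \<le> b" by (simp add: Q_def b_def)
    have "real (6 * card B) \<le> real (7 * q ^ k)" using six by (simp only: of_nat_le_iff)
    then show "6 * b \<le> 7 * Q" by (simp add: Q_def b_def)
  qed
  have finU: "finite U" using U(4) vsD(2)[OF H(1)] finite_subset by blast
  have cU: "real (card U) = \<kappa> * Q" unfolding U(3) \<kappa>_def Q_def by simp
  have U0: "0 \<in> U" by (rule fv.Ksub_zero[OF U(1)])
  have UH: "u \<in> H" if "u \<in> U" for u using that U(4) by blast
  have ptU: "fvec.span {u} \<in> bar ` B" if "u \<in> U" "u \<noteq> 0" for u
    unfolding U(2) pts_iff using that by blast
  have mass: "(\<kappa> - 1) * real (card X) \<le> real (card (vecs U (bar ` X)))" if X: "X \<subseteq> B" for X
  proof -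
    have "card (bar ` X) = card X" by (rule card_image[OF inj_on_subset[OF inj_bar X]])
    moreover have "(p ^ d - 1) * card (bar ` X) \<le> card (vecs U (bar ` X))"
      by (rule vecs_mass[OF d(1) U(1) finU]) (use X U(2) in blast)
    ultimately have "real ((p ^ d - 1) * card X) \<le> real (card (vecs U (bar ` X)))" by (simp only: of_nat_le_iff)
    then show ?thesis using km by (simp only: of_nat_mult)
  qed
  define bads where "bads P = {R \<in> B. R \<noteq> P \<and> bad z (P, R)}" for P
  define Typ where "Typ = {P \<in> B. 15 * q ^ k + 16 * card (bads P) \<le> 16 * card B}"
  have finb: "finite (bads P)" for P unfolding bads_def using finB by simp
  have TypB: "Typ \<subseteq> B" unfolding Typ_def by blast
  have Typ: "3 * Q \<le> 5 * real (card Typ)"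
  proof -
    let ?a = "card (B - Typ)"
    have "q ^ k * ?a = (\<Sum>P\<in>B - Typ. q ^ k)" by simp
    also have "\<dots> \<le> (\<Sum>P\<in>B - Typ. 16 * card (bads P))"
    proof (rule sum_mono)
      fix P assume "P \<in> B - Typ"
      then have "16 * card B < 15 * q ^ k + 16 * card (bads P)" unfolding Typ_def by auto
      then show "q ^ k \<le> 16 * card (bads P)" using size_gt by linarith
    qed
    also have "\<dots> \<le> (\<Sum>P\<in>B. 16 * card (bads P))" by (rule sum_mono2) (use finB in auto)
    also have "\<dots> = 16 * (\<Sum>P\<in>B. card (bads P))" by (rule sum_distrib_left[symmetric])
    also have "(\<Sum>P\<in>B. card (bads P)) = card (SIGMA P:B. bads P)" by (rule card_SigmaI[symmetric]) (use finB finb in auto)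
    also have "(SIGMA P:B. bads P) = {PR \<in> pairs B. bad z PR}" unfolding bads_def pairs_def by blast
    finally have "q ^ k * ?a \<le> 16 * card {PR \<in> pairs B. bad z PR}" .
    then have "45 * (q ^ k * ?a) * q ^ k \<le> 45 * (16 * card {PR \<in> pairs B. bad z PR}) * q ^ k"
      by (intro mult_le_mono1 mult_le_mono2)
    also have "\<dots> \<le> 16 * card B ^ 3" using mult_le_mono2[OF few, of 16] by (simp only: mult_ac)
    finally have "real (45 * (q ^ k * ?a) * q ^ k) \<le> real (16 * card B ^ 3)" by (simp only: of_nat_le_iff)
    then have "45 * Q ^ 2 * real ?a \<le> 16 * b ^ 3" by (simp add: Q_def b_def power2_eq_square mult_ac)
    then have "3 * Q \<le> 5 * (b - real ?a)" using typical_arith[OF _ bQ] Q1 by simp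
    moreover have "b - real ?a = real (card Typ)"
      using card_Diff_subset[OF finite_subset[OF TypB finB] TypB] card_mono[OF finB TypB] by (simp add: b_def of_nat_diff)
    ultimately show ?thesis by simp
  qed
  define T where "T = insert 0 (vecs U (bar ` Typ))"
  have finv: "finite (vecs U X)" for X unfolding vecs_def using finU by simp
  have TU: "T \<subseteq> U" unfolding T_def vecs_def using U0 by blast
  have cT: "3 * (\<kappa> - 1) * Q < 5 * real (card T)"
  proof -
    have "card T = Suc (card (vecs U (bar ` Typ)))" unfolding T_def by (rule card_insert_disjoint[OF finv]) (simp add: vecs_def)
    then have "real (card T) > (\<kappa> - 1) * real (card Typ)" using mass[OF TypB] by simp
    moreover have "(\<kappa> - 1) * (3 * Q) \<le> (\<kappa> - 1) * (5 * real (card Typ))" using Typ k7 by (intro mult_left_mono) auto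
    ultimately show ?thesis by (simp add: algebra_simps)
  qed
  have kQ: "7 * Q \<le> \<kappa> * Q" using k7 Q1 by (intro mult_right_mono) auto
  have half: "card U < 2 * card T"
  proof -
    have "real (card U) < real (2 * card T)" using cT kQ cU by (simp add: algebra_simps)
    then show ?thesis by (simp only: of_nat_less_iff)
  qed
  have typical: "5 * card {w \<in> U. lam (u + w) \<noteq> lam u + lam w} < card U" if u: "u \<in> T" for u
  proof (cases "u = 0")
    case True
    then have "{w \<in> U. lam (u + w) \<noteq> lam u + lam w} = {}" by (simp add: lam_def)
    moreover have "0 < card U" using U0 finU card_gt_0_iff by blast
    ultimately show ?thesis by (simp only: card.empty)
  next
    case False
    then have uU: "u \<in> U" and "fvec.span {u} \<in> bar ` Typ" using u by (auto simp: T_def vecs_def)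
    then obtain P where P: "P \<in> Typ" "bar P = fvec.span {u}" by force
    then have PB: "P \<in> B" and PT: "15 * q ^ k + 16 * card (bads P) \<le> 16 * card B" by (auto simp: Typ_def)
    let ?G = "vecs U (bar ` (B - bads P))"
    have "{w \<in> U. lam (u + w) \<noteq> lam u + lam w} \<subseteq> U - ?G"
    proof
      fix w assume w: "w \<in> {w \<in> U. lam (u + w) \<noteq> lam u + lam w}"
      then have wU: "w \<in> U" by blast
      have "w \<notin> ?G"
      proof
        assume "w \<in> ?G"
        then have w0: "w \<noteq> 0" and "fvec.span {w} \<in> bar ` (B - bads P)" by (auto simp: vecs_def)
        then obtain R where R: "R \<in> B" "R \<notin> bads P" "bar R = fvec.span {w}" by force
        have "lam (u + w) = lam u + lam w"
        proof (rule lam_add[OF UH[OF uU] False P(2) UH[OF wU] w0 R(3) PB R(1)])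
          show "\<not> bad z (P, R)" if "P \<noteq> R" using R(1,2) that unfolding bads_def by blast
          show "fvec.span {u + w} \<in> bar ` B" if "u + w \<noteq> 0" by (rule ptU[OF fv.Ksub_add[OF U(1) uU wU] that])
        qed
        then show False using w by blast
      qed
      then show "w \<in> U - ?G" using wU by blast
    qed
    then have "card {w \<in> U. lam (u + w) \<noteq> lam u + lam w} \<le> card (U - ?G)" by (intro card_mono) (use finU in auto)
    then have "real (card {w \<in> U. lam (u + w) \<noteq> lam u + lam w}) \<le> real (card (U - ?G))" by (simp only: of_nat_le_iff)
    also have "\<dots> = real (card U) - real (card ?G)"
    proof -
      have GU: "?G \<subseteq> U" by (auto simp: vecs_def)
      show ?thesis using card_Diff_subset[OF finv GU] card_mono[OF finU GU] by (simp add: of_nat_diff)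
    qed
    finally have a: "real (card {w \<in> U. lam (u + w) \<noteq> lam u + lam w}) \<le> \<kappa> * Q - real (card ?G)" using cU by simp
    have bB: "bads P \<subseteq> B" unfolding bads_def by blast
    have "card (B - bads P) + card (bads P) = card B"
      using card_Diff_subset[OF finb bB] card_mono[OF finB bB] by simp
    then have "15 * q ^ k \<le> 16 * card (B - bads P)" using PT by linarith
    then have "real (15 * q ^ k) \<le> real (16 * card (B - bads P))" by (simp only: of_nat_le_iff)
    then have "15 * Q \<le> 16 * real (card (B - bads P))" by (simp add: Q_def)
    then have "(\<kappa> - 1) * (15 * Q) \<le> (\<kappa> - 1) * (16 * real (card (B - bads P)))" using k7 by (intro mult_left_mono) auto
    also have "\<dots> \<le> 16 * real (card ?G)" using mass[of "B - bads P"] by auto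
    finally have "15 * (\<kappa> * Q) - 15 * Q \<le> 16 * real (card ?G)" by (simp add: algebra_simps)
    then have "real (5 * card {w \<in> U. lam (u + w) \<noteq> lam u + lam w}) < real (card U)"
      unfolding of_nat_mult of_nat_numeral cU using a kQ Q1 by linarith
    then show ?thesis by (simp only: of_nat_less_iff)
  qed
  have scale: "lam (fscale c u) = c * lam u" if "c \<in> Fix d" "u \<in> U" for c u
    by (rule lam_scale[OF UH[OF that(2)] ptU[OF that(2)]])
  obtain m where madd: "\<And>x y. x \<in> U \<Longrightarrow> y \<in> U \<Longrightarrow> m (x + y) = m x + m y"
    and mscale: "\<And>c x. c \<in> Fix d \<Longrightarrow> x \<in> U \<Longrightarrow> m (fscale c x) = c * m x" and mT: "\<And>x. x \<in> T \<Longrightarrow> m x = lam x"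
  proof -
    have "\<exists>m. (\<forall>x\<in>U. \<forall>y\<in>U. m (x + y) = m x + m y) \<and> (\<forall>c\<in>Fix d. \<forall>x\<in>U. m (fscale c x) = c * m x) \<and> (\<forall>x\<in>T. m x = lam x)"
    proof (rule fv.additive_correction[of "Fix d" U lam T])
      show "lam (fscale c x) = c * lam x" if "c \<in> Fix d" "x \<in> U" for c x by (rule scale[OF that])
      show "5 * card {w \<in> U. lam (u + w) \<noteq> lam u + lam w} < card U" if "u \<in> T" for u by (rule typical[OF that])
    qed (use is_subfield_Fix U(1) finU TU half in blast)+
    then show thesis using that by blast
  qed
  define g where "g u = u + fscale (m u) z" for u
  define U' where "U' = g ` U"
  have g0: "g 0 = 0" using mT[of 0] by (simp add: g_def T_def lam_def)
  have gnz: "g u \<noteq> 0" if "u \<in> U" "u \<noteq> 0" for u unfolding g_def by (rule lift_nonzero[OF UH[OF that(1)] that(2)])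
  have gadd: "g (x + y) = g x + g y" if "x \<in> U" "y \<in> U" for x y
    using madd[OF that] by (simp add: g_def fvec.scale_left_distrib algebra_simps)
  have KU': "fv.Ksub (Fix d) U'"
    unfolding fv.Ksub_def
  proof (intro conjI ballI)
    show "0 \<in> U'" unfolding U'_def using g0 U0 by force
    show "x + y \<in> U'" if xy: "x \<in> U'" "y \<in> U'" for x y
    proof -
      obtain u v where uv: "u \<in> U" "v \<in> U" "x = g u" "y = g v" using xy unfolding U'_def by blast
      have "x + y = g (u + v)" using gadd[OF uv(1,2)] uv(3,4) by simp
      then show ?thesis unfolding U'_def using fv.Ksub_add[OF U(1) uv(1,2)] by blast
    qed
    show "fscale c x \<in> U'" if cx: "c \<in> Fix d" "x \<in> U'" for c x
    proof -
      obtain u where u: "u \<in> U" "x = g u" using cx(2) unfolding U'_def by blast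
      have "fscale c x = g (fscale c u)" unfolding u(2) g_def mscale[OF cx(1) u(1)] by (simp add: fvec.scale_right_distrib)
      then show ?thesis unfolding U'_def using fv.Ksub_scale[OF U(1) cx(1) u(1)] by blast
    qed
  qed
  have U'V: "U' \<subseteq> V"
  proof
    fix x assume "x \<in> U'"
    then obtain u where u: "u \<in> U" "x = g u" unfolding U'_def by blast
    have "u \<in> V" using UH[OF u(1)] H(2) by blast
    then show "x \<in> V" unfolding u(2) g_def by (rule fvec.subspace_add[OF subV _ fvec.subspace_scale[OF subV z(1)]])
  qed
  have finU': "finite U'" unfolding U'_def using finU by simp
  have "inj_on g U"
  proof (rule inj_onI)
    fix x y assume xy: "x \<in> U" "y \<in> U" "g x = g y"
    have xyU: "x - y \<in> U" by (rule fv.Ksub_diff[OF is_subfield_Fix U(1) xy(1,2)])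
    have "g ((x - y) + y) = g (x - y) + g y" by (rule gadd[OF xyU xy(2)])
    then have "g (x - y) = 0" using xy(3) by simp
    then have "x - y = 0" using gnz[OF xyU] by blast
    then show "x = y" by simp
  qed
  then have cU': "card U' = card U" unfolding U'_def by (rule card_image)
  define E where "E = pts U' - B"
  have finE: "finite E" unfolding E_def using finite_pts[OF finU'] by simp
  have Ecard: "30 * real (card E) \<le> 17 * Q"
  proof -
    have "(p ^ d - 1) * card E \<le> card (vecs U' E)" by (rule vecs_mass[OF d(1) KU' finU']) (auto simp: E_def)
    also have "\<dots> \<le> card (g ` (U - T))"
    proof (rule card_mono)
      show "vecs U' E \<subseteq> g ` (U - T)"
      proof
        fix v assume v: "v \<in> vecs U' E"
        then obtain u where u: "u \<in> U" "v = g u" unfolding vecs_def U'_def by blast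
        have v0: "v \<noteq> 0" "fvec.span {v} \<notin> B" using v by (auto simp: vecs_def E_def)
        have u0: "u \<noteq> 0" using g0 u(2) v0(1) by blast
        have "u \<notin> T"
        proof
          assume uT: "u \<in> T"
          obtain P where P: "P \<in> B" "bar P = fvec.span {u}" using ptU[OF u(1) u0] by force
          have "v \<in> P" unfolding u(2) g_def mT[OF uT] by (rule lam_lift[OF P(1) UH[OF u(1)] u0 P(2)])
          then have "P = fvec.span {v}" by (rule point_eq[OF in_pts[OF P(1)] _ v0(1)])
          then show False using v0(2) P(1) by simp
        qed
        then show "v \<in> g ` (U - T)" using u by blast
      qed
    qed (use finU in simp)
    also have "\<dots> \<le> card (U - T)" by (rule card_image_le) (use finU in simp)
    also have "\<dots> = card U - card T" by (rule card_Diff_subset[OF finite_subset[OF TU finU] TU])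
    finally have "real ((p ^ d - 1) * card E) \<le> real (card U - card T)" by (simp only: of_nat_le_iff)
    then have "(\<kappa> - 1) * real (card E) \<le> \<kappa> * Q - real (card T)"
      using km card_mono[OF finU TU] cU by (simp add: of_nat_diff)
    then have "30 * ((\<kappa> - 1) * real (card E)) \<le> 30 * (\<kappa> * Q) - 18 * ((\<kappa> - 1) * Q)" using cT by (simp add: algebra_simps)
    also have "\<dots> \<le> 17 * ((\<kappa> - 1) * Q)" using kQ by (simp add: algebra_simps)
    finally have "(\<kappa> - 1) * (30 * real (card E)) \<le> (\<kappa> - 1) * (17 * Q)" by (simp only: mult.left_commute)
    then show ?thesis using k7 by (subst (asm) mult_le_cancel_left_pos) auto
  qed
  have Epts: "Y \<in> pts V" if "Y \<in> E" for Y using that pts_mono[OF U'V] unfolding E_def by blast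
  have sparse: thesis' if X: "X \<in> pts V"
    and that': "\<And>W. vs (N - k) W \<Longrightarrow> X \<subseteq> W \<Longrightarrow> W \<subseteq> V \<Longrightarrow> (\<And>Y. Y \<in> E \<Longrightarrow> Y \<subseteq> W \<Longrightarrow> Y = X) \<Longrightarrow>
      card {Y \<in> B - {X}. Y \<subseteq> W} < s \<Longrightarrow> thesis'" for X thesis'
  proof -
    define C where "C = (B \<union> E) - {X}"
    define c where "c Y = (if Y \<in> E then 1 else 1 / real s)" for Y
    have finC: "finite C" unfolding C_def using finB finE by simp
    have c0: "c Y \<ge> 0" for Y by (simp add: c_def)
    have nle: "Y \<in> pts V \<and> \<not> Y \<subseteq> X" if Y: "Y \<in> C" for Y
    proof -
      have "Y \<in> pts V" "X \<noteq> Y" using Y in_pts Epts unfolding C_def by auto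
      then show ?thesis using point_not_le[OF X] by blast
    qed
    have h: "1 \<le> N - k" "N - k + k = N" using kN by auto
    obtain W where W: "vs (N - k) W" "X \<subseteq> W" "W \<subseteq> V" "real q ^ k * sum c {P \<in> C. P \<subseteq> W} \<le> sum c C"
      by (rule avg_subspace[OF V vs_point[OF X] point_le[OF X subV] h finC nle c0])
    have s7': "real s \<ge> 7" using s7 by simp
    have BE: "B \<inter> E = {}" by (auto simp: E_def)
    have "sum c C \<le> sum c (B \<union> E)" by (rule sum_mono2) (use finB finE c0 in \<open>auto simp: C_def\<close>)
    also have "\<dots> = sum c B + sum c E" by (rule sum.union_disjoint[OF finB finE BE])
    also have "sum c E = real (card E)" by (simp add: c_def)
    also have "sum c B = b * (1 / real s)"
    proof -
      have "sum c B = (\<Sum>Y\<in>B. 1 / real s)" by (rule sum.cong) (use BE in \<open>auto simp: c_def\<close>)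
      then show ?thesis by (simp add: b_def)
    qed
    also have "b * (1 / real s) \<le> b * (1 / 7)" using s7' bQ Q1 by (intro mult_left_mono divide_left_mono) auto
    finally have "sum c C < Q" using Ecard bQ(2) Q1 by linarith
    then have "Q * sum c {P \<in> C. P \<subseteq> W} < Q * 1" using W(4) unfolding Q_def by linarith
    then have lt1: "sum c {P \<in> C. P \<subseteq> W} < 1" using Q1 by simp
    have fW: "finite {P \<in> C. P \<subseteq> W}" using finC by simp
    show thesis'
    proof (rule that'[OF W(1-3)])
      fix Y assume Y: "Y \<in> E" "Y \<subseteq> W"
      show "Y = X"
      proof (rule ccontr)
        assume "Y \<noteq> X"
        then have "Y \<in> {P \<in> C. P \<subseteq> W}" using Y by (simp add: C_def)
        then have "c Y \<le> sum c {P \<in> C. P \<subseteq> W}" by (rule member_le_sum[OF _ c0 fW])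
        then show False using lt1 Y(1) by (simp add: c_def)
      qed
    next
      have "real (card {Y \<in> B - {X}. Y \<subseteq> W}) * (1 / real s) = (\<Sum>Y\<in>{Y \<in> B - {X}. Y \<subseteq> W}. 1 / real s)" by simp
      also have "\<dots> = sum c {Y \<in> B - {X}. Y \<subseteq> W}" by (rule sum.cong) (use BE in \<open>auto simp: c_def\<close>)
      also have "\<dots> \<le> sum c {P \<in> C. P \<subseteq> W}" by (rule sum_mono2[OF fW]) (use c0 in \<open>auto simp: C_def\<close>)
      also have "\<dots> < 1" by (rule lt1)
      finally show "card {Y \<in> B - {X}. Y \<subseteq> W} < s" using s7 by (simp add: divide_less_eq)
    qed
  qed
  have "q ^ k < card U'"
  proof -
    have "1 * q ^ k < p ^ d * q ^ k" by (rule mult_strict_right_mono) (use d(3) q_gt in auto)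
    then show ?thesis unfolding cU' U(3) by simp
  qed
  note blocks = large_group_blocks[OF is_subfield_Fix KU' U'V this]
  have BU': "P \<in> pts U'" if P: "P \<in> B" for P
  proof (rule sparse[OF in_pts[OF P]])
    fix W assume W: "vs (N - k) W" "P \<subseteq> W" "W \<subseteq> V" "\<And>Y. Y \<in> E \<Longrightarrow> Y \<subseteq> W \<Longrightarrow> Y = P" "card {Y \<in> B - {P}. Y \<subseteq> W} < s"
    let ?D = "{Y \<in> B - {P}. Y \<subseteq> W}"
    have fD: "finite ?D" using finB by simp
    have e: "points_in B W = insert P ?D" using P W(2) by (auto simp: points_in_def)
    have "card (points_in B W) - 1 = card ?D" unfolding e using fD by simp
    then have "s dvd card ?D" using points_dvd[OF W(1,3)] by simp
    then have "card ?D = 0" using W(5) by (metis dvd_imp_le not_le neq0_conv)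
    then have D0: "?D = {}" using fD by (simp only: card_0_eq)
    obtain R where R: "R \<in> pts U'" "R \<subseteq> W" by (rule blocks[OF W(1,3)])
    have "R = P"
    proof (cases "R \<in> B")
      case True then show ?thesis using D0 R(2) by blast
    next
      case False then show ?thesis using W(4)[OF _ R(2)] R(1) by (simp add: E_def)
    qed
    then show "P \<in> pts U'" using R(1) by simp
  qed
  have "E = {}"
  proof (rule equals0I)
    fix X assume X: "X \<in> E"
    then have XU: "X \<in> pts U'" and XB: "X \<notin> B" by (auto simp: E_def)
    show False
    proof (rule sparse[OF Epts[OF X]])
      fix W assume W: "vs (N - k) W" "X \<subseteq> W" "W \<subseteq> V" "\<And>Y. Y \<in> E \<Longrightarrow> Y \<subseteq> W \<Longrightarrow> Y = X" "card {Y \<in> B - {X}. Y \<subseteq> W} < s"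
      have e: "{Y \<in> B - {X}. Y \<subseteq> W} = points_in B W" using XB by (auto simp: points_in_def)
      have "card (points_in B W) - 1 = 0"
      proof (rule ccontr)
        assume "\<not> ?thesis"
        then have "s \<le> card (points_in B W) - 1" using points_dvd[OF W(1,3)] by (intro dvd_imp_le) auto
        then show False using W(5) unfolding e by linarith
      qed
      then have "card (points_in B W) = 1" using points_pos[OF W(1,3)] by simp
      then obtain P where Pe: "points_in B W = {P}" by (rule card_1_singletonE)
      then have P: "P \<in> B" "P \<subseteq> W" by (auto simp: points_in_def)
      have XP: "X \<noteq> P" using XB P(1) by blast
      have sX: "fvec.subspace X" and sP: "fvec.subspace P" and sW: "fvec.subspace W"
        using point_subspace[OF XU] point_subspace[OF BU'[OF P(1)]] vsD(1)[OF W(1)] by auto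
      obtain x where x: "x \<in> X" "x \<in> U'" "x \<noteq> 0" "X = fvec.span {x}" using point_of_U[OF XU] by blast
      obtain y where y: "y \<in> P" "y \<in> U'" "y \<noteq> 0" "P = fvec.span {y}" using point_of_U[OF BU'[OF P(1)]] by blast
      have nXP: False if "w \<in> X" "w \<in> P" "w \<noteq> 0" for w
        using point_eq[OF XU that(1,3)] point_eq[OF BU'[OF P(1)] that(2,3)] XP by simp
      have xy0: "x + y \<noteq> 0"
      proof
        assume "x + y = 0"
        then have "y = - x" by (simp add: add_eq_0_iff)
        then have "y \<in> X" using fvec.subspace_neg[OF sX x(1)] by simp
        then show False by (rule nXP[OF _ y(1,3)])
      qed
      let ?S = "fvec.span {x + y}"
      have SU: "?S \<in> pts U'" unfolding pts_iff using fv.Ksub_add[OF KU' x(2) y(2)] xy0 by blast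
      have "x + y \<in> W" by (rule fvec.subspace_add[OF sW]) (use x(1) y(1) W(2) P(2) in auto)
      then have SW: "?S \<subseteq> W" using span_le_iff[OF sW] by blast
      show False
      proof (cases "?S \<in> B")
        case True
        then have "?S = P" using Pe SW unfolding points_in_def by blast
        then have "x + y \<in> P" using mem_span_self[of "x + y"] by simp
        then have "x + y - y \<in> P" by (rule fvec.subspace_diff[OF sP _ y(1)])
        then have "x \<in> P" by simp
        then show False by (rule nXP[OF x(1) _ x(3)])
      next
        case False
        then have "?S = X" using W(4)[OF _ SW] SU by (simp add: E_def)
        then have "x + y \<in> X" using mem_span_self[of "x + y"] by simp
        then have "x + y - x \<in> X" by (rule fvec.subspace_diff[OF sX _ x(1)])
        then have "y \<in> X" by simp
        then show False by (rule nXP[OF _ y(1,3)])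
      qed
    qed
  qed
  then have "B = pts U'" using BU' unfolding E_def by blast
  then show ?thesis using KU' by blast
qed

end

section \<open>Descent on the dimension\<close>

context small_set_one_mod
begin

text \<open>The bound on \<open>|B|\<close> comes from counting vectors: \<open>p ^ d - 1\<close> nonzero ones on every point, \<open>p ^ d q ^ k\<close>
  in all.\<close>

lemma linear_structure:
  assumes s: "s = p ^ e" and U0: "fv.Ksub (Fix 1) U0" "B = pts U0"
  obtains d U where "d dvd t" "d > 0" "7 \<le> p ^ d" "fv.Ksub (Fix d) U" "B = pts U" "card U = p ^ d * q ^ k" "U \<subseteq> V"
    "6 * card B \<le> 7 * q ^ k"
proof -
  obtain U1 where U1: "fv.Ksub (Fix 1) U1" "B = pts U1" "card U1 = p ^ 1 * q ^ k" "U1 \<subseteq> V"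
    by (rule normal_form[OF one_dvd zero_less_one U0])
  interpret L: linear_small_set p t F s k N V B e U1
    by unfold_locales (use s U1 in auto)
  obtain d U2 where d: "d > 0" "d dvd t" "e \<le> d" "fv.Ksub (Fix d) U2" "B = pts U2" by (rule L.subfield_structure)
  obtain U where U: "fv.Ksub (Fix d) U" "B = pts U" "card U = p ^ d * q ^ k" "U \<subseteq> V"
    by (rule normal_form[OF d(2,1,4,5)])
  have "p ^ e \<le> p ^ d" using d(3) p_gt_1 by (intro power_increasing) auto
  then have k7: "7 \<le> p ^ d" using s7 s by simp
  have finU: "finite U" using U(4) vsD(2)[OF V] finite_subset by blast
  have "(p ^ d - 1) * card B \<le> card (vecs U (pts U))"
    unfolding U(2) by (rule vecs_mass[OF d(2) U(1) finU order_refl])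
  also have "\<dots> \<le> p ^ d * q ^ k" unfolding vecs_pts U(3)[symmetric] by (rule card_mono[OF finU]) blast
  finally have a: "(p ^ d - 1) * card B \<le> p ^ d * q ^ k" .
  have "(p ^ d - 1) * (6 * card B) \<le> 6 * (p ^ d * q ^ k)" using mult_le_mono2[OF a, of 6] by (simp only: mult_ac)
  also have "\<dots> \<le> (p ^ d - 1) * (7 * q ^ k)"
  proof -
    obtain r where r: "p ^ d = r + 7" using k7 by (metis le_add_diff_inverse2)
    show ?thesis unfolding r by (simp add: algebra_simps)
  qed
  finally have "6 * card B \<le> 7 * q ^ k" using k7 by (subst (asm) mult_le_cancel1) auto
  then show thesis using that d(1,2) k7 U by blast
qed

lemma projection_exists:
  assumes z: "z \<in> V" "z \<notin> on_secant"
  obtains H where "projection p t s k N V B z H"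
proof -
  obtain P where P: "P \<in> B" using size_gt by (metis card.empty less_nat_zero_code ex_in_conv)
  obtain R where R: "R \<in> B" "R \<noteq> P" using two_points[OF P] by blast
  have "0 \<in> on_secant" unfolding on_secant_def using P R fvec.subspace_0[OF subV] fvec.subspace_0[OF subspace_join] by blast
  then have z0: "z \<noteq> 0" using z(2) by blast
  obtain H where H: "fv.Ksub UNIV H" "H \<subseteq> V" "z \<notin> H" "card V = card (UNIV :: 'f set) * card H" "fv.Kext UNIV z H = V"
    by (rule fv.Ksub_complement_of[OF is_subfield_UNIV finite _ vsD(2)[OF V] z(1) z0])
      (use subV in \<open>auto simp: fv.Ksub_UNIV\<close>)
  have "q * card H = q * q ^ (N - 1)" using H(4) vsD(3)[OF V] kN by (cases N) (auto simp: q_UNIV)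
  then have "card H = q ^ (N - 1)" using q_gt by simp
  then have "vs (N - 1) H" using H(1,2) vsD(2)[OF V] finite_subset by (auto simp: vs_def fv.Ksub_UNIV)
  then have "projection p t s k N V B z H"
    by unfold_locales (use z H in auto)
  then show thesis by (rule that)
qed

text \<open>Projecting from any vector off the secants gives, by induction, the size bound; it is needed to
  choose the second centre, whose projection can be lifted.\<close>

lemma linear_of_projection:
  assumes N: "2 * k + 2 \<le> N" and s: "s = p ^ e"
    and IH: "\<And>H B'. one_mod s k (N - 1) H B' \<Longrightarrow> \<exists>U. fv.Ksub (Fix 1) U \<and> B' = pts U"
  shows "\<exists>U. fv.Ksub (Fix 1) U \<and> B = pts U"
proof -
  have kN': "k + 2 \<le> N - 1" using N k1 by simp
  have bar_small: "\<exists>d U. d dvd t \<and> d > 0 \<and> 7 \<le> p ^ d \<and> fv.Ksub (Fix d) U \<and> projection.bar z H ` B = pts U \<and>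
      card U = p ^ d * q ^ k \<and> U \<subseteq> H \<and> 6 * card B \<le> 7 * q ^ k"
    if "projection p t s k N V B z H" for z H
  proof -
    interpret Q: projection p t F s k N V B z H by (rule that)
    have om: "one_mod s k (N - 1) H (Q.bar ` B)" by (rule Q.one_mod_bar)
    interpret S: small_set_one_mod p t F s k "N - 1" H "Q.bar ` B"
      by unfold_locales (use om k1 kN' s7 in auto)
    obtain U0 where U0: "fv.Ksub (Fix 1) U0" "Q.bar ` B = pts U0" using IH[OF om] by blast
    obtain d U where "d dvd t" "d > 0" "7 \<le> p ^ d" "fv.Ksub (Fix d) U" "Q.bar ` B = pts U" "card U = p ^ d * q ^ k" "U \<subseteq> H"
      "6 * card (Q.bar ` B) \<le> 7 * q ^ k"
      by (rule S.linear_structure[OF s U0])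
    moreover have "card (Q.bar ` B) = card B" by (rule card_image[OF Q.inj_bar])
    ultimately show ?thesis by auto
  qed
  obtain z0 where z0: "z0 \<in> V" "z0 \<notin> on_secant" using centre_exists(1)[OF N] by blast
  obtain H0 where "projection p t s k N V B z0 H0" by (rule projection_exists[OF z0])
  then have six: "6 * card B \<le> 7 * q ^ k" using bar_small by blast
  obtain z where z: "z \<in> V" "z \<notin> on_secant" "45 * card {PR \<in> pairs B. bad z PR} * q ^ k \<le> card B ^ 3"
    using centre_exists(2)[OF N six] by blast
  obtain H where H: "projection p t s k N V B z H" by (rule projection_exists[OF z(1,2)])
  obtain d U where U: "d dvd t" "d > 0" "7 \<le> p ^ d" "fv.Ksub (Fix d) U" "projection.bar z H ` B = pts U"
      "card U = p ^ d * q ^ k" "U \<subseteq> H"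
    using bar_small[OF H] by blast
  interpret Q: projection p t F s k N V B z H by (rule H)
  obtain U' where U': "fv.Ksub (Fix d) U'" "B = pts U'"
    using Q.lift[OF U six z(3)] by blast
  have "fv.Ksub (Fix 1) U'" by (rule fv.Ksub_mono[OF Fix_mono[OF one_dvd] U'(1)])
  then show ?thesis using U'(2) by blast
qed

end

theorem (in prime_power_field) one_mod_linear:
  assumes k: "1 \<le> k" and s7: "7 \<le> p ^ e" and n: "2 * k \<le> n"
    and base: "\<And>N V B. k + 2 \<le> N \<Longrightarrow> N \<le> n + 1 \<Longrightarrow> one_mod (p ^ e) k N V B \<Longrightarrow> \<exists>U. fv.Ksub (Fix 1) U \<and> B = pts U"
  shows "k + 2 \<le> N \<Longrightarrow> one_mod (p ^ e) k N V B \<Longrightarrow> \<exists>U. fv.Ksub (Fix 1) U \<and> B = pts U"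
proof (induction N arbitrary: V B rule: less_induct)
  case (less N)
  show ?case
  proof (cases "N \<le> n + 1")
    case True then show ?thesis using base less.prems by blast
  next
    case False
    interpret S: small_set_one_mod p t F "p ^ e" k N V B
      by unfold_locales (use less.prems k s7 in auto)
    show ?thesis
    proof (rule S.linear_of_projection[OF _ refl])
      show "2 * k + 2 \<le> N" using False n by simp
      show "\<exists>U. fv.Ksub (Fix 1) U \<and> B' = pts U" if "one_mod (p ^ e) k (N - 1) H B'" for H B'
        using less.IH[OF _ _ that] False n k by simp
    qed
  qed
qed

section \<open>From projective geometry to vector subspaces and back\<close>

context prime_power_field
begin

lemma Fix_1_of_nat: assumes "c \<in> Fix 1" obtains n where "c = of_nat n"
proof -
  have "of_nat n \<in> Fix 1" for n
  proof (induction n)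
    case (Suc n) then show ?case using is_subfield_Fix[of 1] by (auto simp: is_subfield_def)
  qed (use is_subfield_Fix[of 1] in \<open>auto simp: is_subfield_def\<close>)
  then have sub: "(of_nat :: nat \<Rightarrow> 'f) ` {..<p} \<subseteq> Fix 1" by blast
  have "inj_on (of_nat :: nat \<Rightarrow> 'f) {..<p}"
  proof (rule linorder_inj_onI)
    fix i j assume ij: "i < j" "i \<in> {..<p}" "j \<in> {..<p}"
    show "(of_nat i :: 'f) \<noteq> of_nat j"
    proof
      assume "(of_nat i :: 'f) = of_nat j"
      then have "(of_nat (j - i) :: 'f) = 0" using ij(1) by (simp add: of_nat_diff)
      then have "p dvd j - i" by (simp only: char_of_nat[OF prime_p of_nat_p])
      then have "p \<le> j - i" by (rule dvd_imp_le) (use ij(1) in simp)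
      then show False using ij by simp
    qed
  qed auto
  then have "card ((of_nat :: nat \<Rightarrow> 'f) ` {..<p}) = card (Fix 1)" using card_Fix[of 1] by (simp add: card_image)
  then have "(of_nat :: nat \<Rightarrow> 'f) ` {..<p} = Fix 1" by (intro card_subset_eq sub) auto
  then show thesis using assms that by blast
qed

text \<open>The prime field consists of the multiples of \<open>1\<close>, so any additive group is a vector space over it.\<close>

lemma additive_Ksub_Fix_1:
  assumes "0 \<in> U" "\<And>x y. x \<in> U \<Longrightarrow> y \<in> U \<Longrightarrow> x + y \<in> U"
  shows "fv.Ksub (Fix 1) U"
  unfolding fv.Ksub_def
proof (intro conjI ballI)
  fix c x assume cx: "c \<in> Fix 1" "x \<in> U"
  obtain n where n: "c = of_nat n" by (rule Fix_1_of_nat[OF cx(1)])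
  have "fscale (of_nat n) x \<in> U"
  proof (induction n)
    case 0 show ?case using assms(1) by (simp only: of_nat_0 fvec.scale_zero_left)
  next
    case (Suc n)
    have "x + fscale (of_nat n) x \<in> U" by (rule assms(2)[OF cx(2) Suc])
    then show ?case by (simp only: of_nat_Suc fvec.scale_left_distrib fvec.scale_one)
  qed
  then show "fscale c x \<in> U" unfolding n .
qed (use assms in auto)

lemma vs_span: "finite X \<Longrightarrow> fvec.independent X \<Longrightarrow> vs (card X) (fvec.span X)"
proof (induction X rule: finite_induct)
  case empty then show ?case using vs_0 by simp
next
  case (insert x X)
  have i: "fvec.independent X" "x \<notin> fvec.span X" using insert.prems insert.hyps(2) by (auto simp: fvec.independent_insert)
  have "fvec.span (insert x X) = ext x (fvec.span X)"
  proof (intro set_eqI iffI)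
    fix y assume "y \<in> fvec.span (insert x X)"
    then obtain c where "y - fscale c x \<in> fvec.span X" unfolding fvec.span_breakdown_eq by blast
    moreover have "y = (y - fscale c x) + fscale c x" by simp
    ultimately show "y \<in> ext x (fvec.span X)" unfolding fv.Kext_iff by blast
  next
    fix y assume "y \<in> ext x (fvec.span X)"
    then obtain c w where "w \<in> fvec.span X" "y = w + fscale c x" unfolding fv.Kext_iff by blast
    then have "y - fscale c x \<in> fvec.span X" by simp
    then show "y \<in> fvec.span (insert x X)" unfolding fvec.span_breakdown_eq by blast
  qed
  then show ?case using vs_ext[OF insert.IH[OF i(1)] i(2)] insert.hyps by simp
qed

lemma vs_basis:
  assumes V: "vs N V"
  obtains X where "finite X" "X \<subseteq> V" "fvec.independent X" "fvec.span X = V" "card X = N" "fvec.dim V = N"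
proof -
  obtain X where X: "X \<subseteq> V" "fvec.independent X" "V \<subseteq> fvec.span X" "card X = fvec.dim V"
    by (rule fvec.basis_exists)
  have fX: "finite X" using X(1) vsD(2)[OF V] finite_subset by blast
  have sp: "fvec.span X = V" by (rule subset_antisym[OF fvec.span_minimal[OF X(1) vsD(1)[OF V]] X(3)])
  have "card X = N" using vs_span[OF fX X(2)] unfolding sp by (rule vs_inj[OF _ V])
  then show thesis using that fX X sp by simp
qed

lemma vs_coord_space: "vs (n + 1) (coord_space n)"
proof -
  let ?C = "coord_space n :: (nat \<Rightarrow> 'f) set"
  obtain X where X: "X \<subseteq> ?C" "fvec.independent X" "?C \<subseteq> fvec.span X" "card X = fvec.dim ?C"
    by (rule fvec.basis_exists)
  have c: "card X = n + 1" using X(4) by (simp only: dim_coord_space)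
  then have "finite X" using card_ge_0_finite[of X] by simp
  then have "vs (n + 1) (fvec.span X)" using vs_span X(2) c by metis
  moreover have "fvec.span X = ?C"
    by (rule subset_antisym[OF fvec.span_minimal[OF X(1) subspace_coord_space] X(3)])
  ultimately show ?thesis by simp
qed

lemma proj_space_iff: "proj_space n m W \<longleftrightarrow> vs (m + 1) W \<and> W \<subseteq> coord_space n"
proof
  assume a: "proj_space n m W"
  then have W: "fvec.subspace W" "W \<subseteq> coord_space n" "fvec.dim W = m + 1" by (auto simp: proj_space_def)
  have "finite W" using W(2) vsD(2)[OF vs_coord_space] finite_subset by blast
  then obtain M where M: "vs M W" using vs_exists[OF W(1)] by blast
  obtain X where "fvec.dim W = M" by (rule vs_basis[OF M])
  then show "vs (m + 1) W \<and> W \<subseteq> coord_space n" using M W(2,3) by simp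
next
  assume a: "vs (m + 1) W \<and> W \<subseteq> coord_space n"
  then have v: "vs (m + 1) W" by blast
  obtain X where "fvec.dim W = m + 1" by (rule vs_basis[OF v])
  then show "proj_space n m W" using a by (auto simp: proj_space_def vs_def)
qed

lemma proj_points_eq: "proj_points n = pts (coord_space n :: (nat \<Rightarrow> 'f) set)"
proof (intro set_eqI iffI)
  fix P :: "(nat \<Rightarrow> 'f) set" assume "P \<in> proj_points n"
  then have P: "vs 1 P" "P \<subseteq> coord_space n" by (auto simp: proj_points_def proj_space_iff)
  have "card P > card {0 :: nat \<Rightarrow> 'f}" using vsD(3)[OF P(1)] q_gt by simp
  then have "\<not> P \<subseteq> {0}" using card_mono[of "{0 :: nat \<Rightarrow> 'f}" P] by auto
  then obtain x where x: "x \<in> P" "x \<noteq> 0" by blast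
  have "fvec.span {x} \<in> pts P" unfolding pts_iff using x by blast
  then have "vs 1 (fvec.span {x})" by (rule vs_point)
  then have "fvec.span {x} = P" by (rule vs_eq[OF _ P(1)]) (use span_le_iff[OF vsD(1)[OF P(1)]] x(1) in blast)
  then show "P \<in> pts (coord_space n)" unfolding pts_iff using x P(2) by blast
next
  fix P :: "(nat \<Rightarrow> 'f) set" assume P: "P \<in> pts (coord_space n)"
  show "P \<in> proj_points n" unfolding proj_points_def proj_space_iff
    using vs_point[OF P] point_le[OF P subspace_coord_space] by simp
qed

text \<open>The fibres of \<open>(w, v) \<mapsto> w + v\<close> on \<open>W \<times> V\<close> have at most \<open>card (W \<inter> V)\<close> elements.\<close>

lemma card_Int_subspaces:
  assumes C: "vs n C" and W: "vs a W" "W \<subseteq> C" and V: "vs b V" "V \<subseteq> C"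
  shows "card W * card V \<le> card C * card (W \<inter> V)"
proof -
  have fin: "finite C" "finite W" "finite V" using vsD(2)[OF C] vsD(2)[OF W(1)] vsD(2)[OF V(1)] by auto
  have sC: "fvec.subspace C" and sW: "fvec.subspace W" and sV: "fvec.subspace V" using vsD(1)[OF C] vsD(1)[OF W(1)] vsD(1)[OF V(1)] by auto
  let ?F = "\<lambda>c. {x \<in> W \<times> V. fst x + snd x = c}"
  have fibre: "card (?F c) \<le> card (W \<inter> V)" for c
  proof (cases "?F c = {}")
    case True then show ?thesis by (simp only: card.empty)
  next
    case False
    then obtain x0 where x0: "x0 \<in> ?F c" by blast
    then have x0': "fst x0 \<in> W" "snd x0 \<in> V" "fst x0 + snd x0 = c" by auto
    show ?thesis
    proof (rule card_inj_on_le[where f = "\<lambda>x. fst x - fst x0"])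
      show "inj_on (\<lambda>x. fst x - fst x0) (?F c)" by (rule inj_onI) (auto simp: prod_eq_iff)
      show "(\<lambda>x. fst x - fst x0) ` ?F c \<subseteq> W \<inter> V"
      proof
        fix y assume "y \<in> (\<lambda>x. fst x - fst x0) ` ?F c"
        then obtain x where x: "fst x \<in> W" "snd x \<in> V" "fst x + snd x = c" "y = fst x - fst x0" by auto
        have "fst x = c - snd x" "snd x0 = c - fst x0" using x(3) x0'(3) by (simp_all add: eq_diff_eq add.commute)
        then have "y = snd x0 - snd x" using x(4) by (simp add: diff_right_commute)
        then have "y \<in> V" using fvec.subspace_diff[OF sV x0'(2) x(2)] by simp
        moreover have "y \<in> W" unfolding x(4) by (rule fvec.subspace_diff[OF sW x(1) x0'(1)])
        ultimately show "y \<in> W \<inter> V" by blast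
      qed
      show "finite (W \<inter> V)" using fin by simp
    qed
  qed
  have "W \<times> V \<subseteq> (\<Union>c\<in>C. ?F c)"
  proof
    fix x assume x: "x \<in> W \<times> V"
    then have "fst x \<in> C" "snd x \<in> C" using W(2) V(2) by auto
    then have "fst x + snd x \<in> C" by (rule fvec.subspace_add[OF sC])
    then show "x \<in> (\<Union>c\<in>C. ?F c)" using x by blast
  qed
  moreover have "finite (\<Union>c\<in>C. ?F c)" using fin by auto
  ultimately have "card (W \<times> V) \<le> card (\<Union>c\<in>C. ?F c)" by (rule card_mono[rotated])
  also have "\<dots> \<le> (\<Sum>c\<in>C. card (?F c))" by (rule card_UN_le[OF fin(1)])
  also have "\<dots> \<le> (\<Sum>c\<in>C. card (W \<inter> V))" by (rule sum_mono) (rule fibre)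
  finally show ?thesis by (simp add: card_cartesian_product)
qed

text \<open>The dimension formula, by counting.\<close>

lemma vs_Int:
  assumes C: "vs n C" and W: "vs (n - k) W" "W \<subseteq> C" and V: "vs N V" "V \<subseteq> C" and k: "k \<le> N"
  obtains j where "vs j (W \<inter> V)" "N - k \<le> j"
proof -
  have s: "fvec.subspace (W \<inter> V)" using vsD(1)[OF W(1)] vsD(1)[OF V(1)] by (rule fvec.subspace_inter)
  have "finite (W \<inter> V)" using vsD(2)[OF W(1)] by simp
  then obtain j where j: "vs j (W \<inter> V)" using vs_exists[OF s] by blast
  have Nn: "N \<le> n" by (rule vs_le[OF V(1) C V(2)])
  have "q ^ (n - k) * q ^ N \<le> q ^ n * q ^ j"
    using card_Int_subspaces[OF C W V] vsD(3)[OF C] vsD(3)[OF W(1)] vsD(3)[OF V(1)] vsD(3)[OF j] by simp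
  then have "q ^ (n - k + N) \<le> q ^ (n + j)" by (simp only: power_add)
  then have "n - k + N \<le> n + j" by (rule power_le_imp_le_exp[OF q_gt])
  then have "N - k \<le> j" using k Nn by linarith
  then show thesis using that j by blast
qed

end

context small_set_one_mod
begin

text \<open>A subspace of codimension \<open>k\<close> of the big space meets \<open>V\<close> in dimension at least \<open>N - k\<close>, so it contains points
  of \<open>B\<close>. For minimality, averaging in the big space gives through each \<open>P \<in> B\<close> a subspace of codimension \<open>k\<close>
  with fewer than \<open>s\<close> other points of \<open>B\<close>; there are none at all, since the line joining \<open>P\<close> to another would extend,
  inside the intersection with \<open>V\<close>, to an \<open>(N - k)\<close>-space with at least \<open>s\<close> other points.\<close>

lemma small_minimal_blocking:
  assumes VC: "V \<subseteq> coord_space n" and kn: "k \<le> n"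
  shows "small_minimal_blocking_set n k B"
proof -
  let ?C = "coord_space n :: (nat \<Rightarrow> 'f) set"
  have C: "vs (n + 1) ?C" by (rule vs_coord_space)
  have nk: "n - k + 1 = n + 1 - k" using kn by simp
  have section': "\<exists>j. vs j (W \<inter> V) \<and> N - k \<le> j" if W: "vs (n + 1 - k) W" "W \<subseteq> ?C" for W
  proof -
    have "k \<le> N" using kN by simp
    then show ?thesis using vs_Int[OF C W V VC] by blast
  qed
  have Bp: "B \<subseteq> proj_points n" unfolding proj_points_eq using BV pts_mono[OF VC] by blast
  have block: "points_in B W \<noteq> {}" if W: "vs (n + 1 - k) W" "W \<subseteq> ?C" for W
  proof -
    obtain j where j: "vs j (W \<inter> V)" "N - k \<le> j" using section'[OF W] by blast
    have "{0} \<subseteq> W \<inter> V" using fvec.subspace_0[OF vsD(1)[OF j(1)]] by simp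
    then obtain T where T: "vs (N - k) T" "{0} \<subseteq> T" "T \<subseteq> W \<inter> V"
      using vs_between[OF vs_0 j(1) _ le0 j(2)] by blast
    have TV: "T \<subseteq> V" using T(3) by blast
    have "points_in B T \<subseteq> points_in B W" using T(3) by (auto simp: points_in_def)
    moreover have "points_in B T \<noteq> {}" using points_pos[OF T(1) TV] by (metis card.empty not_one_le_zero)
    ultimately show ?thesis by blast
  qed
  have tangent_C: "\<exists>W. vs (n + 1 - k) W \<and> W \<subseteq> ?C \<and> points_in B W = {P}" if P: "P \<in> B" for P
  proof -
    have nle: "R \<in> pts ?C \<and> \<not> R \<subseteq> P" if "R \<in> B - {P}" for R
      using that in_pts pts_mono[OF VC] point_not_le[OF in_pts[OF P]] by blast
    have h: "1 \<le> n + 1 - k" "n + 1 - k + k = n + 1" using kn by auto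
    have PC: "P \<subseteq> ?C" using B_le[OF P] VC by blast
    have finP: "finite (B - {P})" using finB by simp
    obtain W where W: "vs (n + 1 - k) W" "P \<subseteq> W" "W \<subseteq> ?C" "q ^ k * card {R \<in> B - {P}. R \<subseteq> W} \<le> card (B - {P})"
      by (rule avg_card[OF C vs_point[OF in_pts[OF P]] PC h finP nle])
    have "{R \<in> B - {P}. R \<subseteq> W} = {}"
    proof (rule ccontr)
      assume "{R \<in> B - {P}. R \<subseteq> W} \<noteq> {}"
      then obtain R where R: "R \<in> B" "R \<noteq> P" "R \<subseteq> W" by blast
      obtain j where j: "vs j (W \<inter> V)" "N - k \<le> j" using section'[OF W(1,3)] by blast
      have PR: "P \<noteq> R" using R(2) by blast
      have le: "join P R \<subseteq> W \<inter> V"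
        by (rule join_least[OF vsD(1)[OF j(1)]]) (use W(2) R(3) B_le[OF P] B_le[OF R(1)] in auto)
      have h2: "2 \<le> N - k" using kN by simp
      obtain T where T: "vs (N - k) T" "join P R \<subseteq> T" "T \<subseteq> W \<inter> V"
        using vs_between[OF vs_join[OF in_pts[OF P] in_pts[OF R(1)] PR] j(1) le h2 j(2)] by blast
      have TV: "T \<subseteq> V" using T(3) by blast
      have "s \<le> card (points_in B T) - 1"
      proof (rule dvd_imp_le[OF points_dvd[OF T(1) TV]])
        have "{P, R} \<subseteq> points_in B T"
          using P R(1) T(2) join_upper[where P=P and R=R] by (auto simp: points_in_def)
        then have "card {P, R} \<le> card (points_in B T)" by (rule card_mono[OF fin_points_in])
        then show "0 < card (points_in B T) - 1" using PR by simp
      qed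
      also have "card (points_in B T) - 1 \<le> card {R \<in> B - {P}. R \<subseteq> W}"
      proof -
        have "card (points_in B T - {P}) \<le> card {R \<in> B - {P}. R \<subseteq> W}"
          by (rule card_mono) (use finB T(3) in \<open>auto simp: points_in_def\<close>)
        moreover have "card (points_in B T) - card {P} \<le> card (points_in B T - {P})" by (rule diff_card_le_card_Diff) simp
        ultimately show ?thesis by simp
      qed
      finally have "q ^ k * 7 \<le> q ^ k * card {R \<in> B - {P}. R \<subseteq> W}" using s7 by (intro mult_le_mono2) linarith
      also have "\<dots> \<le> card B" using W(4) card_mono[OF finB, of "B - {P}"] by auto
      finally have "q ^ k * 7 \<le> card B" .
      moreover have "q ^ k \<ge> 1" using q_gt by simp
      ultimately show False using small by linarith
    qed
    then have "points_in B W = {P}" using P W(2) unfolding points_in_def by blast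
    then show ?thesis using W by blast
  qed
  have bl: "blocking_set n k X \<longleftrightarrow> X \<subseteq> proj_points n \<and> (\<forall>W. vs (n + 1 - k) W \<and> W \<subseteq> ?C \<longrightarrow> points_in X W \<noteq> {})" for X :: "(nat \<Rightarrow> 'f) set set"
    unfolding blocking_set_def proj_space_iff nk ..
  have "blocking_set n k B" unfolding bl using Bp block by blast
  moreover have "\<not> blocking_set n k B'" if B': "B' \<subset> B" for B'
  proof
    assume b: "blocking_set n k B'"
    obtain P where P: "P \<in> B" "P \<notin> B'" using B' by blast
    obtain W where W: "vs (n + 1 - k) W" "W \<subseteq> ?C" "points_in B W = {P}" using tangent_C[OF P(1)] by blast
    have "points_in B' W \<noteq> {}" using b W(1,2) unfolding bl by blast
    then obtain R where R: "R \<in> B'" "R \<subseteq> W" by (auto simp: points_in_def)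
    then have "R \<in> points_in B W" using B' by (auto simp: points_in_def)
    then show False using W(3) R(1) P(2) by simp
  qed
  moreover have "small_set k B"
  proof -
    have "real (2 * card B) < real (3 * q ^ k + 3)" using small by (simp only: of_nat_less_iff)
    then show ?thesis unfolding small_set_def q_UNIV by simp
  qed
  ultimately show ?thesis unfolding small_minimal_blocking_set_def minimal_blocking_set_def by blast
qed

end

interpretation fp: vector_space_pair "fscale :: 'f::field \<Rightarrow> (nat \<Rightarrow> 'f) \<Rightarrow> nat \<Rightarrow> 'f" "fscale :: 'f::field \<Rightarrow> (nat \<Rightarrow> 'f) \<Rightarrow> nat \<Rightarrow> 'f"
  by unfold_locales

context prime_power_field
begin

text \<open>Map a basis of \<open>V\<close> injectively into a basis of \<open>C\<close>.\<close>

lemma linear_embedding: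
  assumes V: "vs N V" and C: "vs M C" and NM: "N \<le> M"
  obtains f where "Vector_Spaces.linear fscale fscale f" "inj_on f V" "f ` V \<subseteq> C"
proof -
  obtain X where X: "finite X" "X \<subseteq> V" "fvec.independent X" "fvec.span X = V" "card X = N" by (rule vs_basis[OF V])
  obtain Y where Y: "finite Y" "Y \<subseteq> C" "fvec.independent Y" "fvec.span Y = C" "card Y = M" by (rule vs_basis[OF C])
  obtain g where g: "g ` X \<subseteq> Y" "inj_on g X" using card_le_inj[OF X(1) Y(1)] X(5) Y(5) NM by auto
  let ?f = "fp.construct X g"
  have lin: "Vector_Spaces.linear fscale fscale ?f" by (rule fp.linear_construct[OF X(3)])
  have fg: "?f x = g x" if "x \<in> X" for x by (rule fp.construct_basis[OF X(3) that])
  have im: "?f ` X = g ` X" using fg by (intro image_cong) auto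
  have inj: "inj_on ?f X" using g(2) fg by (metis inj_on_cong)
  have ind: "fvec.independent (?f ` X)" unfolding im by (rule fvec.independent_mono[OF Y(3) g(1)])
  have "inj_on ?f (fvec.span X)" by (rule fp.linear_inj_on_span_independent_image[OF lin ind inj])
  then have "inj_on ?f V" unfolding X(4) .
  moreover have "?f ` V \<subseteq> C"
  proof -
    have "?f ` fvec.span X = fvec.span (?f ` X)" by (rule fp.linear_span_image[OF lin, symmetric])
    also have "\<dots> \<subseteq> fvec.span Y" unfolding im by (rule fvec.span_mono[OF g(1)])
    finally show ?thesis unfolding X(4) Y(4) .
  qed
  ultimately show thesis using that lin by blast
qed

lemma one_mod_transfer:
  assumes om: "one_mod s k N V B" and f: "Vector_Spaces.linear fscale fscale f" "inj_on f V"
  shows "one_mod s k N (f ` V) ((`) f ` B)"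
    and "fv.Ksub (Fix 1) U \<Longrightarrow> (`) f ` B = pts U \<Longrightarrow> \<exists>U'. fv.Ksub (Fix 1) U' \<and> B = pts U'"
proof -
  have V: "vs N V" and BV: "B \<subseteq> pts V" using om by (auto simp: one_mod_def)
  have sV: "fvec.subspace V" by (rule vsD(1)[OF V])
  have f0: "f 0 = 0" by (rule fp.linear_0[OF f(1)])
  have fadd: "f (x + y) = f x + f y" for x y by (rule fp.linear_add[OF f(1)])
  have fscl: "f (fscale c x) = fscale c (f x)" for c x by (rule fp.linear_scale[OF f(1)])
  have fnz: "f x \<noteq> 0" if "x \<in> V" "x \<noteq> 0" for x
    using inj_onD[OF f(2), of x 0] that fvec.subspace_0[OF sV] f0 by auto
  have fspan: "f ` fvec.span {x} = fvec.span {f x}" for x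
    using fp.linear_span_image[OF f(1), of "{x}"] by simp
  have BleV: "P \<subseteq> V" if "P \<in> B" for P using point_le[OF _ sV] BV that by blast
  have injB: "inj_on ((`) f) B"
    by (rule inj_onI) (use inj_on_image_eq_iff[OF f(2)] BleV in blast)
  have vV': "vs N (f ` V)"
    using fp.linear_subspace_image[OF f(1) sV] card_image[OF f(2)] vsD[OF V] by (simp add: vs_def)
  show "one_mod s k N (f ` V) ((`) f ` B)"
    unfolding one_mod_def
  proof (intro conjI allI impI vV')
    show "(`) f ` B \<subseteq> pts (f ` V)"
    proof
      fix P' assume "P' \<in> (`) f ` B"
      then obtain P where P: "P \<in> B" "P' = f ` P" by blast
      have "P \<in> pts V" using P(1) BV by blast
      then obtain x where x: "x \<in> V" "x \<noteq> 0" "P = fvec.span {x}" unfolding pts_iff by blast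
      have "P' = fvec.span {f x}" unfolding P(2) x(3) by (rule fspan)
      then show "P' \<in> pts (f ` V)" unfolding pts_iff using fnz[OF x(1,2)] x(1) by blast
    qed
    show "2 * card ((`) f ` B) < 3 * q ^ k + 3" using om card_image[OF injB] by (simp add: one_mod_def)
  next
    fix T assume T: "vs (N - k) T" "T \<subseteq> f ` V"
    define T0 where "T0 = {x \<in> V. f x \<in> T}"
    have im: "f ` T0 = T" using T(2) unfolding T0_def by blast
    have sT: "fvec.subspace T" by (rule vsD(1)[OF T(1)])
    have "fvec.subspace T0" unfolding T0_def fvec.subspace_def
      using fvec.subspace_0[OF sV] fvec.subspace_add[OF sV] fvec.subspace_scale[OF sV]
        fvec.subspace_0[OF sT] fvec.subspace_add[OF sT] fvec.subspace_scale[OF sT] f0 fadd fscl by simp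
    moreover have "finite T0" unfolding T0_def using vsD(2)[OF V] by simp
    moreover have "card T0 = q ^ (N - k)"
    proof -
      have "inj_on f T0" by (rule inj_on_subset[OF f(2)]) (auto simp: T0_def)
      then show ?thesis using card_image[of f T0] vsD(3)[OF T(1)] unfolding im by simp
    qed
    ultimately have vT0: "vs (N - k) T0" by (simp add: vs_def)
    have T0V: "T0 \<subseteq> V" unfolding T0_def by blast
    have "points_in ((`) f ` B) T = (`) f ` points_in B T0"
      unfolding points_in_def T0_def using BleV by fast
    moreover have "inj_on ((`) f) (points_in B T0)" by (rule inj_on_subset[OF injB]) (auto simp: points_in_def)
    ultimately have "card (points_in ((`) f ` B) T) = card (points_in B T0)" by (simp add: card_image)
    then show "[card (points_in ((`) f ` B) T) = 1] (mod s)" using om vT0 T0V unfolding one_mod_def by simp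
  qed
  assume U: "fv.Ksub (Fix 1) U" "(`) f ` B = pts U"
  define U' where "U' = {x \<in> V. f x \<in> U}"
  have "fv.Ksub (Fix 1) U'"
    unfolding U'_def fv.Ksub_def using fvec.subspace_0[OF sV] fvec.subspace_add[OF sV] fvec.subspace_scale[OF sV]
      fv.Ksub_zero[OF U(1)] fv.Ksub_add[OF U(1)] fv.Ksub_scale[OF U(1)] f0 fadd fscl by simp
  moreover have "B = pts U'"
  proof (intro set_eqI iffI)
    fix P assume P: "P \<in> B"
    then have "f ` P \<in> pts U" using U(2) by blast
    then obtain u where u: "u \<in> U" "u \<noteq> 0" "f ` P = fvec.span {u}" unfolding pts_iff by blast
    have "u \<in> f ` P" unfolding u(3) by (rule mem_span_self)
    then obtain y where y: "y \<in> P" "u = f y" by blast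
    have y0: "y \<noteq> 0" using y(2) u(2) f0 by auto
    have yV: "y \<in> V" using y(1) BleV[OF P] by blast
    have "P \<in> pts V" using P BV by blast
    then have "P = fvec.span {y}" by (rule point_eq[OF _ y(1) y0])
    then show "P \<in> pts U'" unfolding pts_iff U'_def using y yV y0 u(1) by blast
  next
    fix P assume "P \<in> pts U'"
    then obtain x where x: "x \<in> V" "f x \<in> U" "x \<noteq> 0" "P = fvec.span {x}" unfolding pts_iff U'_def by blast
    have "fvec.span {f x} \<in> pts U" unfolding pts_iff using x(2) fnz[OF x(1,3)] by blast
    then obtain R where R: "R \<in> B" "f ` R = fvec.span {f x}" using U(2) by (metis imageE)
    have "f x \<in> f ` R" unfolding R(2) by (rule mem_span_self)
    then obtain y where y: "y \<in> R" "f x = f y" by blast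
    have "y \<in> V" using y(1) BleV[OF R(1)] by blast
    then have "x = y" using inj_onD[OF f(2) y(2) x(1)] by blast
    moreover have "R \<in> pts V" using R(1) BV by blast
    ultimately have "R = fvec.span {x}" using point_eq y(1) x(3) by blast
    then show "P \<in> B" using R(1) x(4) by simp
  qed
  ultimately show "\<exists>U'. fv.Ksub (Fix 1) U' \<and> B = pts U'" by blast
qed

lemma base_case:
  assumes k: "1 \<le> k" "k + 2 \<le> N" "N \<le> n + 1" "7 \<le> s" and om: "one_mod s k N V B"
    and lin: "\<And>B :: (nat \<Rightarrow> 'f) set set. small_minimal_blocking_set n k B \<Longrightarrow> linear_set n B"
  shows "\<exists>U. fv.Ksub (Fix 1) U \<and> B = pts U"
proof -
  have V: "vs N V" using om by (simp add: one_mod_def)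
  obtain f where f: "Vector_Spaces.linear fscale fscale f" "inj_on f V" "f ` V \<subseteq> coord_space n"
    by (rule linear_embedding[OF V vs_coord_space k(3)])
  interpret S: small_set_one_mod p t F s k N "f ` V" "(`) f ` B"
    by unfold_locales (rule one_mod_transfer(1)[OF om f(1,2)] k)+
  have "k \<le> n" using k by simp
  then have "linear_set n ((`) f ` B)" by (rule lin[OF S.small_minimal_blocking[OF f(3)]])
  then obtain K U where "subspace_over K U" "(`) f ` B = {fvec.span {u} | u. u \<in> U - {0}}"
    unfolding linear_set_def by (elim exE conjE)
  then have U: "subspace_over K U" "(`) f ` B = pts U" unfolding pts_def .
  have "fv.Ksub (Fix 1) U"
    by (rule additive_Ksub_Fix_1) (use U(1) in \<open>auto simp: subspace_over_def\<close>)
  then show ?thesis by (rule one_mod_transfer(2)[OF om f(1,2) _ U(2)])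
qed

end

theorem theorem1:
  fixes p t k nstar :: nat
  assumes "prime p" and "t \<ge> 1" and "CARD('f::{field,finite}) = p ^ t"
    and "1 \<le> k" and "k \<le> nstar - 1" and "nstar \<ge> 2 * k"
    and "\<forall>B :: (nat \<Rightarrow> 'f) set set. small_minimal_blocking_set nstar k B \<longrightarrow> linear_set nstar B"
  shows "\<forall>n>k. \<forall>(B :: (nat \<Rightarrow> 'f) set set) e.
    small_minimal_blocking_set n k B \<and> is_exponent p n k B e \<and> p ^ e \<ge> 7 \<longrightarrow> linear_set n B"
proof (intro allI impI)
  interpret prime_power_field p t "TYPE('f)" by unfold_locales (use assms(1,3) in auto)
  fix n e and B :: "(nat \<Rightarrow> 'f) set set"
  assume kn: "k < n" and B: "small_minimal_blocking_set n k B \<and> is_exponent p n k B e \<and> p ^ e \<ge> 7"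
  let ?C = "coord_space n :: (nat \<Rightarrow> 'f) set"
  have BC: "B \<subseteq> pts ?C"
    using B unfolding small_minimal_blocking_set_def minimal_blocking_set_def blocking_set_def proj_points_eq by blast
  have nk: "n - k + 1 = n + 1 - k" using kn by simp
  have om: "one_mod (p ^ e) k (n + 1) ?C B"
    unfolding one_mod_def
  proof (intro conjI allI impI vs_coord_space BC)
    fix T assume "vs (n + 1 - k) T" "T \<subseteq> ?C"
    then have "proj_space n (n - k) T" unfolding proj_space_iff nk by blast
    then show "[card (points_in B T) = 1] (mod p ^ e)"
      using B unfolding is_exponent_def meets_one_mod_def by blast
  next
    have "real (card B) < 3 * (real q ^ k + 1) / 2"
      using B unfolding small_minimal_blocking_set_def small_set_def q_UNIV by blast
    then have "real (2 * card B) < real (3 * q ^ k + 3)" by simp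
    then show "2 * card B < 3 * q ^ k + 3" by (simp only: of_nat_less_iff)
  qed
  have s7: "7 \<le> p ^ e" using B by blast
  have "\<exists>U. fv.Ksub (Fix 1) U \<and> B = pts U"
  proof (rule one_mod_linear[OF assms(4) s7 assms(6) _ _ om])
    show "k + 2 \<le> n + 1" using kn by simp
    show "\<exists>U. fv.Ksub (Fix 1) U \<and> B = pts U"
      if "k + 2 \<le> N" "N \<le> nstar + 1" "one_mod (p ^ e) k N V B" for N V B
      by (rule base_case[OF assms(4) that(1,2) s7 that(3) assms(7)[rule_format]])
  qed
  then obtain U where U: "fv.Ksub (Fix 1) U" "B = pts U" by blast
  have "U \<subseteq> ?C"
  proof
    fix u assume u: "u \<in> U"
    show "u \<in> ?C"
    proof (cases "u = 0")
      case True then show ?thesis using fvec.subspace_0[OF subspace_coord_space] by simp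
    next
      case False
      then have "fvec.span {u} \<in> B" unfolding U(2) pts_iff using u by blast
      then have "fvec.span {u} \<subseteq> ?C" by (rule point_le[OF subsetD[OF BC] subspace_coord_space])
      then show ?thesis by (rule subsetD[OF _ mem_span_self])
    qed
  qed
  moreover have "subspace_over (Fix 1) U" using U(1) unfolding fv.Ksub_def subspace_over_def .
  ultimately show "linear_set n B"
    unfolding linear_set_def using is_subfield_Fix[of 1] U(2)[unfolded pts_def] by (intro exI conjI)
qed

end
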